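(* Let $R$ be a Noetherian ring containing $\mathbb{Q}$, and let $A$ be an $R$-algebra which is a retract of a polynomial ring $B = R[X_1, X_2, \ldots, X_n] = R^{[n]}$. Suppose that $\operatorname{tr.deg}_{R/P}(A \otimes_R R/P) = 2$ for each minimal prime ideal $P$ of $R$. Let $F \in A$ be such that $A \otimes_R \operatorname{Qt}(R/P) = \operatorname{Qt}(R/P)[F]^{[1]}$ for each minimal prime ideal $P$ of $R$. If $(F_{X_1}, F_{X_2}, \ldots, F_{X_n})B = B$, then $F$ is a residual coordinate of $A$ over $R$.
   Context: All rings are commutative with unity. For a ring $S$, $S^{[n]}$ denotes a polynomial ring in $n$ variables over $S$; for an $S$-algebra $C$, $C = S^{[n]}$ means $C$ is isomorphic to such a polynomial ring as an $S$-algebra. $\operatorname{Qt}(D)$ is the quotient field of a domain $D$, and for a prime ideal $P$ of $R$, $k(P) = R_P/PR_P$. "$A$ is a retract of $B$" means that $A$ is an $R$-subalgebra of $B$ and there is a surjective $R$-algebra homomorphism $\phi: B \to A$ with $\phi(a) = a$ for all $a \in A$. $F_{X_i} = \partial F/\partial X_i \in B$ is the partial derivative of $F$ viewed as an element of $B$. For a field $L$ that is an $R$-algebra, $A \otimes_R L = L[F]^{[1]}$ means that $A \otimes_R L$ is a polynomial ring in one variable over its subring $L[\overline{F}]$ generated over $L$ by the image $\overline{F}$ of $F$. An $R$-algebra $A$ is an $\mathbb{A}^2$-fibration over $R$ if $A$ is finitely generated and flat over $R$ and $A \otimes_R k(P) = k(P)^{[2]}$ for all $P \in \operatorname{Spec}(R)$.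 (An $R$-algebra $A$ that is a retract as in the claim, with the stated transcendence degree condition, is known to be an $\mathbb{A}^2$-fibration over $R$.) An element $F$ of an $\mathbb{A}^2$-fibration $A$ over $R$ is a residual coordinate of $A$ if $F$ is algebraically independent over $R$ and $A \otimes_R k(P) = (R[F] \otimes_R k(P))^{[1]}$ for each $P \in \operatorname{Spec}(R)$. *)

theory Defs
  imports "HOL-Algebra.Algebra" "HOL-Library.Extended_Nat"
begin

text \<open>An \<open>R\<close>-algebra is a \<open>module\<close> record, which carries a ring structure together with a scalar
  multiplication (see the locale \<open>algebra\<close>).\<close>

section \<open>Algebras and polynomial rings\<close>

definition algebra_via :: "('a \<Rightarrow> 'b) \<Rightarrow> ('b, 'm) ring_scheme \<Rightarrow> ('a, 'b) module" where
  "algebra_via h S = \<lparr>carrier = carrier S, monoid.mult = monoid.mult S, one = \<one>\<^bsub>S\<^esub>,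
     ring.zero = \<zero>\<^bsub>S\<^esub>, ring.add = ring.add S,
     smult = (\<lambda>r s. h r \<otimes>\<^bsub>S\<^esub> s)\<rparr>"

definition alg_hom ::
    "('a, 'm) ring_scheme \<Rightarrow> ('a, 'b, 'p) module_scheme \<Rightarrow> ('a, 'c, 'q) module_scheme \<Rightarrow> ('b \<Rightarrow> 'c) set" where
  "alg_hom R A B = {h \<in> ring_hom A B.
     \<forall>r\<in>carrier R. \<forall>a\<in>carrier A. h (r \<odot>\<^bsub>A\<^esub> a) = r \<odot>\<^bsub>B\<^esub> h a}"

text \<open>The polynomial ring over \<open>R\<close> in variables indexed by \<open>I\<close>: a polynomial maps each monomial,
  a multiset of variables, to its coefficient.\<close>

definition mpoly :: "('a, 'm) ring_scheme \<Rightarrow> 'i set \<Rightarrow> ('a, 'i multiset \<Rightarrow> 'a) module" where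
  "mpoly R I = \<lparr>carrier = ring.indexed_pset R I (carrier R),
     monoid.mult = (\<lambda>p q m. \<Oplus>\<^bsub>R\<^esub>k\<in>{k. k \<subseteq># m}. p k \<otimes>\<^bsub>R\<^esub> q (m - k)),
     one = ring.indexed_const R \<one>\<^bsub>R\<^esub>,
     ring.zero = ring.indexed_const R \<zero>\<^bsub>R\<^esub>,
     ring.add = ring.indexed_padd R,
     smult = (\<lambda>r p m. r \<otimes>\<^bsub>R\<^esub> p m)\<rparr>"

definition partial_deriv :: "('a, 'm) ring_scheme \<Rightarrow> 'i \<Rightarrow> ('i multiset \<Rightarrow> 'a) \<Rightarrow> ('i multiset \<Rightarrow> 'a)" where
  "partial_deriv R i p = (\<lambda>m. [Suc (count m i)] \<cdot>\<^bsub>R\<^esub> p (add_mset i m))"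

text \<open>\<open>C = S\<^sup>[\<^sup>n\<^sup>]\<close>\<close>

definition is_poly_ring :: "('a, 'm) ring_scheme \<Rightarrow> nat \<Rightarrow> ('a, 'b, 'p) module_scheme \<Rightarrow> bool" where
  "is_poly_ring S n C \<longleftrightarrow>
     (\<exists>h\<in>alg_hom S (mpoly S {1..n}) C. bij_betw h (carrier (mpoly S {1..n})) (carrier C))"

definition adjoin :: "('a, 'm) ring_scheme \<Rightarrow> ('a, 'b, 'p) module_scheme \<Rightarrow> 'b set \<Rightarrow> 'b set" where
  "adjoin S C T = generate_ring C ((\<lambda>s. s \<odot>\<^bsub>C\<^esub> \<one>\<^bsub>C\<^esub>) ` carrier S \<union> T)"

text \<open>\<open>C = S[f]\<^sup>[\<^sup>1\<^sup>]\<close>, where \<open>S[f]\<close> is a subring of \<open>C\<close>\<close>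

definition is_poly_ring_over_adjoin ::
    "('a, 'm) ring_scheme \<Rightarrow> 'b \<Rightarrow> ('a, 'b, 'p) module_scheme \<Rightarrow> bool" where
  "is_poly_ring_over_adjoin S f C \<longleftrightarrow>
     is_poly_ring (C\<lparr>carrier := adjoin S C {f}\<rparr>) 1 (algebra_via id C)"

text \<open>The variables of the polynomial ring are indexed by the elements of \<open>T\<close> themselves; the
  homomorphism \<open>h\<close> below is evaluation.\<close>

definition alg_independent :: "('a, 'm) ring_scheme \<Rightarrow> ('a, 'b, 'p) module_scheme \<Rightarrow> 'b set \<Rightarrow> bool" where
  "alg_independent S C T \<longleftrightarrow> T \<subseteq> carrier C \<and>
     (\<exists>h\<in>alg_hom S (mpoly S T) C.
        (\<forall>t\<in>T. h (ring.indexed_var S t) = t) \<and> inj_on h (carrier (mpoly S T)))"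

text \<open>The largest number of elements of \<open>C\<close> algebraically independent over \<open>S\<close>. For an extension
  \<open>S \<subseteq> C\<close> of domains it is the transcendence degree of \<open>Qt(C)\<close> over \<open>Qt(S)\<close>.\<close>

definition tr_deg :: "('a, 'm) ring_scheme \<Rightarrow> ('a, 'b, 'p) module_scheme \<Rightarrow> enat" where
  "tr_deg S C = (SUP T\<in>{T. finite T \<and> alg_independent S C T}. enat (card T))"

definition is_retract :: "('a, 'm) ring_scheme \<Rightarrow> ('a, 'b, 'p) module_scheme \<Rightarrow> 'b set \<Rightarrow> bool" where
  "is_retract R B A \<longleftrightarrow> subring A B \<and> submodule A R B \<and>
     (\<exists>\<phi>\<in>alg_hom R B (B\<lparr>carrier := A\<rparr>). \<phi> ` carrier B = A \<and> (\<forall>a\<in>A. \<phi> a = a))"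

definition contains_rat :: "('a, 'm) ring_scheme \<Rightarrow> bool" where
  "contains_rat R \<longleftrightarrow>
     (\<exists>h\<in>ring_hom \<lparr>carrier = UNIV :: rat set, monoid.mult = (*), one = 1, ring.zero = 0, ring.add = (+)\<rparr> R. inj h)"

definition minimal_prime :: "'a set \<Rightarrow> ('a, 'm) ring_scheme \<Rightarrow> bool" where
  "minimal_prime P R \<longleftrightarrow> primeideal P R \<and> (\<forall>Q. primeideal Q R \<and> Q \<subseteq> P \<longrightarrow> Q = P)"

section \<open>Localization\<close>

definition frac_rel :: "('a, 'm) ring_scheme \<Rightarrow> 'a set \<Rightarrow> (('a \<times> 'a) \<times> ('a \<times> 'a)) set" where
  "frac_rel R S = {((r, s), (r', s')). r \<in> carrier R \<and> r' \<in> carrier R \<and> s \<in> S \<and> s' \<in> S \<and>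
     (\<exists>t\<in>S. t \<otimes>\<^bsub>R\<^esub> (r \<otimes>\<^bsub>R\<^esub> s') = t \<otimes>\<^bsub>R\<^esub> (r' \<otimes>\<^bsub>R\<^esub> s))}"

definition frac :: "('a, 'm) ring_scheme \<Rightarrow> 'a set \<Rightarrow> 'a \<Rightarrow> 'a \<Rightarrow> ('a \<times> 'a) set" where
  "frac R S r s = frac_rel R S `` {(r, s)}"

definition localization :: "('a, 'm) ring_scheme \<Rightarrow> 'a set \<Rightarrow> ('a \<times> 'a) set ring" where
  "localization R S = \<lparr>carrier = (carrier R \<times> S) // frac_rel R S,
     monoid.mult = (\<lambda>U V. \<Union>(r, s)\<in>U. \<Union>(r', s')\<in>V. frac R S (r \<otimes>\<^bsub>R\<^esub> r') (s \<otimes>\<^bsub>R\<^esub> s')),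
     one = frac R S \<one>\<^bsub>R\<^esub> \<one>\<^bsub>R\<^esub>,
     ring.zero = frac R S \<zero>\<^bsub>R\<^esub> \<one>\<^bsub>R\<^esub>,
     ring.add = (\<lambda>U V. \<Union>(r, s)\<in>U. \<Union>(r', s')\<in>V.
        frac R S ((r \<otimes>\<^bsub>R\<^esub> s') \<oplus>\<^bsub>R\<^esub> (r' \<otimes>\<^bsub>R\<^esub> s)) (s \<otimes>\<^bsub>R\<^esub> s'))\<rparr>"

text \<open>\<open>R/P\<close>, \<open>Qt(R/P)\<close> and \<open>k(P)\<close> as \<open>R\<close>-algebras\<close>

definition quot_alg :: "('a, 'm) ring_scheme \<Rightarrow> 'a set \<Rightarrow> ('a, 'a set) module" where
  "quot_alg R P = algebra_via (\<lambda>r. P +>\<^bsub>R\<^esub> r) (R Quot P)"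

definition Qt_alg :: "('a, 'm) ring_scheme \<Rightarrow> 'a set \<Rightarrow> ('a, ('a set \<times> 'a set) set) module" where
  "Qt_alg R P = (let D = R Quot P; S = carrier D - {\<zero>\<^bsub>D\<^esub>} in
     algebra_via (\<lambda>r. frac D S (P +>\<^bsub>R\<^esub> r) \<one>\<^bsub>D\<^esub>) (localization D S))"

definition residue_alg :: "('a, 'm) ring_scheme \<Rightarrow> 'a set \<Rightarrow> ('a, ('a \<times> 'a) set set) module" where
  "residue_alg R P = (let S = carrier R - P; RP = localization R S; \<iota> = (\<lambda>r. frac R S r \<one>\<^bsub>R\<^esub>);
      m = genideal RP (\<iota> ` P) in
     algebra_via (\<lambda>r. m +>\<^bsub>RP\<^esub> \<iota> r) (RP Quot m))"

section \<open>Tensor products\<close>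

text \<open>\<open>M \<otimes>\<^sub>R N\<close> is the free abelian group on \<open>M \<times> N\<close> modulo the bilinear relations. For
  \<open>R\<close>-algebras, multiplying the generators componentwise makes the free group a ring in which
  the relations form an ideal; for mere modules the fields \<open>mult\<close> and \<open>one\<close> are meaningless.\<close>

definition free_ring :: "('a, 'b, 'p) module_scheme \<Rightarrow> ('a, 'c, 'q) module_scheme \<Rightarrow> ('b \<times> 'c \<Rightarrow>\<^sub>0 int) ring" where
  "free_ring M N = \<lparr>carrier = carrier (free_Abelian_group (carrier M \<times> carrier N)),
     monoid.mult = (\<lambda>c d. frag_extend (\<lambda>(m, n).
               frag_extend (\<lambda>(m', n'). frag_of (m \<otimes>\<^bsub>M\<^esub> m', n \<otimes>\<^bsub>N\<^esub> n')) d) c),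
     one = frag_of (\<one>\<^bsub>M\<^esub>, \<one>\<^bsub>N\<^esub>), ring.zero = 0, ring.add = (+)\<rparr>"

definition tensor_rel ::
    "('a, 'm) ring_scheme \<Rightarrow> ('a, 'b, 'p) module_scheme \<Rightarrow> ('a, 'c, 'q) module_scheme \<Rightarrow> ('b \<times> 'c \<Rightarrow>\<^sub>0 int) set" where
  "tensor_rel R M N = generate (free_Abelian_group (carrier M \<times> carrier N))
     ({frag_of (x \<oplus>\<^bsub>M\<^esub> x', y) - frag_of (x, y) - frag_of (x', y) | x x' y.
         x \<in> carrier M \<and> x' \<in> carrier M \<and> y \<in> carrier N} \<union>
      {frag_of (x, y \<oplus>\<^bsub>N\<^esub> y') - frag_of (x, y) - frag_of (x, y') | x y y'.
         x \<in> carrier M \<and> y \<in> carrier N \<and> y' \<in> carrier N} \<union>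
      {frag_of (r \<odot>\<^bsub>M\<^esub> x, y) - frag_of (x, r \<odot>\<^bsub>N\<^esub> y) | r x y.
         r \<in> carrier R \<and> x \<in> carrier M \<and> y \<in> carrier N})"

definition tensor ::
    "('a, 'm) ring_scheme \<Rightarrow> ('a, 'b, 'p) module_scheme \<Rightarrow> ('a, 'c, 'q) module_scheme \<Rightarrow>
       ('b \<times> 'c \<Rightarrow>\<^sub>0 int) set ring" where
  "tensor R M N = free_ring M N Quot tensor_rel R M N"

definition pure_tensor ::
    "('a, 'm) ring_scheme \<Rightarrow> ('a, 'b, 'p) module_scheme \<Rightarrow> ('a, 'c, 'q) module_scheme \<Rightarrow>
       'b \<Rightarrow> 'c \<Rightarrow> ('b \<times> 'c \<Rightarrow>\<^sub>0 int) set" where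
  "pure_tensor R M N x y = tensor_rel R M N +>\<^bsub>free_ring M N\<^esub> frag_of (x, y)"

text \<open>\<open>f \<otimes> g : M \<otimes>\<^sub>R N \<rightarrow> M' \<otimes>\<^sub>R N'\<close>, where the targets \<open>M'\<close> and \<open>N'\<close> are explicit arguments\<close>

definition tensor_map ::
    "('a, 'm) ring_scheme \<Rightarrow> ('a, 'b, 'p) module_scheme \<Rightarrow> ('a, 'c, 'q) module_scheme \<Rightarrow>
       ('d \<Rightarrow> 'b) \<Rightarrow> ('e \<Rightarrow> 'c) \<Rightarrow> ('d \<times> 'e \<Rightarrow>\<^sub>0 int) set \<Rightarrow> ('b \<times> 'c \<Rightarrow>\<^sub>0 int) set" where
  "tensor_map R M' N' f g U =
     (\<Union>c\<in>U. tensor_rel R M' N' +>\<^bsub>free_ring M' N'\<^esub> frag_extend (\<lambda>(x, y). frag_of (f x, g y)) c)"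

text \<open>\<open>A \<otimes>\<^sub>R L\<close> as an \<open>L\<close>-algebra\<close>

definition base_change ::
    "('a, 'm) ring_scheme \<Rightarrow> ('a, 'b, 'p) module_scheme \<Rightarrow> ('a, 'c, 'q) module_scheme \<Rightarrow>
       ('c, ('b \<times> 'c \<Rightarrow>\<^sub>0 int) set) module" where
  "base_change R A L = algebra_via (\<lambda>l. pure_tensor R A L \<one>\<^bsub>A\<^esub> l) (tensor R A L)"

section \<open>Fibrations and residual coordinates\<close>

text \<open>HOL cannot quantify over all types inside a definition. Flatness is therefore tested on modules
  with carrier in a type \<open>'x\<close>; a theorem that concludes it for a type variable \<open>'x\<close> concludes it
  for all modules.\<close>

definition flat :: "'x itself \<Rightarrow> ('a, 'm) ring_scheme \<Rightarrow> ('a, 'b, 'p) module_scheme \<Rightarrow> bool" where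
  "flat _ R A \<longleftrightarrow> (\<forall>(N :: ('a, 'x) module) (N' :: ('a, 'x) module) g.
     module R N \<and> module R N' \<and> g \<in> hom (add_monoid N) (add_monoid N') \<and>
     (\<forall>r\<in>carrier R. \<forall>x\<in>carrier N. g (r \<odot>\<^bsub>N\<^esub> x) = r \<odot>\<^bsub>N'\<^esub> g x) \<and> inj_on g (carrier N) \<longrightarrow>
     inj_on (tensor_map R A N' id g) (carrier (tensor R A N)))"

definition A2_fibration :: "'x itself \<Rightarrow> ('a, 'm) ring_scheme \<Rightarrow> ('a, 'b, 'p) module_scheme \<Rightarrow> bool" where
  "A2_fibration T R A \<longleftrightarrow> algebra R A \<and>
     (\<exists>G. finite G \<and> G \<subseteq> carrier A \<and> adjoin R A G = carrier A) \<and>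
     flat T R A \<and>
     (\<forall>P. primeideal P R \<longrightarrow> is_poly_ring (residue_alg R P) 2 (base_change R A (residue_alg R P)))"

definition residual_coordinate ::
    "'x itself \<Rightarrow> ('a, 'm) ring_scheme \<Rightarrow> ('a, 'b, 'p) module_scheme \<Rightarrow> 'b \<Rightarrow> bool" where
  "residual_coordinate T R A F \<longleftrightarrow> A2_fibration T R A \<and> F \<in> carrier A \<and> alg_independent R A {F} \<and>
     (\<forall>P. primeideal P R \<longrightarrow>
        (let k = residue_alg R P; RF = A\<lparr>carrier := adjoin R A {F}\<rparr> in
         is_poly_ring (tensor R RF k) 1 (algebra_via (tensor_map R A k id id) (tensor R A k))))"

end

theory Submission
  imports Defs "HOL-Library.Multiset_Order"
begin

text \<open>
  Present \<open>A\<close> as the ring of fixed points of the idempotent endomorphism \<open>X\<^sub>i \<mapsto> x\<^sub>i\<close> of \<open>B\<close>, so that \<open>A \<otimes> L\<close> is the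
  ring of fixed points of an idempotent endomorphism of \<open>L[X]\<close>, and use the derivations
  \<open>D\<^sub>i\<^sub>j h = F\<^sub>i h\<^sub>j - F\<^sub>j h\<^sub>i\<close> of \<open>B\<close>. Over a domain, unimodularity of the gradient shows that the polynomials
  killed by all \<open>D\<^sub>i\<^sub>j\<close> are exactly those in \<open>R[F]\<close>. Noetherian induction extends this to every ideal \<open>J\<close>: if all
  coefficients of all \<open>D\<^sub>i\<^sub>j h\<close> lie in \<open>J\<close>, then \<open>h \<in> R[F] + J[X]\<close>.

  Let \<open>Q \<subseteq> P\<close> be primes, \<open>Q\<close> minimal, \<open>K = Qt(R/Q)\<close>, and let \<open>V \<subseteq> K\<close> be a valuation ring lying over \<open>P\<close>, with
  residue field \<open>\<kappa>\<close>. Write \<open>A \<otimes> K = K[F, \<tau>]\<close> with \<open>\<tau> \<in> A\<close>, and let \<open>J\<close> be generated by the coefficients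
  of the \<open>D\<^sub>i\<^sub>j \<tau>\<close>. Then \<open>\<tau> = u + h\<close> with \<open>u \<in> R[F]\<close> and \<open>h \<in> J[X]\<close>. Dividing \<open>h\<close> by a generator of
  \<open>J V\<close> gives \<open>s \<in> V[X]\<close> with \<open>K[F, s] = K[F, \<tau>]\<close> for which some \<open>D\<^sub>i\<^sub>j s\<close> does not vanish over \<open>\<kappa>\<close>.
  Hence \<open>F\<close> and \<open>s\<close> stay algebraically independent over \<open>\<kappa>\<close>, which forces \<open>A \<otimes> \<kappa> = \<kappa>[F, s]\<close>.
  A \<open>k(P)\<close>-linear retraction \<open>\<kappa> \<rightarrow> k(P)\<close> carries this down to \<open>k(P)\<close>.
\<close>

section \<open>Polynomial rings\<close>

text \<open>The obstacle: a second generator of the generic fibre may turn into a polynomial in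
  \<open>F\<close> over k(P). Over a field the common kernel of the \<open>D\<^sub>i\<^sub>j\<close>
  consists of the polynomials in \<open>F\<close>, so for \<tau> in \<open>A\<close> this happens
  exactly when \<open>P\<close> contains all coefficients of the
  \<open>D\<^sub>i\<^sub>j \<tau>\<close>. The repair divides by a greatest common divisor of these
  coefficients, which need not exist in \<open>R\<close> but exists in a valuation ring of the
  fraction field. The quotient is integral only once \<tau> has been corrected by a polynomial in
  \<open>F\<close>; since the ideal of coefficients is arbitrary, the lifting statement is needed
  for all ideals and not only for primes. The price is the residue field \<kappa>, which may be much
  larger than k(P), and the retraction back is linear but not multiplicative. That suffices, because
  \<open>F\<close> and the images of the variables are defined over \<open>R\<close>, so that
  \<open>s\<close> alone has to be moved; a comparison of leading monomials shows that the moved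
  element is, up to a polynomial in \<open>F\<close>, a scalar multiple of \<open>s\<close>.\<close>

lemma finite_subset_mset_set [simp]: "finite {k. k \<subseteq># m}"
proof (induction m)
  case (add x m)
  have "{k. k \<subseteq># add_mset x m} \<subseteq> {k. k \<subseteq># m} \<union> add_mset x ` {k. k \<subseteq># m}"
  proof
    fix k assume "k \<in> {k. k \<subseteq># add_mset x m}"
    hence k: "k \<subseteq># add_mset x m" by simp
    show "k \<in> {k. k \<subseteq># m} \<union> add_mset x ` {k. k \<subseteq># m}"
    proof (cases "x \<in># k")
      case True
      then obtain k' where "k = add_mset x k'" by (metis multi_member_split)
      with k show ?thesis by auto
    next
      case False
      with k have "k \<subseteq># m" by (metis diff_single_trivial subset_eq_diff_conv add_mset_add_single)
      thus ?thesis by simp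
    qed
  qed
  thus ?case using add.IH by (meson finite_UnI finite_imageI finite_subset)
qed simp

abbreviation mconst :: "('a, 'm) ring_scheme \<Rightarrow> 'a \<Rightarrow> 'i multiset \<Rightarrow> 'a" where
  "mconst R \<equiv> ring.indexed_const R"

abbreviation mvar :: "('a, 'm) ring_scheme \<Rightarrow> 'i \<Rightarrow> 'i multiset \<Rightarrow> 'a" where
  "mvar R \<equiv> ring.indexed_var R"

context cring
begin

lemma mpoly_add: "p \<oplus>\<^bsub>mpoly R I\<^esub> q = (\<lambda>m. p m \<oplus> q m)"
  by (simp add: mpoly_def indexed_padd_def)

lemma mpoly_mult: "p \<otimes>\<^bsub>mpoly R I\<^esub> q = (\<lambda>m. \<Oplus>k\<in>{k. k \<subseteq># m}. p k \<otimes> q (m - k))"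
  by (simp add: mpoly_def)

lemma mpoly_zero: "\<zero>\<^bsub>mpoly R I\<^esub> = (\<lambda>m. \<zero>)"
  by (simp add: mpoly_def indexed_zero_def)

lemma mpoly_one: "\<one>\<^bsub>mpoly R I\<^esub> = mconst R \<one>"
  by (simp add: mpoly_def)

lemma mpoly_smult: "r \<odot>\<^bsub>mpoly R I\<^esub> p = (\<lambda>m. r \<otimes> p m)"
  by (simp add: mpoly_def)

lemma mconst_simps [simp]: "mconst R a {#} = a" "m \<noteq> {#} \<Longrightarrow> mconst R a m = \<zero>"
  "mconst R a (add_mset i m') = \<zero>"
  by (simp_all add: indexed_const_def)

lemma mconst_closed [simp, intro]: "a \<in> carrier R \<Longrightarrow> mconst R a \<in> carrier (mpoly R I)"
  by (simp add: mpoly_def indexed_const)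

lemma mpoly_add_closed: "p \<in> carrier (mpoly R I) \<Longrightarrow> q \<in> carrier (mpoly R I) \<Longrightarrow>
    p \<oplus>\<^bsub>mpoly R I\<^esub> q \<in> carrier (mpoly R I)"
  by (simp add: mpoly_def indexed_padd)

lemma mpoly_coeff_closed [simp]: "p \<in> carrier (mpoly R I) \<Longrightarrow> p m \<in> carrier R"
  using indexed_pset_in_carrier[of "carrier R" p I] carrier_coeffE[of p m] by (simp add: mpoly_def)

lemma indexed_pmult_closed: "p \<in> carrier (mpoly R I) \<Longrightarrow> i \<in> I \<Longrightarrow> indexed_pmult p i \<in> carrier (mpoly R I)"
  by (simp add: mpoly_def indexed_pmult)

text \<open>The carrier is generated inductively from constants, sums and multiplications by a
  variable. The description by finite support is what shows that coefficientwise operations, such as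
  derivatives and changes of coefficients, stay inside it.\<close>

lemma mpoly_carrier_iff:
  "p \<in> carrier (mpoly R I) \<longleftrightarrow>
     (\<forall>m. p m \<in> carrier R) \<and> finite {m. p m \<noteq> \<zero>} \<and> (\<forall>m. p m \<noteq> \<zero> \<longrightarrow> set_mset m \<subseteq> I)"
proof
  assume "p \<in> carrier (mpoly R I)"
  hence "p \<in> indexed_pset I (carrier R)" by (simp add: mpoly_def)
  thus "(\<forall>m. p m \<in> carrier R) \<and> finite {m. p m \<noteq> \<zero>} \<and> (\<forall>m. p m \<noteq> \<zero> \<longrightarrow> set_mset m \<subseteq> I)"
  proof induction
    case (indexed_const k)
    have "{m. mconst R k m \<noteq> \<zero>} \<subseteq> {{#}}" by (auto simp: indexed_const_def)
    hence "finite {m. mconst R k m \<noteq> \<zero>}" by (rule finite_subset) simp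
    thus ?case using indexed_const by (auto simp: indexed_const_def)
  next
    case (indexed_padd P Q)
    have "{m. indexed_padd P Q m \<noteq> \<zero>} \<subseteq> {m. P m \<noteq> \<zero>} \<union> {m. Q m \<noteq> \<zero>}"
      by (auto simp: indexed_padd_def)
    hence "finite {m. indexed_padd P Q m \<noteq> \<zero>}"
      using indexed_padd.IH by (meson finite_UnI finite_subset)
    moreover have "set_mset m \<subseteq> I" if "indexed_padd P Q m \<noteq> \<zero>" for m
      using indexed_padd.IH that unfolding indexed_padd_def
      by (cases "P m = \<zero>"; cases "Q m = \<zero>") auto
    ultimately show ?case using indexed_padd.IH by (simp add: indexed_padd_def)
  next
    case (indexed_pmult P i)
    have "{m. indexed_pmult P i m \<noteq> \<zero>} \<subseteq> add_mset i ` {m. P m \<noteq> \<zero>}"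
    proof
      fix m assume "m \<in> {m. indexed_pmult P i m \<noteq> \<zero>}"
      hence "i \<in># m" "P (m - {#i#}) \<noteq> \<zero>" by (auto simp: indexed_pmult_def split: if_splits)
      thus "m \<in> add_mset i ` {m. P m \<noteq> \<zero>}"
        by (intro image_eqI[of _ _ "m - {#i#}"]) auto
    qed
    hence "finite {m. indexed_pmult P i m \<noteq> \<zero>}"
      using indexed_pmult.IH finite_surj by blast
    moreover have "set_mset m \<subseteq> I" if nz: "indexed_pmult P i m \<noteq> \<zero>" for m
    proof -
      have "i \<in># m" "P (m - {#i#}) \<noteq> \<zero>" using nz by (auto simp: indexed_pmult_def split: if_splits)
      then obtain m' where "m = add_mset i m'" "P m' \<noteq> \<zero>" by (metis insert_DiffM)
      thus ?thesis using indexed_pmult.IH indexed_pmult.hyps by auto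
    qed
    ultimately show ?case using indexed_pmult.IH by (simp add: indexed_pmult_def)
  qed
next
  \<comment> \<open>A monomial arises from its coefficient by multiplying with its variables one at
    a time; a finitely supported function is then the sum of its monomials.\<close>
  have single: "(\<lambda>m. if m = m0 then a else \<zero>) \<in> carrier (mpoly R I)"
    if "set_mset m0 \<subseteq> I" "a \<in> carrier R" for m0 a
    using that
  proof (induction m0)
    case empty
    have "(\<lambda>m::'c multiset. if m = {#} then a else \<zero>) = mconst R a" by (auto simp: indexed_const_def)
    thus ?case using empty by simp
  next
    case (add i m0)
    have "(\<lambda>m. if m = add_mset i m0 then a else \<zero>) = indexed_pmult (\<lambda>m. if m = m0 then a else \<zero>) i"
      by (auto simp: indexed_pmult_def fun_eq_iff)
    thus ?case using add by (simp add: indexed_pmult_closed)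
  qed
  assume p: "(\<forall>m. p m \<in> carrier R) \<and> finite {m. p m \<noteq> \<zero>} \<and> (\<forall>m. p m \<noteq> \<zero> \<longrightarrow> set_mset m \<subseteq> I)"
  have "(\<lambda>m. if m \<in> M then p m else \<zero>) \<in> carrier (mpoly R I)" if "finite M" "M \<subseteq> {m. p m \<noteq> \<zero>}" for M
    using that
  proof induction
    case empty
    show ?case using mconst_closed[OF zero_closed, of I] by (simp add: indexed_zero_def)
  next
    case (insert m0 M)
    have "(\<lambda>m. if m \<in> insert m0 M then p m else \<zero>) =
      (\<lambda>m. if m = m0 then p m0 else \<zero>) \<oplus>\<^bsub>mpoly R I\<^esub> (\<lambda>m. if m \<in> M then p m else \<zero>)"
      using p insert.hyps by (auto simp: mpoly_add fun_eq_iff)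
    thus ?case using insert p by (simp add: mpoly_add_closed single)
  qed
  from this[of "{m. p m \<noteq> \<zero>}"] p have "(\<lambda>m. if m \<in> {m. p m \<noteq> \<zero>} then p m else \<zero>) \<in> carrier (mpoly R I)"
    by simp
  moreover have "(\<lambda>m. if m \<in> {m. p m \<noteq> \<zero>} then p m else \<zero>) = p" by auto
  ultimately show "p \<in> carrier (mpoly R I)" by simp
qed

lemma mpoly_carrierI:
  assumes "\<And>m. p m \<in> carrier R" "finite {m. p m \<noteq> \<zero>}" "\<And>m. p m \<noteq> \<zero> \<Longrightarrow> set_mset m \<subseteq> I"
  shows "p \<in> carrier (mpoly R I)"
  using assms by (simp add: mpoly_carrier_iff)

lemma mpoly_finite_support: "p \<in> carrier (mpoly R I) \<Longrightarrow> finite {m. p m \<noteq> \<zero>}"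
  by (simp add: mpoly_carrier_iff)

lemma mpoly_support_subset: "p \<in> carrier (mpoly R I) \<Longrightarrow> p m \<noteq> \<zero> \<Longrightarrow> set_mset m \<subseteq> I"
  by (simp add: mpoly_carrier_iff)

lemma mconst_mult:
  assumes "a \<in> carrier R" "\<And>m. q m \<in> carrier R"
  shows "mconst R a \<otimes>\<^bsub>mpoly R I\<^esub> q = (\<lambda>m. a \<otimes> q m)"
proof
  fix m
  have "(\<Oplus>k\<in>{k. k \<subseteq># m}. mconst R a k \<otimes> q (m - k)) = (\<Oplus>k\<in>{k. k \<subseteq># m}. if {#} = k then a \<otimes> q (m - k) else \<zero>)"
    using assms by (intro finsum_cong') (auto simp: indexed_const_def)
  also have "\<dots> = a \<otimes> q m"
    using assms finsum_singleton[of "{#}" "{k. k \<subseteq># m}" "\<lambda>k. a \<otimes> q (m - k)"] by simp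
  finally show "(mconst R a \<otimes>\<^bsub>mpoly R I\<^esub> q) m = a \<otimes> q m" by (simp add: mpoly_mult)
qed

text \<open>Multiplication by a variable shifts the convolution sum. With this rule, distributivity
  and the case of constants, closure and associativity of the product follow by induction on the
  first factor, without double sums over submultisets.\<close>

lemma indexed_pmult_mult:
  assumes "\<And>m. p m \<in> carrier R" "\<And>m. q m \<in> carrier R"
  shows "indexed_pmult p i \<otimes>\<^bsub>mpoly R I\<^esub> q = indexed_pmult (p \<otimes>\<^bsub>mpoly R I\<^esub> q) i"
proof
  fix m
  show "(indexed_pmult p i \<otimes>\<^bsub>mpoly R I\<^esub> q) m = indexed_pmult (p \<otimes>\<^bsub>mpoly R I\<^esub> q) i m"
  proof (cases "i \<in># m")
    case True
    then obtain m' where m: "m = add_mset i m'" by (metis multi_member_split)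
    let ?g = "\<lambda>k. indexed_pmult p i k \<otimes> q (m - k)"
    have inj: "inj_on (add_mset i) {k. k \<subseteq># m'}" by (auto simp: inj_on_def)
    have "(\<Oplus>k\<in>{k. k \<subseteq># m}. ?g k) = (\<Oplus>k\<in>add_mset i ` {k. k \<subseteq># m'}. ?g k)"
    proof (rule add.finprod_mono_neutral_cong_right)
      show "add_mset i ` {k. k \<subseteq># m'} \<subseteq> {k. k \<subseteq># m}" using m by auto
      fix k assume "k \<in> {k. k \<subseteq># m} - add_mset i ` {k. k \<subseteq># m'}"
      hence "i \<notin># k" using m by (auto simp: image_iff dest!: multi_member_split)
      thus "?g k = \<zero>" using assms by (simp add: indexed_pmult_def)
    qed (use assms in \<open>auto simp: indexed_pmult_def\<close>)
    also have "\<dots> = (\<Oplus>k\<in>{k. k \<subseteq># m'}. ?g (add_mset i k))"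
      using assms inj by (subst add.finprod_reindex[symmetric]) (auto simp: indexed_pmult_def)
    also have "\<dots> = (\<Oplus>k\<in>{k. k \<subseteq># m'}. p k \<otimes> q (m' - k))"
      using assms by (intro finsum_cong') (auto simp: indexed_pmult_def m)
    finally show ?thesis by (simp add: mpoly_mult indexed_pmult_def m)
  next
    case False
    have "(\<Oplus>k\<in>{k. k \<subseteq># m}. indexed_pmult p i k \<otimes> q (m - k)) = \<zero>"
    proof (rule add.finprod_one_eqI)
      fix k assume "k \<in> {k. k \<subseteq># m}"
      hence "i \<notin># k" using False mset_subset_eqD[of k m i] by auto
      thus "indexed_pmult p i k \<otimes> q (m - k) = \<zero>" using assms by (simp add: indexed_pmult_def)
    qed
    thus ?thesis using False by (simp add: mpoly_mult indexed_pmult_def)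
  qed
qed

lemma mpoly_comm:
  fixes p q :: "'i multiset \<Rightarrow> 'a"
  assumes "\<And>m. p m \<in> carrier R" "\<And>m. q m \<in> carrier R"
  shows "p \<otimes>\<^bsub>mpoly R I\<^esub> q = q \<otimes>\<^bsub>mpoly R I\<^esub> p"
proof
  fix m :: "'i multiset"
  \<comment> \<open>Commutativity is the reflection \<open>k \<mapsto> m - k\<close> of the
    submultisets of \<open>m\<close>.\<close>
  have inj: "inj_on (\<lambda>k. m - k) {k. k \<subseteq># m}"
    by (rule inj_on_inverseI[where g = "\<lambda>k. m - k"]) (simp add: multiset_eq_iff subseteq_mset_def)
  have img: "(\<lambda>k. m - k) ` {k. k \<subseteq># m} = {k. k \<subseteq># m}"
  proof
    show "{k. k \<subseteq># m} \<subseteq> (\<lambda>k. m - k) ` {k. k \<subseteq># m}"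
    proof
      fix k assume k: "k \<in> {k. k \<subseteq># m}"
      hence "k = m - (m - k)" by (simp add: multiset_eq_iff subseteq_mset_def)
      moreover have "m - k \<subseteq># m" by simp
      ultimately show "k \<in> (\<lambda>k. m - k) ` {k. k \<subseteq># m}" by blast
    qed
  qed auto
  have "(\<Oplus>k\<in>{k. k \<subseteq># m}. p k \<otimes> q (m - k)) = (\<Oplus>k\<in>(\<lambda>k. m - k) ` {k. k \<subseteq># m}. p k \<otimes> q (m - k))"
    by (simp only: img)
  also have "\<dots> = (\<Oplus>k\<in>{k. k \<subseteq># m}. p (m - k) \<otimes> q (m - (m - k)))"
    using assms inj by (subst add.finprod_reindex) (auto simp: img)
  also have "\<dots> = (\<Oplus>k\<in>{k. k \<subseteq># m}. q k \<otimes> p (m - k))"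
  proof (rule finsum_cong')
    fix k assume "k \<in> {k. k \<subseteq># m}"
    hence "m - (m - k) = k" by (simp add: multiset_eq_iff subseteq_mset_def)
    thus "p (m - k) \<otimes> q (m - (m - k)) = q k \<otimes> p (m - k)" using assms by (simp add: m_comm)
  qed (use assms in auto)
  finally show "(p \<otimes>\<^bsub>mpoly R I\<^esub> q) m = (q \<otimes>\<^bsub>mpoly R I\<^esub> p) m" by (simp add: mpoly_mult)
qed

lemma mpoly_l_distr:
  assumes "\<And>m. p m \<in> carrier R" "\<And>m. q m \<in> carrier R" "\<And>m. r m \<in> carrier R"
  shows "(p \<oplus>\<^bsub>mpoly R I\<^esub> q) \<otimes>\<^bsub>mpoly R I\<^esub> r = p \<otimes>\<^bsub>mpoly R I\<^esub> r \<oplus>\<^bsub>mpoly R I\<^esub> q \<otimes>\<^bsub>mpoly R I\<^esub> r"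
proof
  fix m
  show "((p \<oplus>\<^bsub>mpoly R I\<^esub> q) \<otimes>\<^bsub>mpoly R I\<^esub> r) m = (p \<otimes>\<^bsub>mpoly R I\<^esub> r \<oplus>\<^bsub>mpoly R I\<^esub> q \<otimes>\<^bsub>mpoly R I\<^esub> r) m"
    using assms by (simp add: mpoly_mult mpoly_add l_distr finsum_addf)
qed

lemma mpoly_coeff_mult_closed:
  assumes "\<And>m. p m \<in> carrier R" "\<And>m. q m \<in> carrier R"
  shows "(p \<otimes>\<^bsub>mpoly R I\<^esub> q) m \<in> carrier R"
  using assms by (auto simp: mpoly_mult intro!: finsum_closed)

lemma indexed_pmult_eq_mvar_mult:
  assumes "\<And>m. p m \<in> carrier R"
  shows "indexed_pmult p i = p \<otimes>\<^bsub>mpoly R I\<^esub> mvar R i"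
proof -
  have "p \<otimes>\<^bsub>mpoly R I\<^esub> mvar R i = mvar R i \<otimes>\<^bsub>mpoly R I\<^esub> p"
    using assms by (intro mpoly_comm) (auto simp: indexed_var_def indexed_pmult_def indexed_const_def)
  also have "\<dots> = indexed_pmult (mconst R \<one> \<otimes>\<^bsub>mpoly R I\<^esub> p) i"
    unfolding indexed_var_def using assms by (intro indexed_pmult_mult) (auto simp: indexed_const_def)
  also have "\<dots> = indexed_pmult p i" using assms by (simp add: mconst_mult)
  finally show ?thesis by simp
qed

lemma mvar_closed [simp, intro]: "i \<in> I \<Longrightarrow> mvar R i \<in> carrier (mpoly R I)"
  unfolding indexed_var_def by (intro indexed_pmult_closed) auto

lemma mpoly_induct0 [consumes 1, case_names 1 2 3]:
  assumes "p \<in> carrier (mpoly R I)"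
    and "\<And>a. a \<in> carrier R \<Longrightarrow> P (mconst R a)"
    and "\<And>p q. p \<in> carrier (mpoly R I) \<Longrightarrow> q \<in> carrier (mpoly R I) \<Longrightarrow> P p \<Longrightarrow> P q \<Longrightarrow> P (p \<oplus>\<^bsub>mpoly R I\<^esub> q)"
    and "\<And>p i. p \<in> carrier (mpoly R I) \<Longrightarrow> i \<in> I \<Longrightarrow> P p \<Longrightarrow> P (indexed_pmult p i)"
  shows "P p"
proof -
  have "p \<in> indexed_pset I (carrier R)" using assms(1) by (simp add: mpoly_def)
  thus ?thesis
  proof induction
    case (indexed_padd p q)
    thus ?case using assms(3)[of p q] by (simp add: mpoly_def)
  next
    case (indexed_pmult p i)
    thus ?case using assms(4)[of p i] by (simp add: mpoly_def)
  qed (rule assms(2))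
qed

lemma mpoly_mult_closed:
  assumes "p \<in> carrier (mpoly R I)" "q \<in> carrier (mpoly R I)"
  shows "p \<otimes>\<^bsub>mpoly R I\<^esub> q \<in> carrier (mpoly R I)"
  using assms(1)
proof (induction p rule: mpoly_induct0)
  case (1 a)
  have "{m. a \<otimes> q m \<noteq> \<zero>} \<subseteq> {m. q m \<noteq> \<zero>}" using 1 by auto
  hence "finite {m. a \<otimes> q m \<noteq> \<zero>}" using mpoly_finite_support[OF assms(2)] by (rule finite_subset)
  moreover have "a \<otimes> q m \<noteq> \<zero> \<Longrightarrow> set_mset m \<subseteq> I" for m
    using mpoly_support_subset[OF assms(2), of m] 1 by (cases "q m = \<zero>") auto
  ultimately have "(\<lambda>m. a \<otimes> q m) \<in> carrier (mpoly R I)"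
    using 1 assms(2) by (intro mpoly_carrierI) auto
  thus ?case using 1 assms(2) by (simp add: mconst_mult)
next
  case (2 p p')
  thus ?case using assms(2) by (simp add: mpoly_l_distr mpoly_add_closed)
next
  case (3 p i)
  thus ?case using assms(2) by (simp add: indexed_pmult_mult indexed_pmult_closed)
qed

lemma mpoly_cring: "cring (mpoly R I)"
proof (rule cringI)
  show "abelian_group (mpoly R I)"
  proof (rule abelian_groupI)
    fix p assume p: "p \<in> carrier (mpoly R I)"
    show "\<exists>q\<in>carrier (mpoly R I). q \<oplus>\<^bsub>mpoly R I\<^esub> p = \<zero>\<^bsub>mpoly R I\<^esub>"
    proof
      have "{m. \<ominus> p m \<noteq> \<zero>} \<subseteq> {m. p m \<noteq> \<zero>}" by auto
      hence "finite {m. \<ominus> p m \<noteq> \<zero>}" using mpoly_finite_support[OF p] by (rule finite_subset)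
      moreover have "\<ominus> p m \<noteq> \<zero> \<Longrightarrow> set_mset m \<subseteq> I" for m
        using mpoly_support_subset[OF p, of m] by (cases "p m = \<zero>") auto
      ultimately show "(\<lambda>m. \<ominus> p m) \<in> carrier (mpoly R I)"
        using p by (intro mpoly_carrierI) auto
      show "(\<lambda>m. \<ominus> p m) \<oplus>\<^bsub>mpoly R I\<^esub> p = \<zero>\<^bsub>mpoly R I\<^esub>"
        using p by (auto simp: mpoly_add mpoly_zero l_neg)
    qed
  next
    show "\<zero>\<^bsub>mpoly R I\<^esub> \<in> carrier (mpoly R I)" by (auto intro!: mpoly_carrierI simp: mpoly_zero)
  qed (auto simp: mpoly_add_closed, (auto simp: mpoly_add mpoly_zero a_ac fun_eq_iff))
  show "Group.comm_monoid (mpoly R I)"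
  proof (rule Group.comm_monoidI)
    fix p q r assume p: "p \<in> carrier (mpoly R I)" and qr: "q \<in> carrier (mpoly R I)" "r \<in> carrier (mpoly R I)"
    note cl = qr[THEN mpoly_coeff_closed]
    show "p \<otimes>\<^bsub>mpoly R I\<^esub> q \<otimes>\<^bsub>mpoly R I\<^esub> r = p \<otimes>\<^bsub>mpoly R I\<^esub> (q \<otimes>\<^bsub>mpoly R I\<^esub> r)"
      using p
    proof (induction p rule: mpoly_induct0)
      case (1 a)
      have "(\<lambda>m. a \<otimes> q m) \<otimes>\<^bsub>mpoly R I\<^esub> r = (\<lambda>m. a \<otimes> (q \<otimes>\<^bsub>mpoly R I\<^esub> r) m)"
        using 1 cl by (auto simp: mpoly_mult finsum_rdistr m_assoc intro!: finsum_cong')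
      thus ?case using 1 cl by (simp add: mconst_mult mpoly_coeff_mult_closed)
    next
      case (2 p p')
      thus ?case using cl by (simp add: mpoly_l_distr mpoly_coeff_mult_closed)
    next
      case (3 p i)
      thus ?case using cl by (simp add: indexed_pmult_mult mpoly_coeff_mult_closed)
    qed
  next
    fix p q assume "p \<in> carrier (mpoly R I)" "q \<in> carrier (mpoly R I)"
    thus "p \<otimes>\<^bsub>mpoly R I\<^esub> q = q \<otimes>\<^bsub>mpoly R I\<^esub> p" by (intro mpoly_comm) auto
  qed (auto simp: mpoly_mult_closed mpoly_one mconst_mult)
  fix p q r assume "p \<in> carrier (mpoly R I)" "q \<in> carrier (mpoly R I)" "r \<in> carrier (mpoly R I)"
  thus "(p \<oplus>\<^bsub>mpoly R I\<^esub> q) \<otimes>\<^bsub>mpoly R I\<^esub> r = p \<otimes>\<^bsub>mpoly R I\<^esub> r \<oplus>\<^bsub>mpoly R I\<^esub> q \<otimes>\<^bsub>mpoly R I\<^esub> r"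
    by (intro mpoly_l_distr) auto
qed

lemma mpoly_induct [consumes 1, case_names const add var]:
  assumes "p \<in> carrier (mpoly R I)"
    and "\<And>a. a \<in> carrier R \<Longrightarrow> P (mconst R a)"
    and "\<And>p q. p \<in> carrier (mpoly R I) \<Longrightarrow> q \<in> carrier (mpoly R I) \<Longrightarrow> P p \<Longrightarrow> P q \<Longrightarrow> P (p \<oplus>\<^bsub>mpoly R I\<^esub> q)"
    and "\<And>p i. p \<in> carrier (mpoly R I) \<Longrightarrow> i \<in> I \<Longrightarrow> P p \<Longrightarrow> P (p \<otimes>\<^bsub>mpoly R I\<^esub> mvar R i)"
  shows "P p"
  using assms(1)
proof (induction p rule: mpoly_induct0)
  case (3 p i)
  thus ?case using assms(4)[of p i] indexed_pmult_eq_mvar_mult[of p i I] by simp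
qed (use assms in auto)

lemma mpoly_uminus:
  assumes "p \<in> carrier (mpoly R I)" shows "\<ominus>\<^bsub>mpoly R I\<^esub> p = (\<lambda>m. \<ominus> p m)"
proof -
  interpret B: cring "mpoly R I" by (rule mpoly_cring)
  have "p m \<oplus> (\<ominus>\<^bsub>mpoly R I\<^esub> p) m = \<zero>" for m
    using B.r_neg[OF assms] by (simp add: mpoly_add mpoly_zero fun_eq_iff)
  hence eq: "(\<ominus>\<^bsub>mpoly R I\<^esub> p) m \<oplus> p m = \<zero>" for m
    using mpoly_coeff_closed[OF assms, of m] mpoly_coeff_closed[OF B.a_inv_closed[OF assms], of m]
    by (subst a_comm) auto
  show ?thesis
    using minus_equality[OF eq] mpoly_coeff_closed[OF assms] mpoly_coeff_closed[OF B.a_inv_closed[OF assms]]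
    by auto
qed

lemma mpoly_minus:
  assumes "p \<in> carrier (mpoly R I)" "q \<in> carrier (mpoly R I)"
  shows "p \<ominus>\<^bsub>mpoly R I\<^esub> q = (\<lambda>m. p m \<ominus> q m)"
  using assms by (simp add: a_minus_def mpoly_uminus mpoly_add)

lemma mconst_hom: "mconst R \<in> ring_hom R (mpoly R I)"
proof (rule ring_hom_memI)
  fix x y assume xy: "x \<in> carrier R" "y \<in> carrier R"
  hence "mconst R y m \<in> carrier R" for m :: "'c multiset" by (simp add: indexed_const_def)
  thus "mconst R (x \<otimes> y) = mconst R x \<otimes>\<^bsub>mpoly R I\<^esub> mconst R y"
    using xy by (simp add: mconst_mult) (auto simp: indexed_const_def)
  show "mconst R (x \<oplus> y) = mconst R x \<oplus>\<^bsub>mpoly R I\<^esub> mconst R y"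
    using xy by (auto simp: mpoly_add indexed_const_def)
qed (auto simp: mpoly_one)

lemma mpoly_smult_eq: "a \<in> carrier R \<Longrightarrow> p \<in> carrier (mpoly R I) \<Longrightarrow>
    a \<odot>\<^bsub>mpoly R I\<^esub> p = mconst R a \<otimes>\<^bsub>mpoly R I\<^esub> p"
  by (simp add: mpoly_smult mconst_mult)

end

section \<open>Evaluation homomorphisms of polynomial rings\<close>

definition mmon :: "('a, 'm) ring_scheme \<Rightarrow> ('i \<Rightarrow> 'a) \<Rightarrow> 'i multiset \<Rightarrow> 'a" where
  "mmon C f m = finprod C (\<lambda>i. f i [^]\<^bsub>C\<^esub> count m i) (set_mset m)"

text \<open>An explicit finite sum over the support; \<open>ev_superset\<close> trades the support
  for a larger index set common to two polynomials. Carrying the coefficient map \<theta> covers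
  evaluations in polynomial rings and in tensor products alike.\<close>

definition mev :: "('a, 'm) ring_scheme \<Rightarrow> ('b, 'n) ring_scheme \<Rightarrow> ('a \<Rightarrow> 'b) \<Rightarrow> ('i \<Rightarrow> 'b) \<Rightarrow>
    ('i multiset \<Rightarrow> 'a) \<Rightarrow> 'b" where
  "mev S C \<theta> f p = (\<Oplus>\<^bsub>C\<^esub>m\<in>{m. p m \<noteq> \<zero>\<^bsub>S\<^esub>}. \<theta> (p m) \<otimes>\<^bsub>C\<^esub> mmon C f m)"

lemma ring_hom_cringI:
  assumes "cring S" "cring C" "\<theta> \<in> ring_hom S C" shows "ring_hom_cring S C \<theta>"
  using assms by (simp add: ring_hom_cring_def ring_hom_cring_axioms_def)

locale poly_eval = S?: cring S + C?: cring C
  for S :: "('a, 'm) ring_scheme" (structure) and C :: "('b, 'n) ring_scheme" (structure) +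
  fixes \<theta> :: "'a \<Rightarrow> 'b" and I :: "'i set" and f :: "'i \<Rightarrow> 'b"
  assumes \<theta>: "\<theta> \<in> ring_hom S C" and f: "f \<in> I \<rightarrow> carrier C"

sublocale poly_eval \<subseteq> ring_hom_cring S C \<theta>
  by (rule ring_hom_cringI) (use \<theta> in \<open>auto intro: S.is_cring C.is_cring\<close>)

context poly_eval
begin

abbreviation "ev \<equiv> mev S C \<theta> f"

lemma f_closed [simp]: "i \<in> I \<Longrightarrow> f i \<in> carrier C"
  using f by auto

lemma mmon_closed [simp]: "set_mset m \<subseteq> I \<Longrightarrow> mmon C f m \<in> carrier C"
  by (auto simp: mmon_def intro!: C.finprod_closed)

lemma mmon_superset:
  assumes "finite J" "J \<subseteq> I" "set_mset m \<subseteq> J"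
  shows "mmon C f m = finprod C (\<lambda>i. f i [^]\<^bsub>C\<^esub> count m i) J"
  unfolding mmon_def
  using assms by (intro C.finprod_mono_neutral_cong_left) (auto simp: not_in_iff)

lemma mmon_empty [simp]: "mmon C f {#} = \<one>\<^bsub>C\<^esub>"
  by (simp add: mmon_def)

lemma mmon_add_mset:
  assumes "set_mset m \<subseteq> I" "i \<in> I"
  shows "mmon C f (add_mset i m) = mmon C f m \<otimes>\<^bsub>C\<^esub> f i"
proof -
  let ?J = "insert i (set_mset m)"
  have J: "finite ?J" "?J \<subseteq> I" "i \<in> ?J" using assms by auto
  have "mmon C f (add_mset i m) = finprod C (\<lambda>j. f j [^]\<^bsub>C\<^esub> count (add_mset i m) j) ?J"
    using J by (intro mmon_superset) auto
  also have "\<dots> = finprod C (\<lambda>j. f j [^]\<^bsub>C\<^esub> count m j \<otimes>\<^bsub>C\<^esub> (if j = i then f j else \<one>\<^bsub>C\<^esub>)) ?J"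
    using J by (intro C.finprod_cong') (auto simp: subset_eq)
  also have "\<dots> = finprod C (\<lambda>j. f j [^]\<^bsub>C\<^esub> count m j) ?J \<otimes>\<^bsub>C\<^esub> finprod C (\<lambda>j. if j = i then f j else \<one>\<^bsub>C\<^esub>) ?J"
    using J by (intro C.finprod_multf) (auto simp: subset_eq)
  also have "finprod C (\<lambda>j. if j = i then f j else \<one>\<^bsub>C\<^esub>) ?J = f i"
    using J by (intro C.finprod_singleton_swap) (auto simp: subset_eq)
  also have "finprod C (\<lambda>j. f j [^]\<^bsub>C\<^esub> count m j) ?J = mmon C f m"
    using J by (intro mmon_superset[symmetric]) auto
  finally show ?thesis .
qed

lemma ev_superset:
  assumes "p \<in> carrier (mpoly S I)" "finite M" "{m. p m \<noteq> \<zero>} \<subseteq> M" "\<And>m. m \<in> M \<Longrightarrow> set_mset m \<subseteq> I"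
  shows "ev p = (\<Oplus>\<^bsub>C\<^esub>m\<in>M. \<theta> (p m) \<otimes>\<^bsub>C\<^esub> mmon C f m)"
  unfolding mev_def
  using assms by (intro C.add.finprod_mono_neutral_cong_left) (auto intro!: C.m_closed)

lemma ev_const [simp]:
  assumes "a \<in> carrier S" shows "ev (mconst S a) = \<theta> a"
proof -
  have "ev (mconst S a) = (\<Oplus>\<^bsub>C\<^esub>m\<in>{{#}}. \<theta> (mconst S a m) \<otimes>\<^bsub>C\<^esub> mmon C f m)"
    using assms by (intro ev_superset S.mconst_closed) (auto simp: S.indexed_const_def split: if_splits)
  thus ?thesis using assms by simp
qed

lemma ev_closed [simp, intro]:
  assumes "p \<in> carrier (mpoly S I)" shows "ev p \<in> carrier C"
  unfolding mev_def using assms S.mpoly_support_subset[OF assms]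
  by (intro C.finsum_closed) (auto intro!: C.m_closed mmon_closed)

lemma ev_add:
  assumes p: "p \<in> carrier (mpoly S I)" and q: "q \<in> carrier (mpoly S I)"
  shows "ev (p \<oplus>\<^bsub>mpoly S I\<^esub> q) = ev p \<oplus>\<^bsub>C\<^esub> ev q"
proof -
  let ?M = "{m. p m \<noteq> \<zero>} \<union> {m. q m \<noteq> \<zero>}"
  have M: "finite ?M" "\<And>m. m \<in> ?M \<Longrightarrow> set_mset m \<subseteq> I"
    using S.mpoly_finite_support[OF p] S.mpoly_finite_support[OF q]
      S.mpoly_support_subset[OF p] S.mpoly_support_subset[OF q] by auto
  have cl: "mmon C f m \<in> carrier C" if "m \<in> ?M" for m using M(2)[OF that] by simp
  have "ev (p \<oplus>\<^bsub>mpoly S I\<^esub> q) =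
      (\<Oplus>\<^bsub>C\<^esub>m\<in>?M. \<theta> ((p \<oplus>\<^bsub>mpoly S I\<^esub> q) m) \<otimes>\<^bsub>C\<^esub> mmon C f m)"
    using p q M by (intro ev_superset S.mpoly_add_closed) (auto simp: S.mpoly_add)
  also have "\<dots> = (\<Oplus>\<^bsub>C\<^esub>m\<in>?M. \<theta> (p m) \<otimes>\<^bsub>C\<^esub> mmon C f m \<oplus>\<^bsub>C\<^esub> \<theta> (q m) \<otimes>\<^bsub>C\<^esub> mmon C f m)"
    using p q cl by (intro C.finsum_cong') (auto simp: S.mpoly_add C.l_distr)
  also have "\<dots> = (\<Oplus>\<^bsub>C\<^esub>m\<in>?M. \<theta> (p m) \<otimes>\<^bsub>C\<^esub> mmon C f m) \<oplus>\<^bsub>C\<^esub> (\<Oplus>\<^bsub>C\<^esub>m\<in>?M. \<theta> (q m) \<otimes>\<^bsub>C\<^esub> mmon C f m)"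
    using p q cl by (intro C.finsum_addf) auto
  also have "(\<Oplus>\<^bsub>C\<^esub>m\<in>?M. \<theta> (p m) \<otimes>\<^bsub>C\<^esub> mmon C f m) = ev p"
    using p M by (intro ev_superset[symmetric]) auto
  also have "(\<Oplus>\<^bsub>C\<^esub>m\<in>?M. \<theta> (q m) \<otimes>\<^bsub>C\<^esub> mmon C f m) = ev q"
    using q M by (intro ev_superset[symmetric]) auto
  finally show ?thesis .
qed

lemma ev_pmult:
  assumes p: "p \<in> carrier (mpoly S I)" and i: "i \<in> I"
  shows "ev (S.indexed_pmult p i) = ev p \<otimes>\<^bsub>C\<^esub> f i"
proof -
  let ?M = "{m. p m \<noteq> \<zero>}"
  note ps = S.mpoly_support_subset[OF p]
  have cl: "mmon C f m \<in> carrier C" if "m \<in> ?M" for m using ps that by simp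
  have fin: "finite ?M" by (rule S.mpoly_finite_support[OF p])
  have inj: "inj_on (add_mset i) ?M" by (auto simp: inj_on_def)
  have "ev (S.indexed_pmult p i) = (\<Oplus>\<^bsub>C\<^esub>m\<in>add_mset i ` ?M. \<theta> (S.indexed_pmult p i m) \<otimes>\<^bsub>C\<^esub> mmon C f m)"
  proof (rule ev_superset)
    show "{m. S.indexed_pmult p i m \<noteq> \<zero>} \<subseteq> add_mset i ` ?M"
    proof
      fix m assume "m \<in> {m. S.indexed_pmult p i m \<noteq> \<zero>}"
      hence "i \<in># m" "p (m - {#i#}) \<noteq> \<zero>" by (auto simp: S.indexed_pmult_def split: if_splits)
      thus "m \<in> add_mset i ` ?M" by (intro image_eqI[of _ _ "m - {#i#}"]) auto
    qed
  qed (use ps[THEN subsetD] p i fin in \<open>auto intro!: S.indexed_pmult_closed\<close>)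
  also have "\<dots> = (\<Oplus>\<^bsub>C\<^esub>m\<in>?M. \<theta> (S.indexed_pmult p i (add_mset i m)) \<otimes>\<^bsub>C\<^esub> mmon C f (add_mset i m))"
    using inj p i ps by (subst C.add.finprod_reindex) (auto simp: S.indexed_pmult_def subset_eq intro!: C.m_closed mmon_closed)
  also have "\<dots> = (\<Oplus>\<^bsub>C\<^esub>m\<in>?M. \<theta> (p m) \<otimes>\<^bsub>C\<^esub> mmon C f m \<otimes>\<^bsub>C\<^esub> f i)"
    using p i ps cl by (intro C.finsum_cong') (auto simp: S.indexed_pmult_def mmon_add_mset C.m_assoc)
  also have "\<dots> = ev p \<otimes>\<^bsub>C\<^esub> f i"
    unfolding mev_def using p i cl fin by (intro C.finsum_ldistr[symmetric]) auto
  finally show ?thesis .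
qed

lemma ev_const_mult:
  assumes a: "a \<in> carrier S" and q: "q \<in> carrier (mpoly S I)"
  shows "ev (mconst S a \<otimes>\<^bsub>mpoly S I\<^esub> q) = \<theta> a \<otimes>\<^bsub>C\<^esub> ev q"
proof -
  let ?M = "{m. q m \<noteq> \<zero>}"
  note qs = S.mpoly_support_subset[OF q]
  have cl: "mmon C f m \<in> carrier C" if "m \<in> ?M" for m using qs that by simp
  have fin: "finite ?M" by (rule S.mpoly_finite_support[OF q])
  have eq: "mconst S a \<otimes>\<^bsub>mpoly S I\<^esub> q = (\<lambda>m. a \<otimes> q m)"
    using a q by (simp add: S.mconst_mult)
  have "ev (mconst S a \<otimes>\<^bsub>mpoly S I\<^esub> q) = (\<Oplus>\<^bsub>C\<^esub>m\<in>?M. \<theta> (a \<otimes> q m) \<otimes>\<^bsub>C\<^esub> mmon C f m)"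
    unfolding eq
  proof (rule ev_superset)
    show "(\<lambda>m. a \<otimes> q m) \<in> carrier (mpoly S I)"
      using S.mpoly_mult_closed[OF S.mconst_closed[OF a] q] eq by simp
  qed (use a q qs fin in auto)
  also have "\<dots> = (\<Oplus>\<^bsub>C\<^esub>m\<in>?M. \<theta> a \<otimes>\<^bsub>C\<^esub> (\<theta> (q m) \<otimes>\<^bsub>C\<^esub> mmon C f m))"
    using a q cl by (intro C.finsum_cong') (auto simp: C.m_assoc)
  also have "\<dots> = \<theta> a \<otimes>\<^bsub>C\<^esub> ev q"
    unfolding mev_def using a q cl fin by (intro C.finsum_rdistr[symmetric]) auto
  finally show ?thesis .
qed

lemma ev_hom: "ev \<in> ring_hom (mpoly S I) C"
proof (rule ring_hom_memI)
  fix p q assume p: "p \<in> carrier (mpoly S I)" and q: "q \<in> carrier (mpoly S I)"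
  show "ev (p \<otimes>\<^bsub>mpoly S I\<^esub> q) = ev p \<otimes>\<^bsub>C\<^esub> ev q"
    using p
  proof (induction p rule: S.mpoly_induct0)
    case (1 a)
    thus ?case using q by (simp add: ev_const_mult)
  next
    case (2 p p')
    thus ?case using q by (simp add: S.mpoly_l_distr ev_add S.mpoly_mult_closed C.l_distr)
  next
    case (3 p i)
    thus ?case using q by (simp add: S.indexed_pmult_mult ev_pmult S.mpoly_mult_closed C.m_ac)
  qed
qed (simp_all add: ev_add S.mpoly_one)

lemma ev_var [simp]: "i \<in> I \<Longrightarrow> ev (mvar S i) = f i"
  unfolding S.indexed_var_def by (simp add: ev_pmult)

text \<open>Only \<theta> of the coefficients has to vanish, not the coefficients themselves: this
  is the form in which the induction of the Jacobian criterion \<open>ev_eq_zero_iff\<close>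
  ends.\<close>

lemma ev_coeff_zero:
  assumes p: "p \<in> carrier (mpoly S I)" and z: "\<And>m. m \<noteq> {#} \<Longrightarrow> \<theta> (p m) = \<zero>\<^bsub>C\<^esub>"
  shows "ev p = \<theta> (p {#})"
proof -
  have "(\<Oplus>\<^bsub>C\<^esub>m\<in>insert {#} {m. p m \<noteq> \<zero>}. \<theta> (p m) \<otimes>\<^bsub>C\<^esub> mmon C f m) =
    (\<Oplus>\<^bsub>C\<^esub>m\<in>{{#}}. \<theta> (p m) \<otimes>\<^bsub>C\<^esub> mmon C f m)"
    using p z S.mpoly_support_subset[OF p] S.mpoly_finite_support[OF p]
    by (intro C.add.finprod_mono_neutral_cong_right) (auto intro!: C.m_closed mmon_closed)
  moreover have "ev p = (\<Oplus>\<^bsub>C\<^esub>m\<in>insert {#} {m. p m \<noteq> \<zero>}. \<theta> (p m) \<otimes>\<^bsub>C\<^esub> mmon C f m)"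
    using p S.mpoly_finite_support[OF p] S.mpoly_support_subset[OF p] by (intro ev_superset) auto
  ultimately show ?thesis using p by simp
qed

end

text \<open>Uniqueness in the universal property; the identities between composed homomorphisms
  below are checked through it on constants and variables.\<close>

lemma mpoly_hom_eqI:
  assumes S: "cring S" and C: "cring C"
    and g: "g \<in> ring_hom (mpoly S I) C" and h: "h \<in> ring_hom (mpoly S I) C"
    and c: "\<And>a. a \<in> carrier S \<Longrightarrow> g (mconst S a) = h (mconst S a)"
    and v: "\<And>i. i \<in> I \<Longrightarrow> g (mvar S i) = h (mvar S i)"
    and p: "p \<in> carrier (mpoly S I)"
  shows "g p = h p"
proof -
  interpret S: cring S by fact
  show ?thesis using p
  proof (induction p rule: S.mpoly_induct)
    case (add p q)
    thus ?case using ring_hom_add[OF g] ring_hom_add[OF h] by simp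
  next
    case (var p i)
    thus ?case using ring_hom_mult[OF g] ring_hom_mult[OF h] v S.mvar_closed by simp
  qed (rule c)
qed

section \<open>Change of coefficients along a ring homomorphism\<close>

context ring_hom_cring
begin

lemma comp_mconst [simp]: "a \<in> carrier R \<Longrightarrow> h \<circ> mconst R a = mconst S (h a)"
  by (auto simp: R.indexed_const_def S.indexed_const_def)

lemma comp_pmult [simp]: "h \<circ> R.indexed_pmult p i = S.indexed_pmult (h \<circ> p) i"
  by (auto simp: R.indexed_pmult_def S.indexed_pmult_def)

lemma comp_mvar [simp]: "h \<circ> mvar R i = mvar S i"
  by (simp add: R.indexed_var_def S.indexed_var_def)

lemma comp_closed [simp, intro]:
  assumes p: "p \<in> carrier (mpoly R I)" shows "h \<circ> p \<in> carrier (mpoly S I)"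
proof (rule S.mpoly_carrierI)
  have "{m. (h \<circ> p) m \<noteq> \<zero>\<^bsub>S\<^esub>} \<subseteq> {m. p m \<noteq> \<zero>}" by auto
  thus "finite {m. (h \<circ> p) m \<noteq> \<zero>\<^bsub>S\<^esub>}" using R.mpoly_finite_support[OF p] by (rule finite_subset)
  show "set_mset m \<subseteq> I" if "(h \<circ> p) m \<noteq> \<zero>\<^bsub>S\<^esub>" for m
    using that R.mpoly_support_subset[OF p, of m] by (cases "p m = \<zero>") auto
qed (use p in auto)

lemma comp_hom: "(\<circ>) h \<in> ring_hom (mpoly R I) (mpoly S I)"
proof (rule ring_hom_memI)
  fix p q assume p: "p \<in> carrier (mpoly R I)" and q: "q \<in> carrier (mpoly R I)"
  show "h \<circ> (p \<otimes>\<^bsub>mpoly R I\<^esub> q) = (h \<circ> p) \<otimes>\<^bsub>mpoly S I\<^esub> (h \<circ> q)"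
  proof
    fix m
    have "h (\<Oplus>k\<in>{k. k \<subseteq># m}. p k \<otimes> q (m - k)) =
        finsum S (h \<circ> (\<lambda>k. p k \<otimes> q (m - k))) {k. k \<subseteq># m}"
      using p q by (intro hom_finsum) auto
    also have "\<dots> = finsum S (\<lambda>k. h (p k) \<otimes>\<^bsub>S\<^esub> h (q (m - k))) {k. k \<subseteq># m}"
      using p q by (intro S.finsum_cong') auto
    finally show "(h \<circ> (p \<otimes>\<^bsub>mpoly R I\<^esub> q)) m = ((h \<circ> p) \<otimes>\<^bsub>mpoly S I\<^esub> (h \<circ> q)) m"
      by (simp add: R.mpoly_mult S.mpoly_mult)
  qed
  show "h \<circ> (p \<oplus>\<^bsub>mpoly R I\<^esub> q) = (h \<circ> p) \<oplus>\<^bsub>mpoly S I\<^esub> (h \<circ> q)"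
    using p q by (auto simp: R.mpoly_add S.mpoly_add)
qed (auto simp: R.mpoly_one S.mpoly_one)

end

section \<open>Derivations\<close>

definition derivation :: "('a, 'm) ring_scheme \<Rightarrow> ('a \<Rightarrow> 'a) \<Rightarrow> bool" where
  "derivation C D \<longleftrightarrow> D \<in> carrier C \<rightarrow> carrier C \<and>
     (\<forall>x\<in>carrier C. \<forall>y\<in>carrier C. D (x \<oplus>\<^bsub>C\<^esub> y) = D x \<oplus>\<^bsub>C\<^esub> D y \<and>
        D (x \<otimes>\<^bsub>C\<^esub> y) = D x \<otimes>\<^bsub>C\<^esub> y \<oplus>\<^bsub>C\<^esub> x \<otimes>\<^bsub>C\<^esub> D y)"

lemma derivation_closed: "derivation C D \<Longrightarrow> x \<in> carrier C \<Longrightarrow> D x \<in> carrier C"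
  by (auto simp: derivation_def)

lemma derivation_add: "derivation C D \<Longrightarrow> x \<in> carrier C \<Longrightarrow> y \<in> carrier C \<Longrightarrow>
    D (x \<oplus>\<^bsub>C\<^esub> y) = D x \<oplus>\<^bsub>C\<^esub> D y"
  by (auto simp: derivation_def)

lemma derivation_mult: "derivation C D \<Longrightarrow> x \<in> carrier C \<Longrightarrow> y \<in> carrier C \<Longrightarrow>
    D (x \<otimes>\<^bsub>C\<^esub> y) = D x \<otimes>\<^bsub>C\<^esub> y \<oplus>\<^bsub>C\<^esub> x \<otimes>\<^bsub>C\<^esub> D y"
  by (auto simp: derivation_def)

lemma (in cring) derivation_one:
  assumes D: "derivation R D" shows "D \<one> = \<zero>"
proof -
  have "D \<one> = D \<one> \<oplus> D \<one>"
    using derivation_mult[OF D, of \<one> \<one>] derivation_closed[OF D, of \<one>] by simp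
  thus ?thesis using derivation_closed[OF D, of \<one>] by (metis add.l_cancel_one one_closed)
qed

context cring
begin

lemma pd_closed [simp, intro]:
  assumes p: "p \<in> carrier (mpoly R I)" shows "partial_deriv R i p \<in> carrier (mpoly R I)"
proof (rule mpoly_carrierI)
  have nz: "p (add_mset i m) \<noteq> \<zero>" if "partial_deriv R i p m \<noteq> \<zero>" for m
    using that by (auto simp: partial_deriv_def)
  have "add_mset i ` {m. partial_deriv R i p m \<noteq> \<zero>} \<subseteq> {m. p m \<noteq> \<zero>}" using nz by auto
  hence "finite (add_mset i ` {m. partial_deriv R i p m \<noteq> \<zero>})"
    using mpoly_finite_support[OF p] finite_subset by blast
  thus "finite {m. partial_deriv R i p m \<noteq> \<zero>}" by (rule finite_imageD) (auto simp: inj_on_def)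
  show "set_mset m \<subseteq> I" if "partial_deriv R i p m \<noteq> \<zero>" for m
    using mpoly_support_subset[OF p nz[OF that]] by simp
qed (use p in \<open>auto simp: partial_deriv_def\<close>)

lemma pd_add:
  assumes "p \<in> carrier (mpoly R I)" "q \<in> carrier (mpoly R I)"
  shows "partial_deriv R i (p \<oplus>\<^bsub>mpoly R I\<^esub> q) = partial_deriv R i p \<oplus>\<^bsub>mpoly R I\<^esub> partial_deriv R i q"
  using assms by (auto simp: partial_deriv_def mpoly_add add.nat_pow_distrib simp del: add.nat_pow_Suc)

lemma pd_const [simp]: "partial_deriv R i (mconst R a) = \<zero>\<^bsub>mpoly R I\<^esub>"
  by (auto simp: partial_deriv_def mpoly_zero)

text \<open>The factor \<open>Suc (count m i)\<close> splits as the exponent of \<open>i\<close> in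
  \<open>m\<close> plus one; the extra summand \<open>p\<close> for \<open>i = j\<close> is that
  one.\<close>

lemma pd_pmult:
  assumes p: "p \<in> carrier (mpoly R I)"
  shows "partial_deriv R i (indexed_pmult p j) =
     indexed_pmult (partial_deriv R i p) j \<oplus>\<^bsub>mpoly R I\<^esub> (if i = j then p else \<zero>\<^bsub>mpoly R I\<^esub>)"
proof
  fix m
  show "partial_deriv R i (indexed_pmult p j) m =
     (indexed_pmult (partial_deriv R i p) j \<oplus>\<^bsub>mpoly R I\<^esub> (if i = j then p else \<zero>\<^bsub>mpoly R I\<^esub>)) m"
  proof (cases "i = j")
    case True
    show ?thesis
    proof (cases "i \<in># m")
      case True
      then obtain m' where "m = add_mset i m'" by (metis multi_member_split)
      thus ?thesis using \<open>i = j\<close> p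
        by (simp add: partial_deriv_def indexed_pmult_def mpoly_add add.nat_pow_Suc)
    next
      case False
      moreover from False have "count m i = 0" by (simp add: not_in_iff)
      ultimately show ?thesis using \<open>i = j\<close> p
        by (simp add: partial_deriv_def indexed_pmult_def mpoly_add)
    qed
  next
    case False
    show ?thesis
    proof (cases "j \<in># m")
      case True
      then obtain m' where "m = add_mset j m'" by (metis multi_member_split)
      thus ?thesis using False p
        by (simp add: partial_deriv_def indexed_pmult_def mpoly_add mpoly_zero add_mset_commute[of i j])
    next
      case False
      thus ?thesis using \<open>i \<noteq> j\<close> p
        by (simp add: partial_deriv_def indexed_pmult_def mpoly_add mpoly_zero)
    qed
  qed
qed

lemma pd_derivation: "derivation (mpoly R I) (partial_deriv R i)"
proof -
  interpret B: cring "mpoly R I" by (rule mpoly_cring)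
  have "partial_deriv R i (p \<otimes>\<^bsub>mpoly R I\<^esub> q) =
      partial_deriv R i p \<otimes>\<^bsub>mpoly R I\<^esub> q \<oplus>\<^bsub>mpoly R I\<^esub> p \<otimes>\<^bsub>mpoly R I\<^esub> partial_deriv R i q"
    if p: "p \<in> carrier (mpoly R I)" and q: "q \<in> carrier (mpoly R I)" for p q
    using p
  proof (induction p rule: mpoly_induct0)
    case (1 a)
    have "partial_deriv R i (\<lambda>m. a \<otimes> q m) = (\<lambda>m. a \<otimes> partial_deriv R i q m)"
      using 1 q by (auto simp: partial_deriv_def add_pow_rdistr simp del: add.nat_pow_Suc)
    moreover have "partial_deriv R i q m \<in> carrier R" for m by (rule mpoly_coeff_closed[OF pd_closed[OF q]])
    ultimately have "partial_deriv R i (mconst R a \<otimes>\<^bsub>mpoly R I\<^esub> q) = mconst R a \<otimes>\<^bsub>mpoly R I\<^esub> partial_deriv R i q"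
      using 1 q by (simp add: mconst_mult)
    moreover have "mconst R a \<otimes>\<^bsub>mpoly R I\<^esub> partial_deriv R i q \<in> carrier (mpoly R I)"
      using 1 q by (intro mpoly_mult_closed) auto
    ultimately show ?case using q by (simp add: pd_const[of _ _ I])
next
    case (2 p p')
    thus ?case using q by (simp add: B.l_distr pd_add B.a_ac)
  next
    case (3 p j)
    have [simp]: "indexed_pmult r j \<otimes>\<^bsub>mpoly R I\<^esub> s = indexed_pmult (r \<otimes>\<^bsub>mpoly R I\<^esub> s) j"
      if "r \<in> carrier (mpoly R I)" "s \<in> carrier (mpoly R I)" for r s
      using that by (intro indexed_pmult_mult) auto
    have [simp]: "indexed_pmult (r \<oplus>\<^bsub>mpoly R I\<^esub> s) j = indexed_pmult r j \<oplus>\<^bsub>mpoly R I\<^esub> indexed_pmult s j"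
      if "r \<in> carrier (mpoly R I)" "s \<in> carrier (mpoly R I)" for r s
      using that by (auto simp: indexed_pmult_def mpoly_add)
    have cl [simp]: "indexed_pmult r j \<in> carrier (mpoly R I)" if "r \<in> carrier (mpoly R I)" for r
      using that 3 by (simp add: indexed_pmult_closed)
    show ?case
      using 3 q by (cases "i = j") (simp_all add: pd_pmult[of _ I] B.l_distr B.a_ac)
  qed
  thus ?thesis by (auto simp: derivation_def pd_add)
qed

lemma pd_commute:
  "p \<in> carrier (mpoly R I) \<Longrightarrow> partial_deriv R i (partial_deriv R j p) = partial_deriv R j (partial_deriv R i p)"
proof
  fix m assume p: "p \<in> carrier (mpoly R I)"
  show "partial_deriv R i (partial_deriv R j p) m = partial_deriv R j (partial_deriv R i p) m"
    using p by (cases "i = j")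
      (auto simp: partial_deriv_def add.nat_pow_pow mult.commute add_mset_commute[of i j]
        simp del: add.nat_pow_Suc)
qed

end

context ring_hom_cring
begin

lemma hom_add_pow: "x \<in> carrier R \<Longrightarrow> h (add_pow R (n::nat) x) = add_pow S n (h x)"
  by (induction n) (auto simp: R.add.nat_pow_Suc S.add.nat_pow_Suc)

lemma comp_pd: "p \<in> carrier (mpoly R I) \<Longrightarrow> h \<circ> partial_deriv R i p = partial_deriv S i (h \<circ> p)"
  by (auto simp: partial_deriv_def hom_add_pow)

end

text \<open>Proved for an arbitrary derivation of the target that kills the coefficients, since it
  is applied to partial derivatives as well as to the Jacobian derivations.\<close>

lemma (in poly_eval) chain_rule:
  assumes D: "derivation C D" and k: "\<And>a. a \<in> carrier S \<Longrightarrow> D (\<theta> a) = \<zero>\<^bsub>C\<^esub>" and I: "finite I"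
    and p: "p \<in> carrier (mpoly S I)"
  shows "D (ev p) = (\<Oplus>\<^bsub>C\<^esub>j\<in>I. ev (partial_deriv S j p) \<otimes>\<^bsub>C\<^esub> D (f j))"
  using p
proof (induction p rule: S.mpoly_induct0)
  case (1 a)
  have "ev (partial_deriv S j (mconst S a)) = \<zero>\<^bsub>C\<^esub>" for j
    by (simp add: S.pd_const[of _ _ I] S.mpoly_zero mev_def)
  moreover have "(\<Oplus>\<^bsub>C\<^esub>j\<in>I. \<zero>\<^bsub>C\<^esub> \<otimes>\<^bsub>C\<^esub> D (f j)) = \<zero>\<^bsub>C\<^esub>"
    using derivation_closed[OF D] by (intro C.add.finprod_one_eqI) auto
  ultimately show ?case using 1 k by simp
next
  case (2 p q)
  have "(\<Oplus>\<^bsub>C\<^esub>j\<in>I. ev (partial_deriv S j (p \<oplus>\<^bsub>mpoly S I\<^esub> q)) \<otimes>\<^bsub>C\<^esub> D (f j)) =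
     (\<Oplus>\<^bsub>C\<^esub>j\<in>I. ev (partial_deriv S j p) \<otimes>\<^bsub>C\<^esub> D (f j) \<oplus>\<^bsub>C\<^esub> ev (partial_deriv S j q) \<otimes>\<^bsub>C\<^esub> D (f j))"
    using 2 derivation_closed[OF D] by (intro C.finsum_cong') (auto simp: S.pd_add ev_add C.l_distr)
  also have "\<dots> = D (ev p) \<oplus>\<^bsub>C\<^esub> D (ev q)"
    using 2 derivation_closed[OF D] by (subst C.finsum_addf) auto
  finally show ?case using 2 derivation_add[OF D] by (simp add: ev_add)
next
  case (3 p i)
  note Dc = derivation_closed[OF D]
  have "(\<Oplus>\<^bsub>C\<^esub>j\<in>I. ev (partial_deriv S j (S.indexed_pmult p i)) \<otimes>\<^bsub>C\<^esub> D (f j)) =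
     (\<Oplus>\<^bsub>C\<^esub>j\<in>I. ev (partial_deriv S j p) \<otimes>\<^bsub>C\<^esub> D (f j) \<otimes>\<^bsub>C\<^esub> f i \<oplus>\<^bsub>C\<^esub>
        (if i = j then ev p \<otimes>\<^bsub>C\<^esub> D (f j) else \<zero>\<^bsub>C\<^esub>))"
  proof (rule C.finsum_cong')
    fix j assume j: "j \<in> I"
    have z: "ev \<zero>\<^bsub>mpoly S I\<^esub> = \<zero>\<^bsub>C\<^esub>" by (simp add: S.mpoly_zero mev_def)
    have cl: "S.indexed_pmult (partial_deriv S j p) i \<in> carrier (mpoly S I)"
      using 3 by (intro S.indexed_pmult_closed S.pd_closed)
    have cl0: "\<zero>\<^bsub>mpoly S I\<^esub> \<in> carrier (mpoly S I)"
      by (auto intro!: S.mpoly_carrierI simp: S.mpoly_zero)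
    show "ev (partial_deriv S j (S.indexed_pmult p i)) \<otimes>\<^bsub>C\<^esub> D (f j) =
      ev (partial_deriv S j p) \<otimes>\<^bsub>C\<^esub> D (f j) \<otimes>\<^bsub>C\<^esub> f i \<oplus>\<^bsub>C\<^esub> (if i = j then ev p \<otimes>\<^bsub>C\<^esub> D (f j) else \<zero>\<^bsub>C\<^esub>)"
      using 3 j cl cl0 Dc z by (auto simp: S.pd_pmult[of _ I] ev_add ev_pmult C.l_distr C.r_distr C.m_ac)
  qed (use 3 Dc in auto)
  also have "\<dots> = (\<Oplus>\<^bsub>C\<^esub>j\<in>I. ev (partial_deriv S j p) \<otimes>\<^bsub>C\<^esub> D (f j) \<otimes>\<^bsub>C\<^esub> f i) \<oplus>\<^bsub>C\<^esub> (\<Oplus>\<^bsub>C\<^esub>j\<in>I. if i = j then ev p \<otimes>\<^bsub>C\<^esub> D (f j) else \<zero>\<^bsub>C\<^esub>)"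
    using 3 Dc by (intro C.finsum_addf) auto
  also have "(\<Oplus>\<^bsub>C\<^esub>j\<in>I. if i = j then ev p \<otimes>\<^bsub>C\<^esub> D (f j) else \<zero>\<^bsub>C\<^esub>) = ev p \<otimes>\<^bsub>C\<^esub> D (f i)"
    using 3 Dc I by (intro C.finsum_singleton) auto
  also have "(\<Oplus>\<^bsub>C\<^esub>j\<in>I. ev (partial_deriv S j p) \<otimes>\<^bsub>C\<^esub> D (f j) \<otimes>\<^bsub>C\<^esub> f i) = D (ev p) \<otimes>\<^bsub>C\<^esub> f i"
    using 3 Dc I by (simp add: C.finsum_ldistr)
  finally show ?case using 3 derivation_mult[OF D] by (simp add: ev_pmult)
qed

section \<open>Rings containing the rationals\<close>

text \<open>Invertibility of the positive integers is an elementary form of being an algebra over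
  the rationals: it passes along every ring homomorphism by applying the map to the
  inverses.\<close>

definition qalg :: "('a, 'm) ring_scheme \<Rightarrow> bool" where
  "qalg R \<longleftrightarrow> (\<forall>n::nat. n > 0 \<longrightarrow> (\<exists>u\<in>carrier R. u \<otimes>\<^bsub>R\<^esub> add_pow R n \<one>\<^bsub>R\<^esub> = \<one>\<^bsub>R\<^esub>))"

lemma (in cring) qalg_cancel:
  assumes q: "qalg R" and a: "a \<in> carrier R" and n: "n > 0" and z: "add_pow R (n::nat) a = \<zero>"
  shows "a = \<zero>"
proof -
  obtain u where u: "u \<in> carrier R" "u \<otimes> (add_pow R n \<one>) = \<one>" using q n by (auto simp: qalg_def)
  have "a = u \<otimes> (add_pow R n \<one>) \<otimes> a" using u a by simp
  also have "\<dots> = u \<otimes> (add_pow R n a)" using u(1) a by (simp add: m_assoc add_pow_ldistr)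
  also have "\<dots> = \<zero>" using z u by simp
  finally show ?thesis .
qed

lemma (in ring_hom_cring) qalg_hom: "qalg R \<Longrightarrow> qalg S"
  unfolding qalg_def
proof (intro allI impI)
  fix n :: nat
  assume "\<forall>n::nat. n > 0 \<longrightarrow> (\<exists>u\<in>carrier R. u \<otimes> add_pow R n \<one> = \<one>)" "n > 0"
  then obtain u where u: "u \<in> carrier R" "u \<otimes> add_pow R n \<one> = \<one>" by blast
  have "h u \<otimes>\<^bsub>S\<^esub> h (add_pow R n \<one>) = h \<one>"
    using u by (metis R.add.nat_pow_closed R.one_closed hom_mult)
  thus "\<exists>u\<in>carrier S. u \<otimes>\<^bsub>S\<^esub> add_pow S n \<one>\<^bsub>S\<^esub> = \<one>\<^bsub>S\<^esub>"
    using u(1) by (auto simp: hom_add_pow)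
qed

text \<open>The Jacobian criterion for algebraic independence. By the chain rule a relation
  \<open>ev p = 0\<close> gives, for each derivation, a linear relation among the
  \<open>D (f j)\<close> with the evaluated partial derivatives of \<open>p\<close> as coefficients;
  nondegeneracy makes these zero, so each partial derivative of \<open>p\<close> is again a
  relation, of smaller degree. The derivations and \<theta> are kept general because the criterion
  is applied over \<open>R\<close>, over fields and over a tensor product.\<close>

lemma (in poly_eval) ev_eq_zero_iff:
  assumes "finite I" "qalg C"
    and "\<And>D. D \<in> \<D> \<Longrightarrow> derivation C D" "\<And>D a. D \<in> \<D> \<Longrightarrow> a \<in> carrier S \<Longrightarrow> D (\<theta> a) = \<zero>\<^bsub>C\<^esub>"
    and nd: "\<And>g. g \<in> I \<rightarrow> carrier C \<Longrightarrow> (\<And>D. D \<in> \<D> \<Longrightarrow> (\<Oplus>\<^bsub>C\<^esub>j\<in>I. g j \<otimes>\<^bsub>C\<^esub> D (f j)) = \<zero>\<^bsub>C\<^esub>) \<Longrightarrow>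
        \<forall>j\<in>I. g j = \<zero>\<^bsub>C\<^esub>"
    and "p \<in> carrier (mpoly S I)" "ev p = \<zero>\<^bsub>C\<^esub>"
  shows "\<theta> (p m) = \<zero>\<^bsub>C\<^esub>"
proof -
  have "\<forall>m. \<theta> (p m) = \<zero>\<^bsub>C\<^esub>" if "p \<in> carrier (mpoly S I)" "ev p = \<zero>\<^bsub>C\<^esub>" "\<And>m. p m \<noteq> \<zero> \<Longrightarrow> size m < N" for N p
    using that
  proof (induction N arbitrary: p)
    case 0
    hence "p m = \<zero>" for m using 0(3)[of m] by auto
    thus ?case by simp
  next
    case (Suc N)
    have "(\<Oplus>\<^bsub>C\<^esub>j\<in>I. ev (partial_deriv S j p) \<otimes>\<^bsub>C\<^esub> D (f j)) = \<zero>\<^bsub>C\<^esub>" if D: "D \<in> \<D>" for D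
    proof -
      have "D \<zero>\<^bsub>C\<^esub> = \<zero>\<^bsub>C\<^esub>" using assms(4)[OF D, of \<zero>] by simp
      thus ?thesis using chain_rule[OF assms(3)[OF D] assms(4)[OF D] assms(1) Suc.prems(1)] Suc.prems(2) by simp
    qed
    hence d: "\<forall>j\<in>I. ev (partial_deriv S j p) = \<zero>\<^bsub>C\<^esub>"
      using Suc.prems(1) by (intro nd) auto
    have *: "\<theta> (p (add_mset j m)) = \<zero>\<^bsub>C\<^esub>" if j: "j \<in> I" for j m
    proof -
      have "\<forall>m. \<theta> (partial_deriv S j p m) = \<zero>\<^bsub>C\<^esub>"
      proof (rule Suc.IH)
        fix m assume "partial_deriv S j p m \<noteq> \<zero>"
        hence "p (add_mset j m) \<noteq> \<zero>" by (auto simp: partial_deriv_def)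
        thus "size m < N" using Suc.prems(3) by fastforce
      qed (use Suc.prems(1) j d in auto)
      \<comment> \<open>The multiplicity of the variable is divided out, which is where
        characteristic zero enters.\<close>
      hence "[Suc (count m j)] \<cdot>\<^bsub>C\<^esub> \<theta> (p (add_mset j m)) = \<zero>\<^bsub>C\<^esub>"
        using Suc.prems(1) hom_add_pow[of "p (add_mset j m)" "Suc (count m j)"]
        by (simp add: partial_deriv_def del: S.add.nat_pow_Suc C.add.nat_pow_Suc)
      thus ?thesis using C.qalg_cancel[OF assms(2), of "\<theta> (p (add_mset j m))" "Suc (count m j)"] Suc.prems(1)
        by (simp del: C.add.nat_pow_Suc)
    qed
    have nz: "\<theta> (p m) = \<zero>\<^bsub>C\<^esub>" if ne: "m \<noteq> {#}" for m
    proof -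
      obtain j m' where m: "m = add_mset j m'" using multi_nonempty_split[OF ne] by blast
      show ?thesis
      proof (cases "j \<in> I")
        case True
        thus ?thesis using * m by simp
      next
        case False
        hence "p m = \<zero>" using S.mpoly_support_subset[OF Suc.prems(1), of m] m by auto
        thus ?thesis by simp
      qed
    qed
    have "\<theta> (p {#}) = \<zero>\<^bsub>C\<^esub>" using ev_coeff_zero[OF Suc.prems(1) nz] Suc.prems(2) by simp
    with nz show ?case by (intro allI) (case_tac "m = {#}", auto)
  qed
  note main = this
  \<comment> \<open>The induction bounds the sizes of the occurring monomials strictly, hence the
    \<open>Suc\<close>; for empty support the maximum is meaningless and the claim vacuous.\<close>
  have "size m < Suc (Max (size ` {m. p m \<noteq> \<zero>}))" if "p m \<noteq> \<zero>" for m
    using that S.mpoly_finite_support[OF assms(6)] by (auto simp: less_Suc_eq_le)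
  from main[OF assms(6,7) this] show ?thesis by simp
qed

section \<open>The Jacobian derivations of a polynomial with unimodular gradient\<close>

definition jac :: "('a, 'm) ring_scheme \<Rightarrow> 'i set \<Rightarrow> ('i multiset \<Rightarrow> 'a) \<Rightarrow> 'i \<Rightarrow> 'i \<Rightarrow>
    ('i multiset \<Rightarrow> 'a) \<Rightarrow> ('i multiset \<Rightarrow> 'a)" where
  "jac R I F i j h = partial_deriv R i F \<otimes>\<^bsub>mpoly R I\<^esub> partial_deriv R j h
     \<ominus>\<^bsub>mpoly R I\<^esub> partial_deriv R j F \<otimes>\<^bsub>mpoly R I\<^esub> partial_deriv R i h"

text \<open>This is \<open>R[F]\<close>. Sums of terms \<open>r F^k\<close>, instead of a closure
  under products, turn integration and lifting of coefficients into inductions over single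
  terms.\<close>

inductive_set fspan :: "('a, 'm) ring_scheme \<Rightarrow> 'i set \<Rightarrow> ('i multiset \<Rightarrow> 'a) \<Rightarrow> ('i multiset \<Rightarrow> 'a) set"
  for R I F where
    zero: "\<zero>\<^bsub>mpoly R I\<^esub> \<in> fspan R I F"
  | add: "u \<in> fspan R I F \<Longrightarrow> r \<in> carrier R \<Longrightarrow>
      u \<oplus>\<^bsub>mpoly R I\<^esub> mconst R r \<otimes>\<^bsub>mpoly R I\<^esub> F [^]\<^bsub>mpoly R I\<^esub> (k::nat) \<in> fspan R I F"

lemma (in cring) derivation_zero:
  assumes D: "derivation R D" shows "D \<zero> = \<zero>"
proof -
  have "D \<zero> = D \<zero> \<oplus> D \<zero>" using derivation_add[OF D, of \<zero> \<zero>] by simp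
  thus ?thesis using derivation_closed[OF D, of \<zero>] by (metis add.l_cancel_one zero_closed)
qed

lemma (in cring) derivation_pow:
  assumes D: "derivation R D" and x: "x \<in> carrier R"
  shows "D (x [^] Suc k) = add_pow R (Suc k) (x [^] k) \<otimes> D x"
proof (induction k)
  case 0
  show ?case using x derivation_closed[OF D] by simp
next
  case (Suc k)
  note c = derivation_closed[OF D x]
  have "D (x [^] Suc (Suc k)) = D (x [^] Suc k) \<otimes> x \<oplus> x [^] Suc k \<otimes> D x"
    using derivation_mult[OF D, of "x [^] Suc k" x] x by simp
  also have "D (x [^] Suc k) \<otimes> x = add_pow R (Suc k) (x [^] Suc k) \<otimes> D x"
    unfolding Suc using x c
    by (simp add: add_pow_ldistr add_pow_rdistr m_ac del: add.nat_pow_Suc)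
  also have "add_pow R (Suc k) (x [^] Suc k) \<otimes> D x \<oplus> x [^] Suc k \<otimes> D x =
      add_pow R (Suc (Suc k)) (x [^] Suc k) \<otimes> D x"
    unfolding add.nat_pow_Suc[where n = "Suc k"] using x c by (simp add: l_distr del: add.nat_pow_Suc)
  finally show ?case .
qed

context cring
begin

lemma jac_derivation:
  assumes F: "F \<in> carrier (mpoly R I)" shows "derivation (mpoly R I) (jac R I F i j)"
proof -
  interpret B: cring "mpoly R I" by (rule mpoly_cring)
  note d = pd_derivation[of I]
  show ?thesis unfolding derivation_def
  proof (intro conjI ballI)
    fix x y assume xy: "x \<in> carrier (mpoly R I)" "y \<in> carrier (mpoly R I)"
    have cl: "partial_deriv R k z \<in> carrier (mpoly R I)" if "z \<in> {F, x, y}" for k z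
      using that F xy by auto
    show "jac R I F i j (x \<oplus>\<^bsub>mpoly R I\<^esub> y) = jac R I F i j x \<oplus>\<^bsub>mpoly R I\<^esub> jac R I F i j y"
      unfolding jac_def derivation_add[OF d xy] using cl
      by (simp add: B.r_distr B.minus_eq B.minus_add B.a_ac)
    show "jac R I F i j (x \<otimes>\<^bsub>mpoly R I\<^esub> y) = jac R I F i j x \<otimes>\<^bsub>mpoly R I\<^esub> y \<oplus>\<^bsub>mpoly R I\<^esub> x \<otimes>\<^bsub>mpoly R I\<^esub> jac R I F i j y"
      unfolding jac_def derivation_mult[OF d xy] using cl xy
      by (simp add: B.l_distr B.r_distr B.minus_eq B.minus_add B.a_ac B.m_ac B.l_minus B.r_minus)
  qed (use F in \<open>auto simp: jac_def\<close>)
qed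

lemma jac_closed [simp, intro]:
  "F \<in> carrier (mpoly R I) \<Longrightarrow> h \<in> carrier (mpoly R I) \<Longrightarrow> jac R I F i j h \<in> carrier (mpoly R I)"
  using derivation_closed[OF jac_derivation] .

lemma jac_const [simp]:
  assumes F: "F \<in> carrier (mpoly R I)" shows "jac R I F i j (mconst R a) = \<zero>\<^bsub>mpoly R I\<^esub>"
proof -
  interpret B: cring "mpoly R I" by (rule mpoly_cring)
  show ?thesis using F by (simp add: jac_def pd_const[of _ _ I] B.minus_eq)
qed

lemma jac_self [simp]:
  assumes F: "F \<in> carrier (mpoly R I)" shows "jac R I F i j F = \<zero>\<^bsub>mpoly R I\<^esub>"
proof -
  interpret B: cring "mpoly R I" by (rule mpoly_cring)
  show ?thesis using F by (simp add: jac_def B.m_comm[of "partial_deriv R i F"] B.minus_eq B.r_neg)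
qed

lemma fspan_closed:
  assumes F: "F \<in> carrier (mpoly R I)" and u: "u \<in> fspan R I F" shows "u \<in> carrier (mpoly R I)"
proof -
  interpret B: cring "mpoly R I" by (rule mpoly_cring)
  show ?thesis using u F by induction auto
qed

lemma fspan_add:
  assumes F: "F \<in> carrier (mpoly R I)" and u: "u \<in> fspan R I F" and v: "v \<in> fspan R I F"
  shows "u \<oplus>\<^bsub>mpoly R I\<^esub> v \<in> fspan R I F"
proof -
  interpret B: cring "mpoly R I" by (rule mpoly_cring)
  note uc = fspan_closed[OF F u]
  show ?thesis using v
  proof induction
    case zero
    show ?case using u uc by simp
  next
    case (add v r k)
    have "u \<oplus>\<^bsub>mpoly R I\<^esub> (v \<oplus>\<^bsub>mpoly R I\<^esub> mconst R r \<otimes>\<^bsub>mpoly R I\<^esub> F [^]\<^bsub>mpoly R I\<^esub> k) =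
      (u \<oplus>\<^bsub>mpoly R I\<^esub> v) \<oplus>\<^bsub>mpoly R I\<^esub> mconst R r \<otimes>\<^bsub>mpoly R I\<^esub> F [^]\<^bsub>mpoly R I\<^esub> k"
      using F uc add.hyps fspan_closed[OF F add.hyps(1)] by (simp add: B.a_assoc)
    thus ?case using fspan.add[OF add.IH add.hyps(2), of k] by simp
  qed
qed

lemma fspan_const:
  assumes F: "F \<in> carrier (mpoly R I)" and a: "a \<in> carrier R" shows "mconst R a \<in> fspan R I F"
proof -
  interpret B: cring "mpoly R I" by (rule mpoly_cring)
  show ?thesis using fspan.add[OF fspan.zero a, of I F 0] a F by simp
qed

lemma fspan_const_mult:
  assumes F: "F \<in> carrier (mpoly R I)" and a: "a \<in> carrier R" and u: "u \<in> fspan R I F"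
  shows "mconst R a \<otimes>\<^bsub>mpoly R I\<^esub> u \<in> fspan R I F"
proof -
  interpret B: cring "mpoly R I" by (rule mpoly_cring)
  show ?thesis using u
  proof induction
    case zero
    show ?case using a by (simp add: fspan.zero)
  next
    case (add v r k)
    have "mconst R a \<otimes>\<^bsub>mpoly R I\<^esub> (v \<oplus>\<^bsub>mpoly R I\<^esub> mconst R r \<otimes>\<^bsub>mpoly R I\<^esub> F [^]\<^bsub>mpoly R I\<^esub> k) =
      mconst R a \<otimes>\<^bsub>mpoly R I\<^esub> v \<oplus>\<^bsub>mpoly R I\<^esub> mconst R (a \<otimes> r) \<otimes>\<^bsub>mpoly R I\<^esub> F [^]\<^bsub>mpoly R I\<^esub> k"
      using F a add.hyps fspan_closed[OF F add.hyps(1)]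
      by (simp add: B.r_distr B.m_assoc ring_hom_mult[OF mconst_hom, of a r I])
    thus ?case using fspan.add[OF add.IH, of "a \<otimes> r" k] a add.hyps by simp
  qed
qed

lemma jac_fspan:
  assumes F: "F \<in> carrier (mpoly R I)" and u: "u \<in> fspan R I F"
  shows "jac R I F i j u = \<zero>\<^bsub>mpoly R I\<^esub>"
proof -
  interpret B: cring "mpoly R I" by (rule mpoly_cring)
  note D = jac_derivation[OF F, of i j]
  have z: "jac R I F i j \<zero>\<^bsub>mpoly R I\<^esub> = \<zero>\<^bsub>mpoly R I\<^esub>" by (rule B.derivation_zero[OF D])
  have "jac R I F i j (F [^]\<^bsub>mpoly R I\<^esub> k) = \<zero>\<^bsub>mpoly R I\<^esub>" for k :: nat
  proof (cases k)
    case 0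
    thus ?thesis using B.derivation_one[OF D] by simp
  next
    case (Suc k')
    show ?thesis unfolding Suc B.derivation_pow[OF D F] using F by simp
  qed
  note pw = this
  show ?thesis using u
  proof induction
    case zero
    show ?case by (rule z)
  next
    case (add u r k)
    have c: "u \<in> carrier (mpoly R I)" "mconst R r \<in> carrier (mpoly R I)" "F [^]\<^bsub>mpoly R I\<^esub> k \<in> carrier (mpoly R I)"
      using F add.hyps fspan_closed[OF F] by auto
    have "jac R I F i j (mconst R r \<otimes>\<^bsub>mpoly R I\<^esub> F [^]\<^bsub>mpoly R I\<^esub> k) = \<zero>\<^bsub>mpoly R I\<^esub>"
      unfolding derivation_mult[OF D c(2,3)] pw using c F by simp
    thus ?case unfolding derivation_add[OF D c(1) B.m_closed[OF c(2,3)]] add.IH by simp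
  qed
qed

text \<open>Each coefficient off the constant term occurs in some derivative with a positive integer
  factor, which is invertible; a variable outside \<open>I\<close> cannot occur at all.\<close>

lemma pd_zero_imp_const:
  assumes "qalg R" and h: "h \<in> carrier (mpoly R I)" and z: "\<And>j. j \<in> I \<Longrightarrow> partial_deriv R j h = \<zero>\<^bsub>mpoly R I\<^esub>"
  shows "h = mconst R (h {#})"
proof
  fix m
  show "h m = mconst R (h {#}) m"
  proof (cases "m = {#}")
    case False
    then obtain j m' where m: "m = add_mset j m'" using multi_nonempty_split by blast
    have "h m = \<zero>"
    proof (cases "j \<in> I")
      case True
      hence "add_pow R (Suc (count m' j)) (h m) = \<zero>"
        using z[of j] m by (simp add: partial_deriv_def mpoly_zero fun_eq_iff del: add.nat_pow_Suc)
      thus ?thesis using qalg_cancel[OF assms(1), of "h m" "Suc (count m' j)"] h by (simp del: add.nat_pow_Suc)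
    next
      case False
      thus ?thesis using mpoly_support_subset[OF h, of m] m by auto
    qed
    thus ?thesis using False by simp
  qed simp
qed

text \<open>Antiderivatives in \<open>F\<close>: the term \<open>r F^k\<close> integrates to
  \<open>r F^(k+1) / (k+1)\<close>, whose gradient is \<open>r F^k\<close> times that of
  \<open>F\<close>.\<close>

lemma fspan_integral:
  assumes q: "qalg R" and F: "F \<in> carrier (mpoly R I)" and u: "u \<in> fspan R I F"
  shows "\<exists>U\<in>fspan R I F. \<forall>j. partial_deriv R j U = u \<otimes>\<^bsub>mpoly R I\<^esub> partial_deriv R j F"
  using u
proof induction
  interpret B: cring "mpoly R I" by (rule mpoly_cring)
  note D = pd_derivation[of I]
  case zero
  show ?case using F by (intro bexI[of _ "\<zero>\<^bsub>mpoly R I\<^esub>"]) (auto simp: B.derivation_zero[OF D] fspan.zero)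
next
  interpret B: cring "mpoly R I" by (rule mpoly_cring)
  interpret c: ring_hom_cring R "mpoly R I" "mconst R"
    by (rule ring_hom_cringI) (auto intro: is_cring mpoly_cring mconst_hom)
  note D = pd_derivation[of I]
  case (add u r k)
  then obtain U where U: "U \<in> fspan R I F" "\<And>j. partial_deriv R j U = u \<otimes>\<^bsub>mpoly R I\<^esub> partial_deriv R j F" by blast
  obtain v where v: "v \<in> carrier R" "v \<otimes> add_pow R (Suc k) \<one> = \<one>" using q by (auto simp: qalg_def simp del: add.nat_pow_Suc)
  have one: "mconst R v \<otimes>\<^bsub>mpoly R I\<^esub> add_pow (mpoly R I) (Suc k) \<one>\<^bsub>mpoly R I\<^esub> = \<one>\<^bsub>mpoly R I\<^esub>"
  proof -
    have "mconst R (v \<otimes> add_pow R (Suc k) \<one>) = \<one>\<^bsub>mpoly R I\<^esub>" unfolding v(2) by simp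
    moreover have "mconst R (v \<otimes> add_pow R (Suc k) \<one>) =
        mconst R v \<otimes>\<^bsub>mpoly R I\<^esub> mconst R (add_pow R (Suc k) \<one>)"
      using v(1) by (intro c.hom_mult) auto
    ultimately show ?thesis using c.hom_add_pow[of \<one> "Suc k"] by (simp del: add.nat_pow_Suc B.add.nat_pow_Suc)
  qed
  have inv: "mconst R v \<otimes>\<^bsub>mpoly R I\<^esub> add_pow (mpoly R I) (Suc k) x = x" if x: "x \<in> carrier (mpoly R I)" for x
  proof -
    have "add_pow (mpoly R I) (Suc k) x = add_pow (mpoly R I) (Suc k) \<one>\<^bsub>mpoly R I\<^esub> \<otimes>\<^bsub>mpoly R I\<^esub> x"
      using x B.add_pow_ldistr[of "\<one>\<^bsub>mpoly R I\<^esub>" x "Suc k"] by (simp del: B.add.nat_pow_Suc)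
    hence "mconst R v \<otimes>\<^bsub>mpoly R I\<^esub> add_pow (mpoly R I) (Suc k) x =
       mconst R v \<otimes>\<^bsub>mpoly R I\<^esub> add_pow (mpoly R I) (Suc k) \<one>\<^bsub>mpoly R I\<^esub> \<otimes>\<^bsub>mpoly R I\<^esub> x"
      using x v(1) by (simp add: B.m_assoc del: B.add.nat_pow_Suc)
    thus ?thesis using x one by simp
  qed
  let ?V = "U \<oplus>\<^bsub>mpoly R I\<^esub> mconst R (r \<otimes> v) \<otimes>\<^bsub>mpoly R I\<^esub> F [^]\<^bsub>mpoly R I\<^esub> Suc k"
  note uc = fspan_closed[OF F add.hyps(1)] fspan_closed[OF F U(1)]
  have rvc: "mconst R (r \<otimes> v) \<in> carrier (mpoly R I)" using v add.hyps by simp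
  show ?case
  proof (intro bexI[of _ ?V] allI)
    show "?V \<in> fspan R I F" using U v add.hyps by (intro fspan.add) auto
    fix j
    have "partial_deriv R j ?V = partial_deriv R j U \<oplus>\<^bsub>mpoly R I\<^esub>
        mconst R (r \<otimes> v) \<otimes>\<^bsub>mpoly R I\<^esub> partial_deriv R j (F [^]\<^bsub>mpoly R I\<^esub> Suc k)"
      using uc rvc F derivation_add[OF D, of U "mconst R (r \<otimes> v) \<otimes>\<^bsub>mpoly R I\<^esub> F [^]\<^bsub>mpoly R I\<^esub> Suc k" j]
        derivation_mult[OF D, of "mconst R (r \<otimes> v)" "F [^]\<^bsub>mpoly R I\<^esub> Suc k" j]
      by (simp add: pd_const[of _ _ I] del: B.nat_pow_Suc)
    also have "partial_deriv R j (F [^]\<^bsub>mpoly R I\<^esub> Suc k) =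
        add_pow (mpoly R I) (Suc k) (F [^]\<^bsub>mpoly R I\<^esub> k) \<otimes>\<^bsub>mpoly R I\<^esub> partial_deriv R j F"
      by (rule B.derivation_pow[OF D F])
    also have "mconst R (r \<otimes> v) \<otimes>\<^bsub>mpoly R I\<^esub>
        (add_pow (mpoly R I) (Suc k) (F [^]\<^bsub>mpoly R I\<^esub> k) \<otimes>\<^bsub>mpoly R I\<^esub> partial_deriv R j F) =
        mconst R r \<otimes>\<^bsub>mpoly R I\<^esub> F [^]\<^bsub>mpoly R I\<^esub> k \<otimes>\<^bsub>mpoly R I\<^esub> partial_deriv R j F" (is "?l = ?r")
    proof -
      have "?l = mconst R r \<otimes>\<^bsub>mpoly R I\<^esub> (mconst R v \<otimes>\<^bsub>mpoly R I\<^esub>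
          add_pow (mpoly R I) (Suc k) (F [^]\<^bsub>mpoly R I\<^esub> k)) \<otimes>\<^bsub>mpoly R I\<^esub> partial_deriv R j F"
        using v add.hyps F by (simp add: c.hom_mult B.m_assoc del: B.add.nat_pow_Suc)
      also have "mconst R v \<otimes>\<^bsub>mpoly R I\<^esub> add_pow (mpoly R I) (Suc k) (F [^]\<^bsub>mpoly R I\<^esub> k) = F [^]\<^bsub>mpoly R I\<^esub> k"
        using F by (intro inv) simp
      finally show ?thesis .
    qed
    finally show "partial_deriv R j ?V =
        (u \<oplus>\<^bsub>mpoly R I\<^esub> mconst R r \<otimes>\<^bsub>mpoly R I\<^esub> F [^]\<^bsub>mpoly R I\<^esub> k) \<otimes>\<^bsub>mpoly R I\<^esub> partial_deriv R j F"
      using uc F add.hyps by (simp add: U(2) B.l_distr)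
  qed
qed

end

context ring_hom_cring
begin

lemma comp_minus:
  assumes "p \<in> carrier (mpoly R I)" "q \<in> carrier (mpoly R I)"
  shows "h \<circ> (p \<ominus>\<^bsub>mpoly R I\<^esub> q) = (h \<circ> p) \<ominus>\<^bsub>mpoly S I\<^esub> (h \<circ> q)"
  using assms by (auto simp: R.mpoly_minus[of p I q] S.mpoly_minus[of "h \<circ> p" I "h \<circ> q"] fun_eq_iff R.minus_eq S.minus_eq)

lemma comp_jac:
  assumes "F \<in> carrier (mpoly R I)" "p \<in> carrier (mpoly R I)"
  shows "h \<circ> jac R I F i j p = jac S I (h \<circ> F) i j (h \<circ> p)"
proof -
  interpret B: cring "mpoly R I" by (rule R.mpoly_cring)
  show ?thesis unfolding jac_def using assms
    by (simp add: comp_minus[of _ I] ring_hom_mult[OF comp_hom] comp_pd[of _ I])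
qed

lemma comp_pow:
  assumes "p \<in> carrier (mpoly R I)"
  shows "h \<circ> (p [^]\<^bsub>mpoly R I\<^esub> (k::nat)) = (h \<circ> p) [^]\<^bsub>mpoly S I\<^esub> k"
proof -
  interpret B: cring "mpoly R I" by (rule R.mpoly_cring)
  interpret B': cring "mpoly S I" by (rule S.mpoly_cring)
  show ?thesis using assms
    by (induction k) (auto simp: R.mpoly_one S.mpoly_one ring_hom_mult[OF comp_hom])
qed

lemma comp_fspan_term:
  assumes "F \<in> carrier (mpoly R I)" "u \<in> carrier (mpoly R I)" "r \<in> carrier R"
  shows "h \<circ> (u \<oplus>\<^bsub>mpoly R I\<^esub> mconst R r \<otimes>\<^bsub>mpoly R I\<^esub> F [^]\<^bsub>mpoly R I\<^esub> (k::nat)) =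
    (h \<circ> u) \<oplus>\<^bsub>mpoly S I\<^esub> mconst S (h r) \<otimes>\<^bsub>mpoly S I\<^esub> (h \<circ> F) [^]\<^bsub>mpoly S I\<^esub> k"
proof -
  interpret B: cring "mpoly R I" by (rule R.mpoly_cring)
  show ?thesis using assms
    by (simp add: ring_hom_add[OF comp_hom] ring_hom_mult[OF comp_hom] comp_pow)
qed

lemma comp_zero: "h \<circ> \<zero>\<^bsub>mpoly R I\<^esub> = \<zero>\<^bsub>mpoly S I\<^esub>"
  by (auto simp: R.mpoly_zero S.mpoly_zero)

lemma comp_fspan:
  assumes F: "F \<in> carrier (mpoly R I)" and u: "u \<in> fspan R I F"
  shows "h \<circ> u \<in> fspan S I (h \<circ> F)"
  using u
proof induction
  case zero
  show ?case by (simp add: comp_zero fspan.zero)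
next
  case (add u r k)
  show ?case
    unfolding comp_fspan_term[OF F R.fspan_closed[OF F add.hyps(1)] add.hyps(2)]
    by (rule fspan.add[OF add.IH hom_closed[OF add.hyps(2)]])
qed

lemma fspan_lift:
  assumes F: "F \<in> carrier (mpoly R I)" and surj: "h ` carrier R = carrier S" and v: "v \<in> fspan S I (h \<circ> F)"
  shows "\<exists>u\<in>fspan R I F. h \<circ> u = v"
  using v
proof induction
  case zero
  show ?case using comp_zero fspan.zero by blast
next
  case (add v r k)
  then obtain u where u: "u \<in> fspan R I F" "h \<circ> u = v" by blast
  from add.hyps(2) have "r \<in> h ` carrier R" unfolding surj .
  then obtain r' where r': "r' \<in> carrier R" "h r' = r" by (elim imageE) simp
  have "h \<circ> (u \<oplus>\<^bsub>mpoly R I\<^esub> mconst R r' \<otimes>\<^bsub>mpoly R I\<^esub> F [^]\<^bsub>mpoly R I\<^esub> k) =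
      v \<oplus>\<^bsub>mpoly S I\<^esub> mconst S r \<otimes>\<^bsub>mpoly S I\<^esub> (h \<circ> F) [^]\<^bsub>mpoly S I\<^esub> k"
    unfolding comp_fspan_term[OF F R.fspan_closed[OF F u(1)] r'(1)] u(2) r'(2) ..
  with fspan.add[OF u(1) r'(1), of k] show ?case by blast
qed

end

subsection \<open>Leading monomials\<close>

text \<open>The multiset order on monomials is total, since the variables are ordered, and
  compatible with addition. Any other splitting of \<open>m1 + m2\<close> has its first part above
  \<open>m1\<close> or its second part above \<open>m2\<close>, so a single product remains in the
  convolution; zero divisors do no harm.\<close>

lemma (in cring) mpoly_lead_mult:
  fixes p q :: "'i::wellorder multiset \<Rightarrow> 'a"
  assumes p: "p \<in> carrier (mpoly R I)" and q: "q \<in> carrier (mpoly R I)"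
    and m1: "\<And>m. m1 < m \<Longrightarrow> p m = \<zero>" and m2: "\<And>m. m2 < m \<Longrightarrow> q m = \<zero>"
  shows "(p \<otimes>\<^bsub>mpoly R I\<^esub> q) (m1 + m2) = p m1 \<otimes> q m2"
proof -
  have "(\<Oplus>k\<in>{k. k \<subseteq># m1 + m2}. p k \<otimes> q (m1 + m2 - k)) =
      (\<Oplus>k\<in>{k. k \<subseteq># m1 + m2}. if m1 = k then p m1 \<otimes> q m2 else \<zero>)"
  proof (rule finsum_cong')
    fix k assume "k \<in> {k. k \<subseteq># m1 + m2}"
    hence k: "k + (m1 + m2 - k) = m1 + m2" by simp
    show "p k \<otimes> q (m1 + m2 - k) = (if m1 = k then p m1 \<otimes> q m2 else \<zero>)"
    proof (cases "m1 = k")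
      case True
      thus ?thesis by simp
    next
      case False
      show ?thesis
      proof (cases "m1 < k")
        case True
        thus ?thesis using m1 p q False by simp
      next
        case nl: False
        hence lt: "k < m1" using False by simp
        \<comment> \<open>The two parts sum to \<open>m1 + m2\<close>, so a smaller first part
          forces the second above \<open>m2\<close>.\<close>
        have "m2 < m1 + m2 - k"
        proof (rule ccontr)
          assume "\<not> m2 < m1 + m2 - k"
          hence "k + (m1 + m2 - k) < m1 + m2" using lt by (intro add_less_le_mono) auto
          thus False using k by simp
        qed
        thus ?thesis using m2 p q False by simp
      qed
    qed
  qed (use p q in auto)
  also have "\<dots> = p m1 \<otimes> q m2"
    using p q by (intro finsum_singleton) auto
  finally show ?thesis by (simp add: mpoly_mult)
qed

lemma (in cring) mpoly_lead_exists:
  fixes p :: "'i::wellorder multiset \<Rightarrow> 'a"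
  assumes p: "p \<in> carrier (mpoly R I)" and nz: "p \<noteq> \<zero>\<^bsub>mpoly R I\<^esub>"
  obtains m where "p m \<noteq> \<zero>" "\<And>m'. m < m' \<Longrightarrow> p m' = \<zero>"
proof -
  have ne: "{m. p m \<noteq> \<zero>} \<noteq> {}" using nz by (auto simp: mpoly_zero)
  have fin: "finite {m. p m \<noteq> \<zero>}" by (rule mpoly_finite_support[OF p])
  show thesis
  proof
    show "p (Max {m. p m \<noteq> \<zero>}) \<noteq> \<zero>" using Max_in[OF fin ne] by simp
    show "p m' = \<zero>" if "Max {m. p m \<noteq> \<zero>} < m'" for m'
      using Max_ge[OF fin, of m'] that by (metis mem_Collect_eq not_less)
  qed
qed

lemma (in domain) mpoly_domain: "domain (mpoly R (I :: 'i::wellorder set))"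
proof (rule domain.intro)
  show "cring (mpoly R I)" by (rule mpoly_cring)
  show "domain_axioms (mpoly R I)"
  proof
    show "\<one>\<^bsub>mpoly R I\<^esub> \<noteq> \<zero>\<^bsub>mpoly R I\<^esub>"
    proof
      assume "\<one>\<^bsub>mpoly R I\<^esub> = \<zero>\<^bsub>mpoly R I\<^esub>"
      from fun_cong[OF this, of "{#}"] show False by (simp add: mpoly_one mpoly_zero)
    qed
    fix p q assume pq: "p \<otimes>\<^bsub>mpoly R I\<^esub> q = \<zero>\<^bsub>mpoly R I\<^esub>" and p: "p \<in> carrier (mpoly R I)" and q: "q \<in> carrier (mpoly R I)"
    show "p = \<zero>\<^bsub>mpoly R I\<^esub> \<or> q = \<zero>\<^bsub>mpoly R I\<^esub>"
    proof (rule ccontr)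
      assume c: "\<not> ?thesis"
      obtain m1 where m1: "p m1 \<noteq> \<zero>" "\<And>m'. m1 < m' \<Longrightarrow> p m' = \<zero>" using mpoly_lead_exists[OF p] c by blast
      obtain m2 where m2: "q m2 \<noteq> \<zero>" "\<And>m'. m2 < m' \<Longrightarrow> q m' = \<zero>" using mpoly_lead_exists[OF q] c by blast
      have "p m1 \<otimes> q m2 = \<zero>" using mpoly_lead_mult[OF p q m1(2) m2(2)] pq by (simp add: mpoly_zero)
      thus False using m1(1) m2(1) p q by (simp add: integral_iff)
    qed
  qed
qed

section \<open>Polynomials annihilated by the Jacobian derivations\<close>

text \<open>The Bezout coefficients \<open>b\<close> are part of the data, so that unimodularity of
  the gradient is an equation and survives every change of coefficients
  (\<open>hom_grad_poly\<close>).\<close>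

locale grad_poly = cring R for R :: "('a, 'm) ring_scheme" (structure) +
  fixes I :: "'i::wellorder set" and F :: "'i multiset \<Rightarrow> 'a" and b :: "'i \<Rightarrow> 'i multiset \<Rightarrow> 'a"
  assumes qalg: "qalg R" and finite_I: "finite I" and F: "F \<in> carrier (mpoly R I)"
    and b: "b \<in> I \<rightarrow> carrier (mpoly R I)"
    and unimodular: "(\<Oplus>\<^bsub>mpoly R I\<^esub>i\<in>I. b i \<otimes>\<^bsub>mpoly R I\<^esub> partial_deriv R i F) = \<one>\<^bsub>mpoly R I\<^esub>"
begin

abbreviation "B \<equiv> mpoly R I"

lemma hom_grad_poly:
  assumes S: "cring S" and h: "h \<in> ring_hom R S"
  shows "grad_poly S I (h \<circ> F) (\<lambda>i. h \<circ> b i)"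
proof -
  interpret S: cring S by fact
  interpret h: ring_hom_cring R S h by (rule ring_hom_cringI[OF is_cring S h])
  interpret B: cring B by (rule mpoly_cring)
  interpret B': cring "mpoly S I" by (rule S.mpoly_cring)
  interpret hh: ring_hom_cring B "mpoly S I" "(\<circ>) h"
    by (rule ring_hom_cringI[OF mpoly_cring S.mpoly_cring h.comp_hom])
  note cl = funcset_mem[OF b] pd_closed[OF F]
  have "h \<circ> (\<Oplus>\<^bsub>B\<^esub>i\<in>I. b i \<otimes>\<^bsub>B\<^esub> partial_deriv R i F) = \<one>\<^bsub>mpoly S I\<^esub>"
    unfolding unimodular by (rule hh.hom_one)
  also have "h \<circ> (\<Oplus>\<^bsub>B\<^esub>i\<in>I. b i \<otimes>\<^bsub>B\<^esub> partial_deriv R i F) =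
     (\<Oplus>\<^bsub>mpoly S I\<^esub>i\<in>I. (h \<circ> b i) \<otimes>\<^bsub>mpoly S I\<^esub> partial_deriv S i (h \<circ> F))"
    using cl by (subst hh.hom_finsum) (auto intro!: B'.finsum_cong' S.pd_closed h.comp_closed F simp: h.comp_pd[OF F])
  finally show ?thesis
    using h.qalg_hom[OF qalg] finite_I F b S
    by (auto simp: grad_poly_def grad_poly_axioms_def)
qed

text \<open>Vanishing of the \<open>D\<^sub>i\<^sub>j h\<close> says
  \<open>F\<^sub>i h\<^sub>j = F\<^sub>j h\<^sub>i\<close>, so the gradient of \<open>h\<close> is
  proportional to that of \<open>F\<close>, and unimodularity produces the factor \<open>w\<close>
  inside the polynomial ring. Symmetry of second derivatives makes the
  \<open>D\<^sub>i\<^sub>j\<close> kill \<open>w\<close> as well, and its leading monomial is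
  smaller. By induction \<open>w\<close> lies in \<open>R[F]\<close> and can be integrated there;
  the antiderivative differs from \<open>h\<close> by a constant.\<close>

lemma domain_jac_zero_imp_fspan:
  assumes dom: "domain R" and "h \<in> carrier B"
    and "\<And>i j. i \<in> I \<Longrightarrow> j \<in> I \<Longrightarrow> jac R I F i j h = \<zero>\<^bsub>B\<^esub>"
  shows "h \<in> fspan R I F"
proof -
  interpret domain R by fact
  interpret B: "domain" B by (rule mpoly_domain)
  note D = pd_derivation[of I]
  \<comment> \<open>The induction runs over a bound \<open>M\<close> for the monomials of
    \<open>h\<close>; the multiset order is well-founded because the variables are
    well-ordered.\<close>
  have main: "h \<in> fspan R I F"
    if "h \<in> carrier B" "\<And>i j. i \<in> I \<Longrightarrow> j \<in> I \<Longrightarrow> jac R I F i j h = \<zero>\<^bsub>B\<^esub>"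
      "\<And>m. M < m \<Longrightarrow> h m = \<zero>" for M h
    using that
  proof (induction M arbitrary: h rule: less_induct)
    case (less M h)
    note h = less.prems(1)
    \<comment> \<open>If \<open>h\<^sub>j = w F\<^sub>j\<close> for all \<open>j\<close>, then
      unimodularity forces \<open>w = \<Sum> b\<^sub>i h\<^sub>i\<close>; conversely this sum
      works.\<close>
    define w where "w = (\<Oplus>\<^bsub>B\<^esub>i\<in>I. b i \<otimes>\<^bsub>B\<^esub> partial_deriv R i h)"
    have w: "w \<in> carrier B" unfolding w_def using b h by (intro B.finsum_closed) auto
    have sym: "partial_deriv R i F \<otimes>\<^bsub>B\<^esub> partial_deriv R j h = partial_deriv R j F \<otimes>\<^bsub>B\<^esub> partial_deriv R i h"
      if "i \<in> I" "j \<in> I" for i j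
      using less.prems(2)[OF that] F h by (simp add: jac_def)
    have dh: "partial_deriv R j h = w \<otimes>\<^bsub>B\<^esub> partial_deriv R j F" if j: "j \<in> I" for j
    proof -
      have "w \<otimes>\<^bsub>B\<^esub> partial_deriv R j F =
         (\<Oplus>\<^bsub>B\<^esub>i\<in>I. b i \<otimes>\<^bsub>B\<^esub> partial_deriv R i h \<otimes>\<^bsub>B\<^esub> partial_deriv R j F)"
        unfolding w_def using b h F finite_I by (intro B.finsum_ldistr) auto
      also have "\<dots> = (\<Oplus>\<^bsub>B\<^esub>i\<in>I. b i \<otimes>\<^bsub>B\<^esub> partial_deriv R i F \<otimes>\<^bsub>B\<^esub> partial_deriv R j h)"
      proof (rule B.finsum_cong')
        fix i assume i: "i \<in> I"
        have bi: "b i \<in> carrier B" using b i by auto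
        have "b i \<otimes>\<^bsub>B\<^esub> partial_deriv R i h \<otimes>\<^bsub>B\<^esub> partial_deriv R j F =
          b i \<otimes>\<^bsub>B\<^esub> (partial_deriv R j F \<otimes>\<^bsub>B\<^esub> partial_deriv R i h)"
          using bi h F by (simp add: B.m_ac)
        also have "\<dots> = b i \<otimes>\<^bsub>B\<^esub> partial_deriv R i F \<otimes>\<^bsub>B\<^esub> partial_deriv R j h"
          unfolding sym[OF i j, symmetric] using bi h F by (simp add: B.m_assoc)
        finally show "b i \<otimes>\<^bsub>B\<^esub> partial_deriv R i h \<otimes>\<^bsub>B\<^esub> partial_deriv R j F =
          b i \<otimes>\<^bsub>B\<^esub> partial_deriv R i F \<otimes>\<^bsub>B\<^esub> partial_deriv R j h" .
      qed (use b h F in auto)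
      also have "\<dots> = (\<Oplus>\<^bsub>B\<^esub>i\<in>I. b i \<otimes>\<^bsub>B\<^esub> partial_deriv R i F) \<otimes>\<^bsub>B\<^esub> partial_deriv R j h"
        using b h F finite_I by (intro B.finsum_ldistr[symmetric]) auto
      also have "\<dots> = partial_deriv R j h" unfolding unimodular using h by simp
      finally show ?thesis by simp
    qed
    \<comment> \<open>Differentiate \<open>h\<^sub>j = w F\<^sub>j\<close> by
      \<open>X\<^sub>i\<close> and compare with the roles of \<open>i\<close> and \<open>j\<close>
      exchanged: the terms with second derivatives of \<open>F\<close> cancel.\<close>
    have jw: "jac R I F i j w = \<zero>\<^bsub>B\<^esub>" if ij: "i \<in> I" "j \<in> I" for i j
    proof -
      have e: "partial_deriv R k (partial_deriv R l h) =
          partial_deriv R k w \<otimes>\<^bsub>B\<^esub> partial_deriv R l F \<oplus>\<^bsub>B\<^esub> w \<otimes>\<^bsub>B\<^esub> partial_deriv R k (partial_deriv R l F)"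
        if "l \<in> I" for k l
        unfolding dh[OF that] using w F by (intro derivation_mult[OF D]) auto
      have "partial_deriv R i w \<otimes>\<^bsub>B\<^esub> partial_deriv R j F \<oplus>\<^bsub>B\<^esub> w \<otimes>\<^bsub>B\<^esub> partial_deriv R i (partial_deriv R j F)
         = partial_deriv R j w \<otimes>\<^bsub>B\<^esub> partial_deriv R i F \<oplus>\<^bsub>B\<^esub> w \<otimes>\<^bsub>B\<^esub> partial_deriv R i (partial_deriv R j F)"
        using e[OF ij(2), of i] e[OF ij(1), of j] pd_commute[OF h, of i j] pd_commute[OF F, of i j] by simp
      hence "partial_deriv R i w \<otimes>\<^bsub>B\<^esub> partial_deriv R j F = partial_deriv R j w \<otimes>\<^bsub>B\<^esub> partial_deriv R i F"
        using w F by simp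
      thus ?thesis using w F by (simp add: jac_def B.m_comm[of "partial_deriv R _ F"] B.minus_eq B.r_neg)
    qed
    have "\<exists>u\<in>fspan R I F. u = w"
    proof (cases "w = \<zero>\<^bsub>B\<^esub>")
      case True
      thus ?thesis using fspan.zero by blast
    next
      case False
      then obtain mw where mw: "w mw \<noteq> \<zero>" "\<And>m'. mw < m' \<Longrightarrow> w m' = \<zero>" using mpoly_lead_exists[OF w] by blast
      have "\<exists>j\<in>I. partial_deriv R j F \<noteq> \<zero>\<^bsub>B\<^esub>"
      proof (rule ccontr)
        assume "\<not> ?thesis"
        hence "(\<Oplus>\<^bsub>B\<^esub>i\<in>I. b i \<otimes>\<^bsub>B\<^esub> partial_deriv R i F) = \<zero>\<^bsub>B\<^esub>"
          using b by (intro B.add.finprod_one_eqI) (auto simp: Pi_iff)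
        thus False using unimodular by simp
      qed
      then obtain j where j: "j \<in> I" "partial_deriv R j F \<noteq> \<zero>\<^bsub>B\<^esub>" by blast
      obtain mf where mf: "partial_deriv R j F mf \<noteq> \<zero>" "\<And>m'. mf < m' \<Longrightarrow> partial_deriv R j F m' = \<zero>"
        using mpoly_lead_exists[OF pd_closed[OF F] j(2)] by blast
      \<comment> \<open>The product of the leading terms of \<open>w\<close> and
        \<open>F\<^sub>j\<close> is a term of \<open>h\<^sub>j\<close>, so \<open>h\<close> has a
        term with one more \<open>X\<^sub>j\<close>, strictly above \<open>mw\<close>. This is the
        decrease that the induction on \<open>M\<close> needs.\<close>
      have "partial_deriv R j h (mw + mf) = w mw \<otimes> partial_deriv R j F mf"
        unfolding dh[OF j(1)] by (rule mpoly_lead_mult[OF w pd_closed[OF F] mw(2) mf(2)])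
      also have "\<dots> \<noteq> \<zero>" using mw(1) mf(1) w pd_closed[OF F, of j] by (simp add: integral_iff)
      finally have "h (add_mset j (mw + mf)) \<noteq> \<zero>" by (auto simp: partial_deriv_def)
      hence "add_mset j (mw + mf) \<le> M" using less.prems(3) not_less by blast
      moreover have "mw \<le> mw + mf" by (rule subset_eq_imp_le_multiset) simp
      moreover have "mw + mf < add_mset j (mw + mf)" by (rule le_multiset_right_total)
      ultimately have "mw < M" by order
      thus ?thesis using less.IH[of mw w] w jw mw(2) by blast
    qed
    then obtain U where U: "U \<in> fspan R I F" "\<And>j. partial_deriv R j U = w \<otimes>\<^bsub>B\<^esub> partial_deriv R j F"
      using fspan_integral[OF qalg F] by blast
    note Uc = fspan_closed[OF F U(1)]
    let ?g = "h \<ominus>\<^bsub>B\<^esub> U"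
    have "partial_deriv R j ?g = \<zero>\<^bsub>B\<^esub>" if "j \<in> I" for j
    proof -
      have "partial_deriv R j h = partial_deriv R j (?g \<oplus>\<^bsub>B\<^esub> U)"
        using h Uc by (simp add: B.minus_eq B.a_assoc B.l_neg)
      also have "\<dots> = partial_deriv R j ?g \<oplus>\<^bsub>B\<^esub> partial_deriv R j h"
        unfolding U(2) dh[OF that] using h Uc U(2)[of j] by (subst derivation_add[OF D]) auto
      finally show ?thesis using h Uc
        by (metis B.add.r_cancel_one B.minus_closed pd_closed)
    qed
    hence "?g = mconst R (?g {#})" using h Uc by (intro pd_zero_imp_const[OF qalg]) auto
    moreover have "mconst R (?g {#}) \<in> fspan R I F" using h Uc F mpoly_coeff_closed[of ?g I] by (intro fspan_const) auto
    ultimately have "?g \<oplus>\<^bsub>B\<^esub> U \<in> fspan R I F" using fspan_add[OF F _ U(1)] by metis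
    thus ?case using h Uc by (simp add: B.minus_eq B.a_assoc B.l_neg)
  qed
  show ?thesis
  proof (cases "h = \<zero>\<^bsub>B\<^esub>")
    case True
    thus ?thesis by (simp add: fspan.zero)
  next
    case False
    then obtain m where "h m \<noteq> \<zero>" "\<And>m'. m < m' \<Longrightarrow> h m' = \<zero>" using mpoly_lead_exists[OF assms(2)] by blast
    thus ?thesis using main[of h m] assms(2,3) by blast
  qed
qed

end

lemma (in ideal) quot_hom_cring:
  assumes "cring R" shows "ring_hom_cring R (R Quot I) ((+>) I)"
  by (rule ring_hom_cringI[OF assms quotient_is_cring[OF assms] rcos_ring_hom])

lemma (in ideal) quot_eq_zero_iff: "x \<in> carrier R \<Longrightarrow> I +> x = \<zero>\<^bsub>R Quot I\<^esub> \<longleftrightarrow> x \<in> I"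
  using rcos_const_imp_mem a_rcos_zero[OF is_ideal] by (auto simp: FactRing_def)

lemma (in ideal) quot_surj: "(+>) I ` carrier R = carrier (R Quot I)"
  by (auto simp: FactRing_def A_RCOSETS_def')

lemma (in ideal) quot_comp_zero_iff:
  assumes "cring R" and p: "p \<in> carrier (mpoly R J)"
  shows "(+>) I \<circ> p = \<zero>\<^bsub>mpoly (R Quot I) J\<^esub> \<longleftrightarrow> (\<forall>m. p m \<in> I)"
proof -
  interpret cring R by fact
  interpret q: ring_hom_cring R "R Quot I" "(+>) I" by (rule quot_hom_cring[OF assms(1)])
  show ?thesis using p by (simp add: q.S.mpoly_zero fun_eq_iff quot_eq_zero_iff)
qed

section \<open>Lifting modulo an ideal, and Noetherian induction\<close>

context grad_poly
begin

definition jac_lifts :: "'a set \<Rightarrow> bool" where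
  "jac_lifts J \<longleftrightarrow> (\<forall>h\<in>carrier B. (\<forall>i\<in>I. \<forall>j\<in>I. \<forall>m. jac R I F i j h m \<in> J) \<longrightarrow>
     (\<exists>u\<in>fspan R I F. \<forall>m. h m \<ominus> u m \<in> J))"

text \<open>Reduce modulo \<open>J\<close>: the quotient is a domain with unimodular gradient, and
  the resulting polynomial in \<open>F\<close> over \<open>R / J\<close> lifts coefficient by
  coefficient.\<close>

lemma prime_jac_lifts:
  assumes P: "primeideal J R" shows "jac_lifts J"
  unfolding jac_lifts_def
proof (intro ballI impI)
  interpret primeideal J R by fact
  interpret q: ring_hom_cring R "R Quot J" "(+>) J" by (rule quot_hom_cring[OF is_cring])
  interpret Q: grad_poly "R Quot J" I "(+>) J \<circ> F" "\<lambda>i. (+>) J \<circ> b i"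
    by (rule hom_grad_poly[OF q.S.is_cring q.homh])
  fix h assume h: "h \<in> carrier B" and j: "\<forall>i\<in>I. \<forall>j\<in>I. \<forall>m. jac R I F i j h m \<in> J"
  have "(+>) J \<circ> h \<in> fspan (R Quot J) I ((+>) J \<circ> F)"
  proof (rule Q.domain_jac_zero_imp_fspan)
    show "domain (R Quot J)" by (rule quotient_is_domain)
    fix i k assume ik: "i \<in> I" "k \<in> I"
    have "(+>) J \<circ> jac R I F i k h = \<zero>\<^bsub>mpoly (R Quot J) I\<^esub>"
      using j ik quot_comp_zero_iff[OF is_cring jac_closed[OF F h]] by blast
    thus "jac (R Quot J) I ((+>) J \<circ> F) i k ((+>) J \<circ> h) = \<zero>\<^bsub>mpoly (R Quot J) I\<^esub>"
      by (simp only: q.comp_jac[OF F h])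
  qed (rule q.comp_closed[OF h])
  from q.fspan_lift[OF F quot_surj this]
  obtain u where u: "u \<in> fspan R I F" "(+>) J \<circ> u = (+>) J \<circ> h" by blast
  have "h m \<ominus> u m \<in> J" for m
  proof -
    have c: "h m \<in> carrier R" "u m \<in> carrier R" using h fspan_closed[OF F u(1)] by auto
    have "J +> h m = J +> u m" using fun_cong[OF u(2), of m] by simp
    thus ?thesis using c quotient_eq_iff_same_a_r_cos[OF is_ideal c] by simp
  qed
  thus "\<exists>u\<in>fspan R I F. \<forall>m. h m \<ominus> u m \<in> J" using u(1) by blast
qed

text \<open>Devissage. Modulo \<open>J\<close> the first hypothesis gives \<open>h = u + a g\<close>
  with \<open>u\<close> in \<open>R[F]\<close>. As the derivations kill \<open>u\<close>, the
  coefficients of the \<open>D\<^sub>i\<^sub>j g\<close> lie in the quotient ideal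
  \<open>(J : a)\<close>; by the second hypothesis \<open>g\<close> is a polynomial \<open>v\<close>
  in \<open>F\<close> modulo \<open>(J : a)\<close>, and then \<open>h = u + a v\<close> modulo
  \<open>J\<close>.\<close>

lemma jac_lifts_step:
  assumes J: "ideal J R" and ab: "a \<in> carrier R"
    and 1: "jac_lifts (J <+>\<^bsub>R\<^esub> PIdl a)" and 2: "jac_lifts {c \<in> carrier R. a \<otimes> c \<in> J}"
  shows "jac_lifts J"
  unfolding jac_lifts_def
proof (intro ballI impI)
  interpret ideal J R by fact
  interpret q: ring_hom_cring R "R Quot J" "(+>) J" by (rule quot_hom_cring[OF is_cring])
  interpret B: cring B by (rule mpoly_cring)
  interpret B': cring "mpoly (R Quot J) I" by (rule q.S.mpoly_cring)
  interpret qq: ring_hom_cring B "mpoly (R Quot J) I" "(\<circ>) ((+>) J)"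
    by (rule ring_hom_cringI[OF mpoly_cring q.S.mpoly_cring q.comp_hom])
  fix h assume h: "h \<in> carrier B" and j: "\<forall>i\<in>I. \<forall>j\<in>I. \<forall>m. jac R I F i j h m \<in> J"
  have "x \<in> J <+>\<^bsub>R\<^esub> PIdl a" if x: "x \<in> J" for x
  proof -
    have "x = x \<oplus> \<zero> \<otimes> a" using x ab by (simp add: Icarr)
    thus ?thesis using x ab unfolding set_add_def' cgenideal_def by blast
  qed
  with 1 h j obtain u where u: "u \<in> fspan R I F" "\<And>m. h m \<ominus> u m \<in> J <+>\<^bsub>R\<^esub> PIdl a"
    unfolding jac_lifts_def by blast
  note uc = fspan_closed[OF F u(1)]
  have hu: "h \<ominus>\<^bsub>B\<^esub> u \<in> carrier B" using h uc by simp
  have "\<exists>y. y \<in> carrier R \<and> (h m \<ominus> u m) \<ominus> a \<otimes> y \<in> J" for m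
  proof -
    obtain x y where "x \<in> J" "y \<in> carrier R" "h m \<ominus> u m = x \<oplus> y \<otimes> a"
      using u(2)[of m] unfolding set_add_def' cgenideal_def by blast
    moreover have "x \<oplus> y \<otimes> a \<ominus> a \<otimes> y = x" if "x \<in> J" "y \<in> carrier R"
      using that ab Icarr[OF that(1)] by (simp add: minus_eq a_assoc m_comm[of y a] r_neg)
    ultimately show ?thesis by metis
  qed
  then obtain y where y: "\<And>m. y m \<in> carrier R" "\<And>m. (h m \<ominus> u m) \<ominus> a \<otimes> y m \<in> J" by metis
  \<comment> \<open>The \<open>y m\<close> are chosen separately for each monomial; resetting them
    to zero where \<open>h - u\<close> vanishes gives finite support.\<close>
  define g where "g m = (if h m \<ominus> u m = \<zero> then \<zero> else y m)" for m
  have g: "g \<in> carrier B"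
  proof (rule mpoly_carrierI)
    have sub: "(h \<ominus>\<^bsub>B\<^esub> u) m \<noteq> \<zero>" if "g m \<noteq> \<zero>" for m
      using that h uc by (auto simp: g_def mpoly_minus split: if_splits)
    have "{m. g m \<noteq> \<zero>} \<subseteq> {m. (h \<ominus>\<^bsub>B\<^esub> u) m \<noteq> \<zero>}" using sub by blast
    thus "finite {m. g m \<noteq> \<zero>}" using mpoly_finite_support[OF hu] by (rule finite_subset)
    show "set_mset m \<subseteq> I" if "g m \<noteq> \<zero>" for m using mpoly_support_subset[OF hu sub[OF that]] .
  qed (use y in \<open>auto simp: g_def\<close>)
  have gJ: "(h m \<ominus> u m) \<ominus> a \<otimes> g m \<in> J" for m
    using y(2)[of m] ab additive_subgroup.zero_closed[OF is_additive_subgroup] by (auto simp: g_def minus_eq)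
  let ?a = "mconst R a"
  have ac: "?a \<in> carrier B" using ab by simp
  define r where "r = (h \<ominus>\<^bsub>B\<^esub> u) \<ominus>\<^bsub>B\<^esub> ?a \<otimes>\<^bsub>B\<^esub> g"
  have r: "r \<in> carrier B" using hu ac g by (simp add: r_def)
  have "r m \<in> J" for m
  proof -
    have "r m = (h \<ominus>\<^bsub>B\<^esub> u) m \<ominus> (?a \<otimes>\<^bsub>B\<^esub> g) m"
      unfolding r_def by (subst mpoly_minus[OF hu B.m_closed[OF ac g]]) simp
    also have "(h \<ominus>\<^bsub>B\<^esub> u) m = h m \<ominus> u m" using mpoly_minus[OF h uc] by simp
    also have "(?a \<otimes>\<^bsub>B\<^esub> g) m = a \<otimes> g m" using mconst_mult[of a g I] ab g by simp
    finally show ?thesis using gJ[of m] by simp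
  qed
  hence rz: "(+>) J \<circ> r = \<zero>\<^bsub>mpoly (R Quot J) I\<^esub>" using quot_comp_zero_iff[OF is_cring r] by blast
  have hr: "h = u \<oplus>\<^bsub>B\<^esub> ?a \<otimes>\<^bsub>B\<^esub> g \<oplus>\<^bsub>B\<^esub> r"
  proof -
    have "u \<oplus>\<^bsub>B\<^esub> ?a \<otimes>\<^bsub>B\<^esub> g \<oplus>\<^bsub>B\<^esub> r =
       h \<oplus>\<^bsub>B\<^esub> (u \<oplus>\<^bsub>B\<^esub> \<ominus>\<^bsub>B\<^esub> u) \<oplus>\<^bsub>B\<^esub>
       (?a \<otimes>\<^bsub>B\<^esub> g \<oplus>\<^bsub>B\<^esub> \<ominus>\<^bsub>B\<^esub> (?a \<otimes>\<^bsub>B\<^esub> g))"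
      unfolding r_def using h uc ac g by (simp add: B.minus_eq B.a_ac del: B.r_neg)
    also have "\<dots> = h" using h uc ac g by (simp add: B.r_neg)
    finally show ?thesis by simp
  qed
  \<comment> \<open>Apply \<open>D\<^sub>i\<^sub>j\<close> to \<open>h = u + a g + r\<close>, where
    \<open>r\<close> has coefficients in \<open>J\<close>: the contributions of \<open>h\<close> and
    \<open>r\<close> lie in \<open>J\<close>, and that of \<open>u\<close> is zero.\<close>
  have jg: "a \<otimes> jac R I F i k g m \<in> J" if ik: "i \<in> I" "k \<in> I" for i k m
  proof -
    note D = jac_derivation[OF F, of i k]
    have "jac R I F i k h = jac R I F i k u \<oplus>\<^bsub>B\<^esub> jac R I F i k (?a \<otimes>\<^bsub>B\<^esub> g) \<oplus>\<^bsub>B\<^esub> jac R I F i k r"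
      unfolding hr using uc ac g r derivation_add[OF D] by simp
    also have "jac R I F i k u = \<zero>\<^bsub>B\<^esub>" by (rule jac_fspan[OF F u(1)])
    also have "jac R I F i k (?a \<otimes>\<^bsub>B\<^esub> g) = ?a \<otimes>\<^bsub>B\<^esub> jac R I F i k g"
      using derivation_mult[OF D ac g] F g ac by simp
    finally have e: "jac R I F i k h = ?a \<otimes>\<^bsub>B\<^esub> jac R I F i k g \<oplus>\<^bsub>B\<^esub> jac R I F i k r"
      using F g ac r by simp
    have "(+>) J \<circ> jac R I F i k r = jac (R Quot J) I ((+>) J \<circ> F) i k \<zero>\<^bsub>mpoly (R Quot J) I\<^esub>"
      unfolding q.comp_jac[OF F r] rz ..
    also have "\<dots> = \<zero>\<^bsub>mpoly (R Quot J) I\<^esub>"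
      using q.S.jac_derivation[OF q.comp_closed[OF F]] by (rule B'.derivation_zero)
    finally have "jac R I F i k r m \<in> J" using quot_comp_zero_iff[OF is_cring jac_closed[OF F r]] by blast
    moreover have "jac R I F i k h m \<in> J" using j ik by blast
    moreover have "jac R I F i k h m = a \<otimes> jac R I F i k g m \<oplus> jac R I F i k r m"
      unfolding e using ab jac_closed[OF F g, of i k] by (simp add: mpoly_add mconst_mult[of a _ I])
    moreover have "jac R I F i k g m \<in> carrier R" using jac_closed[OF F g] by (rule mpoly_coeff_closed)
    ultimately have *: "a \<otimes> jac R I F i k g m \<oplus> jac R I F i k r m \<in> J" "jac R I F i k r m \<in> J"
      "jac R I F i k g m \<in> carrier R" by simp_all
    have "a \<otimes> jac R I F i k g m = (a \<otimes> jac R I F i k g m \<oplus> jac R I F i k r m) \<oplus> \<ominus> jac R I F i k r m"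
      using ab * Icarr[OF *(2)] by (simp add: a_assoc r_neg)
    also have "\<dots> \<in> J"
      by (intro additive_subgroup.a_closed[OF is_additive_subgroup] additive_subgroup.a_inv_closed[OF is_additive_subgroup] *)
    finally show ?thesis .
  qed
  have "\<forall>i\<in>I. \<forall>k\<in>I. \<forall>m. jac R I F i k g m \<in> {c \<in> carrier R. a \<otimes> c \<in> J}"
    using jg mpoly_coeff_closed[OF jac_closed[OF F g]] by auto
  with 2 g obtain v where v: "v \<in> fspan R I F" "\<And>m. g m \<ominus> v m \<in> {c \<in> carrier R. a \<otimes> c \<in> J}"
    unfolding jac_lifts_def by blast
  note vc = fspan_closed[OF F v(1)]
  let ?w = "u \<oplus>\<^bsub>B\<^esub> ?a \<otimes>\<^bsub>B\<^esub> v"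
  have "h m \<ominus> ?w m \<in> J" for m
  proof -
    have c: "h m \<in> carrier R" "u m \<in> carrier R" "g m \<in> carrier R" "v m \<in> carrier R"
      using h uc g vc by auto
    have "?w m = u m \<oplus> a \<otimes> v m" using ab vc by (simp add: mpoly_add mconst_mult[of a _ I])
    hence "h m \<ominus> ?w m = ((h m \<ominus> u m) \<ominus> a \<otimes> g m) \<oplus> a \<otimes> (g m \<ominus> v m)"
      using c ab by (simp add: minus_eq r_distr minus_add r_minus a_ac r_neg1 r_neg2)
    thus ?thesis using gJ[of m] v(2)[of m] additive_subgroup.a_closed[OF is_additive_subgroup] by simp
  qed
  moreover have "?w \<in> fspan R I F" by (intro fspan_add fspan_const_mult F u v ab)
  ultimately show "\<exists>u\<in>fspan R I F. \<forall>m. h m \<ominus> u m \<in> J" by blast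
qed

text \<open>An ideal that is maximal among those that fail would be prime: if \<open>a c\<close>
  lies in it but neither factor does, then adding \<open>a\<close> and forming the quotient ideal by
  \<open>a\<close> both give strictly larger ideals, for which the claim holds, and
  \<open>jac_lifts_step\<close> applies. Primes are covered by
  \<open>prime_jac_lifts\<close>.\<close>

lemma noetherian_jac_lifts:
  assumes N: "noetherian_ring R" and J: "ideal J R"
  shows "jac_lifts J"
proof (rule ccontr)
  interpret noetherian_ring R by fact
  assume nJ: "\<not> jac_lifts J"
  define CC where "CC = {J. ideal J R \<and> \<not> jac_lifts J}"
  have "\<exists>M\<in>CC. \<forall>Y\<in>CC. M \<subseteq> Y \<longrightarrow> Y = M"
  proof (rule subset_Zorn_nonempty)
    show "CC \<noteq> {}" using J nJ by (auto simp: CC_def)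
    fix C assume C: "C \<noteq> {}" "subset.chain CC C"
    hence "subset.chain {I. ideal I R} C" by (auto simp: CC_def subset.chain_def)
    \<comment> \<open>In a Noetherian ring a nonempty chain of ideals contains its union, so the
      upper bound is a member of the chain.\<close>
    from ideal_chain_is_trivial[OF C(1) this] show "\<Union>C \<in> CC" using C(2) by (auto simp: subset.chain_def)
  qed
  then obtain M where M: "ideal M R" "\<not> jac_lifts M" and max: "\<And>Y. ideal Y R \<Longrightarrow> \<not> jac_lifts Y \<Longrightarrow> M \<subseteq> Y \<Longrightarrow> Y = M"
    by (auto simp: CC_def)
  interpret M: ideal M R by fact
  have "M \<noteq> carrier R"
  proof
    assume e: "M = carrier R"
    have "jac_lifts M" unfolding jac_lifts_def e
      using fspan.zero fspan_closed[OF F fspan.zero] by (intro ballI impI bexI[of _ "\<zero>\<^bsub>B\<^esub>"]) auto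
    thus False using M by simp
  qed
  have "primeideal M R"
  proof (rule primeidealI[OF M(1) is_cring])
    show "carrier R \<noteq> M" using \<open>M \<noteq> carrier R\<close> by simp
    fix a c assume a: "a \<in> carrier R" and c: "c \<in> carrier R" and ac: "a \<otimes> c \<in> M"
    show "a \<in> M \<or> c \<in> M"
    proof (rule ccontr)
      assume n: "\<not> (a \<in> M \<or> c \<in> M)"
      have 1: "jac_lifts (M <+>\<^bsub>R\<^esub> PIdl a)"
      proof (rule ccontr)
        assume "\<not> jac_lifts (M <+>\<^bsub>R\<^esub> PIdl a)"
        moreover have "ideal (M <+>\<^bsub>R\<^esub> PIdl a) R" by (rule add_ideals[OF M(1) cgenideal_ideal[OF a]])
        moreover have "M \<subseteq> M <+>\<^bsub>R\<^esub> PIdl a"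
        proof
          fix x assume x: "x \<in> M"
          have "x = x \<oplus> \<zero> \<otimes> a" using x a by (simp add: M.Icarr)
          thus "x \<in> M <+>\<^bsub>R\<^esub> PIdl a" using x a unfolding set_add_def' cgenideal_def by blast
        qed
        ultimately have "M <+>\<^bsub>R\<^esub> PIdl a = M" by (intro max)
        moreover have "a \<in> M <+>\<^bsub>R\<^esub> PIdl a"
        proof -
          have "a = \<zero> \<oplus> \<one> \<otimes> a" using a by simp
          moreover have "\<zero> \<in> M" by (rule additive_subgroup.zero_closed[OF M.is_additive_subgroup])
          ultimately show ?thesis unfolding set_add_def' cgenideal_def by blast
        qed
        ultimately show False using n by simp
      qed
      have 2: "jac_lifts {x \<in> carrier R. a \<otimes> x \<in> M}" (is "jac_lifts ?A")
      proof (rule ccontr)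
        assume "\<not> jac_lifts ?A"
        moreover have "ideal ?A R"
        proof (rule idealI)
          show "ring R" by (rule cring.axioms(1)[OF is_cring])
          show "subgroup ?A (add_monoid R)"
          proof (rule add.subgroupI)
            show "?A \<noteq> {}" using a additive_subgroup.zero_closed[OF M.is_additive_subgroup] by auto
            fix x assume "x \<in> ?A"
            thus "\<ominus> x \<in> ?A" using a additive_subgroup.a_inv_closed[OF M.is_additive_subgroup, of "a \<otimes> x"]
              by (simp add: r_minus)
          next
            fix x y assume "x \<in> ?A" "y \<in> ?A"
            thus "x \<oplus> y \<in> ?A" using a additive_subgroup.a_closed[OF M.is_additive_subgroup, of "a \<otimes> x" "a \<otimes> y"]
              by (simp add: r_distr)
          qed auto
          fix x y assume xy: "x \<in> ?A" "y \<in> carrier R"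
          have "a \<otimes> (y \<otimes> x) = y \<otimes> (a \<otimes> x)" using a xy by (simp add: m_lcomm)
          thus 1: "y \<otimes> x \<in> ?A" using a xy M.I_l_closed by simp
          thus "x \<otimes> y \<in> ?A" using xy by (simp add: m_comm)
        qed
        moreover have "M \<subseteq> ?A" using a M.Icarr M.I_l_closed by auto
        ultimately have "?A = M" by (intro max)
        thus False using n ac c by auto
      qed
      show False using jac_lifts_step[OF M(1) a 1 2] M(2) by simp
    qed
  qed
  thus False using prime_jac_lifts M(2) by simp
qed

end

section \<open>Valuation rings\<close>

text \<open>These are the values at \<open>x\<close> of the polynomials of degree at most
  \<open>n\<close> with coefficients in \<open>T\<close>. Stratifying \<open>T[x]\<close> by degree
  keeps the degrees available for the minimality argument in
  \<open>valuation_ring_exists\<close>.\<close>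

primrec horner :: "('a, 'm) ring_scheme \<Rightarrow> 'a set \<Rightarrow> 'a \<Rightarrow> nat \<Rightarrow> 'a set" where
  "horner K T x 0 = T"
| "horner K T x (Suc n) = {t \<oplus>\<^bsub>K\<^esub> u \<otimes>\<^bsub>K\<^esub> x | t u. t \<in> T \<and> u \<in> horner K T x n}"

declare horner.simps(2) [simp del]

lemma hornerI: "v = t \<oplus>\<^bsub>K\<^esub> u \<otimes>\<^bsub>K\<^esub> x \<Longrightarrow> t \<in> T \<Longrightarrow> u \<in> horner K T x n \<Longrightarrow> v \<in> horner K T x (Suc n)"
  by (auto simp: horner.simps(2))

lemma hornerE:
  assumes "v \<in> horner K T x (Suc n)"
  obtains t u where "v = t \<oplus>\<^bsub>K\<^esub> u \<otimes>\<^bsub>K\<^esub> x" "t \<in> T" "u \<in> horner K T x n"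
  using assms by (auto simp: horner.simps(2))

context cring
begin

lemma horner_closed: "T \<subseteq> carrier R \<Longrightarrow> x \<in> carrier R \<Longrightarrow> u \<in> horner R T x n \<Longrightarrow> u \<in> carrier R"
  by (induction n arbitrary: u) (auto simp: horner.simps(2))

lemma horner_Suc_mono:
  assumes "\<zero> \<in> T" "T \<subseteq> carrier R" "x \<in> carrier R" "u \<in> horner R T x n"
  shows "u \<in> horner R T x (Suc n)"
  using assms(4)
proof (induction n arbitrary: u)
  case 0
  hence "u = u \<oplus> \<zero> \<otimes> x" using assms by auto
  from hornerI[OF this, of T 0] show ?case using 0 assms by simp
next
  case (Suc n)
  then obtain t v where tv: "u = t \<oplus> v \<otimes> x" "t \<in> T" "v \<in> horner R T x n" by (elim hornerE)
  from hornerI[OF tv(1,2) Suc.IH[OF tv(3)]] show ?case .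
qed

lemma horner_mono:
  assumes "\<zero> \<in> T" "T \<subseteq> carrier R" "x \<in> carrier R" "n \<le> n'" "u \<in> horner R T x n"
  shows "u \<in> horner R T x n'"
  using assms(4,5)
proof (induction rule: dec_induct)
  case (step k)
  thus ?case using horner_Suc_mono[OF assms(1-3)] by blast
qed

lemma horner_add:
  assumes T: "T \<subseteq> carrier R" "\<And>s t. s \<in> T \<Longrightarrow> t \<in> T \<Longrightarrow> s \<oplus> t \<in> T" and x: "x \<in> carrier R"
    and "u \<in> horner R T x n" "v \<in> horner R T x n"
  shows "u \<oplus> v \<in> horner R T x n"
  using assms(4,5)
proof (induction n arbitrary: u v)
  case 0
  thus ?case using T by simp
next
  case (Suc n)
  then obtain t u' s v' where tu: "u = t \<oplus> u' \<otimes> x" "t \<in> T" "u' \<in> horner R T x n"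
    "v = s \<oplus> v' \<otimes> x" "s \<in> T" "v' \<in> horner R T x n" by (elim hornerE)
  have c: "t \<in> carrier R" "s \<in> carrier R" "u' \<in> carrier R" "v' \<in> carrier R"
    using tu T(1) horner_closed[OF T(1) x] by auto
  have "u \<oplus> v = (t \<oplus> s) \<oplus> (u' \<oplus> v') \<otimes> x" using c x tu by (simp add: l_distr a_ac)
  from hornerI[OF this T(2)[OF tu(2,5)] Suc.IH[OF tu(3,6)]] show ?case .
qed

lemma horner_smult:
  assumes T: "T \<subseteq> carrier R" "\<And>t. t \<in> T \<Longrightarrow> s \<otimes> t \<in> T" and x: "x \<in> carrier R" "s \<in> carrier R"
    and "u \<in> horner R T x n"
  shows "s \<otimes> u \<in> horner R T x n"
  using assms(5)
proof (induction n arbitrary: u)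
  case 0
  thus ?case using T by simp
next
  case (Suc n)
  then obtain t u' where tu: "u = t \<oplus> u' \<otimes> x" "t \<in> T" "u' \<in> horner R T x n" by (elim hornerE)
  have c: "t \<in> carrier R" "u' \<in> carrier R" using tu T(1) horner_closed[OF T(1) x(1)] by auto
  have "s \<otimes> u = (s \<otimes> t) \<oplus> (s \<otimes> u') \<otimes> x" using c x tu by (simp add: r_distr m_assoc)
  from hornerI[OF this T(2)[OF tu(2)] Suc.IH[OF tu(3)]] show ?case .
qed

lemma horner_shift:
  assumes "\<zero> \<in> T" "T \<subseteq> carrier R" "x \<in> carrier R" "u \<in> horner R T x n"
  shows "u \<otimes> x \<in> horner R T x (Suc n)"
proof -
  have "u \<otimes> x = \<zero> \<oplus> u \<otimes> x" using assms horner_closed[OF assms(2,3,4)] by simp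
  from hornerI[OF this assms(1,4)] show ?thesis .
qed

text \<open>Two coefficient sets occur because \<open>T\<close> is only a module over
  \<open>S\<close>: with \<open>S\<close> a subring and \<open>T\<close> an ideal of it, the rule
  makes \<open>T[x]\<close> an ideal of \<open>S[x]\<close>.\<close>

lemma horner_mult:
  assumes S: "S \<subseteq> carrier R" and T: "\<zero> \<in> T" "T \<subseteq> carrier R" "\<And>s t. s \<in> T \<Longrightarrow> t \<in> T \<Longrightarrow> s \<oplus> t \<in> T"
    and ST: "\<And>s t. s \<in> S \<Longrightarrow> t \<in> T \<Longrightarrow> s \<otimes> t \<in> T" and x: "x \<in> carrier R"
    and "u \<in> horner R S x n" and v: "v \<in> horner R T x m"
  shows "u \<otimes> v \<in> horner R T x (n + m)"
  using assms(7)
proof (induction n arbitrary: u)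
  case 0
  hence u: "u \<in> S" by simp
  show ?case using horner_smult[OF T(2) ST[OF u] x subsetD[OF S u] v] by simp
next
  case (Suc n)
  then obtain s u' where su: "u = s \<oplus> u' \<otimes> x" "s \<in> S" "u' \<in> horner R S x n" by (elim hornerE)
  have c: "s \<in> carrier R" "u' \<in> carrier R" "v \<in> carrier R"
    using su S horner_closed[OF S x] horner_closed[OF T(2) x v] by auto
  have 1: "s \<otimes> v \<in> horner R T x (Suc n + m)"
    by (rule horner_mono[OF T(1,2) x _ horner_smult[OF T(2) ST[OF su(2)] x c(1) v]]) simp
  have 2: "u' \<otimes> v \<otimes> x \<in> horner R T x (Suc n + m)"
    using horner_shift[OF T(1,2) x Suc.IH[OF su(3)]] by simp
  have e: "u \<otimes> v = s \<otimes> v \<oplus> u' \<otimes> v \<otimes> x" unfolding su(1) using c x by (simp add: l_distr m_assoc m_comm[of x v])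
  show ?case unfolding e by (rule horner_add[OF T(2,3) x 1 2])
qed

text \<open>The recursion exposes only the constant term; eliminating a highest power needs the top
  one.\<close>

lemma horner_top:
  assumes T: "T \<subseteq> carrier R" and x: "x \<in> carrier R" and "u \<in> horner R T x (Suc n)"
  shows "\<exists>v\<in>horner R T x n. \<exists>t\<in>T. u = v \<oplus> t \<otimes> x [^] Suc n"
  using assms(3)
proof (induction n arbitrary: u)
  case 0
  then obtain t v where tv: "u = t \<oplus> v \<otimes> x" "t \<in> T" "v \<in> horner R T x 0" by (elim hornerE)
  have "u = t \<oplus> v \<otimes> x [^] Suc 0" unfolding tv(1) using x by simp
  moreover have "t \<in> horner R T x 0" "v \<in> T" using tv(2,3) by simp_all
  ultimately show ?case by blast
next
  case (Suc n)
  obtain t v where tv: "u = t \<oplus> v \<otimes> x" "t \<in> T" "v \<in> horner R T x (Suc n)" using Suc.prems by (rule hornerE)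
  from Suc.IH[OF tv(3)] obtain v' t' where v': "v' \<in> horner R T x n" "t' \<in> T" "v = v' \<oplus> t' \<otimes> x [^] Suc n" by blast
  have c: "t \<in> carrier R" "t' \<in> carrier R" "v' \<in> carrier R" using tv v' T horner_closed[OF T x] by auto
  have "u = (t \<oplus> v' \<otimes> x) \<oplus> t' \<otimes> x [^] Suc (Suc n)"
    using c x tv(1) v'(3) by (simp add: l_distr m_assoc a_assoc)
  thus ?case using hornerI[OF refl tv(2) v'(1)] v'(2) by blast
qed

end

section \<open>Chevalley's extension theorem\<close>

locale place_data = field K for K :: "('a, 'm) ring_scheme" (structure) +
  fixes D p :: "'a set"
  assumes D: "subring D K" and p_sub: "p \<subseteq> D" and p_zero: "\<zero> \<in> p"
    and p_add: "\<And>x y. x \<in> p \<Longrightarrow> y \<in> p \<Longrightarrow> x \<oplus> y \<in> p"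
    and p_mult: "\<And>x y. x \<in> D \<Longrightarrow> y \<in> p \<Longrightarrow> x \<otimes> y \<in> p"
    and p_one: "\<one> \<notin> p" and p_prime: "\<And>x y. x \<in> D - p \<Longrightarrow> y \<in> D - p \<Longrightarrow> x \<otimes> y \<in> D - p"
begin

text \<open>A pair of a subring and one of its ideals that contains \<open>p\<close> and avoids \<open>D - p\<close>. The maximal
  such pairs are the valuation rings of \<open>K\<close> that dominate \<open>D\<close> localized at \<open>p\<close>.\<close>

definition dominating :: "'a set \<Rightarrow> 'a set \<Rightarrow> bool" where
  "dominating S I \<longleftrightarrow> subring S K \<and> D \<subseteq> S \<and> p \<subseteq> I \<and> I \<subseteq> S \<and> (\<forall>x\<in>I. \<forall>y\<in>I. x \<oplus> y \<in> I) \<and>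
     (\<forall>x\<in>S. \<forall>y\<in>I. x \<otimes> y \<in> I) \<and> I \<inter> (D - p) = {}"

text \<open>Zorn's lemma for pairs ordered componentwise. A pair is coded as one set of elements
  tagged with a Boolean, so that the order becomes plain inclusion.\<close>

lemma dominating_maximal_exists:
  "\<exists>S I. dominating S I \<and> (\<forall>S' I'. dominating S' I' \<longrightarrow> S \<subseteq> S' \<longrightarrow> I \<subseteq> I' \<longrightarrow> S' = S \<and> I' = I)"
proof -
  define f where "f Z = {x. (x, False) \<in> Z}" for Z :: "('a \<times> bool) set"
  define g where "g Z = {x. (x, True) \<in> Z}" for Z :: "('a \<times> bool) set"
  define A where "A = {Z. dominating (f Z) (g Z)}"
  have "\<exists>M\<in>A. \<forall>Y\<in>A. M \<subseteq> Y \<longrightarrow> Y = M"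
  proof (rule subset_Zorn_nonempty)
    have "f (D \<times> {False} \<union> p \<times> {True}) = D" "g (D \<times> {False} \<union> p \<times> {True}) = p"
      by (auto simp: f_def g_def)
    moreover have "dominating D p"
      using D p_sub p_add p_mult by (auto simp: dominating_def)
    ultimately have "D \<times> {False} \<union> p \<times> {True} \<in> A" by (simp add: A_def)
    thus "A \<noteq> {}" by blast
    fix C assume ne: "C \<noteq> {}" and C: "subset.chain A C"
    have dom: "dominating (f Z) (g Z)" if "Z \<in> C" for Z using C that by (auto simp: A_def subset.chain_def)
    have two: "\<exists>Z\<in>C. a \<in> Z \<and> b \<in> Z" if ab: "a \<in> \<Union>C" "b \<in> \<Union>C" for a b
    proof -
      obtain X1 X2 where "X1 \<in> C" "a \<in> X1" "X2 \<in> C" "b \<in> X2" using ab by blast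
      moreover from this C have "X1 \<subseteq> X2 \<or> X2 \<subseteq> X1" by (auto simp: subset_chain_def)
      ultimately show ?thesis by blast
    qed
    have f_iff: "x \<in> f (\<Union>C) \<longleftrightarrow> (\<exists>Z\<in>C. x \<in> f Z)" and g_iff: "x \<in> g (\<Union>C) \<longleftrightarrow> (\<exists>Z\<in>C. x \<in> g Z)" for x
      by (auto simp: f_def g_def)
    obtain Z0 where Z0: "Z0 \<in> C" using ne by blast
    have ff: "\<exists>Z\<in>C. x \<in> f Z \<and> y \<in> f Z" if "x \<in> f (\<Union>C)" "y \<in> f (\<Union>C)" for x y
      using two[of "(x, False)" "(y, False)"] that by (auto simp: f_def)
    have gg: "\<exists>Z\<in>C. x \<in> g Z \<and> y \<in> g Z" if "x \<in> g (\<Union>C)" "y \<in> g (\<Union>C)" for x y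
      using two[of "(x, True)" "(y, True)"] that by (auto simp: g_def)
    have fg: "\<exists>Z\<in>C. x \<in> f Z \<and> y \<in> g Z" if "x \<in> f (\<Union>C)" "y \<in> g (\<Union>C)" for x y
      using two[of "(x, False)" "(y, True)"] that by (auto simp: f_def g_def)
    have sr: "subring (f Z) K" if "Z \<in> C" for Z using dom[OF that] by (simp add: dominating_def)
    have "subring (f (\<Union>C)) K"
    proof (rule subringI)
      show "f (\<Union>C) \<subseteq> carrier K" using f_iff sr subringE(1) by blast
      show "\<one> \<in> f (\<Union>C)" using f_iff subringE(3)[OF sr[OF Z0]] Z0 by blast
      show "\<ominus> x \<in> f (\<Union>C)" if "x \<in> f (\<Union>C)" for x using that f_iff subringE(5)[OF sr] by blast
      show "x \<otimes> y \<in> f (\<Union>C)" if "x \<in> f (\<Union>C)" "y \<in> f (\<Union>C)" for x y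
        using ff[OF that] f_iff subringE(6)[OF sr] by blast
      show "x \<oplus> y \<in> f (\<Union>C)" if "x \<in> f (\<Union>C)" "y \<in> f (\<Union>C)" for x y
        using ff[OF that] f_iff subringE(7)[OF sr] by blast
    qed
    moreover have Dp: "D \<subseteq> f Z0" "p \<subseteq> g Z0" using dom[OF Z0] by (auto simp: dominating_def)
    have "D \<subseteq> f (\<Union>C)" "p \<subseteq> g (\<Union>C)" using Dp Z0 by (auto simp: f_def g_def)
    moreover have "g Z \<subseteq> f Z" if "Z \<in> C" for Z using dom[OF that] by (simp add: dominating_def)
    hence "g (\<Union>C) \<subseteq> f (\<Union>C)" by (auto simp: f_def g_def)
    moreover have "x \<oplus> y \<in> g (\<Union>C)" if xy: "x \<in> g (\<Union>C)" "y \<in> g (\<Union>C)" for x y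
    proof -
      obtain Z where Z: "Z \<in> C" "x \<in> g Z" "y \<in> g Z" using gg[OF xy] by blast
      from dom[OF Z(1)] Z(2,3) have "x \<oplus> y \<in> g Z" by (simp add: dominating_def)
      thus ?thesis using Z(1) g_iff by blast
    qed
    moreover have "x \<otimes> y \<in> g (\<Union>C)" if xy: "x \<in> f (\<Union>C)" "y \<in> g (\<Union>C)" for x y
    proof -
      obtain Z where Z: "Z \<in> C" "x \<in> f Z" "y \<in> g Z" using fg[OF xy] by blast
      from dom[OF Z(1)] Z(2,3) have "x \<otimes> y \<in> g Z" by (simp add: dominating_def)
      thus ?thesis using Z(1) g_iff by blast
    qed
    moreover have "g Z \<inter> (D - p) = {}" if "Z \<in> C" for Z using dom[OF that] by (simp add: dominating_def)
    hence "g (\<Union>C) \<inter> (D - p) = {}" using g_iff by blast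
    ultimately have "dominating (f (\<Union>C)) (g (\<Union>C))" by (simp add: dominating_def)
    thus "\<Union>C \<in> A" by (simp add: A_def)
  qed
  then obtain M where M: "M \<in> A" "\<And>Y. Y \<in> A \<Longrightarrow> M \<subseteq> Y \<Longrightarrow> Y = M" by blast
  have "S' = f M \<and> I' = g M" if "dominating S' I'" "f M \<subseteq> S'" "g M \<subseteq> I'" for S' I'
  proof -
    let ?Y = "S' \<times> {False} \<union> I' \<times> {True}"
    have fg: "f ?Y = S'" "g ?Y = I'" by (auto simp: f_def g_def)
    hence "?Y \<in> A" using that by (simp add: A_def)
    moreover have "M \<subseteq> ?Y"
    proof
      fix z assume z: "z \<in> M"
      obtain x b where zx: "z = (x, b)" by (cases z)
      show "z \<in> ?Y" using z zx that by (cases b) (auto simp: f_def g_def)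
    qed
    ultimately have "?Y = M" by (rule M(2))
    thus ?thesis using fg by metis
  qed
  thus ?thesis using M(1) by (auto simp: A_def)
qed

text \<open>Chevalley's theorem: a maximal dominating pair is a valuation ring with its maximal
  ideal. The localization of \<open>D\<close> at \<open>p\<close> is never formed; elements
  \<open>r + i\<close> with \<open>r\<close> in \<open>D - p\<close> and \<open>i\<close> in the
  ideal take the part of its units.\<close>

lemma valuation_ring_exists:
  "\<exists>V m. subring V K \<and> D \<subseteq> V \<and> p \<subseteq> m \<and> m \<subseteq> V \<and> (\<forall>x\<in>m. \<forall>y\<in>m. x \<oplus> y \<in> m) \<and>
     (\<forall>x\<in>V. \<forall>y\<in>m. x \<otimes> y \<in> m) \<and> m \<inter> (D - p) = {} \<and>
     (\<forall>x\<in>carrier K - V. inv x \<in> m) \<and> (\<forall>x\<in>V - m. inv x \<in> V)"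
proof -
  obtain S I where good: "dominating S I"
    and max: "\<And>S' I'. dominating S' I' \<Longrightarrow> S \<subseteq> S' \<Longrightarrow> I \<subseteq> I' \<Longrightarrow> S' = S \<and> I' = I"
    using dominating_maximal_exists by blast
  have S: "subring S K" "D \<subseteq> S" and I: "p \<subseteq> I" "I \<subseteq> S" "\<And>x y. x \<in> I \<Longrightarrow> y \<in> I \<Longrightarrow> x \<oplus> y \<in> I"
    "\<And>x y. x \<in> S \<Longrightarrow> y \<in> I \<Longrightarrow> x \<otimes> y \<in> I" "\<And>x. x \<in> I \<Longrightarrow> x \<in> D - p \<Longrightarrow> False"
    using good by (auto simp: dominating_def)
  note SE = subringE[OF S(1)]
  have I0: "\<zero> \<in> I" using I(1) p_zero by blast
  have Ic: "I \<subseteq> carrier K" using I(2) SE(1) by blast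
  have one: "\<one> \<in> D - p" using p_one subringE(3)[OF D] by simp
  have neg: "\<ominus> x \<in> I" if "x \<in> I" for x
  proof -
    have "\<ominus> x = (\<ominus> \<one>) \<otimes> x" using that Ic by (auto simp: l_minus)
    thus ?thesis using I(4)[OF SE(5)[OF SE(3)] that] by simp
  qed
  \<comment> \<open>If the ideal generated by \<open>I\<close> in \<open>S[x]\<close> still avoids
    \<open>D - p\<close>, then \<open>S[x]\<close> with this ideal is a dominating pair, and
    maximality puts \<open>x\<close> into \<open>S\<close>.\<close>
  have adj: "x \<in> S" if x: "x \<in> carrier K" and h: "\<And>n. horner K I x n \<inter> (D - p) = {}" for x
  proof -
    let ?S = "\<Union>n. horner K S x n" and ?I = "\<Union>n. horner K I x n"
    have Sadd: "\<And>s t. s \<in> S \<Longrightarrow> t \<in> S \<Longrightarrow> s \<oplus> t \<in> S" using SE(7) by blast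
    have up: "u \<in> horner K S x (max n n')" "v \<in> horner K S x (max n n')"
      if "u \<in> horner K S x n" "v \<in> horner K S x n'" for u v n n'
      using that horner_mono[OF SE(2) SE(1) x] by (meson max.cobounded1 max.cobounded2)+
    have upI: "u \<in> horner K I x (max n n')" "v \<in> horner K I x (max n n')"
      if "u \<in> horner K I x n" "v \<in> horner K I x n'" for u v n n'
      using that horner_mono[OF I0 Ic x] by (meson max.cobounded1 max.cobounded2)+
    have "subring ?S K"
    proof (rule subringI)
      show "?S \<subseteq> carrier K" using horner_closed[OF SE(1) x] by blast
      have S0: "S \<subseteq> ?S" using UN_upper[of 0 UNIV "horner K S x"] by simp
      show "\<one> \<in> ?S" using SE(3) S0 by blast
      show mult: "u \<otimes> v \<in> ?S" if uv: "u \<in> ?S" "v \<in> ?S" for u v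
      proof -
        obtain n n' where "u \<in> horner K S x n" "v \<in> horner K S x n'" using uv by blast
        from horner_mult[OF SE(1) SE(2) SE(1) Sadd SE(6) x this] show ?thesis by blast
      qed
      show "\<ominus> u \<in> ?S" if u: "u \<in> ?S" for u
      proof -
        have "\<ominus> \<one> \<in> ?S" using SE(5)[OF SE(3)] S0 by blast
        from mult[OF this u] show ?thesis using u horner_closed[OF SE(1) x] by (auto simp: l_minus)
      qed
      show "u \<oplus> v \<in> ?S" if uv: "u \<in> ?S" "v \<in> ?S" for u v
      proof -
        obtain n n' where "u \<in> horner K S x n" "v \<in> horner K S x n'" using uv by blast
        from up[OF this] show ?thesis using horner_add[OF SE(1) Sadd x] by blast
      qed
    qed
    moreover have "S \<subseteq> ?S" "I \<subseteq> ?I"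
      using UN_upper[of 0 UNIV "horner K S x"] UN_upper[of 0 UNIV "horner K I x"] by simp_all
    moreover have "horner K I x n \<subseteq> horner K S x n" for n using I(2) by (induction n) (auto simp: horner.simps(2))
    hence "?I \<subseteq> ?S" by blast
    moreover have Iadd: "u \<oplus> v \<in> ?I" if uv: "u \<in> ?I" "v \<in> ?I" for u v
    proof -
      obtain n n' where "u \<in> horner K I x n" "v \<in> horner K I x n'" using uv by blast
      from upI[OF this] show ?thesis using horner_add[OF Ic I(3) x] by blast
    qed
    moreover have Imult: "u \<otimes> v \<in> ?I" if uv: "u \<in> ?S" "v \<in> ?I" for u v
    proof -
      obtain n n' where "u \<in> horner K S x n" "v \<in> horner K I x n'" using uv by blast
      from horner_mult[OF SE(1) I0 Ic I(3) I(4) x this] show ?thesis by blast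
    qed
    moreover have "?I \<inter> (D - p) = {}" using h by blast
    moreover have "D \<subseteq> ?S" using S(2) \<open>S \<subseteq> ?S\<close> by (rule subset_trans)
    moreover have "p \<subseteq> ?I" using I(1) \<open>I \<subseteq> ?I\<close> by (rule subset_trans)
    ultimately have "dominating ?S ?I" unfolding dominating_def by (intro conjI ballI Iadd Imult)
    from max[OF this \<open>S \<subseteq> ?S\<close> \<open>I \<subseteq> ?I\<close>] have "?S = S" by blast
    moreover have "x = \<zero> \<oplus> \<one> \<otimes> x" using x by simp
    from hornerI[OF this SE(2), of 0] have "x \<in> horner K S x (Suc 0)" using SE(3) by simp
    ultimately show "x \<in> S" by blast
  qed
  have DmS: "x \<in> carrier K" if "x \<in> D" for x using that S(2) SE(1) by blast
  \<comment> \<open>The elements \<open>r + i\<close> with \<open>r\<close> in \<open>D - p\<close>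
    and \<open>i\<close> in \<open>I\<close> are closed under products; \<open>UInot\<close> keeps
    them out of \<open>I\<close>.\<close>
  have UImult: "\<exists>r\<in>D - p. \<exists>i\<in>I. x \<otimes> y = r \<oplus> i"
    if "r \<in> D - p" "i \<in> I" "x = r \<oplus> i" "r' \<in> D - p" "i' \<in> I" "y = r' \<oplus> i'" for x y r i r' i'
  proof -
    have c: "r \<in> carrier K" "i \<in> carrier K" "r' \<in> carrier K" "i' \<in> carrier K" using that Ic DmS by auto
    have "x \<otimes> y = r \<otimes> r' \<oplus> (r \<otimes> i' \<oplus> (r' \<otimes> i \<oplus> i \<otimes> i'))"
      using c that by (simp add: l_distr r_distr m_ac a_ac)
    moreover have "r \<otimes> i' \<oplus> (r' \<otimes> i \<oplus> i \<otimes> i') \<in> I"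
      using that S(2) I(2) by (intro I(3) I(4)) auto
    ultimately show ?thesis using p_prime[OF that(1) that(4)] by blast
  qed
  have UInot: "r \<oplus> i \<notin> I" if "r \<in> D - p" "i \<in> I" for r i
  proof
    assume "r \<oplus> i \<in> I"
    hence "(r \<oplus> i) \<oplus> \<ominus> i \<in> I" using neg that I(3) by blast
    moreover have "(r \<oplus> i) \<oplus> \<ominus> i = r" using that DmS Ic by (auto simp: a_assoc r_neg)
    ultimately show False using I(5)[of r] that(1) by simp
  qed
  have unit1: "inv u \<in> S \<and> u \<noteq> \<zero>" if r: "r \<in> D - p" "i \<in> I" "u = r \<oplus> i" for u r i
  proof -
    have uc: "u \<in> carrier K" using r DmS Ic by auto
    have u0: "u \<noteq> \<zero>" using UInot[OF r(1,2)] r(3) I0 by auto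
    hence uU: "u \<in> Units K" using uc field_Units by simp
    have ic: "inv u \<in> carrier K" using uU by simp
    have uS: "u \<in> S" using r S(2) I(2) SE(7) by blast
    \<comment> \<open>Multiplying by \<open>u^n\<close> clears the powers of \<open>inv u\<close>:
      an element of \<open>D - p\<close> inside \<open>I[inv u]\<close> would yield an element of
      \<open>I\<close> of the form \<open>r' + i'\<close>.\<close>
    have pw: "v \<otimes> u [^] n \<in> I" if "v \<in> horner K I (inv u) n" for v n
      using that
    proof (induction n arbitrary: v)
      case 0
      thus ?case using Ic by auto
    next
      case (Suc n)
      then obtain t w where tw: "v = t \<oplus> w \<otimes> inv u" "t \<in> I" "w \<in> horner K I (inv u) n" by (elim hornerE)
      have c: "t \<in> carrier K" "w \<in> carrier K" using tw Ic horner_closed[OF Ic ic] by auto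
      have "v \<otimes> u [^] Suc n = u [^] Suc n \<otimes> t \<oplus> w \<otimes> (inv u \<otimes> u) \<otimes> u [^] n"
        using c ic uc tw by (simp add: l_distr r_distr m_ac)
      also have "\<dots> = u [^] Suc n \<otimes> t \<oplus> w \<otimes> u [^] n" using c uU by simp
      also have "\<dots> \<in> I"
      proof -
        have "u [^] Suc n \<in> S" using uS SE(3,6) by (induction n) (auto simp: uc)
        thus ?thesis using Suc.IH[OF tw(3)] tw(2) I(3,4) by blast
      qed
      finally show ?case .
    qed
    have pw2: "\<exists>r'\<in>D - p. \<exists>i'\<in>I. r0 \<otimes> u [^] n = r' \<oplus> i'" if "r0 \<in> D - p" for r0 and n :: nat
    proof (induction n)
      case 0
      have "r0 \<otimes> u [^] (0::nat) = r0 \<oplus> \<zero>" using that DmS by auto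
      thus ?case using that I0 by blast
    next
      case (Suc n)
      then obtain r' i' where ri: "r' \<in> D - p" "i' \<in> I" "r0 \<otimes> u [^] n = r' \<oplus> i'" by blast
      have "r0 \<otimes> u [^] Suc n = (r0 \<otimes> u [^] n) \<otimes> u" using that DmS uc by (simp add: m_assoc)
      thus ?case using UImult[OF ri r] by simp
    qed
    have "inv u \<in> S"
    proof (rule adj[OF ic], rule ccontr)
      fix n assume "horner K I (inv u) n \<inter> (D - p) \<noteq> {}"
      then obtain r0 where r0: "r0 \<in> horner K I (inv u) n" "r0 \<in> D - p" by blast
      show False using pw[OF r0(1)] pw2[OF r0(2), of n] UInot by auto
    qed
    thus ?thesis using u0 by simp
  qed
  \<comment> \<open>\<open>I + y S\<close> is strictly larger than \<open>I\<close>, so it meets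
    \<open>D - p\<close>; an equation \<open>r = i + y z\<close> makes \<open>y z = r - i\<close> a
    unit of \<open>S\<close> by \<open>unit1\<close>.\<close>
  have unit2: "inv y \<in> S" if y: "y \<in> S - I" for y
  proof -
    have yc: "y \<in> carrier K" using y SE(1) by blast
    let ?I = "{i \<oplus> y \<otimes> z | i z. i \<in> I \<and> z \<in> S}"
    have c: "i \<in> carrier K" "z \<in> carrier K" if "i \<in> I" "z \<in> S" for i z using that Ic SE(1) by auto
    have sub: "I \<subseteq> ?I"
    proof
      fix x assume "x \<in> I"
      moreover from this have "x = x \<oplus> y \<otimes> \<zero>" using Ic yc by auto
      ultimately show "x \<in> ?I" using SE(2) by blast
    qed
    have y1: "y \<in> ?I"
    proof -
      have "y = \<zero> \<oplus> y \<otimes> \<one>" using yc by simp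
      thus ?thesis using I0 SE(3) by blast
    qed
    have "\<exists>x\<in>?I. x \<in> D - p"
    proof (rule ccontr)
      assume "\<not> (\<exists>x\<in>?I. x \<in> D - p)"
      hence "?I \<inter> (D - p) = {}" by blast
      moreover have "?I \<subseteq> S" using I(2) y SE(6,7) by blast
      moreover have Iadd: "u \<oplus> v \<in> ?I" if uv: "u \<in> ?I" "v \<in> ?I" for u v
      proof -
        obtain i z i' z' where e: "i \<in> I" "z \<in> S" "u = i \<oplus> y \<otimes> z" "i' \<in> I" "z' \<in> S" "v = i' \<oplus> y \<otimes> z'" using uv by auto
        have "u \<oplus> v = (i \<oplus> i') \<oplus> y \<otimes> (z \<oplus> z')" using c[OF e(1,2)] c[OF e(4,5)] yc e(3,6) by (simp add: r_distr a_ac)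
        thus ?thesis using I(3)[OF e(1,4)] SE(7)[OF e(2,5)] by blast
      qed
      moreover have Imult: "u \<otimes> v \<in> ?I" if uv: "u \<in> S" "v \<in> ?I" for u v
      proof -
        obtain i z where e: "i \<in> I" "z \<in> S" "v = i \<oplus> y \<otimes> z" using uv by auto
        have "u \<otimes> v = (u \<otimes> i) \<oplus> y \<otimes> (u \<otimes> z)" using c[OF e(1,2)] c[OF e(1) uv(1)] yc e(3) by (simp add: r_distr m_ac)
        thus ?thesis using I(4)[OF uv(1) e(1)] SE(6)[OF uv(1) e(2)] by blast
      qed
      moreover have "p \<subseteq> ?I" using I(1) sub by (rule subset_trans)
      ultimately have "dominating S ?I" unfolding dominating_def by (intro conjI ballI Iadd Imult S)
      from max[OF this subset_refl sub] have "?I = I" by blast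
      thus False using y y1 by blast
    qed
    then obtain i z where iz: "i \<in> I" "z \<in> S" "i \<oplus> y \<otimes> z \<in> D - p" by blast
    note c' = c[OF iz(1,2)]
    have "y \<otimes> z = (i \<oplus> y \<otimes> z) \<oplus> \<ominus> i" using c' yc by (simp add: a_ac r_neg r_neg2)
    from unit1[OF iz(3) neg[OF iz(1)] this] have u: "inv (y \<otimes> z) \<in> S" "y \<otimes> z \<noteq> \<zero>" by auto
    have "y \<noteq> \<zero>" "z \<noteq> \<zero>" using u(2) c' yc by auto
    hence U: "y \<in> Units K" "z \<in> Units K" using c' yc by (simp_all add: field_Units)
    have yz: "y \<otimes> z \<in> Units K" using U by simp
    have "y \<otimes> (z \<otimes> inv (y \<otimes> z)) = \<one>" using yz c' yc by (simp add: m_assoc[symmetric])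
    hence "inv y = z \<otimes> inv (y \<otimes> z)" using yz c' yc by (intro comm_inv_char) auto
    thus ?thesis using SE(6)[OF iz(2) u(1)] by simp
  qed
  \<comment> \<open>The classical degree argument: given two relations expressing \<open>1\<close>
    with coefficients in \<open>I\<close>, one in powers of \<open>x\<close> and one in powers of
    its inverse \<open>y\<close>, the larger degree can be lowered with the help of the other
    relation.\<close>
  have nocase: "\<not> (\<one> \<in> horner K I x n \<and> \<one> \<in> horner K I y m)"
    if "x \<in> carrier K" "y \<in> carrier K" "x \<otimes> y = \<one>" for x y n m
    using that
  proof (induction "n + m" arbitrary: n m x y rule: less_induct)
    case less
    have main: False
      if mn: "m \<le> n" and IH: "\<And>n'. n' < n \<Longrightarrow> \<not> (\<one> \<in> horner K I x n' \<and> \<one> \<in> horner K I y m)"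
        and x: "x \<in> carrier K" and y: "y \<in> carrier K" and xy: "x \<otimes> y = \<one>"
        and 1: "\<one> \<in> horner K I x n" and 2: "\<one> \<in> horner K I y m" for x y n m
    proof (cases m)
      case 0
      hence "\<one> \<in> I" using 2 by simp
      thus False using I(5) one by blast
    next
      case (Suc m')
      then obtain n' where n: "n = Suc n'" "m' \<le> n'" using mn by (cases n) auto
      obtain i0 v where iv: "i0 \<in> I" "v \<in> horner K I y m'" "\<one> = i0 \<oplus> v \<otimes> y"
        using 2 unfolding Suc by (elim hornerE)
      have c: "i0 \<in> carrier K" "v \<in> carrier K" using iv Ic horner_closed[OF Ic y] by auto
      \<comment> \<open>The constant term \<open>i0\<close> lies in \<open>I\<close>, so
        \<open>1 - i0\<close> is a unit of \<open>S\<close>. Dividing by it expresses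
        \<open>x\<close> as a polynomial in \<open>y\<close> of degree at most \<open>m'\<close>
        with coefficients in \<open>I\<close>, and multiplying with \<open>x^m'\<close> turns this
        into a formula for \<open>x^(m'+1)\<close> of degree at most \<open>m'\<close> in
        \<open>x\<close>.\<close>
      have vy: "v \<otimes> y = \<one> \<oplus> \<ominus> i0" using iv(3) c y by (simp add: a_comm a_assoc r_neg r_neg1 r_neg2)
      from unit1[OF one neg[OF iv(1)] vy] have u: "inv (v \<otimes> y) \<in> S" "v \<otimes> y \<noteq> \<zero>" by auto
      hence U: "v \<otimes> y \<in> Units K" using c y field_Units by simp
      define w where "w = inv (v \<otimes> y) \<otimes> v"
      have w: "w \<in> horner K I y m'" unfolding w_def
        using horner_smult[OF Ic I(4)[OF u(1)] y _ iv(2)] U by simp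
      have wc: "w \<in> carrier K" using horner_closed[OF Ic y w] .
      have "w \<otimes> y = \<one>" unfolding w_def using U c y by (simp add: m_assoc)
      hence wx: "w = x" using xy wc x y
        by (metis m_assoc m_comm r_one)
      have Sx: "x [^] k \<in> horner K S x k" for k :: nat
      proof (induction k)
        case 0
        show ?case using SE(3) by simp
      next
        case (Suc k)
        show ?case using horner_shift[OF SE(2,1) x Suc] by simp
      qed
      have tx: "t \<otimes> x [^] k \<in> horner K I x (k + j)" if "t \<in> horner K I x j" for t k j
        using horner_mult[OF SE(1) I0 Ic I(3) I(4) x Sx that, of k] that horner_closed[OF Ic x that] x
        by (simp add: m_comm)
      \<comment> \<open>Reversal of polynomials: since \<open>x y = 1\<close>, multiplying by
        \<open>x^k\<close> turns a polynomial in \<open>y\<close> of degree at most \<open>k\<close>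
        into one in \<open>x\<close>.\<close>
      have rev: "u \<otimes> x [^] k \<in> horner K I x k" if "u \<in> horner K I y k" for u k
        using that
      proof (induction k arbitrary: u)
        case 0
        thus ?case using Ic by auto
      next
        case (Suc k)
        then obtain t u' where tu: "u = t \<oplus> u' \<otimes> y" "t \<in> I" "u' \<in> horner K I y k" by (elim hornerE)
        have cc: "t \<in> carrier K" "u' \<in> carrier K" using tu Ic horner_closed[OF Ic y] by auto
        have "u \<otimes> x [^] Suc k = t \<otimes> x [^] Suc k \<oplus> u' \<otimes> x [^] k \<otimes> (x \<otimes> y)"
          using cc x y tu(1) by (simp add: l_distr r_distr m_ac)
        also have "\<dots> = t \<otimes> x [^] Suc k \<oplus> u' \<otimes> x [^] k" using xy cc x by simp
        also have "\<dots> \<in> horner K I x (Suc k)"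
          using tx[of t 0 "Suc k"] tu(2) horner_Suc_mono[OF I0 Ic x Suc.IH[OF tu(3)]]
          by (intro horner_add[OF Ic I(3) x]) auto
        finally show ?case .
      qed
      have xm: "x [^] Suc m' \<in> horner K I x m'" using rev[OF w] wx x nat_pow_mult[OF x, of 1 m'] by (simp add: m_comm)
      \<comment> \<open>The top power \<open>x^(n'+1)\<close> in the relation for \<open>x\<close>
        is going to be replaced by lower ones.\<close>
      obtain v' t where vt: "v' \<in> horner K I x n'" "t \<in> I" "\<one> = v' \<oplus> t \<otimes> x [^] Suc n'"
        using horner_top[OF Ic x, of \<one> n'] 1 n by auto
      have "x [^] Suc n' = x [^] Suc m' \<otimes> x [^] (n' - m')" using n(2) x nat_pow_mult[OF x, of "Suc m'" "n' - m'"] by simp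
      also have "\<dots> \<in> horner K I x ((n' - m') + m')" by (rule tx[OF xm])
      finally have xn: "x [^] Suc n' \<in> horner K I x n'" using n(2) by simp
      have "t \<otimes> x [^] Suc n' \<in> horner K I x n'"
        using horner_smult[OF Ic I(4) x _ xn] vt(2) I(2) Ic by blast
      with vt have "\<one> \<in> horner K I x n'" using horner_add[OF Ic I(3) x vt(1)] by metis
      thus False using IH[of n'] n 2 by simp
    qed
    show ?case
    proof
      assume a: "\<one> \<in> horner K I x n \<and> \<one> \<in> horner K I y m"
      show False
      proof (cases "m \<le> n")
        case True
        show False by (rule main[OF True _ less.prems(1,2,3)]) (use a less in auto)
      next
        case False
        have "\<not> (\<one> \<in> horner K I y n' \<and> \<one> \<in> horner K I x n)" if "n' < m" for n'
          using less.hyps[of n n' x y] that less.prems by auto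
        thus False using main[of n m y x] False a less.prems by (auto simp: m_comm)
      qed
    qed
  qed
  \<comment> \<open>If neither \<open>x\<close> nor its inverse were in \<open>S\<close>, then by
    \<open>adj\<close> both extended ideals would meet \<open>D - p\<close>; the elements of
    \<open>D - p\<close> are units of \<open>S\<close>, so both would contain \<open>1\<close>,
    against \<open>nocase\<close>.\<close>
  have val: "x \<in> S \<or> inv x \<in> S" if x: "x \<in> carrier K" "x \<noteq> \<zero>" for x
  proof (rule ccontr)
    assume n: "\<not> ?thesis"
    have U: "x \<in> Units K" using x field_Units by simp
    have one_in: "\<exists>n. \<one> \<in> horner K I z n" if z: "z \<in> carrier K" "z \<notin> S" for z
    proof -
      obtain n r where r: "r \<in> horner K I z n" "r \<in> D - p" using adj[OF z(1)] z(2) by blast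
      have rr: "r = r \<oplus> \<zero>" using DmS r by auto
      have u: "inv r \<in> S" "r \<noteq> \<zero>" using unit1[OF r(2) I0 rr] by auto
      hence "inv r \<otimes> r = \<one>" using DmS r field_Units by auto
      moreover have "inv r \<otimes> r \<in> horner K I z n" using horner_smult[OF Ic I(4)[OF u(1)] z(1) _ r(1)] u SE(1) by auto
      ultimately show ?thesis by auto
    qed
    obtain a b where "\<one> \<in> horner K I x a" "\<one> \<in> horner K I (inv x) b" using one_in[of x] one_in[of "inv x"] x n U by auto
    thus False using nocase[of x "inv x" a b] U x by simp
  qed
  have "inv x \<in> I" if x: "x \<in> carrier K - S" for x
  proof (rule ccontr)
    assume n: "inv x \<notin> I"
    have x0: "x \<noteq> \<zero>" using x SE(2) by auto
    hence U: "x \<in> Units K" using x field_Units by simp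
    have "inv x \<in> S" using val[of x] x x0 by auto
    hence "inv (inv x) \<in> S" using unit2 n by blast
    thus False using x U by simp
  qed
  note inv_in = this
  show ?thesis
  proof (rule exI[of _ S], rule exI[of _ I], intro conjI ballI)
    show "I \<inter> (D - p) = {}" using I(5) by blast
  qed (use S I unit2 inv_in in \<open>simp_all add: DiffI\<close>)
qed

end

declare One_nat_def [simp del]

section \<open>Linear retractions onto a subfield\<close>

text \<open>No embedding of \<open>k\<close> into \<open>K\<close> is given, so linearity is phrased
  over \<open>R\<close>. Instead of choosing a basis, the kernel of the retraction is constructed: a
  submodule \<open>H\<close> of \<open>K\<close>, maximal among those that contain no
  \<open>e u\<close> with \<rho> \<open>u\<close> nonzero. Maximality makes every \<open>x\<close>
  congruent modulo \<open>H\<close> to a fraction \<open>a / b\<close> from \<open>R\<close>, and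
  \<open>l x\<close> is that fraction read in \<open>k\<close>.\<close>

lemma linear_retraction_exists:
  assumes "cring R" "cring K" "field k" and e: "e \<in> ring_hom R K" and \<rho>: "\<rho> \<in> ring_hom R k"
    and ker: "\<And>r. r \<in> carrier R \<Longrightarrow> e r = \<zero>\<^bsub>K\<^esub> \<longleftrightarrow> \<rho> r = \<zero>\<^bsub>k\<^esub>"
  shows "\<exists>l. l \<in> carrier K \<rightarrow> carrier k \<and> l \<one>\<^bsub>K\<^esub> = \<one>\<^bsub>k\<^esub> \<and>
     (\<forall>x\<in>carrier K. \<forall>y\<in>carrier K. l (x \<oplus>\<^bsub>K\<^esub> y) = l x \<oplus>\<^bsub>k\<^esub> l y) \<and>
     (\<forall>r\<in>carrier R. \<forall>x\<in>carrier K. l (e r \<otimes>\<^bsub>K\<^esub> x) = \<rho> r \<otimes>\<^bsub>k\<^esub> l x)"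
proof -
  interpret R: cring R by fact
  interpret K: cring K by fact
  interpret k: field k by fact
  interpret e: ring_hom_cring R K e by (rule ring_hom_cringI[OF assms(1,2) e])
  interpret r: ring_hom_cring R k \<rho> by (rule ring_hom_cringI[OF assms(1) k.is_cring \<rho>])
  define U where "U = {r \<in> carrier R. \<rho> r \<noteq> \<zero>\<^bsub>k\<^esub>}"
  have U1: "\<one>\<^bsub>R\<^esub> \<in> U" by (simp add: U_def)
  have Um: "a \<otimes>\<^bsub>R\<^esub> b \<in> U" if "a \<in> U" "b \<in> U" for a b using that by (auto simp: U_def k.integral_iff)
  have Uc: "a \<in> carrier R" if "a \<in> U" for a using that by (simp add: U_def)
  define sub where "sub H \<longleftrightarrow> H \<subseteq> carrier K \<and> \<zero>\<^bsub>K\<^esub> \<in> H \<and> (\<forall>x\<in>H. \<forall>y\<in>H. x \<oplus>\<^bsub>K\<^esub> y \<in> H) \<and>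
     (\<forall>r\<in>carrier R. \<forall>x\<in>H. e r \<otimes>\<^bsub>K\<^esub> x \<in> H) \<and> H \<inter> e ` U = {}" for H
  have "\<exists>M\<in>{H. sub H}. \<forall>Y\<in>{H. sub H}. M \<subseteq> Y \<longrightarrow> Y = M"
  proof (rule subset_Zorn_nonempty)
    have "e u \<noteq> \<zero>\<^bsub>K\<^esub>" if "u \<in> U" for u using ker that by (simp add: U_def)
    hence "sub {\<zero>\<^bsub>K\<^esub>}" by (fastforce simp: sub_def)
    thus "{H. sub H} \<noteq> {}" by blast
    fix C assume C: "C \<noteq> {}" "subset.chain {H. sub H} C"
    have s: "sub H" if "H \<in> C" for H using C(2) that by (auto simp: subset_chain_def)
    have add: "x \<oplus>\<^bsub>K\<^esub> y \<in> \<Union>C" if xy: "x \<in> \<Union>C" "y \<in> \<Union>C" for x y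
    proof -
      obtain H1 H2 where H: "H1 \<in> C" "x \<in> H1" "H2 \<in> C" "y \<in> H2" using xy by blast
      have "H1 \<subseteq> H2 \<or> H2 \<subseteq> H1" using C(2) H(1,3) by (simp add: subset_chain_def)
      then obtain H where "H \<in> C" "x \<in> H" "y \<in> H" using H by blast
      thus ?thesis using s[of H] by (auto simp: sub_def)
    qed
    have mult: "e r \<otimes>\<^bsub>K\<^esub> x \<in> \<Union>C" if rx: "r \<in> carrier R" "x \<in> \<Union>C" for r x
    proof -
      obtain H where "H \<in> C" "x \<in> H" using rx(2) by blast
      thus ?thesis using s[of H] rx(1) unfolding sub_def by blast
    qed
    obtain H0 where H0: "H0 \<in> C" using C(1) by blast
    have "\<zero>\<^bsub>K\<^esub> \<in> \<Union>C" using s[OF H0] H0 by (auto simp: sub_def)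
    moreover have "H \<subseteq> carrier K" "H \<inter> e ` U = {}" if "H \<in> C" for H using s[OF that] by (simp_all add: sub_def)
    hence "\<Union>C \<subseteq> carrier K" "\<Union>C \<inter> e ` U = {}" by blast+
    ultimately show "\<Union>C \<in> {H. sub H}" using add mult by (simp add: sub_def)
  qed
  then obtain H where H: "sub H" and max: "\<And>Y. sub Y \<Longrightarrow> H \<subseteq> Y \<Longrightarrow> Y = H" by blast
  have Hc: "\<And>x. x \<in> H \<Longrightarrow> x \<in> carrier K" and H0: "\<zero>\<^bsub>K\<^esub> \<in> H"
    and Ha: "\<And>x y. x \<in> H \<Longrightarrow> y \<in> H \<Longrightarrow> x \<oplus>\<^bsub>K\<^esub> y \<in> H"
    and Hm: "\<And>r x. r \<in> carrier R \<Longrightarrow> x \<in> H \<Longrightarrow> e r \<otimes>\<^bsub>K\<^esub> x \<in> H"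
    and Hd: "\<And>u. u \<in> U \<Longrightarrow> e u \<notin> H"
    using H by (auto simp: sub_def)
  have Hn: "\<ominus>\<^bsub>K\<^esub> x \<in> H" if "x \<in> H" for x
    using Hm[of "\<ominus>\<^bsub>R\<^esub> \<one>\<^bsub>R\<^esub>" x] that Hc[OF that] by (simp add: K.l_minus)
  \<comment> \<open>This expresses \<open>x \<equiv> a / b\<close> modulo \<open>H\<close> and
    \<open>c = a / b\<close> in \<open>k\<close>, without dividing in \<open>K\<close>, which is
    only a ring here.\<close>
  define good where "good x c \<longleftrightarrow> (\<exists>a\<in>carrier R. \<exists>b\<in>U. e b \<otimes>\<^bsub>K\<^esub> x \<ominus>\<^bsub>K\<^esub> e a \<in> H \<and> \<rho> b \<otimes>\<^bsub>k\<^esub> c = \<rho> a)" for x c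
  have ex: "\<exists>c\<in>carrier k. good x c" if x: "x \<in> carrier K" for x
  proof -
    have "\<exists>a\<in>carrier R. \<exists>b\<in>U. e b \<otimes>\<^bsub>K\<^esub> x \<ominus>\<^bsub>K\<^esub> e a \<in> H"
    proof (cases "x \<in> H")
      case True
      thus ?thesis using U1 x
        by - (rule bexI[of _ "\<zero>\<^bsub>R\<^esub>"], rule bexI[of _ "\<one>\<^bsub>R\<^esub>"], auto simp: K.minus_eq)
    next
      case False
      let ?H = "{h \<oplus>\<^bsub>K\<^esub> e r \<otimes>\<^bsub>K\<^esub> x | h r. h \<in> H \<and> r \<in> carrier R}"
      have HH: "H \<subseteq> ?H"
      proof
        fix h assume h: "h \<in> H"
        hence "h = h \<oplus>\<^bsub>K\<^esub> e \<zero>\<^bsub>R\<^esub> \<otimes>\<^bsub>K\<^esub> x" using Hc x by simp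
        thus "h \<in> ?H" using h by blast
      qed
      have xH: "x \<in> ?H"
      proof -
        have "x = \<zero>\<^bsub>K\<^esub> \<oplus>\<^bsub>K\<^esub> e \<one>\<^bsub>R\<^esub> \<otimes>\<^bsub>K\<^esub> x" using x by simp
        thus ?thesis using H0 by blast
      qed
      \<comment> \<open>Adjoining \<open>x\<close> to \<open>H\<close> must hit some
        \<open>e u\<close>; the coefficient \<open>r\<close> of \<open>x\<close> in it is nonzero in
        \<open>k\<close>, since otherwise \<open>e u\<close> would already lie in
        \<open>H\<close>.\<close>
      have "\<not> sub ?H" using max[OF _ HH] xH False by blast
      moreover have "?H \<subseteq> carrier K" using Hc x by auto
      moreover have "\<zero>\<^bsub>K\<^esub> \<in> ?H" using HH H0 by blast
      moreover have "u \<oplus>\<^bsub>K\<^esub> v \<in> ?H" if uv: "u \<in> ?H" "v \<in> ?H" for u v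
      proof -
        obtain h r h' r' where g: "h \<in> H" "r \<in> carrier R" "u = h \<oplus>\<^bsub>K\<^esub> e r \<otimes>\<^bsub>K\<^esub> x"
          "h' \<in> H" "r' \<in> carrier R" "v = h' \<oplus>\<^bsub>K\<^esub> e r' \<otimes>\<^bsub>K\<^esub> x" using uv by blast
        have "u \<oplus>\<^bsub>K\<^esub> v = (h \<oplus>\<^bsub>K\<^esub> h') \<oplus>\<^bsub>K\<^esub> e (r \<oplus>\<^bsub>R\<^esub> r') \<otimes>\<^bsub>K\<^esub> x"
          using g x Hc[OF g(1)] Hc[OF g(4)] by (simp add: K.l_distr K.a_ac)
        thus ?thesis using Ha[OF g(1,4)] g(2,5) by blast
      qed
      moreover have "e r' \<otimes>\<^bsub>K\<^esub> u \<in> ?H" if uv: "r' \<in> carrier R" "u \<in> ?H" for u r'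
      proof -
        obtain h r where g: "h \<in> H" "r \<in> carrier R" "u = h \<oplus>\<^bsub>K\<^esub> e r \<otimes>\<^bsub>K\<^esub> x" using uv by blast
        have "e r' \<otimes>\<^bsub>K\<^esub> u = (e r' \<otimes>\<^bsub>K\<^esub> h) \<oplus>\<^bsub>K\<^esub> e (r' \<otimes>\<^bsub>R\<^esub> r) \<otimes>\<^bsub>K\<^esub> x"
          using g x Hc[OF g(1)] uv(1) by (simp add: K.r_distr K.m_assoc)
        thus ?thesis using Hm[OF uv(1) g(1)] g(2) uv(1) by blast
      qed
      ultimately have "?H \<inter> e ` U \<noteq> {}" unfolding sub_def by meson
      then obtain h r u where g: "h \<in> H" "r \<in> carrier R" "u \<in> U" "e u = h \<oplus>\<^bsub>K\<^esub> e r \<otimes>\<^bsub>K\<^esub> x" by fastforce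
      have "r \<in> U"
      proof (rule ccontr)
        assume "r \<notin> U"
        hence "e r = \<zero>\<^bsub>K\<^esub>" using ker g(2) by (simp add: U_def)
        hence "e u = h" using g x Hc by simp
        thus False using Hd g by auto
      qed
      moreover have "e r \<otimes>\<^bsub>K\<^esub> x \<ominus>\<^bsub>K\<^esub> e u = \<ominus>\<^bsub>K\<^esub> h"
        unfolding g(4) using g(2) x Hc[OF g(1)]
        by (simp add: K.minus_eq K.minus_add K.a_ac K.r_neg K.r_neg1 K.r_neg2)
      ultimately show ?thesis using Hn[OF g(1)] Uc[OF g(3)] by metis
    qed
    then obtain a b where ab: "a \<in> carrier R" "b \<in> U" "e b \<otimes>\<^bsub>K\<^esub> x \<ominus>\<^bsub>K\<^esub> e a \<in> H" by blast
    have bU: "\<rho> b \<in> Units k" using ab(2) by (simp add: U_def k.field_Units)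
    have "\<rho> b \<otimes>\<^bsub>k\<^esub> (inv\<^bsub>k\<^esub> \<rho> b \<otimes>\<^bsub>k\<^esub> \<rho> a) = \<rho> a" using bU ab Uc by (simp add: k.m_assoc[symmetric])
    thus ?thesis using ab bU unfolding good_def by (intro bexI[of _ "inv\<^bsub>k\<^esub> \<rho> b \<otimes>\<^bsub>k\<^esub> \<rho> a"]) auto
  qed
  have uniq: "c = c'" if g: "good x c" "good x c'" and x: "x \<in> carrier K" and c: "c \<in> carrier k" "c' \<in> carrier k" for x c c'
  proof -
    obtain a b a' b' where ab: "a \<in> carrier R" "b \<in> U" "e b \<otimes>\<^bsub>K\<^esub> x \<ominus>\<^bsub>K\<^esub> e a \<in> H" "\<rho> b \<otimes>\<^bsub>k\<^esub> c = \<rho> a"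
      "a' \<in> carrier R" "b' \<in> U" "e b' \<otimes>\<^bsub>K\<^esub> x \<ominus>\<^bsub>K\<^esub> e a' \<in> H" "\<rho> b' \<otimes>\<^bsub>k\<^esub> c' = \<rho> a'"
      using g unfolding good_def by blast
    note bc = Uc[OF ab(2)] Uc[OF ab(6)]
    \<comment> \<open>Cross multiplication eliminates \<open>x\<close>; what remains is some
      \<open>e r\<close> in \<open>H\<close>, and \<open>H\<close> contains \<open>e r\<close> only
      when \<rho> \<open>r\<close> vanishes.\<close>
    have "e b \<otimes>\<^bsub>K\<^esub> (e b' \<otimes>\<^bsub>K\<^esub> x \<ominus>\<^bsub>K\<^esub> e a') \<oplus>\<^bsub>K\<^esub> \<ominus>\<^bsub>K\<^esub> (e b' \<otimes>\<^bsub>K\<^esub> (e b \<otimes>\<^bsub>K\<^esub> x \<ominus>\<^bsub>K\<^esub> e a)) =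
       e (b' \<otimes>\<^bsub>R\<^esub> a \<ominus>\<^bsub>R\<^esub> b \<otimes>\<^bsub>R\<^esub> a')"
      using bc ab(1,5) x
      by (simp add: R.minus_eq K.minus_eq K.r_distr K.minus_add K.r_minus K.m_ac K.a_ac K.r_neg K.r_neg1 K.r_neg2)
    moreover have "e b \<otimes>\<^bsub>K\<^esub> (e b' \<otimes>\<^bsub>K\<^esub> x \<ominus>\<^bsub>K\<^esub> e a') \<oplus>\<^bsub>K\<^esub> \<ominus>\<^bsub>K\<^esub> (e b' \<otimes>\<^bsub>K\<^esub> (e b \<otimes>\<^bsub>K\<^esub> x \<ominus>\<^bsub>K\<^esub> e a)) \<in> H"
      by (intro Ha Hm Hn ab bc)
    ultimately have "e (b' \<otimes>\<^bsub>R\<^esub> a \<ominus>\<^bsub>R\<^esub> b \<otimes>\<^bsub>R\<^esub> a') \<in> H" by simp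
    hence "b' \<otimes>\<^bsub>R\<^esub> a \<ominus>\<^bsub>R\<^esub> b \<otimes>\<^bsub>R\<^esub> a' \<notin> U" using Hd by blast
    hence "\<rho> (b' \<otimes>\<^bsub>R\<^esub> a \<ominus>\<^bsub>R\<^esub> b \<otimes>\<^bsub>R\<^esub> a') = \<zero>\<^bsub>k\<^esub>" using bc ab by (simp add: U_def)
    hence "\<rho> b' \<otimes>\<^bsub>k\<^esub> \<rho> a = \<rho> b \<otimes>\<^bsub>k\<^esub> \<rho> a'" using bc ab by (simp add: R.minus_eq k.minus_eq[symmetric])
    hence "(\<rho> b' \<otimes>\<^bsub>k\<^esub> \<rho> b) \<otimes>\<^bsub>k\<^esub> c = (\<rho> b' \<otimes>\<^bsub>k\<^esub> \<rho> b) \<otimes>\<^bsub>k\<^esub> c'"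
    proof -
      have "(\<rho> b' \<otimes>\<^bsub>k\<^esub> \<rho> b) \<otimes>\<^bsub>k\<^esub> c = \<rho> b' \<otimes>\<^bsub>k\<^esub> (\<rho> b \<otimes>\<^bsub>k\<^esub> c)" using bc c by (simp add: k.m_assoc)
      also have "\<dots> = \<rho> b \<otimes>\<^bsub>k\<^esub> (\<rho> b' \<otimes>\<^bsub>k\<^esub> c')" unfolding ab(4,8) by fact
      also have "\<dots> = (\<rho> b' \<otimes>\<^bsub>k\<^esub> \<rho> b) \<otimes>\<^bsub>k\<^esub> c'" using bc c by (simp add: k.m_ac)
      finally show ?thesis .
    qed
    moreover have "\<rho> b' \<otimes>\<^bsub>k\<^esub> \<rho> b \<noteq> \<zero>\<^bsub>k\<^esub>" using ab(2,6) by (simp add: U_def k.integral_iff)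
    ultimately show ?thesis using bc c k.m_lcancel[of "\<rho> b' \<otimes>\<^bsub>k\<^esub> \<rho> b" c c'] by simp
  qed
  define l where "l x = (SOME c. c \<in> carrier k \<and> good x c)" for x
  have l: "l x \<in> carrier k" "good x (l x)" if "x \<in> carrier K" for x
    using someI_ex[of "\<lambda>c. c \<in> carrier k \<and> good x c"] ex[OF that] unfolding l_def by blast+
  have lI: "l x = c" if "good x c" "x \<in> carrier K" "c \<in> carrier k" for x c
    using uniq[OF l(2)[OF that(2)] that(1,2) l(1)[OF that(2)] that(3)] .
  have one: "l \<one>\<^bsub>K\<^esub> = \<one>\<^bsub>k\<^esub>"
  proof (rule lI)
    show "good \<one>\<^bsub>K\<^esub> \<one>\<^bsub>k\<^esub>" unfolding good_def
      by (rule bexI[of _ "\<one>\<^bsub>R\<^esub>"], rule bexI[of _ "\<one>\<^bsub>R\<^esub>"]) (use H0 U1 in \<open>auto simp: K.minus_eq K.r_neg\<close>)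
  qed auto
  have add: "l (x \<oplus>\<^bsub>K\<^esub> y) = l x \<oplus>\<^bsub>k\<^esub> l y" if xy: "x \<in> carrier K" "y \<in> carrier K" for x y
  proof (rule lI)
    obtain a b a' b' where ab: "a \<in> carrier R" "b \<in> U" "e b \<otimes>\<^bsub>K\<^esub> x \<ominus>\<^bsub>K\<^esub> e a \<in> H" "\<rho> b \<otimes>\<^bsub>k\<^esub> l x = \<rho> a"
      "a' \<in> carrier R" "b' \<in> U" "e b' \<otimes>\<^bsub>K\<^esub> y \<ominus>\<^bsub>K\<^esub> e a' \<in> H" "\<rho> b' \<otimes>\<^bsub>k\<^esub> l y = \<rho> a'"
      using l(2)[OF xy(1)] l(2)[OF xy(2)] unfolding good_def by blast
    note bc = Uc[OF ab(2)] Uc[OF ab(6)]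
    show "good (x \<oplus>\<^bsub>K\<^esub> y) (l x \<oplus>\<^bsub>k\<^esub> l y)" unfolding good_def
    proof (rule bexI[of _ "b' \<otimes>\<^bsub>R\<^esub> a \<oplus>\<^bsub>R\<^esub> b \<otimes>\<^bsub>R\<^esub> a'"], rule bexI[of _ "b \<otimes>\<^bsub>R\<^esub> b'"], rule conjI)
      have "e (b \<otimes>\<^bsub>R\<^esub> b') \<otimes>\<^bsub>K\<^esub> (x \<oplus>\<^bsub>K\<^esub> y) \<ominus>\<^bsub>K\<^esub> e (b' \<otimes>\<^bsub>R\<^esub> a \<oplus>\<^bsub>R\<^esub> b \<otimes>\<^bsub>R\<^esub> a') =
         e b' \<otimes>\<^bsub>K\<^esub> (e b \<otimes>\<^bsub>K\<^esub> x \<ominus>\<^bsub>K\<^esub> e a) \<oplus>\<^bsub>K\<^esub> e b \<otimes>\<^bsub>K\<^esub> (e b' \<otimes>\<^bsub>K\<^esub> y \<ominus>\<^bsub>K\<^esub> e a')"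
        using bc ab(1,5) xy by (simp add: K.minus_eq K.r_distr K.minus_add K.r_minus K.m_ac K.a_ac)
      also have "\<dots> \<in> H" by (intro Ha Hm ab bc)
      finally show "e (b \<otimes>\<^bsub>R\<^esub> b') \<otimes>\<^bsub>K\<^esub> (x \<oplus>\<^bsub>K\<^esub> y) \<ominus>\<^bsub>K\<^esub> e (b' \<otimes>\<^bsub>R\<^esub> a \<oplus>\<^bsub>R\<^esub> b \<otimes>\<^bsub>R\<^esub> a') \<in> H" .
      show "\<rho> (b \<otimes>\<^bsub>R\<^esub> b') \<otimes>\<^bsub>k\<^esub> (l x \<oplus>\<^bsub>k\<^esub> l y) = \<rho> (b' \<otimes>\<^bsub>R\<^esub> a \<oplus>\<^bsub>R\<^esub> b \<otimes>\<^bsub>R\<^esub> a')"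
        using bc ab(1,5) l(1)[OF xy(1)] l(1)[OF xy(2)] by (simp add: ab(4,8)[symmetric] k.r_distr k.m_ac)
    qed (use bc ab Um in auto)
  qed (use xy l in auto)
  have mult: "l (e r \<otimes>\<^bsub>K\<^esub> x) = \<rho> r \<otimes>\<^bsub>k\<^esub> l x" if r: "r \<in> carrier R" and x: "x \<in> carrier K" for r x
  proof (rule lI)
    obtain a b where ab: "a \<in> carrier R" "b \<in> U" "e b \<otimes>\<^bsub>K\<^esub> x \<ominus>\<^bsub>K\<^esub> e a \<in> H" "\<rho> b \<otimes>\<^bsub>k\<^esub> l x = \<rho> a"
      using l(2)[OF x] unfolding good_def by blast
    note bc = Uc[OF ab(2)]
    show "good (e r \<otimes>\<^bsub>K\<^esub> x) (\<rho> r \<otimes>\<^bsub>k\<^esub> l x)" unfolding good_def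
    proof (rule bexI[of _ "r \<otimes>\<^bsub>R\<^esub> a"], rule bexI[of _ b], rule conjI)
      have "e b \<otimes>\<^bsub>K\<^esub> (e r \<otimes>\<^bsub>K\<^esub> x) \<ominus>\<^bsub>K\<^esub> e (r \<otimes>\<^bsub>R\<^esub> a) = e r \<otimes>\<^bsub>K\<^esub> (e b \<otimes>\<^bsub>K\<^esub> x \<ominus>\<^bsub>K\<^esub> e a)"
        using bc ab(1) r x by (simp add: K.minus_eq K.r_distr K.r_minus K.m_ac)
      also have "\<dots> \<in> H" by (intro Hm ab r)
      finally show "e b \<otimes>\<^bsub>K\<^esub> (e r \<otimes>\<^bsub>K\<^esub> x) \<ominus>\<^bsub>K\<^esub> e (r \<otimes>\<^bsub>R\<^esub> a) \<in> H" .
      show "\<rho> b \<otimes>\<^bsub>k\<^esub> (\<rho> r \<otimes>\<^bsub>k\<^esub> l x) = \<rho> (r \<otimes>\<^bsub>R\<^esub> a)"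
        using bc ab(1) r l(1)[OF x] by (simp add: ab(4)[symmetric] k.m_ac)
    qed (use bc ab r in auto)
  qed (use r x l in auto)
  show ?thesis using l(1) one add mult by (intro exI[of _ l]) auto
qed

section \<open>Subalgebras generated by two polynomials\<close>

text \<open>\<open>L[F, s]\<close>, as the image of a polynomial ring in two variables\<close>

definition gen2 :: "('a, 'm) ring_scheme \<Rightarrow> 'i set \<Rightarrow> ('i multiset \<Rightarrow> 'a) \<Rightarrow> ('i multiset \<Rightarrow> 'a) \<Rightarrow> ('i multiset \<Rightarrow> 'a) set" where
  "gen2 L I F s = mev L (mpoly L I) (mconst L) (\<lambda>j::nat. if j = 1 then F else s) ` carrier (mpoly L {1..2})"

lemma (in cring) poly_eval_mconst:
  "f \<in> J \<rightarrow> carrier (mpoly R I) \<Longrightarrow> poly_eval R (mpoly R I) (mconst R) J f"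
  by (intro poly_eval.intro poly_eval_axioms.intro is_cring mpoly_cring mconst_hom)

lemma (in poly_eval) ev_mem:
  assumes p: "p \<in> carrier (mpoly S I)" and T: "\<And>a. a \<in> carrier S \<Longrightarrow> \<theta> a \<in> T" "\<And>i. i \<in> I \<Longrightarrow> f i \<in> T"
    "\<And>x y. x \<in> T \<Longrightarrow> y \<in> T \<Longrightarrow> x \<oplus>\<^bsub>C\<^esub> y \<in> T" "\<And>x y. x \<in> T \<Longrightarrow> y \<in> T \<Longrightarrow> x \<otimes>\<^bsub>C\<^esub> y \<in> T"
  shows "ev p \<in> T"
  using p
proof (induction p rule: S.mpoly_induct)
  case (const a)
  thus ?case by (simp add: T)
next
  case (add p q)
  thus ?case by (simp add: ev_add T)
next
  case (var p i)
  thus ?case by (simp add: ring_hom_mult[OF ev_hom] T S.mvar_closed)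
qed

text \<open>Naturality in the coefficient ring and in the target at once; the compatibility of
  retractions and of two-generator subalgebras with base change are instances.\<close>

lemma ev_natural:
  assumes "poly_eval S C \<theta> J f" "poly_eval S' C' \<theta>' J f'" and h: "h \<in> ring_hom S S'" and g: "g \<in> ring_hom C C'"
    and c: "\<And>a. a \<in> carrier S \<Longrightarrow> g (\<theta> a) = \<theta>' (h a)" and v: "\<And>j. j \<in> J \<Longrightarrow> g (f j) = f' j"
    and p: "p \<in> carrier (mpoly S J)"
  shows "g (mev S C \<theta> f p) = mev S' C' \<theta>' f' (h \<circ> p)"
proof -
  interpret A1: poly_eval S C \<theta> J f by fact
  interpret A2: poly_eval S' C' \<theta>' J f' by fact
  interpret h: ring_hom_cring S S' h by (rule ring_hom_cringI[OF A1.S.is_cring A2.S.is_cring h])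
  have "(g \<circ> mev S C \<theta> f) p = (mev S' C' \<theta>' f' \<circ> (\<circ>) h) p"
  proof (rule mpoly_hom_eqI[OF A1.S.is_cring A2.C.is_cring _ _ _ _ p])
    show "g \<circ> mev S C \<theta> f \<in> ring_hom (mpoly S J) C'" by (rule ring_hom_trans[OF A1.ev_hom g])
    show "mev S' C' \<theta>' f' \<circ> (\<circ>) h \<in> ring_hom (mpoly S J) C'" by (rule ring_hom_trans[OF h.comp_hom A2.ev_hom])
    show "(g \<circ> mev S C \<theta> f) (mconst S a) = (mev S' C' \<theta>' f' \<circ> (\<circ>) h) (mconst S a)" if "a \<in> carrier S" for a
      using that by (simp only: comp_apply A1.ev_const h.comp_mconst A2.ev_const c h.hom_closed)
    show "(g \<circ> mev S C \<theta> f) (mvar S j) = (mev S' C' \<theta>' f' \<circ> (\<circ>) h) (mvar S j)" if "j \<in> J" for j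
      using that by (simp only: comp_apply A1.ev_var h.comp_mvar A2.ev_var v)
  qed
  thus ?thesis by simp
qed

context cring
begin

lemma poly_eval_gen2:
  "F \<in> carrier (mpoly R I) \<Longrightarrow> s \<in> carrier (mpoly R I) \<Longrightarrow>
    poly_eval R (mpoly R I) (mconst R) {1..2} (\<lambda>j::nat. if j = 1 then F else s)"
  by (intro poly_eval_mconst) auto

context
  fixes I :: "'i set" and F s
  assumes Fs: "F \<in> carrier (mpoly R I)" "s \<in> carrier (mpoly R I)"
begin

interpretation B: cring "mpoly R I" by (rule mpoly_cring)
interpretation E: poly_eval R "mpoly R I" "mconst R" "{1..2}" "\<lambda>j::nat. if j = 1 then F else s"
  by (rule poly_eval_gen2[OF Fs])
interpretation EE: ring_hom_cring "mpoly R {1..2::nat}" "mpoly R I" E.ev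
  by (rule ring_hom_cringI[OF mpoly_cring mpoly_cring E.ev_hom])

lemma gen2_closed: "u \<in> gen2 R I F s \<Longrightarrow> u \<in> carrier (mpoly R I)"
  unfolding gen2_def by auto

lemma gen2_const: "a \<in> carrier R \<Longrightarrow> mconst R a \<in> gen2 R I F s"
  unfolding gen2_def by (rule image_eqI[of _ _ "mconst R a"]) auto

lemma gen2_F: "F \<in> gen2 R I F s"
  unfolding gen2_def by (rule image_eqI[of _ _ "mvar R 1"]) auto

lemma gen2_s: "s \<in> gen2 R I F s"
  unfolding gen2_def by (rule image_eqI[of _ _ "mvar R 2"]) auto

lemma gen2_add:
  assumes "u \<in> gen2 R I F s" "v \<in> gen2 R I F s" shows "u \<oplus>\<^bsub>mpoly R I\<^esub> v \<in> gen2 R I F s"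
proof -
  obtain p q where pq: "p \<in> carrier (mpoly R {1..2::nat})" "q \<in> carrier (mpoly R {1..2::nat})" "u = E.ev p" "v = E.ev q"
    using assms unfolding gen2_def by blast
  thus ?thesis unfolding gen2_def by (intro image_eqI[of _ _ "p \<oplus>\<^bsub>mpoly R {1..2::nat}\<^esub> q"]) auto
qed

lemma gen2_mult:
  assumes "u \<in> gen2 R I F s" "v \<in> gen2 R I F s" shows "u \<otimes>\<^bsub>mpoly R I\<^esub> v \<in> gen2 R I F s"
proof -
  obtain p q where pq: "p \<in> carrier (mpoly R {1..2::nat})" "q \<in> carrier (mpoly R {1..2::nat})" "u = E.ev p" "v = E.ev q"
    using assms unfolding gen2_def by blast
  thus ?thesis unfolding gen2_def by (intro image_eqI[of _ _ "p \<otimes>\<^bsub>mpoly R {1..2::nat}\<^esub> q"]) auto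
qed

lemma gen2_pow: "u \<in> gen2 R I F s \<Longrightarrow> u [^]\<^bsub>mpoly R I\<^esub> (n::nat) \<in> gen2 R I F s"
proof (induction n)
  case 0
  show ?case unfolding B.nat_pow_0 mpoly_one by (rule gen2_const[OF one_closed])
next
  case (Suc n)
  thus ?case using gen2_mult[of "u [^]\<^bsub>mpoly R I\<^esub> n" u] by simp
qed

lemma fspan_subset_gen2: "u \<in> fspan R I F \<Longrightarrow> u \<in> gen2 R I F s"
proof (induction rule: fspan.induct)
  case zero
  show ?case using gen2_const[of \<zero>] by (simp add: mpoly_zero indexed_zero_def)
next
  case (add u r k)
  thus ?case by (intro gen2_add gen2_mult gen2_const gen2_pow gen2_F)
qed

lemma gen2_ev:
  assumes p: "p \<in> carrier (mpoly R J)" and f: "\<And>j. j \<in> J \<Longrightarrow> f j \<in> gen2 R I F s"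
  shows "mev R (mpoly R I) (mconst R) f p \<in> gen2 R I F s"
proof -
  interpret f: poly_eval R "mpoly R I" "mconst R" J f
    by (rule poly_eval_mconst) (use f gen2_closed in auto)
  show ?thesis by (rule f.ev_mem[OF p]) (auto intro: gen2_const f gen2_add gen2_mult)
qed

lemma gen2_subset:
  assumes "F' \<in> gen2 R I F s" "s' \<in> gen2 R I F s" shows "gen2 R I F' s' \<subseteq> gen2 R I F s"
  using gen2_ev[of _ "{1..2::nat}" "\<lambda>j. if j = 1 then F' else s'"] assms unfolding gen2_def[of _ _ F' s'] by auto

end

text \<open>Induction over the polynomial multiplies the denominators of its parts, so they are
  taken from a multiplicatively closed set \<open>T\<close>.\<close>

lemma clear_denominators:
  assumes K: "cring K" and i: "\<iota> \<in> ring_hom R K" and T: "T \<subseteq> carrier R" "\<one> \<in> T" "\<And>a b. a \<in> T \<Longrightarrow> b \<in> T \<Longrightarrow> a \<otimes> b \<in> T"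
    and frac: "\<And>c. c \<in> carrier K \<Longrightarrow> \<exists>a\<in>carrier R. \<exists>d\<in>T. \<iota> d \<otimes>\<^bsub>K\<^esub> c = \<iota> a"
    and p: "p \<in> carrier (mpoly K I)"
  shows "\<exists>q\<in>carrier (mpoly R I). \<exists>d\<in>T. \<iota> \<circ> q = mconst K (\<iota> d) \<otimes>\<^bsub>mpoly K I\<^esub> p"
proof -
  interpret K: cring K by fact
  interpret i: ring_hom_cring R K \<iota> by (rule ring_hom_cringI[OF is_cring K i])
  interpret B: cring "mpoly R I" by (rule mpoly_cring)
  interpret BK: cring "mpoly K I" by (rule K.mpoly_cring)
  show ?thesis using p
  proof (induction p rule: K.mpoly_induct)
    case (const c)
    then obtain a d where ad: "a \<in> carrier R" "d \<in> T" "\<iota> d \<otimes>\<^bsub>K\<^esub> c = \<iota> a" using frac by blast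
    hence "\<iota> \<circ> mconst R a = mconst K (\<iota> d) \<otimes>\<^bsub>mpoly K I\<^esub> mconst K c"
      using const T(1) ring_hom_mult[OF K.mconst_hom, of "\<iota> d" c I] by auto
    thus ?case using ad by blast
  next
    case (add p q)
    then obtain p' d q' d' where e: "p' \<in> carrier (mpoly R I)" "d \<in> T" "\<iota> \<circ> p' = mconst K (\<iota> d) \<otimes>\<^bsub>mpoly K I\<^esub> p"
      "q' \<in> carrier (mpoly R I)" "d' \<in> T" "\<iota> \<circ> q' = mconst K (\<iota> d') \<otimes>\<^bsub>mpoly K I\<^esub> q" by blast
    have dc: "d \<in> carrier R" "d' \<in> carrier R" using e T(1) by auto
    let ?r = "mconst R d' \<otimes>\<^bsub>mpoly R I\<^esub> p' \<oplus>\<^bsub>mpoly R I\<^esub> mconst R d \<otimes>\<^bsub>mpoly R I\<^esub> q'"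
    have "\<iota> \<circ> ?r = mconst K (\<iota> (d \<otimes> d')) \<otimes>\<^bsub>mpoly K I\<^esub> (p \<oplus>\<^bsub>mpoly K I\<^esub> q)"
      using e dc add.hyps ring_hom_mult[OF K.mconst_hom, of "\<iota> d" "\<iota> d'" I]
      by (simp add: ring_hom_add[OF i.comp_hom] ring_hom_mult[OF i.comp_hom] BK.r_distr BK.m_ac)
    thus ?case using e dc T(3) by (intro bexI[of _ ?r] bexI[of _ "d \<otimes> d'"]) auto
  next
    case (var p j)
    then obtain p' d where e: "p' \<in> carrier (mpoly R I)" "d \<in> T" "\<iota> \<circ> p' = mconst K (\<iota> d) \<otimes>\<^bsub>mpoly K I\<^esub> p" by blast
    have dc: "d \<in> carrier R" using e T(1) by auto
    have "\<iota> \<circ> (p' \<otimes>\<^bsub>mpoly R I\<^esub> mvar R j) = mconst K (\<iota> d) \<otimes>\<^bsub>mpoly K I\<^esub> (p \<otimes>\<^bsub>mpoly K I\<^esub> mvar K j)"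
      using e dc var by (simp add: ring_hom_mult[OF i.comp_hom] BK.m_assoc)
    thus ?case using e var by (intro bexI[of _ "p' \<otimes>\<^bsub>mpoly R I\<^esub> mvar R j"] bexI[of _ d]) auto
  qed
qed

end

text \<open>Over a valuation ring a finite set of nonzero elements generates a principal fractional
  ideal, and one of them is a generator. No value group is needed:
  \<open>inv t \<otimes> c \<in> V\<close> says that \<open>c\<close> is a multiple of
  \<open>t\<close>.\<close>

lemma (in field) valuation_maximum:
  assumes V: "\<And>x y. x \<in> V \<Longrightarrow> y \<in> V \<Longrightarrow> x \<otimes> y \<in> V" "\<one> \<in> V" "V \<subseteq> carrier R"
    and val: "\<And>x. x \<in> carrier R \<Longrightarrow> x \<noteq> \<zero> \<Longrightarrow> x \<in> V \<or> inv x \<in> V"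
    and T: "finite T" "T \<noteq> {}" "T \<subseteq> carrier R - {\<zero>}"
  shows "\<exists>t\<in>T. \<forall>c\<in>T. inv t \<otimes> c \<in> V"
  using T
proof (induction T rule: finite_ne_induct)
  case (singleton a)
  thus ?case using V(2) by (simp add: field_Units)
next
  case (insert a T)
  then obtain t where t: "t \<in> T" "\<forall>c\<in>T. inv t \<otimes> c \<in> V" by blast
  have c: "a \<in> Units R" "t \<in> Units R" using insert t field_Units by auto
  show ?case
  proof (cases "inv t \<otimes> a \<in> V")
    case True
    thus ?thesis using t by (intro bexI[of _ t]) auto
  next
    case False
    have "inv t \<otimes> a \<noteq> \<zero>" using c by (metis Units_inv_Units Units_m_closed field_Units DiffD2 singletonI)
    hence "inv (inv t \<otimes> a) \<in> V" using val[of "inv t \<otimes> a"] False c by auto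
    moreover have "inv (inv t \<otimes> a) = inv a \<otimes> t"
    proof (rule comm_inv_char)
      have "inv t \<otimes> a \<otimes> (inv a \<otimes> t) = inv t \<otimes> (a \<otimes> inv a) \<otimes> t"
        using c by (simp only: m_assoc Units_closed Units_inv_closed m_closed)
      thus "inv t \<otimes> a \<otimes> (inv a \<otimes> t) = \<one>" using c by simp
    qed (use c in auto)
    ultimately have at: "inv a \<otimes> t \<in> V" by simp
    have "inv a \<otimes> c \<in> V" if c': "c \<in> T" for c
    proof -
      have cc: "c \<in> carrier R" using insert c' by auto
      have "(inv a \<otimes> t) \<otimes> (inv t \<otimes> c) = inv a \<otimes> (t \<otimes> inv t) \<otimes> c"
        using \<open>a \<in> Units R\<close> \<open>t \<in> Units R\<close> cc by (simp only: m_assoc Units_closed Units_inv_closed m_closed)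
      hence "inv a \<otimes> c = (inv a \<otimes> t) \<otimes> (inv t \<otimes> c)" using \<open>a \<in> Units R\<close> \<open>t \<in> Units R\<close> cc by simp
      thus ?thesis using V(1)[OF at] t(2) c' by simp
    qed
    moreover have "inv a \<otimes> a \<in> V" using c V(2) by simp
    ultimately show ?thesis by blast
  qed
qed

section \<open>Specialization of a coordinate\<close>

text \<open>The pair to be dominated is the image of \<open>R\<close> in \<open>K\<close> with the
  image of the kernel of \<rho>. Since \<rho> vanishes on the kernel of \<iota>, the latter is a
  proper prime ideal whose preimage in \<open>R\<close> is exactly the kernel of \<rho>.\<close>

lemma residue_field_exists:
  assumes "cring R" "field K" "field k" and i: "\<iota> \<in> ring_hom R K" and \<rho>: "\<rho> \<in> ring_hom R k"
    and ker: "\<And>r. r \<in> carrier R \<Longrightarrow> \<iota> r = \<zero>\<^bsub>K\<^esub> \<Longrightarrow> \<rho> r = \<zero>\<^bsub>k\<^esub>"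
  shows "\<exists>V m. subring V K \<and> ideal m (K\<lparr>carrier := V\<rparr>) \<and> field ((K\<lparr>carrier := V\<rparr>) Quot m) \<and>
     (\<forall>r\<in>carrier R. \<iota> r \<in> V \<and> (\<iota> r \<in> m \<longleftrightarrow> \<rho> r = \<zero>\<^bsub>k\<^esub>)) \<and> (\<forall>x\<in>carrier K - V. inv\<^bsub>K\<^esub> x \<in> m)"
proof -
  interpret R: cring R by fact
  interpret K: field K by fact
  interpret k: field k by fact
  interpret i: ring_hom_cring R K \<iota> by (rule ring_hom_cringI[OF assms(1) K.is_cring i])
  interpret r: ring_hom_cring R k \<rho> by (rule ring_hom_cringI[OF assms(1) k.is_cring \<rho>])
  let ?D = "\<iota> ` carrier R" and ?p = "\<iota> ` {r \<in> carrier R. \<rho> r = \<zero>\<^bsub>k\<^esub>}"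
  have pm: "\<iota> r \<in> ?p \<longleftrightarrow> \<rho> r = \<zero>\<^bsub>k\<^esub>" if r: "r \<in> carrier R" for r
  proof
    assume "\<iota> r \<in> ?p"
    then obtain r' where r': "r' \<in> carrier R" "\<rho> r' = \<zero>\<^bsub>k\<^esub>" "\<iota> r = \<iota> r'" by auto
    have "\<iota> (r \<ominus>\<^bsub>R\<^esub> r') = \<zero>\<^bsub>K\<^esub>" using r r' by (simp add: R.minus_eq K.r_neg)
    hence "\<rho> (r \<ominus>\<^bsub>R\<^esub> r') = \<zero>\<^bsub>k\<^esub>" using ker r r' by simp
    thus "\<rho> r = \<zero>\<^bsub>k\<^esub>" using r r' by (simp add: R.minus_eq)
  qed (use r in auto)
  have one: "\<one>\<^bsub>K\<^esub> \<notin> ?p" using pm[OF R.one_closed] by simp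
  interpret P: place_data K ?D ?p
  proof (intro place_data.intro place_data_axioms.intro)
    show "field K" by fact
    show "subring ?D K"
    proof (rule K.subringI)
      show "?D \<subseteq> carrier K" by auto
      show "\<one>\<^bsub>K\<^esub> \<in> ?D" by (rule image_eqI[of _ _ "\<one>\<^bsub>R\<^esub>"]) auto
    next
      fix x assume "x \<in> ?D"
      then obtain a where "a \<in> carrier R" "x = \<iota> a" by blast
      thus "\<ominus>\<^bsub>K\<^esub> x \<in> ?D" by (intro image_eqI[of _ _ "\<ominus>\<^bsub>R\<^esub> a"]) auto
    next
      fix x y assume "x \<in> ?D" "y \<in> ?D"
      then obtain a b where ab: "a \<in> carrier R" "x = \<iota> a" "b \<in> carrier R" "y = \<iota> b" by blast
      show "x \<otimes>\<^bsub>K\<^esub> y \<in> ?D" using ab by (intro image_eqI[of _ _ "a \<otimes>\<^bsub>R\<^esub> b"]) auto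
      show "x \<oplus>\<^bsub>K\<^esub> y \<in> ?D" using ab by (intro image_eqI[of _ _ "a \<oplus>\<^bsub>R\<^esub> b"]) auto
    qed
    show "\<zero>\<^bsub>K\<^esub> \<in> ?p" by (rule image_eqI[of _ _ "\<zero>\<^bsub>R\<^esub>"]) auto
  next
    fix x y assume "x \<in> ?p" "y \<in> ?p"
    then obtain a b where ab: "a \<in> carrier R" "\<rho> a = \<zero>\<^bsub>k\<^esub>" "x = \<iota> a" "b \<in> carrier R" "\<rho> b = \<zero>\<^bsub>k\<^esub>" "y = \<iota> b" by blast
    show "x \<oplus>\<^bsub>K\<^esub> y \<in> ?p" using ab by (intro image_eqI[of _ _ "a \<oplus>\<^bsub>R\<^esub> b"]) auto
  next
    fix x y assume "x \<in> ?D" "y \<in> ?p"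
    then obtain a b where ab: "a \<in> carrier R" "x = \<iota> a" "b \<in> carrier R" "\<rho> b = \<zero>\<^bsub>k\<^esub>" "y = \<iota> b" by blast
    show "x \<otimes>\<^bsub>K\<^esub> y \<in> ?p" using ab by (intro image_eqI[of _ _ "a \<otimes>\<^bsub>R\<^esub> b"]) auto
  next
    fix x y assume "x \<in> ?D - ?p" "y \<in> ?D - ?p"
    then obtain a b where ab: "a \<in> carrier R" "x = \<iota> a" "x \<notin> ?p" "b \<in> carrier R" "y = \<iota> b" "y \<notin> ?p" by blast
    have "\<rho> a \<noteq> \<zero>\<^bsub>k\<^esub>" "\<rho> b \<noteq> \<zero>\<^bsub>k\<^esub>" using ab pm by auto
    hence "\<rho> (a \<otimes>\<^bsub>R\<^esub> b) \<noteq> \<zero>\<^bsub>k\<^esub>" using ab by (simp add: k.integral_iff)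
    hence "\<iota> (a \<otimes>\<^bsub>R\<^esub> b) \<in> ?D - ?p" using ab pm[of "a \<otimes>\<^bsub>R\<^esub> b"] by blast
    thus "x \<otimes>\<^bsub>K\<^esub> y \<in> ?D - ?p" using ab by simp
  qed (use one in auto)
  obtain V m where V: "subring V K" "?D \<subseteq> V" "?p \<subseteq> m" "m \<subseteq> V" "\<forall>x\<in>m. \<forall>y\<in>m. x \<oplus>\<^bsub>K\<^esub> y \<in> m"
    "\<forall>x\<in>V. \<forall>y\<in>m. x \<otimes>\<^bsub>K\<^esub> y \<in> m" "m \<inter> (?D - ?p) = {}" "\<forall>x\<in>carrier K - V. inv\<^bsub>K\<^esub> x \<in> m" "\<forall>x\<in>V - m. inv\<^bsub>K\<^esub> x \<in> V"
    using P.valuation_ring_exists by (elim exE conjE)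
  let ?V = "K\<lparr>carrier := V\<rparr>"
  interpret V: cring ?V using K.subcring_iff K.subcringI'[OF V(1)] subringE(1)[OF V(1)] by blast
  note VE = subringE[OF V(1)]
  have m_iff: "\<iota> r \<in> m \<longleftrightarrow> \<rho> r = \<zero>\<^bsub>k\<^esub>" if r: "r \<in> carrier R" for r
    using pm[OF r] V(3,7) r by blast
  have m0: "\<zero>\<^bsub>K\<^esub> \<in> m" using m_iff[OF R.zero_closed] by simp
  have m1: "\<one>\<^bsub>K\<^esub> \<notin> m" using m_iff[OF R.one_closed] by simp
  have id: "ideal m ?V"
  proof (rule idealI[OF V.ring_axioms])
    show "subgroup m (add_monoid ?V)"
    proof (rule V.add.subgroupI)
      fix x assume x: "x \<in> m"
      have xV: "x \<in> carrier ?V" using x V(4) by auto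
      have "(\<ominus>\<^bsub>?V\<^esub> \<one>\<^bsub>?V\<^esub>) \<otimes>\<^bsub>?V\<^esub> x \<in> m" using V(6) x V.a_inv_closed[OF V.one_closed] by simp
      thus "\<ominus>\<^bsub>?V\<^esub> x \<in> m" using V.l_minus[OF V.one_closed xV] xV by (simp only: V.l_one)
    qed (use V m0 in auto)
    fix a x assume a: "a \<in> m" "x \<in> carrier ?V"
    hence "a \<in> carrier K" "x \<in> carrier K" using V(4) VE(1) by auto
    thus "x \<otimes>\<^bsub>?V\<^esub> a \<in> m" "a \<otimes>\<^bsub>?V\<^esub> x \<in> m" using a V(6) K.m_comm[of a x] by simp_all
  qed
  interpret m: ideal m ?V by fact
  \<comment> \<open>Everything in \<open>V\<close> outside \<open>m\<close> is a unit of
    \<open>V\<close>, so no proper ideal is larger than \<open>m\<close>.\<close>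
  interpret mm: maximalideal m ?V
  proof (rule maximalidealI[OF id])
    show "carrier ?V \<noteq> m" using m1 VE(3) by auto
    fix J assume J: "ideal J ?V" "m \<subseteq> J" "J \<subseteq> carrier ?V"
    interpret J: ideal J ?V by fact
    show "J = m \<or> J = carrier ?V"
    proof (rule ccontr)
      assume n: "\<not> ?thesis"
      then obtain y where y: "y \<in> J" "y \<notin> m" using J(2) by blast
      have yV: "y \<in> V" using J(3) y by auto
      have "y \<in> Units K" using y m0 yV VE(1) K.field_Units by auto
      moreover have "inv\<^bsub>K\<^esub> y \<in> V" using V(9) y yV by blast
      hence "y \<otimes>\<^bsub>K\<^esub> inv\<^bsub>K\<^esub> y \<in> J" using J.I_r_closed[OF y(1), of "inv\<^bsub>K\<^esub> y"] by simp
      ultimately have "\<one>\<^bsub>?V\<^esub> \<in> J" by simp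
      from J.one_imp_carrier[OF this] show False using n by blast
    qed
  qed
  have "field (?V Quot m)" by (rule mm.quotient_is_field[OF V.is_cring])
  thus ?thesis using V(1,2,8) id m_iff by - (rule exI[of _ V], rule exI[of _ m], auto)
qed

lemma (in abelian_monoid) finsum_one_two:
  "f 1 \<in> carrier G \<Longrightarrow> f 2 \<in> carrier G \<Longrightarrow> finsum G f {1..2::nat} = f 1 \<oplus> f 2"
proof -
  assume "f 1 \<in> carrier G" "f 2 \<in> carrier G"
  moreover have "{1..2::nat} = {1, 2}" by auto
  ultimately show ?thesis by (simp add: finsum_insert)
qed

section \<open>Algebraic independence of F and a second polynomial\<close>

context grad_poly
begin

lemma qalg_mpoly: "qalg B"
  by (rule ring_hom_cring.qalg_hom[OF ring_hom_cringI[OF is_cring mpoly_cring mconst_hom] qalg])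

text \<open>Multiply the Bezout identity by \<open>g\<close>: the gradient of \<open>F\<close> can
  be cancelled even in the presence of zero divisors.\<close>

lemma unimodular_zero:
  assumes g: "g \<in> carrier B"
    and z: "\<And>i. i \<in> I \<Longrightarrow> g \<otimes>\<^bsub>B\<^esub> partial_deriv R i F = \<zero>\<^bsub>B\<^esub>"
  shows "g = \<zero>\<^bsub>B\<^esub>"
proof -
  interpret B: cring B by (rule mpoly_cring)
  have bc: "b i \<in> carrier B" if "i \<in> I" for i using b that by auto
  have "g = g \<otimes>\<^bsub>B\<^esub> (\<Oplus>\<^bsub>B\<^esub>i\<in>I. b i \<otimes>\<^bsub>B\<^esub> partial_deriv R i F)"
    using g by (simp add: unimodular)
  also have "\<dots> = (\<Oplus>\<^bsub>B\<^esub>i\<in>I. g \<otimes>\<^bsub>B\<^esub> (b i \<otimes>\<^bsub>B\<^esub> partial_deriv R i F))"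
    using g bc F finite_I by (intro B.finsum_rdistr) auto
  also have "\<dots> = \<zero>\<^bsub>B\<^esub>"
  proof (rule B.add.finprod_one_eqI)
    fix i assume i: "i \<in> I"
    have "g \<otimes>\<^bsub>B\<^esub> (b i \<otimes>\<^bsub>B\<^esub> partial_deriv R i F) = b i \<otimes>\<^bsub>B\<^esub> (g \<otimes>\<^bsub>B\<^esub> partial_deriv R i F)"
      using g bc[OF i] F by (simp add: B.m_lcomm)
    thus "g \<otimes>\<^bsub>B\<^esub> (b i \<otimes>\<^bsub>B\<^esub> partial_deriv R i F) = \<zero>\<^bsub>B\<^esub>"
      using z[OF i] bc[OF i] by simp
  qed
  finally show ?thesis .
qed

text \<open>The Jacobian criterion with all partial derivatives. From
  \<open>g1 F\<^sub>i + g2 s\<^sub>i = 0\<close> for every \<open>i\<close>, eliminating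
  \<open>g1\<close> gives \<open>g2 D\<^sub>i\<^sub>j s = 0\<close>, so \<open>g2 = 0\<close>, and
  unimodularity then cancels the gradient of \<open>F\<close> from \<open>g1\<close>.\<close>

lemma ev_pair_zero:
  assumes dom: "domain R" and s: "s \<in> carrier B" and ij: "i \<in> I" "j \<in> I"
    and nz: "jac R I F i j s \<noteq> \<zero>\<^bsub>B\<^esub>"
    and q: "q \<in> carrier (mpoly R {1..2::nat})"
    and z: "mev R B (mconst R) (\<lambda>j::nat. if j = 1 then F else s) q = \<zero>\<^bsub>B\<^esub>"
  shows "q m = \<zero>"
proof -
  interpret domain R by fact
  interpret B: "domain" B by (rule mpoly_domain)
  let ?f = "\<lambda>j::nat. if j = 1 then F else s"
  interpret E: poly_eval R B "mconst R" "{1..2}" ?f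
    by (rule poly_eval_gen2[OF F s])
  have "mconst R (q m) = \<zero>\<^bsub>B\<^esub>"
  proof (rule E.ev_eq_zero_iff[where \<D> = "(\<lambda>i. partial_deriv R i) ` I"])
    fix D assume "D \<in> (\<lambda>i. partial_deriv R i) ` I"
    thus "derivation B D" by (auto intro: pd_derivation)
  next
    fix D a assume "D \<in> (\<lambda>i. partial_deriv R i) ` I"
    thus "D (mconst R a) = \<zero>\<^bsub>B\<^esub>" by (auto simp: pd_const[of _ _ I])
  next
    fix g :: "nat \<Rightarrow> 'i multiset \<Rightarrow> 'a"
    assume g: "g \<in> {1..2} \<rightarrow> carrier B"
      and h: "\<And>D. D \<in> (\<lambda>i. partial_deriv R i) ` I \<Longrightarrow> (\<Oplus>\<^bsub>B\<^esub>j\<in>{1..2}. g j \<otimes>\<^bsub>B\<^esub> D (?f j)) = \<zero>\<^bsub>B\<^esub>"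
    have gc: "g 1 \<in> carrier B" "g 2 \<in> carrier B" using g by auto
    have h': "g 1 \<otimes>\<^bsub>B\<^esub> partial_deriv R i F \<oplus>\<^bsub>B\<^esub> g 2 \<otimes>\<^bsub>B\<^esub> partial_deriv R i s = \<zero>\<^bsub>B\<^esub>"
      if "i \<in> I" for i
      using h[of "partial_deriv R i"] that gc F s by (simp add: B.finsum_one_two)
    have e: "g 2 \<otimes>\<^bsub>B\<^esub> partial_deriv R i s = \<ominus>\<^bsub>B\<^esub> (g 1 \<otimes>\<^bsub>B\<^esub> partial_deriv R i F)" if "i \<in> I" for i
      using h'[OF that] gc F s by (metis B.a_comm B.m_closed B.minus_equality pd_closed)
    have "g 2 \<otimes>\<^bsub>B\<^esub> jac R I F i j s =
       partial_deriv R i F \<otimes>\<^bsub>B\<^esub> (g 2 \<otimes>\<^bsub>B\<^esub> partial_deriv R j s) \<ominus>\<^bsub>B\<^esub>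
       partial_deriv R j F \<otimes>\<^bsub>B\<^esub> (g 2 \<otimes>\<^bsub>B\<^esub> partial_deriv R i s)"
      using gc F s pd_closed by (simp add: jac_def B.minus_eq B.r_distr B.r_minus B.m_lcomm)
    also have "\<dots> = \<zero>\<^bsub>B\<^esub>"
      unfolding e[OF ij(1)] e[OF ij(2)] using gc F pd_closed
      by (simp add: B.minus_eq B.r_minus B.m_ac B.l_neg)
    finally have g2: "g 2 = \<zero>\<^bsub>B\<^esub>" using nz gc F s by (simp add: B.integral_iff)
    have "g 1 = \<zero>\<^bsub>B\<^esub>"
    proof (rule unimodular_zero[OF gc(1)])
      fix i assume "i \<in> I"
      from h'[OF this] show "g 1 \<otimes>\<^bsub>B\<^esub> partial_deriv R i F = \<zero>\<^bsub>B\<^esub>"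
        unfolding g2 using gc F s by simp
    qed
    moreover have "j = 1 \<or> j = 2" if "j \<in> {1..2::nat}" for j using that by auto
    ultimately show "\<forall>j\<in>{1..2}. g j = \<zero>\<^bsub>B\<^esub>" using g2 by metis
  qed (use qalg_mpoly q z in auto)
  from fun_cong[OF this, of "{#}"] show ?thesis by (simp add: mpoly_zero)
qed

text \<open>A Jacobian derivation kills the constants and \<open>F\<close>, so the chain rule leaves
  only the partial derivative in the second variable.\<close>

lemma jac_ev_pair:
  assumes s: "s \<in> carrier B" and q: "q \<in> carrier (mpoly R {1..2::nat})"
  shows "jac R I F i j (mev R B (mconst R) (\<lambda>j::nat. if j = 1 then F else s) q) =
    mev R B (mconst R) (\<lambda>j::nat. if j = 1 then F else s) (partial_deriv R 2 q) \<otimes>\<^bsub>B\<^esub> jac R I F i j s"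
proof -
  interpret B: cring B by (rule mpoly_cring)
  interpret E: poly_eval R B "mconst R" "{1..2}" "\<lambda>j::nat. if j = 1 then F else s"
    by (rule poly_eval_gen2[OF F s])
  show ?thesis
    using E.chain_rule[OF jac_derivation[OF F] jac_const[OF F] _ q, of i j] F s q
    by (simp add: B.finsum_one_two)
qed

end

section \<open>The idempotent endomorphism and its base changes\<close>

locale retract_data = grad_poly R I F b for R :: "('a, 'm) ring_scheme" (structure) and I :: "'i::wellorder set" and F b +
  fixes x :: "'i \<Rightarrow> 'i multiset \<Rightarrow> 'a"
  assumes x: "x \<in> I \<rightarrow> carrier (mpoly R I)"
    and x_fixed: "\<And>i. i \<in> I \<Longrightarrow> mev R (mpoly R I) (mconst R) x (x i) = x i"
    and F_fixed: "mev R (mpoly R I) (mconst R) x F = F"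
begin

text \<open>The retraction of \<open>S[X\<^sub>i | i \<in> I]\<close> obtained by base change along \<open>h : R \<rightarrow> S\<close>\<close>

definition retr :: "('c, 'n) ring_scheme \<Rightarrow> ('a \<Rightarrow> 'c) \<Rightarrow> ('i multiset \<Rightarrow> 'c) \<Rightarrow> ('i multiset \<Rightarrow> 'c)" where
  "retr S h = mev S (mpoly S I) (mconst S) (\<lambda>i. h \<circ> x i)"

lemma x_closed: "i \<in> I \<Longrightarrow> x i \<in> carrier B" using x by auto

context
  fixes S :: "('c, 'n) ring_scheme" and h assumes S: "cring S" and h: "h \<in> ring_hom R S"
begin

interpretation S: cring S by (rule S)
interpretation h: ring_hom_cring R S h by (rule ring_hom_cringI[OF is_cring S h])
interpretation P: poly_eval S "mpoly S I" "mconst S" I "\<lambda>i. h \<circ> x i"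
  by (rule S.poly_eval_mconst) (use x in auto)
interpretation P0: poly_eval R B "mconst R" I x
  by (rule poly_eval_mconst[OF x])

lemma retr_hom: "retr S h \<in> ring_hom (mpoly S I) (mpoly S I)"
  unfolding retr_def by (rule P.ev_hom)

lemma retr_const: "a \<in> carrier S \<Longrightarrow> retr S h (mconst S a) = mconst S a"
  unfolding retr_def by (rule P.ev_const)

lemma retr_natural:
  assumes p: "p \<in> carrier B"
  shows "h \<circ> mev R B (mconst R) x p = retr S h (h \<circ> p)"
  unfolding retr_def
proof (rule ev_natural[where g = "(\<circ>) h" and J = I])
  show "poly_eval R B (mconst R) I x" by (rule poly_eval_mconst[OF x])
  show "poly_eval S (mpoly S I) (mconst S) I (\<lambda>i. h \<circ> x i)" by (rule S.poly_eval_mconst) (use x in auto)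
qed (use p h in \<open>simp_all add: h.comp_hom h.comp_mconst\<close>)

lemma retr_x: "i \<in> I \<Longrightarrow> retr S h (h \<circ> x i) = h \<circ> x i"
  using retr_natural[OF x_closed] x_fixed by simp

lemma retr_F: "retr S h (h \<circ> F) = h \<circ> F"
  using retr_natural[OF F] F_fixed by simp

lemma retr_idem:
  assumes p: "p \<in> carrier (mpoly S I)" shows "retr S h (retr S h p) = retr S h p"
proof -
  have "(retr S h \<circ> retr S h) p = retr S h p"
  proof (rule mpoly_hom_eqI[OF S S.mpoly_cring _ retr_hom _ _ p])
    show "retr S h \<circ> retr S h \<in> ring_hom (mpoly S I) (mpoly S I)" by (rule ring_hom_trans[OF retr_hom retr_hom])
    show "(retr S h \<circ> retr S h) (mvar S i) = retr S h (mvar S i)" if "i \<in> I" for i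
    proof -
      have "retr S h (mvar S i) = h \<circ> x i" unfolding retr_def using that by (rule P.ev_var)
      thus ?thesis using retr_x[OF that] by (simp only: comp_apply)
    qed
  qed (simp only: comp_apply retr_const)
  thus ?thesis by simp
qed

lemma retr_fspan:
  assumes "u \<in> fspan S I (h \<circ> F)" shows "retr S h u = u"
proof -
  interpret r: ring_hom_cring "mpoly S I" "mpoly S I" "retr S h"
    by (rule ring_hom_cringI[OF S.mpoly_cring S.mpoly_cring retr_hom])
  have hF: "h \<circ> F \<in> carrier (mpoly S I)" using F by (rule h.comp_closed)
  have pw: "retr S h ((h \<circ> F) [^]\<^bsub>mpoly S I\<^esub> k) = (h \<circ> F) [^]\<^bsub>mpoly S I\<^esub> k" for k :: nat
  proof (induction k)
    case (Suc k)
    have "retr S h ((h \<circ> F) [^]\<^bsub>mpoly S I\<^esub> k \<otimes>\<^bsub>mpoly S I\<^esub> (h \<circ> F)) = (h \<circ> F) [^]\<^bsub>mpoly S I\<^esub> k \<otimes>\<^bsub>mpoly S I\<^esub> (h \<circ> F)"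
      using r.hom_mult[OF P.C.nat_pow_closed[OF hF] hF, of k] unfolding Suc retr_F .
    thus ?case by (simp only: P.C.nat_pow_Suc)
  qed (simp only: P.C.nat_pow_0 r.hom_one)
  show ?thesis using assms
  proof induction
    case zero
    show ?case by (rule r.hom_zero)
  next
    case (add u a k)
    have c: "u \<in> carrier (mpoly S I)" "mconst S a \<in> carrier (mpoly S I)" "(h \<circ> F) [^]\<^bsub>mpoly S I\<^esub> k \<in> carrier (mpoly S I)"
      using S.fspan_closed[OF hF] add.hyps hF by auto
    show ?case
      unfolding r.hom_add[OF c(1) P.C.m_closed[OF c(2,3)]] r.hom_mult[OF c(2,3)] pw add.IH retr_const[OF add.hyps(2)] ..
  qed
qed

text \<open>A fixed \<open>p\<close> equals its own value at the reduced point \<open>x\<close>, so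
  a subalgebra that contains the reductions of the \<open>x i\<close> contains the whole fixed
  ring.\<close>

lemma fixed_gen2:
  assumes s: "s \<in> carrier (mpoly S I)" and g: "\<And>i. i \<in> I \<Longrightarrow> h \<circ> x i \<in> gen2 S I (h \<circ> F) s"
    and p: "p \<in> carrier (mpoly S I)" "retr S h p = p"
  shows "p \<in> gen2 S I (h \<circ> F) s"
proof -
  have "mev S (mpoly S I) (mconst S) (\<lambda>i. h \<circ> x i) p \<in> gen2 S I (h \<circ> F) s"
    by (rule S.gen2_ev[OF h.comp_closed[OF F] s p(1) g])
  thus ?thesis using p(2) unfolding retr_def by simp
qed

end

end

abbreviation ev2 :: "('a, 'm) ring_scheme \<Rightarrow> 'i set \<Rightarrow> ('i multiset \<Rightarrow> 'a) \<Rightarrow> ('i multiset \<Rightarrow> 'a) \<Rightarrow>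
    (nat multiset \<Rightarrow> 'a) \<Rightarrow> ('i multiset \<Rightarrow> 'a)" where
  "ev2 L I F s \<equiv> mev L (mpoly L I) (mconst L) (\<lambda>j::nat. if j = 1 then F else s)"

context ring_hom_cring
begin

lemma comp_ev2:
  assumes Fs: "F \<in> carrier (mpoly R I)" "s \<in> carrier (mpoly R I)" and q: "q \<in> carrier (mpoly R {1..2})"
  shows "h \<circ> ev2 R I F s q = ev2 S I (h \<circ> F) (h \<circ> s) (h \<circ> q)"
proof (rule ev_natural[where g = "(\<circ>) h" and J = "{1..2}"])
  show "poly_eval R (mpoly R I) (mconst R) {1..2} (\<lambda>j::nat. if j = 1 then F else s)"
    by (rule R.poly_eval_gen2[OF Fs])
  show "poly_eval S (mpoly S I) (mconst S) {1..2} (\<lambda>j::nat. if j = 1 then h \<circ> F else h \<circ> s)"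
    by (rule S.poly_eval_gen2[OF comp_closed[OF Fs(1)] comp_closed[OF Fs(2)]])
  show "(\<circ>) h \<in> ring_hom (mpoly R I) (mpoly S I)" by (rule comp_hom)
  show "h \<circ> mconst R a = mconst S (h a)" if "a \<in> carrier R" for a using that by (rule comp_mconst)
qed (use q in auto)

lemma comp_gen2:
  assumes Fs: "F \<in> carrier (mpoly R I)" "s \<in> carrier (mpoly R I)" and u: "u \<in> gen2 R I F s"
  shows "h \<circ> u \<in> gen2 S I (h \<circ> F) (h \<circ> s)"
proof -
  obtain q where q: "q \<in> carrier (mpoly R {1..2::nat})" "u = ev2 R I F s q" using u unfolding gen2_def by blast
  show ?thesis unfolding q(2) comp_ev2[OF Fs q(1)] gen2_def by (rule imageI[OF comp_closed[OF q(1)]])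
qed

end

lemma (in cring) jac_scale:
  assumes F: "F \<in> carrier (mpoly R I)" and s: "s \<in> carrier (mpoly R I)" and c: "c \<in> carrier R"
  shows "jac R I F i j (mconst R c \<otimes>\<^bsub>mpoly R I\<^esub> s) = mconst R c \<otimes>\<^bsub>mpoly R I\<^esub> jac R I F i j s"
proof -
  interpret B: cring "mpoly R I" by (rule mpoly_cring)
  show ?thesis using derivation_mult[OF jac_derivation[OF F] mconst_closed[OF c] s, of i j] F s c by simp
qed

lemma (in cring) jac_add:
  assumes "F \<in> carrier (mpoly R I)" "s \<in> carrier (mpoly R I)" "t \<in> carrier (mpoly R I)"
  shows "jac R I F i j (s \<oplus>\<^bsub>mpoly R I\<^esub> t) = jac R I F i j s \<oplus>\<^bsub>mpoly R I\<^esub> jac R I F i j t"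
  using derivation_add[OF jac_derivation[OF assms(1)] assms(2,3)] .

lemma (in field) mconst_inverse:
  assumes c: "c \<in> carrier R" "c \<noteq> \<zero>" and p: "p \<in> carrier (mpoly R I)"
  shows "mconst R (inv c) \<otimes>\<^bsub>mpoly R I\<^esub> (mconst R c \<otimes>\<^bsub>mpoly R I\<^esub> p) = p"
    "mconst R c \<otimes>\<^bsub>mpoly R I\<^esub> (mconst R (inv c) \<otimes>\<^bsub>mpoly R I\<^esub> p) = p"
proof -
  have U: "c \<in> Units R" using c field_Units by simp
  interpret B: cring "mpoly R I" by (rule mpoly_cring)
  have cc: "c \<in> carrier R" "inv c \<in> carrier R" using U by auto
  note C = mconst_closed[OF cc(1), of I] mconst_closed[OF cc(2), of I]
  have one: "mconst R (inv c) \<otimes>\<^bsub>mpoly R I\<^esub> mconst R c = \<one>\<^bsub>mpoly R I\<^esub>"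
    "mconst R c \<otimes>\<^bsub>mpoly R I\<^esub> mconst R (inv c) = \<one>\<^bsub>mpoly R I\<^esub>"
    unfolding ring_hom_mult[OF mconst_hom cc(2,1), symmetric] ring_hom_mult[OF mconst_hom cc, symmetric]
    using U by (simp_all add: mpoly_one)
  show "mconst R (inv c) \<otimes>\<^bsub>mpoly R I\<^esub> (mconst R c \<otimes>\<^bsub>mpoly R I\<^esub> p) = p"
    by (simp only: B.m_assoc[OF C(2,1) p, symmetric] one B.l_one[OF p])
  show "mconst R c \<otimes>\<^bsub>mpoly R I\<^esub> (mconst R (inv c) \<otimes>\<^bsub>mpoly R I\<^esub> p) = p"
    by (simp only: B.m_assoc[OF C p, symmetric] one B.l_one[OF p])
qed

section \<open>Passage to the residue field of a valuation ring\<close>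

context retract_data
begin

lemma retr_comp:
  assumes S: "cring S" and T: "cring T" and h: "h \<in> ring_hom R S" and g: "g \<in> ring_hom S T"
    and p: "p \<in> carrier (mpoly S I)"
  shows "g \<circ> retr S h p = retr T (g \<circ> h) (g \<circ> p)"
proof -
  interpret S: cring S by fact
  interpret T: cring T by fact
  interpret h: ring_hom_cring R S h by (rule ring_hom_cringI[OF is_cring S h])
  interpret g: ring_hom_cring S T g by (rule ring_hom_cringI[OF S T g])
  show ?thesis unfolding retr_def
  proof (rule ev_natural[where g = "(\<circ>) g" and J = I])
    show "poly_eval S (mpoly S I) (mconst S) I (\<lambda>i. h \<circ> x i)"
      using x_closed by (intro S.poly_eval_mconst) auto
    show "poly_eval T (mpoly T I) (mconst T) I (\<lambda>i. g \<circ> h \<circ> x i)"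
      using g.comp_closed[OF h.comp_closed[OF x_closed]] by (intro T.poly_eval_mconst) (auto simp: o_assoc)
    show "(\<circ>) g \<in> ring_hom (mpoly S I) (mpoly T I)" by (rule g.comp_hom)
    show "g \<circ> mconst S a = mconst T (g a)" if "a \<in> carrier S" for a using that by (rule g.comp_mconst)
    show "g \<circ> (h \<circ> x i) = g \<circ> h \<circ> x i" for i by (rule o_assoc)
  qed (use g p in auto)
qed

text \<open>Elements of \<open>A \<otimes> K\<close> come from \<open>A\<close> up to a scalar. A
  polynomial obtained by clearing denominators need not be fixed over \<open>R\<close>, because
  \<iota> need not be injective; applying the retraction repairs this and does not change the image
  over \<open>K\<close>, which is fixed already.\<close>

lemma scale_to_base:
  assumes K: "domain K" and i: "\<iota> \<in> ring_hom R K"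
    and frac: "\<And>c. c \<in> carrier K \<Longrightarrow> \<exists>a\<in>carrier R. \<exists>d\<in>carrier R. \<iota> d \<noteq> \<zero>\<^bsub>K\<^esub> \<and> \<iota> d \<otimes>\<^bsub>K\<^esub> c = \<iota> a"
    and s: "s \<in> carrier (mpoly K I)" "retr K \<iota> s = s"
  shows "\<exists>\<tau>\<in>carrier B. \<exists>d\<in>carrier R. mev R B (mconst R) x \<tau> = \<tau> \<and> \<iota> d \<noteq> \<zero>\<^bsub>K\<^esub> \<and>
    \<iota> \<circ> \<tau> = mconst K (\<iota> d) \<otimes>\<^bsub>mpoly K I\<^esub> s"
proof -
  interpret K: "domain" K by fact
  interpret i: ring_hom_cring R K \<iota> by (rule ring_hom_cringI[OF is_cring K.is_cring i])
  interpret P: poly_eval R B "mconst R" I x by (rule poly_eval_mconst[OF x])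
  let ?T = "{d \<in> carrier R. \<iota> d \<noteq> \<zero>\<^bsub>K\<^esub>}"
  have "\<exists>q\<in>carrier B. \<exists>d\<in>?T. \<iota> \<circ> q = mconst K (\<iota> d) \<otimes>\<^bsub>mpoly K I\<^esub> s"
    by (rule clear_denominators[OF K.is_cring i _ _ _ _ s(1)]) (use frac in \<open>auto simp: K.integral_iff\<close>)
  then obtain q d where q: "q \<in> carrier B" "d \<in> carrier R" "\<iota> d \<noteq> \<zero>\<^bsub>K\<^esub>" "\<iota> \<circ> q = mconst K (\<iota> d) \<otimes>\<^bsub>mpoly K I\<^esub> s"
    by blast
  have dc: "mconst K (\<iota> d) \<in> carrier (mpoly K I)" using q(2) by auto
  have "\<iota> \<circ> P.ev q = retr K \<iota> (\<iota> \<circ> q)" by (rule retr_natural[OF K.is_cring i q(1)])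
  also have "\<dots> = mconst K (\<iota> d) \<otimes>\<^bsub>mpoly K I\<^esub> s"
    unfolding q(4) ring_hom_mult[OF retr_hom[OF K.is_cring i] dc s(1)] s(2)
    using q(2) by (simp only: retr_const[OF K.is_cring i] i.hom_closed)
  finally have 1: "\<iota> \<circ> P.ev q = mconst K (\<iota> d) \<otimes>\<^bsub>mpoly K I\<^esub> s" .
  have "retr R id (retr R id q) = retr R id q" by (rule retr_idem[OF is_cring id_ring_hom q(1)])
  hence "P.ev (P.ev q) = P.ev q" by (simp add: retr_def)
  thus ?thesis using 1 q P.ev_closed[OF q(1)] by blast
qed

text \<open>That the reductions of \<open>F\<close> and \<open>s\<close> generate the fibre is a
  saturation argument: the polynomial expressing \<open>x i\<close> through \<open>F\<close> and
  \<open>s\<close> over \<open>K\<close> must have coefficients in \<open>V\<close>, since otherwise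
  dividing it by a coefficient of least value and reducing would give a nontrivial relation between
  \<open>F\<close> and \<open>s\<close> over \<kappa>.\<close>

lemma residue_step:
  assumes noeth: "noetherian_ring R" and K: "field K" and i: "\<iota> \<in> ring_hom R K"
    and V: "subring V K" and m: "ideal m (K\<lparr>carrier := V\<rparr>)" and k: "field ((K\<lparr>carrier := V\<rparr>) Quot m)"
    and iV: "\<And>r. r \<in> carrier R \<Longrightarrow> \<iota> r \<in> V" and inv: "\<And>y. y \<in> carrier K \<Longrightarrow> y \<notin> V \<Longrightarrow> inv\<^bsub>K\<^esub> y \<in> m"
    and \<tau>: "\<tau> \<in> carrier B" "mev R B (mconst R) x \<tau> = \<tau>"
    and g: "\<And>i. i \<in> I \<Longrightarrow> \<iota> \<circ> x i \<in> gen2 K I (\<iota> \<circ> F) (\<iota> \<circ> \<tau>)"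
    and nz: "i1 \<in> I" "j1 \<in> I" "jac K I (\<iota> \<circ> F) i1 j1 (\<iota> \<circ> \<tau>) \<noteq> \<zero>\<^bsub>mpoly K I\<^esub>"
  defines "\<kappa> \<equiv> (K\<lparr>carrier := V\<rparr>) Quot m" and "e \<equiv> (+>\<^bsub>K\<lparr>carrier := V\<rparr>\<^esub>) m \<circ> \<iota>"
  shows "\<exists>s\<in>carrier (mpoly \<kappa> I). retr \<kappa> e s = s \<and> (\<forall>i\<in>I. e \<circ> x i \<in> gen2 \<kappa> I (e \<circ> F) s) \<and>
     (\<exists>i\<in>I. \<exists>j\<in>I. jac \<kappa> I (e \<circ> F) i j s \<noteq> \<zero>\<^bsub>mpoly \<kappa> I\<^esub>)"
proof -
  interpret K: field K by fact
  let ?V = "K\<lparr>carrier := V\<rparr>"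
  note VE = subringE[OF V]
  interpret V: cring ?V using K.subcring_iff K.subcringI'[OF V] VE(1) by blast
  interpret m: ideal m ?V by fact
  interpret k: field \<kappa> unfolding \<kappa>_def by fact
  interpret i: ring_hom_cring R K \<iota> by (rule ring_hom_cringI[OF is_cring K.is_cring i])
  have iV': "\<iota> \<in> ring_hom R ?V" using i iV by (auto simp: ring_hom_def)
  interpret iV: ring_hom_cring R ?V \<iota> by (rule ring_hom_cringI[OF is_cring V.is_cring iV'])
  have idh: "id \<in> ring_hom ?V K" using VE(1) by (auto simp: ring_hom_def)
  interpret id: ring_hom_cring ?V K id by (rule ring_hom_cringI[OF V.is_cring K.is_cring idh])
  define \<pi> where "\<pi> = (+>\<^bsub>K\<lparr>carrier := V\<rparr>\<^esub>) m"
  interpret p: ring_hom_cring ?V \<kappa> \<pi> unfolding \<kappa>_def \<pi>_def by (rule m.quot_hom_cring[OF V.is_cring])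
  have e: "e = \<pi> \<circ> \<iota>" by (simp add: e_def \<pi>_def)
  have eh: "e \<in> ring_hom R \<kappa>" unfolding e by (rule ring_hom_trans[OF iV' p.homh])
  interpret G: grad_poly \<kappa> I "e \<circ> F" "\<lambda>i. e \<circ> b i" by (rule hom_grad_poly[OF k.is_cring eh])
  interpret B: cring B by (rule mpoly_cring)
  interpret BK: cring "mpoly K I" by (rule K.mpoly_cring)
  have mV: "m \<subseteq> V" using m.a_subset by simp
  have val: "y \<in> V \<or> inv\<^bsub>K\<^esub> y \<in> V" if "y \<in> carrier K" for y using inv[OF that] mV by blast
  have to_V: "q \<in> carrier (mpoly ?V J)" if "q \<in> carrier (mpoly K J)" "\<And>l. q l \<in> V" for q :: "'d multiset \<Rightarrow> _" and J
    using that K.mpoly_finite_support[OF that(1)] K.mpoly_support_subset[OF that(1)] by (intro V.mpoly_carrierI) auto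
  define Cs where "Cs = {jac R I F i j \<tau> l | i j l. i \<in> I \<and> j \<in> I}"
  have CsR: "Cs \<subseteq> carrier R" using mpoly_coeff_closed[OF jac_closed[OF F \<tau>(1)]] by (auto simp: Cs_def)
  define J where "J = genideal R Cs"
  have J: "ideal J R" unfolding J_def by (rule genideal_ideal[OF CsR])
  have "jac_lifts J" by (rule noetherian_jac_lifts[OF noeth J])
  moreover have "Cs \<subseteq> J" unfolding J_def by (rule genideal_self[OF CsR])
  hence "\<forall>i\<in>I. \<forall>j\<in>I. \<forall>l. jac R I F i j \<tau> l \<in> J" by (auto simp: Cs_def)
  ultimately obtain u where u: "u \<in> fspan R I F" "\<And>l. \<tau> l \<ominus> u l \<in> J" unfolding jac_lifts_def using \<tau>(1) by blast
  note uc = fspan_closed[OF F u(1)]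
  define h where "h = \<tau> \<ominus>\<^bsub>B\<^esub> u"
  have hc: "h \<in> carrier B" unfolding h_def using \<tau>(1) uc by simp
  have hJ: "h l \<in> J" for l using u(2)[of l] unfolding h_def mpoly_minus[OF \<tau>(1) uc] .
  have \<tau>h: "\<tau> = u \<oplus>\<^bsub>B\<^esub> h" unfolding h_def using \<tau>(1) uc by (simp add: B.minus_eq B.a_lcomm[of u] B.r_neg)
  \<comment> \<open>\<open>C\<close> is a finite set of generators of \<open>J V\<close>, from which
    \<open>t\<close> is chosen so that it divides all of them in \<open>V\<close>. It is nonempty
    because the given \<open>D\<^sub>i\<^sub>j \<tau>\<close> does not vanish over
    \<open>K\<close>.\<close>
  define C where "C = \<iota> ` Cs - {\<zero>\<^bsub>K\<^esub>}"
  have "C \<subseteq> (\<Union>i\<in>I. \<Union>j\<in>I. (\<lambda>l. \<iota> (jac R I F i j \<tau> l)) ` {l. jac R I F i j \<tau> l \<noteq> \<zero>})"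
  proof
    fix c assume "c \<in> C"
    then obtain i j l where ijl: "i \<in> I" "j \<in> I" "c = \<iota> (jac R I F i j \<tau> l)" "c \<noteq> \<zero>\<^bsub>K\<^esub>" unfolding C_def Cs_def by blast
    hence "jac R I F i j \<tau> l \<noteq> \<zero>" by auto
    thus "c \<in> (\<Union>i\<in>I. \<Union>j\<in>I. (\<lambda>l. \<iota> (jac R I F i j \<tau> l)) ` {l. jac R I F i j \<tau> l \<noteq> \<zero>})" using ijl by blast
  qed
  hence finC: "finite C"
    by (rule finite_subset) (use finite_I mpoly_finite_support[OF jac_closed[OF F \<tau>(1)]] in auto)
  have jK: "jac K I (\<iota> \<circ> F) i j (\<iota> \<circ> \<tau>) = \<iota> \<circ> jac R I F i j \<tau>" for i j by (rule i.comp_jac[OF F \<tau>(1), symmetric])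
  have "\<exists>l. \<iota> (jac R I F i1 j1 \<tau> l) \<noteq> \<zero>\<^bsub>K\<^esub>"
    using nz(3) unfolding jK by (auto simp: K.mpoly_zero fun_eq_iff)
  then obtain l where l: "\<iota> (jac R I F i1 j1 \<tau> l) \<noteq> \<zero>\<^bsub>K\<^esub>" by blast
  have "jac R I F i1 j1 \<tau> l \<in> Cs" using nz(1,2) unfolding Cs_def by blast
  hence neC: "C \<noteq> {}" using l unfolding C_def by blast
  have CK: "C \<subseteq> carrier K - {\<zero>\<^bsub>K\<^esub>}" using CsR by (auto simp: C_def)
  have "\<exists>t\<in>C. \<forall>c\<in>C. inv\<^bsub>K\<^esub> t \<otimes>\<^bsub>K\<^esub> c \<in> V"
    by (rule K.valuation_maximum[OF VE(6) VE(3) VE(1) val finC neC CK])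
  then obtain t where t: "t \<in> C" "\<And>c. c \<in> C \<Longrightarrow> inv\<^bsub>K\<^esub> t \<otimes>\<^bsub>K\<^esub> c \<in> V" by blast
  have tK: "t \<in> carrier K" "t \<noteq> \<zero>\<^bsub>K\<^esub>" using t(1) CK by auto
  hence tU: "t \<in> Units K" by (simp add: K.field_Units)
  \<comment> \<open>The condition cuts out an ideal of \<open>R\<close>, so it is enough to check it
    on the generators in \<open>Cs\<close>.\<close>
  have tJ: "inv\<^bsub>K\<^esub> t \<otimes>\<^bsub>K\<^esub> \<iota> r \<in> V" if "r \<in> J" for r
  proof -
    let ?J = "{r \<in> carrier R. inv\<^bsub>K\<^esub> t \<otimes>\<^bsub>K\<^esub> \<iota> r \<in> V}"
    have "ideal ?J R"
    proof (rule idealI[OF cring.axioms(1)[OF is_cring]])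
      show "subgroup ?J (add_monoid R)"
      proof (rule add.subgroupI)
        show "?J \<noteq> {}" using tU VE(2) by (auto intro!: exI[of _ \<zero>])
        fix a assume a: "a \<in> ?J"
        thus "\<ominus> a \<in> ?J" using tU VE(5)[of "inv\<^bsub>K\<^esub> t \<otimes>\<^bsub>K\<^esub> \<iota> a"] by (simp add: K.r_minus)
      next
        fix a c assume "a \<in> ?J" "c \<in> ?J"
        thus "a \<oplus> c \<in> ?J" using tU VE(7)[of "inv\<^bsub>K\<^esub> t \<otimes>\<^bsub>K\<^esub> \<iota> a" "inv\<^bsub>K\<^esub> t \<otimes>\<^bsub>K\<^esub> \<iota> c"] by (simp add: K.r_distr)
      qed auto
      fix a c assume ac: "a \<in> ?J" "c \<in> carrier R"
      have "inv\<^bsub>K\<^esub> t \<otimes>\<^bsub>K\<^esub> (\<iota> c \<otimes>\<^bsub>K\<^esub> \<iota> a) = \<iota> c \<otimes>\<^bsub>K\<^esub> (inv\<^bsub>K\<^esub> t \<otimes>\<^bsub>K\<^esub> \<iota> a)" using ac tU by (simp add: K.m_lcomm)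
      thus 1: "c \<otimes> a \<in> ?J" using ac VE(6)[OF iV[OF ac(2)]] by simp
      thus "a \<otimes> c \<in> ?J" using ac by (simp add: m_comm)
    qed
    moreover have "Cs \<subseteq> ?J"
    proof
      fix c assume c: "c \<in> Cs"
      show "c \<in> ?J"
      proof (cases "\<iota> c = \<zero>\<^bsub>K\<^esub>")
        case True
        thus ?thesis using c CsR tU VE(2) by auto
      next
        case False
        thus ?thesis using c CsR t(2)[of "\<iota> c"] by (auto simp: C_def)
      qed
    qed
    ultimately have "J \<subseteq> ?J" unfolding J_def by (rule genideal_minimal)
    thus ?thesis using that by blast
  qed
  have ih: "\<iota> \<circ> h \<in> carrier (mpoly K I)" by (rule i.comp_closed[OF hc])
  define s where "s = mconst K (inv\<^bsub>K\<^esub> t) \<otimes>\<^bsub>mpoly K I\<^esub> (\<iota> \<circ> h)"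
  have ct: "mconst K (inv\<^bsub>K\<^esub> t) \<in> carrier (mpoly K I)" using tU by auto
  have sK: "s \<in> carrier (mpoly K I)" unfolding s_def using ct ih by simp
  have sl: "s l = inv\<^bsub>K\<^esub> t \<otimes>\<^bsub>K\<^esub> \<iota> (h l)" for l
    unfolding s_def using K.mconst_mult[of "inv\<^bsub>K\<^esub> t" "\<iota> \<circ> h" I] tU hc by auto
  have sV: "s \<in> carrier (mpoly ?V I)" by (rule to_V[OF sK]) (simp add: sl tJ[OF hJ])
  have FV: "\<iota> \<circ> F \<in> carrier (mpoly ?V I)" by (rule iV.comp_closed[OF F])
  have FK: "\<iota> \<circ> F \<in> carrier (mpoly K I)" by (rule i.comp_closed[OF F])
  have hts: "\<iota> \<circ> h = mconst K t \<otimes>\<^bsub>mpoly K I\<^esub> s" unfolding s_def by (rule K.mconst_inverse(2)[OF tK ih, symmetric])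
  have jh: "jac R I F i j h = jac R I F i j \<tau>" for i j
    unfolding \<tau>h jac_add[OF F uc hc] jac_fspan[OF F u(1)] using F hc by simp
  have js: "jac ?V I (\<iota> \<circ> F) i j s l = inv\<^bsub>K\<^esub> t \<otimes>\<^bsub>K\<^esub> \<iota> (jac R I F i j \<tau> l)" for i j l
  proof -
    have "jac ?V I (\<iota> \<circ> F) i j s = jac K I (\<iota> \<circ> F) i j s" using id.comp_jac[OF FV sV, of i j] by simp
    also have "\<dots> = mconst K (inv\<^bsub>K\<^esub> t) \<otimes>\<^bsub>mpoly K I\<^esub> jac K I (\<iota> \<circ> F) i j (\<iota> \<circ> h)"
      unfolding s_def using tU by (intro K.jac_scale[OF FK ih]) simp
    also have "jac K I (\<iota> \<circ> F) i j (\<iota> \<circ> h) = \<iota> \<circ> jac R I F i j \<tau>"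
      unfolding i.comp_jac[OF F hc, symmetric] jh ..
    finally have eq: "jac ?V I (\<iota> \<circ> F) i j s = mconst K (inv\<^bsub>K\<^esub> t) \<otimes>\<^bsub>mpoly K I\<^esub> (\<iota> \<circ> jac R I F i j \<tau>)" .
    have "mconst K (inv\<^bsub>K\<^esub> t) \<otimes>\<^bsub>mpoly K I\<^esub> (\<iota> \<circ> jac R I F i j \<tau>) =
        (\<lambda>m. inv\<^bsub>K\<^esub> t \<otimes>\<^bsub>K\<^esub> (\<iota> \<circ> jac R I F i j \<tau>) m)"
      by (rule K.mconst_mult) (use tU mpoly_coeff_closed[OF jac_closed[OF F \<tau>(1), of i j]] in auto)
    thus ?thesis by (simp only: eq comp_apply)
  qed
  \<comment> \<open>\<open>t\<close> is itself one of the coefficients, so after division by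
    \<open>t\<close> one coefficient of \<open>D\<^sub>i\<^sub>j s\<close> equals \<open>1\<close>
    and survives in \<kappa>.\<close>
  obtain i0 j0 l0 where ijl: "i0 \<in> I" "j0 \<in> I" "\<iota> (jac R I F i0 j0 \<tau> l0) = t" using t(1) by (auto simp: C_def Cs_def)
  define s1 where "s1 = \<pi> \<circ> s"
  have s1: "s1 \<in> carrier (mpoly \<kappa> I)" unfolding s1_def by (rule p.comp_closed[OF sV])
  have nz1: "jac \<kappa> I (e \<circ> F) i0 j0 s1 \<noteq> \<zero>\<^bsub>mpoly \<kappa> I\<^esub>"
  proof
    assume z: "jac \<kappa> I (e \<circ> F) i0 j0 s1 = \<zero>\<^bsub>mpoly \<kappa> I\<^esub>"
    have "\<pi> \<circ> jac ?V I (\<iota> \<circ> F) i0 j0 s = \<zero>\<^bsub>mpoly \<kappa> I\<^esub>"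
      unfolding p.comp_jac[OF FV sV] using z by (simp only: s1_def e o_assoc)
    from fun_cong[OF this, of l0] have "\<pi> (inv\<^bsub>K\<^esub> t \<otimes>\<^bsub>K\<^esub> t) = \<zero>\<^bsub>\<kappa>\<^esub>" by (simp add: js ijl k.mpoly_zero)
    thus False using tU p.hom_one by simp
  qed
  \<comment> \<open>\<open>h\<close> is fixed because both \<tau> and the polynomials in
    \<open>F\<close> are; scaling by a constant and reduction to \<kappa> commute with the
    retraction.\<close>
  have rs: "retr \<kappa> e s1 = s1"
  proof -
    have "retr R id u = u" by (rule retr_fspan[OF is_cring id_ring_hom]) (use u in simp)
    hence "mev R B (mconst R) x u = u" by (simp add: retr_def)
    interpret P: poly_eval R B "mconst R" I x by (rule poly_eval_mconst[OF x])
    interpret PP: ring_hom_cring B B P.ev by (rule ring_hom_cringI[OF mpoly_cring mpoly_cring P.ev_hom])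
    have "P.ev h = h" unfolding h_def B.minus_eq using \<tau> uc \<open>P.ev u = u\<close> by simp
    hence "retr K \<iota> (\<iota> \<circ> h) = \<iota> \<circ> h" using retr_natural[OF K.is_cring i hc] by simp
    hence "retr K \<iota> s = s" unfolding s_def ring_hom_mult[OF retr_hom[OF K.is_cring i] ct ih]
      using tU by (simp only: retr_const[OF K.is_cring i] K.Units_inv_closed)
    hence "retr ?V \<iota> s = s" using retr_comp[OF V.is_cring K.is_cring iV' idh sV] by simp
    thus ?thesis using retr_comp[OF V.is_cring k.is_cring iV' p.homh sV] unfolding s1_def e by simp
  qed
  have gs: "e \<circ> x i \<in> gen2 \<kappa> I (e \<circ> F) s1" if i: "i \<in> I" for i
  proof -
    have "\<iota> \<circ> \<tau> = (\<iota> \<circ> u) \<oplus>\<^bsub>mpoly K I\<^esub> mconst K t \<otimes>\<^bsub>mpoly K I\<^esub> s"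
      unfolding \<tau>h ring_hom_add[OF i.comp_hom uc hc] hts ..
    also have "\<dots> \<in> gen2 K I (\<iota> \<circ> F) s"
      by (intro K.gen2_add[OF FK sK] K.gen2_mult[OF FK sK] K.gen2_const[OF FK sK tK(1)] K.gen2_s[OF FK sK]
          K.fspan_subset_gen2[OF FK sK] i.comp_fspan[OF F u(1)])
    finally have "\<iota> \<circ> x i \<in> gen2 K I (\<iota> \<circ> F) s"
      using g[OF i] K.gen2_subset[OF FK sK K.gen2_F[OF FK sK]] by blast
    then obtain q where q: "q \<in> carrier (mpoly K {1..2::nat})" "\<iota> \<circ> x i = ev2 K I (\<iota> \<circ> F) s q"
      unfolding gen2_def by blast
    \<comment> \<open>Including \<open>1\<close> keeps the set nonempty, and a chosen
      \<open>t2\<close> outside \<open>V\<close> is then an actual coefficient of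
      \<open>q\<close>.\<close>
    let ?T = "insert \<one>\<^bsub>K\<^esub> (q ` {l. q l \<noteq> \<zero>\<^bsub>K\<^esub>})"
    have "\<exists>t\<in>?T. \<forall>c\<in>?T. inv\<^bsub>K\<^esub> t \<otimes>\<^bsub>K\<^esub> c \<in> V"
      using K.mpoly_finite_support[OF q(1)] q(1)
      by (intro K.valuation_maximum[OF VE(6) VE(3) VE(1) val]) auto
    then obtain t2 where t2: "t2 \<in> ?T" "\<And>c. c \<in> ?T \<Longrightarrow> inv\<^bsub>K\<^esub> t2 \<otimes>\<^bsub>K\<^esub> c \<in> V" by blast
    have t2U: "t2 \<in> Units K" using t2(1) q(1) by (auto simp: K.field_Units)
    have qV': "inv\<^bsub>K\<^esub> t2 \<otimes>\<^bsub>K\<^esub> q l \<in> V" for l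
      using t2(2)[of "q l"] t2U VE(2) by (cases "q l = \<zero>\<^bsub>K\<^esub>") auto
    \<comment> \<open>Otherwise \<open>q / t2\<close> has coefficients in \<open>V\<close>, one of
      them equal to \<open>1\<close>, while its value \<open>x i / t2\<close> has all its
      coefficients in \<open>m\<close>.\<close>
    have t2V: "t2 \<in> V"
    proof (rule ccontr)
      assume n: "t2 \<notin> V"
      have im: "inv\<^bsub>K\<^esub> t2 \<in> m" by (rule inv[OF _ n]) (use t2U in auto)
      have ne: "t2 \<noteq> \<one>\<^bsub>K\<^esub>" using n VE(3) by auto
      then obtain l1 where l1: "q l1 = t2" using t2(1) by auto
      define q' where "q' = mconst K (inv\<^bsub>K\<^esub> t2) \<otimes>\<^bsub>mpoly K {1..2::nat}\<^esub> q"
      have q'l: "q' l = inv\<^bsub>K\<^esub> t2 \<otimes>\<^bsub>K\<^esub> q l" for l unfolding q'_def using t2U q(1) by (simp add: K.mconst_mult)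
      have q'K: "q' \<in> carrier (mpoly K {1..2::nat})" unfolding q'_def using t2U q(1) by (intro K.mpoly_mult_closed) auto
      have q'V: "q' \<in> carrier (mpoly ?V {1..2::nat})" by (rule to_V[OF q'K]) (simp add: q'l qV')
      interpret E: poly_eval K "mpoly K I" "mconst K" "{1..2}" "\<lambda>j::nat. if j = 1 then \<iota> \<circ> F else s"
        by (rule K.poly_eval_gen2[OF FK sK])
      have "ev2 ?V I (\<iota> \<circ> F) s q' = ev2 K I (\<iota> \<circ> F) s q'" using id.comp_ev2[OF FV sV q'V] by (simp only: id_comp)
      also have "\<dots> = mconst K (inv\<^bsub>K\<^esub> t2) \<otimes>\<^bsub>mpoly K I\<^esub> (\<iota> \<circ> x i)"
        unfolding q'_def q(2) using t2U q(1) by (intro E.ev_const_mult) auto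
      finally have ev: "ev2 ?V I (\<iota> \<circ> F) s q' l = inv\<^bsub>K\<^esub> t2 \<otimes>\<^bsub>K\<^esub> \<iota> (x i l)" for l
        using t2U x_closed[OF i] by (simp add: K.mconst_mult)
      have "\<pi> \<circ> ev2 ?V I (\<iota> \<circ> F) s q' = \<zero>\<^bsub>mpoly \<kappa> I\<^esub>"
      proof
        fix l
        have xl: "\<iota> (x i l) \<in> carrier ?V" using x_closed[OF i] by (simp add: iV)
        have "inv\<^bsub>K\<^esub> t2 \<otimes>\<^bsub>K\<^esub> \<iota> (x i l) \<in> m" using m.I_r_closed[OF im xl] by simp
        hence "\<pi> (inv\<^bsub>K\<^esub> t2 \<otimes>\<^bsub>K\<^esub> \<iota> (x i l)) = \<zero>\<^bsub>\<kappa>\<^esub>"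
          unfolding \<pi>_def \<kappa>_def using m.quot_eq_zero_iff[of "inv\<^bsub>K\<^esub> t2 \<otimes>\<^bsub>K\<^esub> \<iota> (x i l)"] mV by auto
        thus "(\<pi> \<circ> ev2 ?V I (\<iota> \<circ> F) s q') l = \<zero>\<^bsub>mpoly \<kappa> I\<^esub> l"
          by (simp only: comp_apply ev k.mpoly_zero)
      qed
      hence z: "ev2 \<kappa> I (e \<circ> F) s1 (\<pi> \<circ> q') = \<zero>\<^bsub>mpoly \<kappa> I\<^esub>"
        unfolding p.comp_ev2[OF FV sV q'V] by (simp only: s1_def e o_assoc)
      have "(\<pi> \<circ> q') l1 = \<zero>\<^bsub>\<kappa>\<^esub>"
        by (rule G.ev_pair_zero[OF k.domain_axioms s1 ijl(1,2) nz1 p.comp_closed[OF q'V] z])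
      thus False using t2U p.hom_one by (simp add: q'l l1)
    qed
    have "q l \<in> V" for l
    proof -
      have "q l = t2 \<otimes>\<^bsub>K\<^esub> (inv\<^bsub>K\<^esub> t2 \<otimes>\<^bsub>K\<^esub> q l)"
        using t2U K.Units_closed[OF t2U] K.mpoly_coeff_closed[OF q(1), of l] K.m_assoc[of t2 "inv\<^bsub>K\<^esub> t2" "q l"] by simp
      thus ?thesis using VE(6)[OF t2V qV'[of l]] by simp
    qed
    hence qV: "q \<in> carrier (mpoly ?V {1..2::nat})" by (rule to_V[OF q(1)])
    have "\<iota> \<circ> x i = ev2 ?V I (\<iota> \<circ> F) s q" unfolding q(2) using id.comp_ev2[OF FV sV qV] by (simp only: id_comp)
    hence "\<iota> \<circ> x i \<in> gen2 ?V I (\<iota> \<circ> F) s" unfolding gen2_def using qV by blast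
    from p.comp_gen2[OF FV sV this] show ?thesis by (simp only: s1_def e o_assoc)
  qed
  show ?thesis using s1 rs gs nz1 ijl(1,2) by blast
qed

end

section \<open>Descent of a coordinate along a linear retraction\<close>

locale linear_retraction = e: ring_hom_cring R K e + r: ring_hom_cring R k \<rho>
  for R :: "('a, 'm) ring_scheme" and K :: "('c, 'n) ring_scheme" and k :: "('d, 'o) ring_scheme" and e \<rho> +
  fixes l :: "'c \<Rightarrow> 'd"
  assumes l_closed: "x \<in> carrier K \<Longrightarrow> l x \<in> carrier k" and l_one: "l \<one>\<^bsub>K\<^esub> = \<one>\<^bsub>k\<^esub>"
    and l_add: "x \<in> carrier K \<Longrightarrow> y \<in> carrier K \<Longrightarrow> l (x \<oplus>\<^bsub>K\<^esub> y) = l x \<oplus>\<^bsub>k\<^esub> l y"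
    and l_smult: "r \<in> carrier R \<Longrightarrow> x \<in> carrier K \<Longrightarrow> l (e r \<otimes>\<^bsub>K\<^esub> x) = \<rho> r \<otimes>\<^bsub>k\<^esub> l x"
begin

lemma l_zero: "l \<zero>\<^bsub>K\<^esub> = \<zero>\<^bsub>k\<^esub>"
  using l_smult[of "\<zero>\<^bsub>R\<^esub>" "\<zero>\<^bsub>K\<^esub>"] l_closed[of "\<zero>\<^bsub>K\<^esub>"] by simp

lemma l_e: "r \<in> carrier R \<Longrightarrow> l (e r) = \<rho> r"
  using l_smult[of r "\<one>\<^bsub>K\<^esub>"] l_one by simp

lemma l_finsum: "finite A \<Longrightarrow> f \<in> A \<rightarrow> carrier K \<Longrightarrow> l (finsum K f A) = finsum k (\<lambda>a. l (f a)) A"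
proof (induction A rule: finite_induct)
  case (insert a A)
  hence fa: "f a \<in> carrier K" "f \<in> A \<rightarrow> carrier K" by auto
  have "l (f a \<oplus>\<^bsub>K\<^esub> finsum K f A) = l (f a) \<oplus>\<^bsub>k\<^esub> finsum k (\<lambda>a. l (f a)) A"
    using fa insert.IH by (simp add: l_add)
  moreover have "(\<lambda>a. l (f a)) \<in> A \<rightarrow> carrier k" using fa(2) l_closed by auto
  ultimately show ?case using insert.hyps fa l_closed[OF fa(1)] by (simp add: e.S.finsum_insert r.S.finsum_insert)
qed (simp add: l_zero)

lemma comp_l_closed:
  assumes p: "p \<in> carrier (mpoly K I)" shows "l \<circ> p \<in> carrier (mpoly k I)"
proof (rule r.S.mpoly_carrierI)
  have nz: "p m \<noteq> \<zero>\<^bsub>K\<^esub>" if "(l \<circ> p) m \<noteq> \<zero>\<^bsub>k\<^esub>" for m using that l_zero by auto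
  have "{m. (l \<circ> p) m \<noteq> \<zero>\<^bsub>k\<^esub>} \<subseteq> {m. p m \<noteq> \<zero>\<^bsub>K\<^esub>}" using nz by blast
  thus "finite {m. (l \<circ> p) m \<noteq> \<zero>\<^bsub>k\<^esub>}" using e.S.mpoly_finite_support[OF p] by (rule finite_subset)
  show "set_mset m \<subseteq> I" if "(l \<circ> p) m \<noteq> \<zero>\<^bsub>k\<^esub>" for m using e.S.mpoly_support_subset[OF p nz[OF that]] .
qed (use p l_closed in auto)

lemma comp_l_add:
  "p \<in> carrier (mpoly K I) \<Longrightarrow> q \<in> carrier (mpoly K I) \<Longrightarrow> l \<circ> (p \<oplus>\<^bsub>mpoly K I\<^esub> q) = (l \<circ> p) \<oplus>\<^bsub>mpoly k I\<^esub> (l \<circ> q)"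
  by (auto simp: e.S.mpoly_add r.S.mpoly_add l_add)

lemma comp_l_const: "l \<circ> mconst K a = mconst k (l a)"
  by (auto simp: e.S.indexed_const_def r.S.indexed_const_def l_zero)

lemma comp_l_comp: "p \<in> carrier (mpoly R I) \<Longrightarrow> l \<circ> (e \<circ> p) = \<rho> \<circ> p"
  by (auto simp: l_e)

text \<open>\<open>l\<close> is not multiplicative, but it is linear over \<open>R\<close>, so it
  respects multiplication by polynomials with coefficients in \<open>R\<close>. That is enough for
  evaluation at a point defined over \<open>R\<close> and for the Jacobian derivations of a
  polynomial \<open>F\<close> over \<open>R\<close>.\<close>

lemma comp_l_mult:
  assumes p: "p \<in> carrier (mpoly K I)" and q: "q \<in> carrier (mpoly R I)"
  shows "l \<circ> (p \<otimes>\<^bsub>mpoly K I\<^esub> (e \<circ> q)) = (l \<circ> p) \<otimes>\<^bsub>mpoly k I\<^esub> (\<rho> \<circ> q)"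
proof
  fix m
  have "l (finsum K (\<lambda>j. p j \<otimes>\<^bsub>K\<^esub> e (q (m - j))) {j. j \<subseteq># m}) = finsum k (\<lambda>j. l (p j \<otimes>\<^bsub>K\<^esub> e (q (m - j)))) {j. j \<subseteq># m}"
    using p q by (intro l_finsum) auto
  also have "\<dots> = finsum k (\<lambda>j. l (p j) \<otimes>\<^bsub>k\<^esub> \<rho> (q (m - j))) {j. j \<subseteq># m}"
    using p q l_closed by (intro r.S.finsum_cong') (auto simp: e.S.m_comm[of "p _"] r.S.m_comm[of "l (p _)"] l_smult)
  finally show "(l \<circ> (p \<otimes>\<^bsub>mpoly K I\<^esub> (e \<circ> q))) m = ((l \<circ> p) \<otimes>\<^bsub>mpoly k I\<^esub> (\<rho> \<circ> q)) m"
    by (simp add: e.S.mpoly_mult r.S.mpoly_mult)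
qed

lemma comp_l_ev:
  assumes f: "\<And>j. j \<in> J \<Longrightarrow> f j \<in> carrier (mpoly R I)" and q: "q \<in> carrier (mpoly K J)"
  shows "l \<circ> mev K (mpoly K I) (mconst K) (\<lambda>j. e \<circ> f j) q = mev k (mpoly k I) (mconst k) (\<lambda>j. \<rho> \<circ> f j) (l \<circ> q)"
proof -
  interpret E: poly_eval K "mpoly K I" "mconst K" J "\<lambda>j. e \<circ> f j"
    by (rule e.S.poly_eval_mconst) (use f in auto)
  interpret E': poly_eval k "mpoly k I" "mconst k" J "\<lambda>j. \<rho> \<circ> f j"
    by (rule r.S.poly_eval_mconst) (use f in auto)
  show ?thesis using q
  proof (induction q rule: e.S.mpoly_induct)
    case (const a)
    thus ?case by (simp only: E.ev_const comp_l_const E'.ev_const l_closed)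
  next
    case (add p q)
    thus ?case
      by (simp only: E.ev_add comp_l_add E.ev_closed E'.ev_add comp_l_closed)
  next
    case (var p j)
    have vK: "mvar K j = e \<circ> mvar R j" and vk: "mvar k j = \<rho> \<circ> mvar R j" by simp_all
    have vR: "mvar R j \<in> carrier (mpoly R J)" using var(2) by (rule e.R.mvar_closed)
    have "E.ev (p \<otimes>\<^bsub>mpoly K J\<^esub> mvar K j) = E.ev p \<otimes>\<^bsub>mpoly K I\<^esub> (e \<circ> f j)"
      using var ring_hom_mult[OF E.ev_hom var(1) e.S.mvar_closed[OF var(2)]] E.ev_var[OF var(2)] by simp
    hence "l \<circ> E.ev (p \<otimes>\<^bsub>mpoly K J\<^esub> mvar K j) = (l \<circ> E.ev p) \<otimes>\<^bsub>mpoly k I\<^esub> (\<rho> \<circ> f j)"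
      by (simp only: comp_l_mult[OF E.ev_closed[OF var(1)] f[OF var(2)]])
    also have "\<dots> = E'.ev (l \<circ> p) \<otimes>\<^bsub>mpoly k I\<^esub> E'.ev (mvar k j)"
      by (simp only: var(3) E'.ev_var[OF var(2)])
    also have "\<dots> = E'.ev ((l \<circ> p) \<otimes>\<^bsub>mpoly k J\<^esub> mvar k j)"
      by (rule ring_hom_mult[OF E'.ev_hom comp_l_closed[OF var(1)] r.S.mvar_closed[OF var(2)], symmetric])
    also have "(l \<circ> p) \<otimes>\<^bsub>mpoly k J\<^esub> mvar k j = l \<circ> (p \<otimes>\<^bsub>mpoly K J\<^esub> mvar K j)"
      unfolding vK vk by (rule comp_l_mult[OF var(1) vR, symmetric])
    finally show ?case .
  qed
qed

lemma comp_l_add_pow: "x \<in> carrier K \<Longrightarrow> l (add_pow K (n::nat) x) = add_pow k n (l x)"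
  by (induction n) (auto simp: l_zero l_add l_closed)

lemma comp_l_pd: "p \<in> carrier (mpoly K I) \<Longrightarrow> l \<circ> partial_deriv K i p = partial_deriv k i (l \<circ> p)"
  by (auto simp: partial_deriv_def comp_l_add_pow simp del: e.S.add.nat_pow_Suc r.S.add.nat_pow_Suc)

lemma comp_l_jac:
  assumes F: "F \<in> carrier (mpoly R I)" and p: "p \<in> carrier (mpoly K I)"
  shows "l \<circ> jac K I (e \<circ> F) i j p = jac k I (\<rho> \<circ> F) i j (l \<circ> p)"
proof -
  interpret BK: cring "mpoly K I" by (rule e.S.mpoly_cring)
  interpret Bk: cring "mpoly k I" by (rule r.S.mpoly_cring)
  have eF: "e \<circ> F \<in> carrier (mpoly K I)" "\<rho> \<circ> F \<in> carrier (mpoly k I)" using F by auto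
  have lp: "l \<circ> p \<in> carrier (mpoly k I)" by (rule comp_l_closed[OF p])
  have one: "l \<circ> (partial_deriv K i (e \<circ> F) \<otimes>\<^bsub>mpoly K I\<^esub> partial_deriv K j p) =
      partial_deriv k i (\<rho> \<circ> F) \<otimes>\<^bsub>mpoly k I\<^esub> partial_deriv k j (l \<circ> p)" for i j
  proof -
    have "l \<circ> (partial_deriv K j p \<otimes>\<^bsub>mpoly K I\<^esub> (e \<circ> partial_deriv R i F)) =
       (l \<circ> partial_deriv K j p) \<otimes>\<^bsub>mpoly k I\<^esub> (\<rho> \<circ> partial_deriv R i F)"
      using F p by (intro comp_l_mult) auto
    thus ?thesis unfolding e.comp_pd[OF F] r.comp_pd[OF F] comp_l_pd[OF p]
      using BK.m_comm[OF e.S.pd_closed[OF eF(1)] e.S.pd_closed[OF p]] Bk.m_comm[OF r.S.pd_closed[OF eF(2)] r.S.pd_closed[OF lp]]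
      by simp
  qed
  have minus: "l \<circ> (a \<ominus>\<^bsub>mpoly K I\<^esub> c) = (l \<circ> a) \<ominus>\<^bsub>mpoly k I\<^esub> (l \<circ> c)"
    if a: "a \<in> carrier (mpoly K I)" and c: "c \<in> carrier (mpoly K I)" for a c
  proof -
    have d: "a \<ominus>\<^bsub>mpoly K I\<^esub> c \<in> carrier (mpoly K I)" using a c by simp
    have "a = (a \<ominus>\<^bsub>mpoly K I\<^esub> c) \<oplus>\<^bsub>mpoly K I\<^esub> c" using a c by (simp add: BK.minus_eq BK.a_assoc BK.l_neg)
    hence "l \<circ> a = (l \<circ> (a \<ominus>\<^bsub>mpoly K I\<^esub> c)) \<oplus>\<^bsub>mpoly k I\<^esub> (l \<circ> c)" using comp_l_add[OF d c] by simp
    thus ?thesis using comp_l_closed[OF d] comp_l_closed[OF c] by (simp add: Bk.minus_eq Bk.a_assoc Bk.r_neg)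
  qed
  show ?thesis unfolding jac_def
    using minus[OF BK.m_closed[OF e.S.pd_closed[OF eF(1)] e.S.pd_closed[OF p]] BK.m_closed[OF e.S.pd_closed[OF eF(1)] e.S.pd_closed[OF p]]]
    by (simp only: one)
qed

end

context retract_data
begin

text \<open>Scaling \<open>s\<close> so that some coefficient of some
  \<open>D\<^sub>i\<^sub>j s\<close> is \<open>1\<close>, applying \<open>l\<close> and clearing
  denominators yields \<tau> in \<open>A\<close> with \<open>D\<^sub>i\<^sub>j \<tau>\<close>
  nonzero over \<open>k\<close>. It generates: over \<open>K\<close> one has
  \<open>D\<^sub>i\<^sub>j \<tau> = w D\<^sub>i\<^sub>j s\<close>, while by construction the left
  side has no monomial outside the support of \<open>D\<^sub>i\<^sub>j s\<close>; so
  \<open>w\<close> is constant, and \<tau> is a nonzero multiple of \<open>s\<close> plus a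
  polynomial in \<open>F\<close>. Hence \<open>x i\<close> is over \<open>K\<close> a polynomial in
  \<open>F\<close> and \<tau>, both defined over \<open>R\<close>, and \<open>l\<close> moves its
  coefficients to \<open>k\<close>.\<close>

lemma descent:
  assumes K: "field K" and k: "field k" and e: "e \<in> ring_hom R K" and \<rho>: "\<rho> \<in> ring_hom R k"
    and ker: "\<And>r. r \<in> carrier R \<Longrightarrow> e r = \<zero>\<^bsub>K\<^esub> \<longleftrightarrow> \<rho> r = \<zero>\<^bsub>k\<^esub>"
    and frac: "\<And>c. c \<in> carrier k \<Longrightarrow> \<exists>a\<in>carrier R. \<exists>d\<in>carrier R. \<rho> d \<noteq> \<zero>\<^bsub>k\<^esub> \<and> \<rho> d \<otimes>\<^bsub>k\<^esub> c = \<rho> a"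
    and s: "s \<in> carrier (mpoly K I)" "retr K e s = s"
    and g: "\<And>i. i \<in> I \<Longrightarrow> e \<circ> x i \<in> gen2 K I (e \<circ> F) s"
    and nz: "i1 \<in> I" "j1 \<in> I" "jac K I (e \<circ> F) i1 j1 s \<noteq> \<zero>\<^bsub>mpoly K I\<^esub>"
  shows "\<exists>\<tau>\<in>carrier B. mev R B (mconst R) x \<tau> = \<tau> \<and> (\<forall>i\<in>I. \<rho> \<circ> x i \<in> gen2 k I (\<rho> \<circ> F) (\<rho> \<circ> \<tau>)) \<and>
     (\<exists>i\<in>I. \<exists>j\<in>I. jac k I (\<rho> \<circ> F) i j (\<rho> \<circ> \<tau>) \<noteq> \<zero>\<^bsub>mpoly k I\<^esub>)"
proof -
  interpret K: field K by fact
  interpret k: field k by fact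
  obtain l where l: "l \<in> carrier K \<rightarrow> carrier k" "l \<one>\<^bsub>K\<^esub> = \<one>\<^bsub>k\<^esub>"
     "\<And>x y. x \<in> carrier K \<Longrightarrow> y \<in> carrier K \<Longrightarrow> l (x \<oplus>\<^bsub>K\<^esub> y) = l x \<oplus>\<^bsub>k\<^esub> l y"
     "\<And>r x. r \<in> carrier R \<Longrightarrow> x \<in> carrier K \<Longrightarrow> l (e r \<otimes>\<^bsub>K\<^esub> x) = \<rho> r \<otimes>\<^bsub>k\<^esub> l x"
    using linear_retraction_exists[OF is_cring K.is_cring k e \<rho> ker] by blast
  interpret l: linear_retraction R K k e \<rho> l
    by (intro linear_retraction.intro ring_hom_cringI is_cring K.is_cring k.is_cring e \<rho> linear_retraction_axioms.intro)
      (use l in auto)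
  interpret G: grad_poly K I "e \<circ> F" "\<lambda>i. e \<circ> b i" by (rule hom_grad_poly[OF K.is_cring e])
  interpret BK: "domain" "mpoly K I" by (rule K.mpoly_domain)
  interpret Bk: "domain" "mpoly k I" by (rule k.mpoly_domain)
  have eF: "e \<circ> F \<in> carrier (mpoly K I)" "\<rho> \<circ> F \<in> carrier (mpoly k I)" using F by auto
  obtain l1 where l1: "jac K I (e \<circ> F) i1 j1 s l1 \<noteq> \<zero>\<^bsub>K\<^esub>" using nz(3) by (auto simp: K.mpoly_zero fun_eq_iff)
  \<comment> \<open>The scaling makes the coefficient at \<open>l1\<close> equal to
    \<open>1\<close>, which \<open>l\<close> maps to \<open>1\<close>; without it \<open>l\<close>
    might kill every coefficient.\<close>
  define \<mu> where "\<mu> = inv\<^bsub>K\<^esub> (jac K I (e \<circ> F) i1 j1 s l1)"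
  have jc: "jac K I (e \<circ> F) i j s \<in> carrier (mpoly K I)" for i j by (rule K.jac_closed[OF eF(1) s(1)])
  have jU: "jac K I (e \<circ> F) i1 j1 s l1 \<in> Units K" using l1 K.mpoly_coeff_closed[OF jc] by (simp add: K.field_Units)
  have \<mu>: "\<mu> \<in> carrier K" unfolding \<mu>_def using jU by simp
  have \<mu>c: "mconst K \<mu> \<in> carrier (mpoly K I)" using \<mu> by simp
  define s2 where "s2 = l \<circ> (mconst K \<mu> \<otimes>\<^bsub>mpoly K I\<^esub> s)"
  have \<mu>s: "mconst K \<mu> \<otimes>\<^bsub>mpoly K I\<^esub> s \<in> carrier (mpoly K I)" using \<mu>c s(1) by simp
  have s2: "s2 \<in> carrier (mpoly k I)" unfolding s2_def by (rule l.comp_l_closed[OF \<mu>s])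
  have j2: "jac k I (\<rho> \<circ> F) i j s2 m = l (\<mu> \<otimes>\<^bsub>K\<^esub> jac K I (e \<circ> F) i j s m)" for i j m
  proof -
    have "jac k I (\<rho> \<circ> F) i j s2 = l \<circ> (mconst K \<mu> \<otimes>\<^bsub>mpoly K I\<^esub> jac K I (e \<circ> F) i j s)"
      unfolding s2_def l.comp_l_jac[OF F \<mu>s, symmetric] K.jac_scale[OF eF(1) s(1) \<mu>] ..
    also have "mconst K \<mu> \<otimes>\<^bsub>mpoly K I\<^esub> jac K I (e \<circ> F) i j s = (\<lambda>m. \<mu> \<otimes>\<^bsub>K\<^esub> jac K I (e \<circ> F) i j s m)"
      by (rule K.mconst_mult[OF \<mu> K.mpoly_coeff_closed[OF jc]])
    finally have eq: "jac k I (\<rho> \<circ> F) i j s2 = l \<circ> (\<lambda>m. \<mu> \<otimes>\<^bsub>K\<^esub> jac K I (e \<circ> F) i j s m)" .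
    show ?thesis by (rule fun_cong[OF eq, of m, unfolded comp_apply[of l]])
  qed
  have "retr k \<rho> s2 = l \<circ> retr K e (mconst K \<mu> \<otimes>\<^bsub>mpoly K I\<^esub> s)"
    unfolding retr_def s2_def by (rule l.comp_l_ev[OF x_closed \<mu>s, symmetric])
  also have "retr K e (mconst K \<mu> \<otimes>\<^bsub>mpoly K I\<^esub> s) = mconst K \<mu> \<otimes>\<^bsub>mpoly K I\<^esub> s"
    unfolding ring_hom_mult[OF retr_hom[OF K.is_cring e] \<mu>c s(1)] s(2) retr_const[OF K.is_cring e \<mu>] ..
  finally have rs2: "retr k \<rho> s2 = s2" unfolding s2_def .
  obtain \<tau> d where \<tau>: "\<tau> \<in> carrier B" "d \<in> carrier R" "mev R B (mconst R) x \<tau> = \<tau>"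
    "\<rho> d \<noteq> \<zero>\<^bsub>k\<^esub>" "\<rho> \<circ> \<tau> = mconst k (\<rho> d) \<otimes>\<^bsub>mpoly k I\<^esub> s2"
    using scale_to_base[OF k.domain_axioms \<rho> frac s2 rs2] by blast
  have rd: "\<rho> d \<in> carrier k" using \<tau>(2) by simp
  have jt: "jac k I (\<rho> \<circ> F) i j (\<rho> \<circ> \<tau>) m = \<rho> d \<otimes>\<^bsub>k\<^esub> l (\<mu> \<otimes>\<^bsub>K\<^esub> jac K I (e \<circ> F) i j s m)" for i j m
  proof -
    have "mconst k (\<rho> d) \<otimes>\<^bsub>mpoly k I\<^esub> jac k I (\<rho> \<circ> F) i j s2 = (\<lambda>m. \<rho> d \<otimes>\<^bsub>k\<^esub> jac k I (\<rho> \<circ> F) i j s2 m)"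
      by (rule k.mconst_mult[OF rd k.mpoly_coeff_closed[OF k.jac_closed[OF eF(2) s2]]])
    thus ?thesis unfolding \<tau>(5) k.jac_scale[OF eF(2) s2 rd] by (simp only: j2)
  qed
  have "jac k I (\<rho> \<circ> F) i1 j1 (\<rho> \<circ> \<tau>) l1 = \<rho> d"
    unfolding jt using jU rd by (simp add: \<mu>_def l(2))
  hence nzk: "jac k I (\<rho> \<circ> F) i1 j1 (\<rho> \<circ> \<tau>) \<noteq> \<zero>\<^bsub>mpoly k I\<^esub>" using \<tau>(4) by (auto simp: k.mpoly_zero)
  have et: "e \<circ> \<tau> \<in> carrier (mpoly K I)" using \<tau>(1) by auto
  have "retr K e (e \<circ> \<tau>) = e \<circ> \<tau>" using retr_natural[OF K.is_cring e \<tau>(1)] \<tau>(3) by simp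
  hence "e \<circ> \<tau> \<in> gen2 K I (e \<circ> F) s" using fixed_gen2[OF K.is_cring e s(1) g et] by blast
  then obtain q where q: "q \<in> carrier (mpoly K {1..2::nat})" "e \<circ> \<tau> = ev2 K I (e \<circ> F) s q" unfolding gen2_def by blast
  interpret E: poly_eval K "mpoly K I" "mconst K" "{1..2}" "\<lambda>j::nat. if j = 1 then e \<circ> F else s"
    by (rule K.poly_eval_gen2[OF eF(1) s(1)])
  define w where "w = ev2 K I (e \<circ> F) s (partial_deriv K 2 q)"
  have w: "w \<in> carrier (mpoly K I)" unfolding w_def by (rule E.ev_closed[OF K.pd_closed[OF q(1)]])
  have jw: "jac K I (e \<circ> F) i j (e \<circ> \<tau>) = w \<otimes>\<^bsub>mpoly K I\<^esub> jac K I (e \<circ> F) i j s" for i j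
    unfolding q(2) w_def by (rule G.jac_ev_pair[OF s(1) q(1)])
  have jet: "jac K I (e \<circ> F) i j (e \<circ> \<tau>) m = e (jac R I F i j \<tau> m)" for i j m
    unfolding l.e.comp_jac[OF F \<tau>(1), symmetric] by simp
  have jrt: "jac k I (\<rho> \<circ> F) i j (\<rho> \<circ> \<tau>) m = \<rho> (jac R I F i j \<tau> m)" for i j m
    unfolding l.r.comp_jac[OF F \<tau>(1), symmetric] by simp
  \<comment> \<open>Both coefficients are images of the same element of \<open>R\<close>, and
    \<open>e\<close> and \<rho> have the same kernel.\<close>
  have jiff: "jac K I (e \<circ> F) i j (e \<circ> \<tau>) m = \<zero>\<^bsub>K\<^esub> \<longleftrightarrow> jac k I (\<rho> \<circ> F) i j (\<rho> \<circ> \<tau>) m = \<zero>\<^bsub>k\<^esub>" for i j m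
    unfolding jet jrt by (rule ker[OF mpoly_coeff_closed[OF jac_closed[OF F \<tau>(1)]]])
  have supp: "jac K I (e \<circ> F) i j s m \<noteq> \<zero>\<^bsub>K\<^esub>" if "jac K I (e \<circ> F) i j (e \<circ> \<tau>) m \<noteq> \<zero>\<^bsub>K\<^esub>" for i j m
    using that unfolding jiff jt using rd \<mu> l.l_zero by auto
  have "jac K I (e \<circ> F) i1 j1 (e \<circ> \<tau>) \<noteq> \<zero>\<^bsub>mpoly K I\<^esub>"
    using nzk jiff by (auto simp: K.mpoly_zero k.mpoly_zero fun_eq_iff)
  hence wnz: "w \<noteq> \<zero>\<^bsub>mpoly K I\<^esub>" unfolding jw using jc by auto
  obtain mw where mw: "w mw \<noteq> \<zero>\<^bsub>K\<^esub>" "\<And>m'. mw < m' \<Longrightarrow> w m' = \<zero>\<^bsub>K\<^esub>" using K.mpoly_lead_exists[OF w wnz] by blast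
  obtain ms where ms: "jac K I (e \<circ> F) i1 j1 s ms \<noteq> \<zero>\<^bsub>K\<^esub>" "\<And>m'. ms < m' \<Longrightarrow> jac K I (e \<circ> F) i1 j1 s m' = \<zero>\<^bsub>K\<^esub>"
    using K.mpoly_lead_exists[OF jc nz(3)] by blast
  \<comment> \<open>Leading monomials add up, so a nonconstant leading monomial of \<open>w\<close>
    would push \<open>D\<^sub>i\<^sub>j \<tau>\<close> outside the support of
    \<open>D\<^sub>i\<^sub>j s\<close>.\<close>
  have "jac K I (e \<circ> F) i1 j1 (e \<circ> \<tau>) (mw + ms) = w mw \<otimes>\<^bsub>K\<^esub> jac K I (e \<circ> F) i1 j1 s ms"
    unfolding jw by (rule K.mpoly_lead_mult[OF w jc mw(2) ms(2)])
  also have "\<dots> \<noteq> \<zero>\<^bsub>K\<^esub>" using mw(1) ms(1) w jc[of i1 j1] by (simp add: K.integral_iff)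
  finally have "\<not> ms < mw + ms" using supp ms(2) by blast
  hence mw0: "mw = {#}" by (metis add.left_neutral add_less_cancel_right le_multiset_empty_left)
  define c where "c = w {#}"
  have c: "c \<in> carrier K" "c \<noteq> \<zero>\<^bsub>K\<^esub>" using mw(1) w unfolding mw0 c_def by auto
  have wc: "w = mconst K c"
  proof
    fix m show "w m = mconst K c m"
      using mw(2)[of m] unfolding mw0 c_def by (cases "m = {#}") auto
  qed
  define y where "y = (e \<circ> \<tau>) \<ominus>\<^bsub>mpoly K I\<^esub> mconst K c \<otimes>\<^bsub>mpoly K I\<^esub> s"
  have cs: "mconst K c \<otimes>\<^bsub>mpoly K I\<^esub> s \<in> carrier (mpoly K I)" using c s(1) by simp
  have y: "y \<in> carrier (mpoly K I)" unfolding y_def using et cs by simp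
  have ety: "e \<circ> \<tau> = y \<oplus>\<^bsub>mpoly K I\<^esub> mconst K c \<otimes>\<^bsub>mpoly K I\<^esub> s"
    unfolding y_def using et cs by (simp add: BK.minus_eq BK.a_assoc BK.l_neg)
  \<comment> \<open>All Jacobian derivations kill \<open>y\<close>, so over the field
    \<open>K\<close> it is a polynomial in \<open>F\<close>.\<close>
  have "y \<in> fspan K I (e \<circ> F)"
  proof (rule G.domain_jac_zero_imp_fspan[OF K.domain_axioms y])
    fix i j
    have "jac K I (e \<circ> F) i j (e \<circ> \<tau>) = jac K I (e \<circ> F) i j y \<oplus>\<^bsub>mpoly K I\<^esub> mconst K c \<otimes>\<^bsub>mpoly K I\<^esub> jac K I (e \<circ> F) i j s"
      unfolding ety K.jac_add[OF eF(1) y cs] K.jac_scale[OF eF(1) s(1) c(1)] ..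
    hence "mconst K c \<otimes>\<^bsub>mpoly K I\<^esub> jac K I (e \<circ> F) i j s = jac K I (e \<circ> F) i j y \<oplus>\<^bsub>mpoly K I\<^esub> mconst K c \<otimes>\<^bsub>mpoly K I\<^esub> jac K I (e \<circ> F) i j s"
      unfolding jw wc .
    thus "jac K I (e \<circ> F) i j y = \<zero>\<^bsub>mpoly K I\<^esub>"
      using K.jac_closed[OF eF(1) y, of i j] jc[of i j] mconst_closed c(1)
      by (metis BK.add.r_cancel_one BK.m_closed K.mconst_closed)
  qed
  hence yg: "y \<in> gen2 K I (e \<circ> F) (e \<circ> \<tau>)" by (rule K.fspan_subset_gen2[OF eF(1) et])
  have cU: "inv\<^bsub>K\<^esub> c \<in> carrier K" using c K.field_Units by simp
  have "s = mconst K (inv\<^bsub>K\<^esub> c) \<otimes>\<^bsub>mpoly K I\<^esub> ((e \<circ> \<tau>) \<oplus>\<^bsub>mpoly K I\<^esub> mconst K (\<ominus>\<^bsub>K\<^esub> \<one>\<^bsub>K\<^esub>) \<otimes>\<^bsub>mpoly K I\<^esub> y)"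
  proof -
    have "mconst K (\<ominus>\<^bsub>K\<^esub> \<one>\<^bsub>K\<^esub>) \<otimes>\<^bsub>mpoly K I\<^esub> y = \<ominus>\<^bsub>mpoly K I\<^esub> y"
      unfolding K.mconst_mult[OF K.a_inv_closed[OF K.one_closed] K.mpoly_coeff_closed[OF y]] K.mpoly_uminus[OF y]
      using K.mpoly_coeff_closed[OF y] by (simp add: K.l_minus)
    moreover have "(e \<circ> \<tau>) \<oplus>\<^bsub>mpoly K I\<^esub> \<ominus>\<^bsub>mpoly K I\<^esub> y = mconst K c \<otimes>\<^bsub>mpoly K I\<^esub> s"
      unfolding ety using y cs by (simp add: BK.a_comm[of y] BK.a_assoc BK.r_neg)
    ultimately show ?thesis by (simp only: K.mconst_inverse(1)[OF c s(1)])
  qed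
  also have "\<dots> \<in> gen2 K I (e \<circ> F) (e \<circ> \<tau>)"
    by (intro K.gen2_mult[OF eF(1) et] K.gen2_add[OF eF(1) et] K.gen2_const[OF eF(1) et] K.gen2_s[OF eF(1) et] yg cU K.a_inv_closed K.one_closed)
  finally have sg: "gen2 K I (e \<circ> F) s \<subseteq> gen2 K I (e \<circ> F) (e \<circ> \<tau>)"
    by (rule K.gen2_subset[OF eF(1) et K.gen2_F[OF eF(1) et]])
  have "\<rho> \<circ> x i \<in> gen2 k I (\<rho> \<circ> F) (\<rho> \<circ> \<tau>)" if i: "i \<in> I" for i
  proof -
    obtain q where q: "q \<in> carrier (mpoly K {1..2::nat})" "e \<circ> x i = ev2 K I (e \<circ> F) (e \<circ> \<tau>) q"
      using g[OF i] sg unfolding gen2_def by blast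
    have eta: "(\<lambda>j::nat. if j = 1 then e \<circ> F else e \<circ> \<tau>) = (\<lambda>j. e \<circ> (if j = 1 then F else \<tau>))"
      "(\<lambda>j::nat. if j = 1 then \<rho> \<circ> F else \<rho> \<circ> \<tau>) = (\<lambda>j. \<rho> \<circ> (if j = 1 then F else \<tau>))" by auto
    have "\<rho> \<circ> x i = l \<circ> (e \<circ> x i)" by (rule l.comp_l_comp[OF x_closed[OF i], symmetric])
    also have "\<dots> = mev k (mpoly k I) (mconst k) (\<lambda>j. \<rho> \<circ> (if j = 1 then F else \<tau>)) (l \<circ> q)"
      unfolding q(2) eta by (rule l.comp_l_ev[OF _ q(1)]) (use F \<tau>(1) in auto)
    finally show ?thesis unfolding gen2_def eta using l.comp_l_closed[OF q(1)] by blast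
  qed
  thus ?thesis using \<tau>(1,3) nzk nz(1,2) by blast
qed

text \<open>The only link assumed between \<open>K\<close> and \<open>k\<close> is that the kernel
  of \<iota> lies in that of \<rho>. A valuation ring of \<open>K\<close> over this specialization
  supplies a residue field in which a coordinate exists, and the descent leads from there to
  \<open>k\<close>.\<close>

theorem coordinate_specialization:
  assumes noeth: "noetherian_ring R" and K: "field K" and k: "field k"
    and i: "\<iota> \<in> ring_hom R K" and \<rho>: "\<rho> \<in> ring_hom R k"
    and ker: "\<And>r. r \<in> carrier R \<Longrightarrow> \<iota> r = \<zero>\<^bsub>K\<^esub> \<Longrightarrow> \<rho> r = \<zero>\<^bsub>k\<^esub>"
    and fracK: "\<And>c. c \<in> carrier K \<Longrightarrow> \<exists>a\<in>carrier R. \<exists>d\<in>carrier R. \<iota> d \<noteq> \<zero>\<^bsub>K\<^esub> \<and> \<iota> d \<otimes>\<^bsub>K\<^esub> c = \<iota> a"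
    and frack: "\<And>c. c \<in> carrier k \<Longrightarrow> \<exists>a\<in>carrier R. \<exists>d\<in>carrier R. \<rho> d \<noteq> \<zero>\<^bsub>k\<^esub> \<and> \<rho> d \<otimes>\<^bsub>k\<^esub> c = \<rho> a"
    and s: "s \<in> carrier (mpoly K I)" "retr K \<iota> s = s"
    and g: "\<And>i. i \<in> I \<Longrightarrow> \<iota> \<circ> x i \<in> gen2 K I (\<iota> \<circ> F) s"
    and ns: "s \<notin> fspan K I (\<iota> \<circ> F)"
  shows "\<exists>\<tau>\<in>carrier B. mev R B (mconst R) x \<tau> = \<tau> \<and> (\<forall>i\<in>I. \<rho> \<circ> x i \<in> gen2 k I (\<rho> \<circ> F) (\<rho> \<circ> \<tau>)) \<and>
     (\<exists>i\<in>I. \<exists>j\<in>I. jac k I (\<rho> \<circ> F) i j (\<rho> \<circ> \<tau>) \<noteq> \<zero>\<^bsub>mpoly k I\<^esub>)"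
proof -
  interpret K: field K by fact
  interpret k: field k by fact
  interpret i: ring_hom_cring R K \<iota> by (rule ring_hom_cringI[OF is_cring K.is_cring i])
  interpret G: grad_poly K I "\<iota> \<circ> F" "\<lambda>i. \<iota> \<circ> b i" by (rule hom_grad_poly[OF K.is_cring i])
  interpret BK: "domain" "mpoly K I" by (rule K.mpoly_domain)
  have iF: "\<iota> \<circ> F \<in> carrier (mpoly K I)" using F by auto
  \<comment> \<open>The contrapositive of the kernel computation over a domain: outside
    \<open>K[F]\<close> some Jacobian derivation is nonzero.\<close>
  obtain i1 j1 where nz: "i1 \<in> I" "j1 \<in> I" "jac K I (\<iota> \<circ> F) i1 j1 s \<noteq> \<zero>\<^bsub>mpoly K I\<^esub>"
    using G.domain_jac_zero_imp_fspan[OF K.domain_axioms s(1)] ns by blast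
  obtain \<tau> d where \<tau>: "\<tau> \<in> carrier B" "d \<in> carrier R" "mev R B (mconst R) x \<tau> = \<tau>"
    "\<iota> d \<noteq> \<zero>\<^bsub>K\<^esub>" "\<iota> \<circ> \<tau> = mconst K (\<iota> d) \<otimes>\<^bsub>mpoly K I\<^esub> s"
    using scale_to_base[OF K.domain_axioms i fracK s] by blast
  have id: "\<iota> d \<in> carrier K" using \<tau>(2) by simp
  have it: "\<iota> \<circ> \<tau> \<in> carrier (mpoly K I)" using \<tau>(1) by auto
  have dc: "mconst K (\<iota> d) \<noteq> \<zero>\<^bsub>mpoly K I\<^esub>"
  proof
    assume "mconst K (\<iota> d) = \<zero>\<^bsub>mpoly K I\<^esub>"
    from fun_cong[OF this, of "{#}"] show False using \<tau>(4) by (simp add: K.mpoly_zero)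
  qed
  have nz': "jac K I (\<iota> \<circ> F) i1 j1 (\<iota> \<circ> \<tau>) \<noteq> \<zero>\<^bsub>mpoly K I\<^esub>"
    unfolding \<tau>(5) K.jac_scale[OF iF s(1) id]
    using nz(3) dc BK.integral_iff[OF K.mconst_closed[OF id] K.jac_closed[OF iF s(1)]] by blast
  have di: "inv\<^bsub>K\<^esub> \<iota> d \<in> carrier K" using \<tau>(4) id K.field_Units by simp
  have "s = mconst K (inv\<^bsub>K\<^esub> \<iota> d) \<otimes>\<^bsub>mpoly K I\<^esub> (\<iota> \<circ> \<tau>)"
    unfolding \<tau>(5) by (rule K.mconst_inverse(1)[OF id \<tau>(4) s(1), symmetric])
  also have "\<dots> \<in> gen2 K I (\<iota> \<circ> F) (\<iota> \<circ> \<tau>)"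
    by (intro K.gen2_mult[OF iF it] K.gen2_const[OF iF it di] K.gen2_s[OF iF it])
  finally have g': "\<iota> \<circ> x i \<in> gen2 K I (\<iota> \<circ> F) (\<iota> \<circ> \<tau>)" if "i \<in> I" for i
    using g[OF that] K.gen2_subset[OF iF it K.gen2_F[OF iF it]] by blast
  obtain V m where V: "subring V K" "ideal m (K\<lparr>carrier := V\<rparr>)" "field ((K\<lparr>carrier := V\<rparr>) Quot m)"
    "\<And>r. r \<in> carrier R \<Longrightarrow> \<iota> r \<in> V" "\<And>r. r \<in> carrier R \<Longrightarrow> \<iota> r \<in> m \<longleftrightarrow> \<rho> r = \<zero>\<^bsub>k\<^esub>"
    "\<And>x. x \<in> carrier K \<Longrightarrow> x \<notin> V \<Longrightarrow> inv\<^bsub>K\<^esub> x \<in> m"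
    using residue_field_exists[OF is_cring K k i \<rho> ker] by blast
  let ?V = "K\<lparr>carrier := V\<rparr>"
  let ?e = "(+>\<^bsub>K\<lparr>carrier := V\<rparr>\<^esub>) m \<circ> \<iota>"
  interpret V: cring ?V using K.subcring_iff K.subcringI'[OF V(1)] subringE(1)[OF V(1)] by blast
  interpret m: ideal m ?V by fact
  have iV: "\<iota> \<in> ring_hom R ?V" using i V(4) by (auto simp: ring_hom_def)
  have e: "?e \<in> ring_hom R (?V Quot m)" by (rule ring_hom_trans[OF iV m.rcos_ring_hom])
  have ke: "?e r = \<zero>\<^bsub>?V Quot m\<^esub> \<longleftrightarrow> \<rho> r = \<zero>\<^bsub>k\<^esub>" if "r \<in> carrier R" for r
    using m.quot_eq_zero_iff[of "\<iota> r"] V(4,5) that by simp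
  obtain s1 i0 j0 where s1: "s1 \<in> carrier (mpoly (?V Quot m) I)" "retr (?V Quot m) ?e s1 = s1"
    "\<And>i. i \<in> I \<Longrightarrow> ?e \<circ> x i \<in> gen2 (?V Quot m) I (?e \<circ> F) s1"
    "i0 \<in> I" "j0 \<in> I" "jac (?V Quot m) I (?e \<circ> F) i0 j0 s1 \<noteq> \<zero>\<^bsub>mpoly (?V Quot m) I\<^esub>"
    using residue_step[OF noeth K i V(1,2,3,4,6) \<tau>(1,3) g' nz(1,2) nz'] by blast
  show ?thesis by (rule descent[OF V(3) k e \<rho> ke frack s1])
qed

end

section \<open>Minimal primes\<close>

lemma (in cring) minimal_prime_exists:
  assumes P: "primeideal P R"
  shows "\<exists>Q. minimal_prime Q R \<and> Q \<subseteq> P"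
proof -
  \<comment> \<open>Complements are used so that a minimal prime becomes a maximal element for
    Zorn's lemma; the union of a chain of complements is the complement of an intersection of
    primes, which is prime along a chain.\<close>
  define A where "A = {carrier R - Q | Q. primeideal Q R \<and> Q \<subseteq> P}"
  have "\<exists>M\<in>A. \<forall>Y\<in>A. M \<subseteq> Y \<longrightarrow> Y = M"
  proof (rule subset_Zorn_nonempty)
    show "A \<noteq> {}" using P unfolding A_def by blast
    fix C assume C: "C \<noteq> {}" "subset.chain A C"
    define Q where "Q = carrier R - \<Union>C"
    have prime: "\<exists>Q'. primeideal Q' R \<and> Q' \<subseteq> P \<and> Y = carrier R - Q'" if "Y \<in> C" for Y
      using C(2) that unfolding A_def subset_chain_def by blast
    have total: "X1 \<subseteq> X2 \<or> X2 \<subseteq> X1" if "X1 \<in> C" "X2 \<in> C" for X1 X2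
      using C(2) that unfolding subset_chain_def by blast
    have iff: "a \<in> Q \<longleftrightarrow> a \<in> carrier R \<and> (\<forall>Q'. primeideal Q' R \<and> carrier R - Q' \<in> C \<longrightarrow> a \<in> Q')" for a
    proof
      assume "a \<in> Q" thus "a \<in> carrier R \<and> (\<forall>Q'. primeideal Q' R \<and> carrier R - Q' \<in> C \<longrightarrow> a \<in> Q')"
        unfolding Q_def by blast
    next
      assume r: "a \<in> carrier R \<and> (\<forall>Q'. primeideal Q' R \<and> carrier R - Q' \<in> C \<longrightarrow> a \<in> Q')"
      have "a \<notin> Y" if YC: "Y \<in> C" for Y
      proof -
        obtain Q' where "primeideal Q' R" "Y = carrier R - Q'" using prime[OF YC] by blast
        thus ?thesis using r YC by blast
      qed
      thus "a \<in> Q" using r unfolding Q_def by blast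
    qed
    obtain Y0 where Y0: "Y0 \<in> C" using C(1) by blast
    then obtain Q0 where Q0: "primeideal Q0 R" "Q0 \<subseteq> P" "Y0 = carrier R - Q0" using prime by blast
    have QQ0: "Q \<subseteq> Q0" using iff Q0 Y0 by blast
    have id: "ideal Q' R" if "primeideal Q' R" for Q' using that by (rule primeideal.axioms(1))
    have idl: "ideal Q R"
    proof (rule idealI[OF ring_axioms])
      show "subgroup Q (add_monoid R)"
      proof (rule add.subgroupI)
        show "Q \<subseteq> carrier R" unfolding Q_def by blast
        have "\<zero> \<in> Q" unfolding iff using additive_subgroup.zero_closed[OF ideal.axioms(1)[OF id]] by auto
        thus "Q \<noteq> {}" by blast
        show "\<ominus> a \<in> Q" if "a \<in> Q" for a
          using that unfolding iff using additive_subgroup.a_inv_closed[OF ideal.axioms(1)[OF id]] by auto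
        show "a \<oplus> c \<in> Q" if "a \<in> Q" "c \<in> Q" for a c
          using that unfolding iff using additive_subgroup.a_closed[OF ideal.axioms(1)[OF id]] by auto
      qed
      show "y \<otimes> a \<in> Q" "a \<otimes> y \<in> Q" if "a \<in> Q" "y \<in> carrier R" for a y
        using that unfolding iff using ideal.I_l_closed[OF id] ideal.I_r_closed[OF id] by auto
    qed
    have "primeideal Q R"
    proof (rule primeidealI[OF idl is_cring])
      show "carrier R \<noteq> Q" using QQ0 primeideal.I_notcarr[OF Q0(1)] ideal.Icarr[OF id[OF Q0(1)]] by blast
      fix a c assume ac: "a \<in> carrier R" "c \<in> carrier R" "a \<otimes> c \<in> Q"
      show "a \<in> Q \<or> c \<in> Q"
      proof (rule ccontr)
        assume n: "\<not> (a \<in> Q \<or> c \<in> Q)"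
        then obtain Y1 Y2 where Y: "Y1 \<in> C" "a \<in> Y1" "Y2 \<in> C" "c \<in> Y2" using ac unfolding Q_def by blast
        then obtain Y where YC: "Y \<in> C" "a \<in> Y" "c \<in> Y" using total[OF Y(1,3)] by blast
        obtain Q' where Q': "primeideal Q' R" "Y = carrier R - Q'" using prime[OF YC(1)] by blast
        have "a \<otimes> c \<in> Q'" using ac(3) Q' YC(1) unfolding iff by blast
        thus False using primeideal.I_prime[OF Q'(1) ac(1,2)] YC Q' by blast
      qed
    qed
    moreover have "Q \<subseteq> P" using QQ0 Q0(2) by blast
    moreover have "\<Union>C \<subseteq> carrier R" using prime by blast
    hence "\<Union>C = carrier R - Q" unfolding Q_def by blast
    ultimately show "\<Union>C \<in> A" unfolding A_def by blast
  qed
  then obtain M where M: "M \<in> A" "\<And>Y. Y \<in> A \<Longrightarrow> M \<subseteq> Y \<Longrightarrow> Y = M" by blast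
  then obtain Q where Q: "primeideal Q R" "Q \<subseteq> P" "M = carrier R - Q" unfolding A_def by blast
  have "Q' = Q" if Q': "primeideal Q' R" "Q' \<subseteq> Q" for Q'
  proof -
    have "carrier R - Q' \<in> A" using Q' Q(2) unfolding A_def by blast
    from M(2)[OF this] have "carrier R - Q' = carrier R - Q" using Q' Q(3) by blast
    moreover have "Q \<subseteq> carrier R" "Q' \<subseteq> carrier R"
      using ideal.Icarr[OF primeideal.axioms(1)[OF Q(1)]] ideal.Icarr[OF primeideal.axioms(1)[OF Q'(1)]] by blast+
    ultimately show ?thesis by blast
  qed
  thus ?thesis using Q unfolding minimal_prime_def by blast
qed

section \<open>Localization and residue fields\<close>

locale mult_set = cring R for R :: "('a, 'm) ring_scheme" (structure) +
  fixes S :: "'a set"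
  assumes S_sub: "S \<subseteq> carrier R" and S_one: "\<one> \<in> S" and S_mult: "\<And>s t. s \<in> S \<Longrightarrow> t \<in> S \<Longrightarrow> s \<otimes> t \<in> S"
begin

lemma S_closed [simp]: "s \<in> S \<Longrightarrow> s \<in> carrier R" using S_sub by auto

lemma frac_rel_equiv: "equiv (carrier R \<times> S) (frac_rel R S)"
proof (rule equivI)
  show "frac_rel R S \<subseteq> (carrier R \<times> S) \<times> (carrier R \<times> S)" by (auto simp: frac_rel_def)
  show "refl_on (carrier R \<times> S) (frac_rel R S)"
    using S_one by (auto simp: refl_on_def frac_rel_def)
  show "sym (frac_rel R S)" by (auto simp: sym_def frac_rel_def) (metis)
  show "trans (frac_rel R S)"
  proof (rule transI)
    fix x y z assume "(x, y) \<in> frac_rel R S" "(y, z) \<in> frac_rel R S"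
    then obtain r s r' s' r'' s'' t t' where e: "x = (r, s)" "y = (r', s')" "z = (r'', s'')"
      "r \<in> carrier R" "r' \<in> carrier R" "r'' \<in> carrier R" "s \<in> S" "s' \<in> S" "s'' \<in> S" "t \<in> S" "t' \<in> S"
      "t \<otimes> (r \<otimes> s') = t \<otimes> (r' \<otimes> s)" "t' \<otimes> (r' \<otimes> s'') = t' \<otimes> (r'' \<otimes> s')"
      by (auto simp: frac_rel_def)
    \<comment> \<open>The middle denominator \<open>s'\<close> has to be part of the witness, as it
      cannot be cancelled.\<close>
    have "(t \<otimes> t' \<otimes> s') \<otimes> (r \<otimes> s'') = (t' \<otimes> s'') \<otimes> (t \<otimes> (r \<otimes> s'))" using e(4-11) by (simp add: m_ac)
    also have "\<dots> = (t \<otimes> s) \<otimes> (t' \<otimes> (r' \<otimes> s''))" unfolding e(12) using e(4-11) by (simp add: m_ac)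
    also have "\<dots> = (t \<otimes> t' \<otimes> s') \<otimes> (r'' \<otimes> s)" unfolding e(13) using e(4-11) by (simp add: m_ac)
    finally show "(x, z) \<in> frac_rel R S" using e S_mult by (auto simp: frac_rel_def)
  qed
qed

lemma frac_eq_iff:
  assumes "r \<in> carrier R" "s \<in> S" "r' \<in> carrier R" "s' \<in> S"
  shows "frac R S r s = frac R S r' s' \<longleftrightarrow> (\<exists>t\<in>S. t \<otimes> (r \<otimes> s') = t \<otimes> (r' \<otimes> s))"
  unfolding frac_def using assms by (subst eq_equiv_class_iff[OF frac_rel_equiv]) (auto simp: frac_rel_def)

lemma frac_eqI:
  assumes "r \<in> carrier R" "s \<in> S" "r' \<in> carrier R" "s' \<in> S" "r \<otimes> s' = r' \<otimes> s"
  shows "frac R S r s = frac R S r' s'"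
  using assms S_one by (auto simp: frac_eq_iff)

lemma mem_fracD: "(a, b) \<in> frac R S r s \<Longrightarrow> a \<in> carrier R \<and> b \<in> S \<and> (\<exists>t\<in>S. t \<otimes> (r \<otimes> b) = t \<otimes> (a \<otimes> s))"
  by (auto simp: frac_def frac_rel_def)

lemma mem_frac_self: "r \<in> carrier R \<Longrightarrow> s \<in> S \<Longrightarrow> (r, s) \<in> frac R S r s"
  using S_one by (auto simp: frac_def frac_rel_def)

lemma localization_simps:
  "carrier (localization R S) = (carrier R \<times> S) // frac_rel R S"
  "\<one>\<^bsub>localization R S\<^esub> = frac R S \<one> \<one>" "\<zero>\<^bsub>localization R S\<^esub> = frac R S \<zero> \<one>"
  by (simp_all add: localization_def)

lemma frac_closed [simp]: "r \<in> carrier R \<Longrightarrow> s \<in> S \<Longrightarrow> frac R S r s \<in> carrier (localization R S)"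
  by (simp add: localization_simps frac_def quotientI)

lemma localization_cases:
  assumes "x \<in> carrier (localization R S)"
  obtains r s where "r \<in> carrier R" "s \<in> S" "x = frac R S r s"
  using assms by (auto simp: localization_simps frac_def elim!: quotientE)

text \<open>The product is defined as a union over all representatives; the rule holds because every
  pair of representatives contributes the same class.\<close>

lemma frac_mult:
  assumes rs: "r \<in> carrier R" "s \<in> S" "r' \<in> carrier R" "s' \<in> S"
  shows "frac R S r s \<otimes>\<^bsub>localization R S\<^esub> frac R S r' s' = frac R S (r \<otimes> r') (s \<otimes> s')"
proof -
  have eq: "frac R S (a \<otimes> c) (b \<otimes> d) = frac R S (r \<otimes> r') (s \<otimes> s')"
    if m: "(a, b) \<in> frac R S r s" "(c, d) \<in> frac R S r' s'" for a b c d
  proof -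
    obtain t t' where t: "t \<in> S" "t' \<in> S" "t \<otimes> (r \<otimes> b) = t \<otimes> (a \<otimes> s)" "t' \<otimes> (r' \<otimes> d) = t' \<otimes> (c \<otimes> s')"
      and c: "a \<in> carrier R" "b \<in> S" "c \<in> carrier R" "d \<in> S"
      using mem_fracD[OF m(1)] mem_fracD[OF m(2)] by blast
    have "(t \<otimes> t') \<otimes> ((a \<otimes> c) \<otimes> (s \<otimes> s')) = (t \<otimes> (a \<otimes> s)) \<otimes> (t' \<otimes> (c \<otimes> s'))" using rs c t(1,2) by (simp add: m_ac)
    also have "\<dots> = (t \<otimes> (r \<otimes> b)) \<otimes> (t' \<otimes> (r' \<otimes> d))" by (simp only: t(3,4))
    also have "\<dots> = (t \<otimes> t') \<otimes> ((r \<otimes> r') \<otimes> (b \<otimes> d))" using rs c t(1,2) by (simp add: m_ac)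
    finally show ?thesis using S_mult rs c t(1,2) by (subst frac_eq_iff) auto
  qed
  have "(\<Union>(r', s')\<in>frac R S r' s'. frac R S (a \<otimes> r') (b \<otimes> s')) = frac R S (r \<otimes> r') (s \<otimes> s')"
    if "(a, b) \<in> frac R S r s" for a b
    by (rule UN_constant_eq[OF mem_frac_self[OF rs(3,4)]]) (use eq[OF that] in auto)
  hence "(\<Union>(r, s)\<in>frac R S r s. \<Union>(r', s')\<in>frac R S r' s'. frac R S (r \<otimes> r') (s \<otimes> s')) = frac R S (r \<otimes> r') (s \<otimes> s')"
    by (intro UN_constant_eq[OF mem_frac_self[OF rs(1,2)]]) auto
  thus ?thesis by (simp add: localization_def)
qed

lemma frac_add:
  assumes rs: "r \<in> carrier R" "s \<in> S" "r' \<in> carrier R" "s' \<in> S"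
  shows "frac R S r s \<oplus>\<^bsub>localization R S\<^esub> frac R S r' s' = frac R S (r \<otimes> s' \<oplus> r' \<otimes> s) (s \<otimes> s')"
proof -
  have eq: "frac R S (a \<otimes> d \<oplus> c \<otimes> b) (b \<otimes> d) = frac R S (r \<otimes> s' \<oplus> r' \<otimes> s) (s \<otimes> s')"
    if m: "(a, b) \<in> frac R S r s" "(c, d) \<in> frac R S r' s'" for a b c d
  proof -
    obtain t t' where t: "t \<in> S" "t' \<in> S" "t \<otimes> (r \<otimes> b) = t \<otimes> (a \<otimes> s)" "t' \<otimes> (r' \<otimes> d) = t' \<otimes> (c \<otimes> s')"
      and c: "a \<in> carrier R" "b \<in> S" "c \<in> carrier R" "d \<in> S"
      using mem_fracD[OF m(1)] mem_fracD[OF m(2)] by blast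
    have "(t \<otimes> t') \<otimes> ((a \<otimes> d \<oplus> c \<otimes> b) \<otimes> (s \<otimes> s')) =
        (t' \<otimes> d \<otimes> s') \<otimes> (t \<otimes> (a \<otimes> s)) \<oplus> (t \<otimes> b \<otimes> s) \<otimes> (t' \<otimes> (c \<otimes> s'))"
      using rs c t(1,2) by (simp add: l_distr r_distr m_ac)
    also have "\<dots> = (t' \<otimes> d \<otimes> s') \<otimes> (t \<otimes> (r \<otimes> b)) \<oplus> (t \<otimes> b \<otimes> s) \<otimes> (t' \<otimes> (r' \<otimes> d))" by (simp only: t(3,4))
    also have "\<dots> = (t \<otimes> t') \<otimes> ((r \<otimes> s' \<oplus> r' \<otimes> s) \<otimes> (b \<otimes> d))"
      using rs c t(1,2) by (simp add: l_distr r_distr m_ac)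
    finally show ?thesis using S_mult rs c t(1,2) by (subst frac_eq_iff) auto
  qed
  have "(\<Union>(r', s')\<in>frac R S r' s'. frac R S (a \<otimes> s' \<oplus> r' \<otimes> b) (b \<otimes> s')) = frac R S (r \<otimes> s' \<oplus> r' \<otimes> s) (s \<otimes> s')"
    if "(a, b) \<in> frac R S r s" for a b
    by (rule UN_constant_eq[OF mem_frac_self[OF rs(3,4)]]) (use eq[OF that] in auto)
  hence "(\<Union>(r, s)\<in>frac R S r s. \<Union>(r', s')\<in>frac R S r' s'. frac R S (r \<otimes> s' \<oplus> r' \<otimes> s) (s \<otimes> s')) = frac R S (r \<otimes> s' \<oplus> r' \<otimes> s) (s \<otimes> s')"
    by (intro UN_constant_eq[OF mem_frac_self[OF rs(1,2)]]) auto
  thus ?thesis by (simp add: localization_def)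
qed

lemma localization_cring: "cring (localization R S)"
proof (rule cringI)
  show "abelian_group (localization R S)"
  proof (rule abelian_groupI)
    fix x y assume x: "x \<in> carrier (localization R S)" and y: "y \<in> carrier (localization R S)"
    obtain a b where a: "a \<in> carrier R" "b \<in> S" "x = frac R S a b" using x by (rule localization_cases)
    obtain c d where c: "c \<in> carrier R" "d \<in> S" "y = frac R S c d" using y by (rule localization_cases)
    show "x \<oplus>\<^bsub>localization R S\<^esub> y \<in> carrier (localization R S)" using a c S_mult by (simp add: frac_add)
    show "x \<oplus>\<^bsub>localization R S\<^esub> y = y \<oplus>\<^bsub>localization R S\<^esub> x" using a c by (simp add: frac_add a_comm m_comm)
    fix z assume z: "z \<in> carrier (localization R S)"
    obtain e f where e: "e \<in> carrier R" "f \<in> S" "z = frac R S e f" using z by (rule localization_cases)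
    show "x \<oplus>\<^bsub>localization R S\<^esub> y \<oplus>\<^bsub>localization R S\<^esub> z = x \<oplus>\<^bsub>localization R S\<^esub> (y \<oplus>\<^bsub>localization R S\<^esub> z)"
    proof -
      have "(a \<otimes> d \<oplus> c \<otimes> b) \<otimes> f \<oplus> e \<otimes> (b \<otimes> d) = a \<otimes> (d \<otimes> f) \<oplus> (c \<otimes> f \<oplus> e \<otimes> d) \<otimes> b"
        using a c e by (simp add: l_distr r_distr m_ac a_assoc)
      moreover have "b \<otimes> d \<otimes> f = b \<otimes> (d \<otimes> f)" using a c e by (simp add: m_assoc)
      ultimately show ?thesis using a c e S_mult by (simp add: frac_add)
    qed
  next
    show "\<zero>\<^bsub>localization R S\<^esub> \<in> carrier (localization R S)" using S_one by (simp add: localization_simps(3))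
  next
    fix x assume x: "x \<in> carrier (localization R S)"
    obtain a b where a: "a \<in> carrier R" "b \<in> S" "x = frac R S a b" using x by (rule localization_cases)
    show "\<zero>\<^bsub>localization R S\<^esub> \<oplus>\<^bsub>localization R S\<^esub> x = x" using a S_one by (simp add: localization_simps(3) frac_add)
    have "frac R S (\<ominus> a) b \<oplus>\<^bsub>localization R S\<^esub> x = \<zero>\<^bsub>localization R S\<^esub>"
      using a S_one S_mult by (simp add: localization_simps(3) frac_add) (intro frac_eqI, auto simp: l_minus l_neg)
    thus "\<exists>y\<in>carrier (localization R S). y \<oplus>\<^bsub>localization R S\<^esub> x = \<zero>\<^bsub>localization R S\<^esub>"
      using a by (intro bexI[of _ "frac R S (\<ominus> a) b"]) auto
  qed
  show "Group.comm_monoid (localization R S)"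
  proof (rule Group.comm_monoidI)
    fix x y assume x: "x \<in> carrier (localization R S)" and y: "y \<in> carrier (localization R S)"
    obtain a b where a: "a \<in> carrier R" "b \<in> S" "x = frac R S a b" using x by (rule localization_cases)
    obtain c d where c: "c \<in> carrier R" "d \<in> S" "y = frac R S c d" using y by (rule localization_cases)
    show "x \<otimes>\<^bsub>localization R S\<^esub> y \<in> carrier (localization R S)" using a c S_mult by (simp add: frac_mult)
    show "x \<otimes>\<^bsub>localization R S\<^esub> y = y \<otimes>\<^bsub>localization R S\<^esub> x" using a c by (simp add: frac_mult m_comm)
    fix z assume z: "z \<in> carrier (localization R S)"
    obtain e f where e: "e \<in> carrier R" "f \<in> S" "z = frac R S e f" using z by (rule localization_cases)
    show "x \<otimes>\<^bsub>localization R S\<^esub> y \<otimes>\<^bsub>localization R S\<^esub> z = x \<otimes>\<^bsub>localization R S\<^esub> (y \<otimes>\<^bsub>localization R S\<^esub> z)"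
      using a c e S_mult by (simp add: frac_mult m_assoc)
  next
    show "\<one>\<^bsub>localization R S\<^esub> \<in> carrier (localization R S)" using S_one by (simp add: localization_simps(2))
    fix x assume x: "x \<in> carrier (localization R S)"
    obtain a b where a: "a \<in> carrier R" "b \<in> S" "x = frac R S a b" using x by (rule localization_cases)
    show "\<one>\<^bsub>localization R S\<^esub> \<otimes>\<^bsub>localization R S\<^esub> x = x" using a S_one by (simp add: localization_simps(2) frac_mult)
  qed
  fix x y z assume x: "x \<in> carrier (localization R S)" and y: "y \<in> carrier (localization R S)" and z: "z \<in> carrier (localization R S)"
  obtain a b where a: "a \<in> carrier R" "b \<in> S" "x = frac R S a b" using x by (rule localization_cases)
  obtain c d where c: "c \<in> carrier R" "d \<in> S" "y = frac R S c d" using y by (rule localization_cases)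
  obtain e f where e: "e \<in> carrier R" "f \<in> S" "z = frac R S e f" using z by (rule localization_cases)
  show "(x \<oplus>\<^bsub>localization R S\<^esub> y) \<otimes>\<^bsub>localization R S\<^esub> z = x \<otimes>\<^bsub>localization R S\<^esub> z \<oplus>\<^bsub>localization R S\<^esub> y \<otimes>\<^bsub>localization R S\<^esub> z"
    using a c e S_mult by (simp add: frac_add frac_mult) (intro frac_eqI, auto simp: l_distr r_distr m_ac a_ac)
qed

lemma frac_hom: "(\<lambda>r. frac R S r \<one>) \<in> ring_hom R (localization R S)"
  by (rule ring_hom_memI) (auto simp: S_one frac_mult frac_add localization_simps(2))

end

text \<open>\<open>Qt(R/P)\<close> and \<open>k(P)\<close> are built differently, one as fractions
  of a quotient and one as a quotient of fractions. What is used of either is that it is a field in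
  which exactly \<open>P\<close> becomes zero and whose elements are fractions of images of
  \<open>R\<close>.\<close>

definition frac_field :: "('a, 'm) ring_scheme \<Rightarrow> 'a set \<Rightarrow> ('a, 'b, 'p) module_scheme \<Rightarrow> bool" where
  "frac_field R P L \<longleftrightarrow> field L \<and> (\<lambda>r. r \<odot>\<^bsub>L\<^esub> \<one>\<^bsub>L\<^esub>) \<in> ring_hom R L \<and>
     (\<forall>r\<in>carrier R. \<forall>c\<in>carrier L. r \<odot>\<^bsub>L\<^esub> c = (r \<odot>\<^bsub>L\<^esub> \<one>\<^bsub>L\<^esub>) \<otimes>\<^bsub>L\<^esub> c) \<and>
     (\<forall>r\<in>carrier R. r \<odot>\<^bsub>L\<^esub> \<one>\<^bsub>L\<^esub> = \<zero>\<^bsub>L\<^esub> \<longleftrightarrow> r \<in> P) \<and>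
     (\<forall>c\<in>carrier L. \<exists>a\<in>carrier R. \<exists>d\<in>carrier R. d \<odot>\<^bsub>L\<^esub> \<one>\<^bsub>L\<^esub> \<noteq> \<zero>\<^bsub>L\<^esub> \<and> (d \<odot>\<^bsub>L\<^esub> \<one>\<^bsub>L\<^esub>) \<otimes>\<^bsub>L\<^esub> c = a \<odot>\<^bsub>L\<^esub> \<one>\<^bsub>L\<^esub>)"

lemma algebra_via_simps [simp]:
  "carrier (algebra_via h S) = carrier S" "x \<otimes>\<^bsub>algebra_via h S\<^esub> y = x \<otimes>\<^bsub>S\<^esub> y" "\<one>\<^bsub>algebra_via h S\<^esub> = \<one>\<^bsub>S\<^esub>"
  "\<zero>\<^bsub>algebra_via h S\<^esub> = \<zero>\<^bsub>S\<^esub>" "x \<oplus>\<^bsub>algebra_via h S\<^esub> y = x \<oplus>\<^bsub>S\<^esub> y" "r \<odot>\<^bsub>algebra_via h S\<^esub> x = h r \<otimes>\<^bsub>S\<^esub> x"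
  by (simp_all add: algebra_via_def)

lemma cring_cong:
  assumes "cring S" and "carrier T = carrier S" "\<And>x y. x \<otimes>\<^bsub>T\<^esub> y = x \<otimes>\<^bsub>S\<^esub> y" "\<one>\<^bsub>T\<^esub> = \<one>\<^bsub>S\<^esub>"
    "\<zero>\<^bsub>T\<^esub> = \<zero>\<^bsub>S\<^esub>" "\<And>x y. x \<oplus>\<^bsub>T\<^esub> y = x \<oplus>\<^bsub>S\<^esub> y"
  shows "cring T"
proof -
  interpret S: cring S by fact
  show ?thesis
  proof (rule cringI)
    show "abelian_group T"
      by (rule abelian_groupI) (use S.a_ac S.add.l_inv_ex in \<open>auto simp: assms S.a_ac intro: bexI[of _ "\<ominus>\<^bsub>S\<^esub> _"] S.l_neg\<close>)
    show "Group.comm_monoid T"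
      by (rule Group.comm_monoidI) (auto simp: assms S.m_ac)
  qed (auto simp: assms S.l_distr)
qed

lemma algebra_via_cring: "cring S \<Longrightarrow> cring (algebra_via h S)"
  by (rule cring_cong[of S]) auto

lemma (in cring) mult_eq_one_Units:
  assumes "x \<otimes> y = \<one>" "x \<in> carrier R" "y \<in> carrier R" shows "x \<in> Units R"
  using assms m_comm[OF assms(2,3)] unfolding Units_def by auto

text \<open>The field property comes out of the description by fractions: an element is
  \<open>a / d\<close>, it is zero when \<open>a\<close> lies in \<open>P\<close>, and otherwise
  \<open>a\<close> is invertible.\<close>

lemma frac_field_algebra_via:
  assumes R: "cring R" and S: "cring S" and h: "h \<in> ring_hom R S" and ker: "\<And>r. r \<in> carrier R \<Longrightarrow> h r = \<zero>\<^bsub>S\<^esub> \<longleftrightarrow> r \<in> P"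
    and P: "\<one>\<^bsub>R\<^esub> \<notin> P"
    and fr: "\<And>c. c \<in> carrier S \<Longrightarrow> \<exists>a\<in>carrier R. \<exists>d\<in>carrier R. h d \<in> Units S \<and> h d \<otimes>\<^bsub>S\<^esub> c = h a"
    and un: "\<And>r. r \<in> carrier R \<Longrightarrow> r \<notin> P \<Longrightarrow> h r \<in> Units S"
  shows "frac_field R P (algebra_via h S)"
proof -
  interpret R: cring R by fact
  interpret S: cring S by fact
  interpret h: ring_hom_cring R S h by (rule ring_hom_cringI[OF R S h])
  interpret A: cring "algebra_via h S" by (rule algebra_via_cring[OF S])
  have one: "\<one>\<^bsub>S\<^esub> \<noteq> \<zero>\<^bsub>S\<^esub>" using ker[OF R.one_closed] P by simp
  have smult1: "h r \<otimes>\<^bsub>S\<^esub> \<one>\<^bsub>S\<^esub> = h r" if "r \<in> carrier R" for r using that by simp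
  have u0: "u \<noteq> \<zero>\<^bsub>S\<^esub>" if "u \<in> Units S" for u using that one by (metis S.Units_closed S.Units_l_inv S.Units_inv_closed S.r_null)
  have "field (algebra_via h S)"
  proof (rule A.cring_fieldI2)
    show "\<zero>\<^bsub>algebra_via h S\<^esub> \<noteq> \<one>\<^bsub>algebra_via h S\<^esub>" using one by simp
    fix c assume c: "c \<in> carrier (algebra_via h S)" "c \<noteq> \<zero>\<^bsub>algebra_via h S\<^esub>"
    obtain a d where ad: "a \<in> carrier R" "d \<in> carrier R" "h d \<in> Units S" "h d \<otimes>\<^bsub>S\<^esub> c = h a" using fr[of c] c by auto
    have "a \<notin> P"
    proof
      assume "a \<in> P"
      hence "h d \<otimes>\<^bsub>S\<^esub> c = \<zero>\<^bsub>S\<^esub>" using ad ker by simp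
      hence "inv\<^bsub>S\<^esub> h d \<otimes>\<^bsub>S\<^esub> (h d \<otimes>\<^bsub>S\<^esub> c) = \<zero>\<^bsub>S\<^esub>" using ad(3) by simp
      moreover have "inv\<^bsub>S\<^esub> h d \<otimes>\<^bsub>S\<^esub> (h d \<otimes>\<^bsub>S\<^esub> c) = (inv\<^bsub>S\<^esub> h d \<otimes>\<^bsub>S\<^esub> h d) \<otimes>\<^bsub>S\<^esub> c"
        using c ad(3) S.Units_closed by (intro S.m_assoc[symmetric]) auto
      ultimately show False using c ad(3) by simp
    qed
    hence u: "h a \<in> Units S" using un ad by simp
    have "c \<otimes>\<^bsub>S\<^esub> (h d \<otimes>\<^bsub>S\<^esub> inv\<^bsub>S\<^esub> h a) = (h d \<otimes>\<^bsub>S\<^esub> c) \<otimes>\<^bsub>S\<^esub> inv\<^bsub>S\<^esub> h a" proof -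
      have hc: "h d \<in> carrier S" "inv\<^bsub>S\<^esub> h a \<in> carrier S" "c \<in> carrier S" using c u ad by auto
      have "c \<otimes>\<^bsub>S\<^esub> (h d \<otimes>\<^bsub>S\<^esub> inv\<^bsub>S\<^esub> h a) = (c \<otimes>\<^bsub>S\<^esub> h d) \<otimes>\<^bsub>S\<^esub> inv\<^bsub>S\<^esub> h a" using hc by (simp only: S.m_assoc)
      thus ?thesis using S.m_comm[OF hc(3,1)] by simp
    qed
    also have "\<dots> = \<one>\<^bsub>S\<^esub>" unfolding ad(4) using u by simp
    finally show "\<exists>b\<in>carrier (algebra_via h S). c \<otimes>\<^bsub>algebra_via h S\<^esub> b = \<one>\<^bsub>algebra_via h S\<^esub>"
      using u ad by (intro bexI[of _ "h d \<otimes>\<^bsub>S\<^esub> inv\<^bsub>S\<^esub> h a"]) auto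
  qed
  moreover have "(\<lambda>r. r \<odot>\<^bsub>algebra_via h S\<^esub> \<one>\<^bsub>algebra_via h S\<^esub>) \<in> ring_hom R (algebra_via h S)"
    by (rule ring_hom_memI) auto
  moreover have "\<exists>a\<in>carrier R. \<exists>d\<in>carrier R. h d \<noteq> \<zero>\<^bsub>S\<^esub> \<and> h d \<otimes>\<^bsub>S\<^esub> c = h a" if "c \<in> carrier S" for c
    using fr[OF that] u0 by blast
  ultimately show ?thesis using ker by (simp add: frac_field_def smult1 S.m_assoc)
qed

lemma frac_field_Qt_alg:
  assumes R: "cring R" and P: "primeideal P R" shows "frac_field R P (Qt_alg R P)"
proof -
  interpret R: cring R by fact
  interpret P: primeideal P R by fact
  define D where "D = R Quot P"
  interpret D: "domain" D unfolding D_def by (rule P.quotient_is_domain)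
  interpret q: ring_hom_cring R D "(+>\<^bsub>R\<^esub>) P" unfolding D_def by (rule P.quot_hom_cring[OF R])
  define S where "S = carrier D - {\<zero>\<^bsub>D\<^esub>}"
  interpret L: mult_set D S by unfold_locales (auto simp: S_def D.integral_iff)
  have surj: "\<exists>a\<in>carrier R. P +>\<^bsub>R\<^esub> a = x" if "x \<in> carrier D" for x
    
  proof -
    have "x \<in> (+>\<^bsub>R\<^esub>) P ` carrier R" using that unfolding D_def P.quot_surj .
    then obtain a where "x = P +>\<^bsub>R\<^esub> a" "a \<in> carrier R" by (rule imageE)
    thus ?thesis by (intro bexI[of _ a]) simp_all
  qed
  have z: "P +>\<^bsub>R\<^esub> r = \<zero>\<^bsub>D\<^esub> \<longleftrightarrow> r \<in> P" if "r \<in> carrier R" for r using P.quot_eq_zero_iff[OF that] by (simp add: D_def)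
  have unit: "frac D S x \<one>\<^bsub>D\<^esub> \<in> Units (localization D S)" if "x \<in> S" for x
  proof -
    interpret LL: cring "localization D S" by (rule L.localization_cring)
    have "frac D S x \<one>\<^bsub>D\<^esub> \<otimes>\<^bsub>localization D S\<^esub> frac D S \<one>\<^bsub>D\<^esub> x = \<one>\<^bsub>localization D S\<^esub>"
      using that L.S_one by (simp add: L.frac_mult L.localization_simps(2)) (intro L.frac_eqI, auto)
    moreover have "frac D S x \<one>\<^bsub>D\<^esub> \<in> carrier (localization D S)" "frac D S \<one>\<^bsub>D\<^esub> x \<in> carrier (localization D S)"
      using that L.S_one L.S_closed[OF that] by auto
    ultimately show ?thesis by (rule LL.mult_eq_one_Units)
  qed
  have "frac_field R P (algebra_via (\<lambda>r. frac D S (P +>\<^bsub>R\<^esub> r) \<one>\<^bsub>D\<^esub>) (localization D S))"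
  proof (rule frac_field_algebra_via[OF R L.localization_cring])
    have "(\<lambda>r. frac D S r \<one>\<^bsub>D\<^esub>) \<circ> (+>\<^bsub>R\<^esub>) P \<in> ring_hom R (localization D S)"
      by (rule ring_hom_trans[OF q.homh L.frac_hom])
    thus "(\<lambda>r. frac D S (P +>\<^bsub>R\<^esub> r) \<one>\<^bsub>D\<^esub>) \<in> ring_hom R (localization D S)" by (simp add: comp_def)
    show "frac D S (P +>\<^bsub>R\<^esub> r) \<one>\<^bsub>D\<^esub> = \<zero>\<^bsub>localization D S\<^esub> \<longleftrightarrow> r \<in> P" if r: "r \<in> carrier R" for r
      unfolding L.localization_simps(3) z[OF r, symmetric] using r L.S_one
      by (subst L.frac_eq_iff) (auto simp: S_def D.integral_iff)
    show "\<one>\<^bsub>R\<^esub> \<notin> P" using P.I_notcarr P.one_imp_carrier by auto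
    show "frac D S (P +>\<^bsub>R\<^esub> r) \<one>\<^bsub>D\<^esub> \<in> Units (localization D S)" if "r \<in> carrier R" "r \<notin> P" for r
      using that z by (intro unit) (auto simp: S_def)
    fix c assume "c \<in> carrier (localization D S)"
    then obtain x y where xy: "x \<in> carrier D" "y \<in> S" "c = frac D S x y" by (rule L.localization_cases)
    obtain a where a: "a \<in> carrier R" "P +>\<^bsub>R\<^esub> a = x" using surj[OF xy(1)] by blast
    obtain d where d: "d \<in> carrier R" "P +>\<^bsub>R\<^esub> d = y" using surj[of y] xy(2) by (auto simp: S_def)
    have "frac D S (P +>\<^bsub>R\<^esub> d) \<one>\<^bsub>D\<^esub> \<otimes>\<^bsub>localization D S\<^esub> c = frac D S (P +>\<^bsub>R\<^esub> a) \<one>\<^bsub>D\<^esub>"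
      unfolding a d xy(3) using xy L.S_one L.S_closed[OF xy(2)]
      by (simp add: L.frac_mult) (intro L.frac_eqI, auto simp: D.m_comm)
    moreover have "frac D S (P +>\<^bsub>R\<^esub> d) \<one>\<^bsub>D\<^esub> \<in> Units (localization D S)" unfolding d(2) by (rule unit[OF xy(2)])
    ultimately show "\<exists>a\<in>carrier R. \<exists>d\<in>carrier R. frac D S (P +>\<^bsub>R\<^esub> d) \<one>\<^bsub>D\<^esub> \<in> Units (localization D S) \<and>
        frac D S (P +>\<^bsub>R\<^esub> d) \<one>\<^bsub>D\<^esub> \<otimes>\<^bsub>localization D S\<^esub> c = frac D S (P +>\<^bsub>R\<^esub> a) \<one>\<^bsub>D\<^esub>"
      using a d by blast
  qed
  thus ?thesis by (simp add: Qt_alg_def Let_def D_def S_def)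
qed

lemma frac_field_residue_alg:
  assumes R: "cring R" and P: "primeideal P R" shows "frac_field R P (residue_alg R P)"
proof -
  interpret R: cring R by fact
  interpret P: primeideal P R by fact
  define S where "S = carrier R - P"
  have oneP: "\<one>\<^bsub>R\<^esub> \<notin> P" using P.I_notcarr P.one_imp_carrier by auto
  interpret L: mult_set R S
    by unfold_locales (use P.I_prime oneP in \<open>auto simp: S_def\<close>)
  let ?L = "localization R S"
  interpret LL: cring ?L by (rule L.localization_cring)
  let ?i = "\<lambda>r. frac R S r \<one>\<^bsub>R\<^esub>"
  \<comment> \<open>The ideal \<open>P R\<^sub>P\<close> made explicit. Whether the numerator lies
    in \<open>P\<close> does not depend on the representative, since \<open>P\<close> is
    prime.\<close>
  define M where "M = {frac R S r s | r s. r \<in> P \<and> s \<in> S}"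
  define m where "m = genideal ?L (?i ` P)"
  have Pc: "r \<in> carrier R" if "r \<in> P" for r using that by (rule P.Icarr)
  have iP: "?i ` P \<subseteq> carrier ?L" using Pc L.S_one by auto
  have memM: "frac R S r s \<in> M \<longleftrightarrow> r \<in> P" if rs: "r \<in> carrier R" "s \<in> S" for r s
  proof
    assume "frac R S r s \<in> M"
    then obtain r' s' where e: "r' \<in> P" "s' \<in> S" "frac R S r s = frac R S r' s'" unfolding M_def by blast
    then obtain t where t: "t \<in> S" "t \<otimes>\<^bsub>R\<^esub> (r \<otimes>\<^bsub>R\<^esub> s') = t \<otimes>\<^bsub>R\<^esub> (r' \<otimes>\<^bsub>R\<^esub> s)" using rs Pc by (auto simp: L.frac_eq_iff)
    have "t \<otimes>\<^bsub>R\<^esub> (r' \<otimes>\<^bsub>R\<^esub> s) \<in> P" using e t rs by (intro P.I_l_closed[OF P.I_r_closed[OF e(1)]]) auto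
    hence "t \<otimes>\<^bsub>R\<^esub> (r \<otimes>\<^bsub>R\<^esub> s') \<in> P" using t(2) by simp
    hence "r \<otimes>\<^bsub>R\<^esub> s' \<in> P" using P.I_prime[of t "r \<otimes>\<^bsub>R\<^esub> s'"] t e rs by (auto simp: S_def)
    moreover have "s' \<in> carrier R" "s' \<notin> P" using e by (auto simp: S_def)
    ultimately show "r \<in> P" using P.I_prime[OF rs(1)] by blast
  qed (use rs in \<open>auto simp: M_def\<close>)
  have Mid: "ideal M ?L"
  proof (rule idealI[OF LL.ring_axioms])
    show "subgroup M (add_monoid ?L)"
    proof (rule LL.add.subgroupI)
      show "M \<subseteq> carrier ?L" using Pc by (auto simp: M_def)
      show "M \<noteq> {}" using memM[of "\<zero>\<^bsub>R\<^esub>" "\<one>\<^bsub>R\<^esub>"] L.S_one additive_subgroup.zero_closed[OF P.is_additive_subgroup] by auto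
      fix x assume "x \<in> M"
      then obtain r s where x: "r \<in> P" "s \<in> S" "x = frac R S r s" unfolding M_def by blast
      have "frac R S (\<ominus>\<^bsub>R\<^esub> r) s \<oplus>\<^bsub>?L\<^esub> x = \<zero>\<^bsub>?L\<^esub>"
        using x Pc[OF x(1)] L.S_one L.S_mult by (simp add: L.localization_simps(3) L.frac_add) (intro L.frac_eqI, auto simp: R.l_minus R.l_neg)
      hence "\<ominus>\<^bsub>?L\<^esub> x = frac R S (\<ominus>\<^bsub>R\<^esub> r) s" using x Pc[OF x(1)] by (intro LL.minus_equality) auto
      thus "\<ominus>\<^bsub>?L\<^esub> x \<in> M" using x Pc[OF x(1)] memM additive_subgroup.a_inv_closed[OF P.is_additive_subgroup] by simp
    next
      fix x y assume "x \<in> M" "y \<in> M"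
      then obtain r s r' s' where x: "r \<in> P" "s \<in> S" "x = frac R S r s" "r' \<in> P" "s' \<in> S" "y = frac R S r' s'" unfolding M_def by blast
      have "r \<otimes>\<^bsub>R\<^esub> s' \<oplus>\<^bsub>R\<^esub> r' \<otimes>\<^bsub>R\<^esub> s \<in> P"
        using x by (intro additive_subgroup.a_closed[OF P.is_additive_subgroup] P.I_r_closed) auto
      thus "x \<oplus>\<^bsub>?L\<^esub> y \<in> M" using x Pc L.S_mult by (simp add: L.frac_add memM)
    qed
    fix a x assume a: "a \<in> M" and x: "x \<in> carrier ?L"
    obtain r s where a': "r \<in> P" "s \<in> S" "a = frac R S r s" using a unfolding M_def by blast
    obtain c d where x': "c \<in> carrier R" "d \<in> S" "x = frac R S c d" using x by (rule L.localization_cases)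
    show "x \<otimes>\<^bsub>?L\<^esub> a \<in> M" using a' x' Pc P.I_l_closed L.S_mult by (simp add: L.frac_mult memM)
    show "a \<otimes>\<^bsub>?L\<^esub> x \<in> M" using a' x' Pc P.I_r_closed L.S_mult by (simp add: L.frac_mult memM)
  qed
  have "m = M"
  proof
    show "m \<subseteq> M" unfolding m_def by (rule LL.genideal_minimal[OF Mid]) (use memM L.S_one Pc in auto)
    show "M \<subseteq> m"
    proof
      fix x assume "x \<in> M"
      then obtain r s where x: "r \<in> P" "s \<in> S" "x = frac R S r s" unfolding M_def by blast
      interpret m: ideal m ?L unfolding m_def by (rule LL.genideal_ideal[OF iP])
      have "?i r \<in> m" unfolding m_def using LL.genideal_self[OF iP] x(1) by blast
      hence "?i r \<otimes>\<^bsub>?L\<^esub> frac R S \<one>\<^bsub>R\<^esub> s \<in> m" using x by (intro m.I_r_closed) auto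
      thus "x \<in> m" using x Pc[OF x(1)] L.S_one by (simp add: L.frac_mult)
    qed
  qed
  interpret m: ideal m ?L unfolding \<open>m = M\<close> by (rule Mid)
  interpret q: ring_hom_cring ?L "?L Quot m" "(+>\<^bsub>?L\<^esub>) m" by (rule m.quot_hom_cring[OF LL.is_cring])
  have unit: "m +>\<^bsub>?L\<^esub> ?i r \<in> Units (?L Quot m)" if r: "r \<in> S" for r
  proof -
    have "?i r \<otimes>\<^bsub>?L\<^esub> frac R S \<one>\<^bsub>R\<^esub> r = \<one>\<^bsub>?L\<^esub>"
      using r L.S_one by (simp add: L.frac_mult L.localization_simps(2)) (intro L.frac_eqI, auto)
    hence "(m +>\<^bsub>?L\<^esub> ?i r) \<otimes>\<^bsub>?L Quot m\<^esub> (m +>\<^bsub>?L\<^esub> frac R S \<one>\<^bsub>R\<^esub> r) = \<one>\<^bsub>?L Quot m\<^esub>"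
      using q.hom_mult[of "?i r" "frac R S \<one>\<^bsub>R\<^esub> r"] r L.S_one q.hom_one by simp
    moreover have "m +>\<^bsub>?L\<^esub> ?i r \<in> carrier (?L Quot m)" "m +>\<^bsub>?L\<^esub> frac R S \<one>\<^bsub>R\<^esub> r \<in> carrier (?L Quot m)"
      using r L.S_one by auto
    ultimately show ?thesis by (rule q.S.mult_eq_one_Units)
  qed
  have "frac_field R P (algebra_via (\<lambda>r. m +>\<^bsub>?L\<^esub> ?i r) (?L Quot m))"
  proof (rule frac_field_algebra_via[OF R q.S.is_cring _ _ oneP])
    have "(+>\<^bsub>?L\<^esub>) m \<circ> ?i \<in> ring_hom R (?L Quot m)" by (rule ring_hom_trans[OF L.frac_hom q.homh])
    thus "(\<lambda>r. m +>\<^bsub>?L\<^esub> ?i r) \<in> ring_hom R (?L Quot m)" by (simp add: comp_def)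
    show "m +>\<^bsub>?L\<^esub> ?i r = \<zero>\<^bsub>?L Quot m\<^esub> \<longleftrightarrow> r \<in> P" if "r \<in> carrier R" for r
      using m.quot_eq_zero_iff[of "?i r"] that L.S_one memM[of r "\<one>\<^bsub>R\<^esub>"] \<open>m = M\<close> by simp
    show "m +>\<^bsub>?L\<^esub> ?i r \<in> Units (?L Quot m)" if "r \<in> carrier R" "r \<notin> P" for r using that by (intro unit) (simp add: S_def)
    fix c assume "c \<in> carrier (?L Quot m)"
    then obtain x where x: "x \<in> carrier ?L" "c = m +>\<^bsub>?L\<^esub> x" using m.quot_surj by blast
    obtain a d where ad: "a \<in> carrier R" "d \<in> S" "x = frac R S a d" using x(1) by (rule L.localization_cases)
    have "?i d \<otimes>\<^bsub>?L\<^esub> x = ?i a" using ad L.S_one by (simp add: L.frac_mult) (intro L.frac_eqI, auto simp: R.m_comm)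
    hence eq: "(m +>\<^bsub>?L\<^esub> ?i d) \<otimes>\<^bsub>?L Quot m\<^esub> c = m +>\<^bsub>?L\<^esub> ?i a"
      using q.hom_mult[of "?i d" x] ad x L.S_one by simp
    show "\<exists>a\<in>carrier R. \<exists>d\<in>carrier R. m +>\<^bsub>?L\<^esub> ?i d \<in> Units (?L Quot m) \<and>
        (m +>\<^bsub>?L\<^esub> ?i d) \<otimes>\<^bsub>?L Quot m\<^esub> c = m +>\<^bsub>?L\<^esub> ?i a"
      by (rule bexI[OF _ ad(1)], rule bexI[OF _ L.S_closed[OF ad(2)]], rule conjI[OF unit[OF ad(2)] eq])
  qed
  thus ?thesis by (simp add: residue_alg_def Let_def S_def m_def)
qed

section \<open>Tensor products\<close>

text \<open>Additivity is recorded for differences, since the elements of the free group are reached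
  from \<open>0\<close> and the generators by subtraction.\<close>

lemma frag_hom_exists:
  assumes A: "abelian_group A" and f: "f \<in> S \<rightarrow> carrier A"
  shows "\<exists>h. (\<forall>c. Poly_Mapping.keys c \<subseteq> S \<longrightarrow> h c \<in> carrier A) \<and> h 0 = \<zero>\<^bsub>A\<^esub> \<and>
    (\<forall>c d. Poly_Mapping.keys c \<subseteq> S \<longrightarrow> Poly_Mapping.keys d \<subseteq> S \<longrightarrow> h (c - d) = h c \<ominus>\<^bsub>A\<^esub> h d) \<and>
    (\<forall>x\<in>S. h (frag_of x) = f x)"
proof -
  interpret A: abelian_group A by fact
  have "f ` S \<subseteq> carrier (add_monoid A)" using f by auto
  then obtain h where h: "h \<in> hom (free_Abelian_group S) (add_monoid A)" "\<And>x. x \<in> S \<Longrightarrow> h (frag_of x) = f x"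
    using comm_group.free_Abelian_group_universal[OF A.a_comm_group] by metis
  interpret h: group_hom "free_Abelian_group S" "add_monoid A" h
    using h(1) A.a_group by (simp add: group_hom_def group_hom_axioms_def)
  have "h (c - d) = h c \<ominus>\<^bsub>A\<^esub> h d" if "Poly_Mapping.keys c \<subseteq> S" "Poly_Mapping.keys d \<subseteq> S" for c d
    using h.hom_mult[of c "- d"] h.hom_inv[of d] that by (simp add: a_minus_def a_inv_def keys_minus)
  moreover have "h c \<in> carrier A" if "Poly_Mapping.keys c \<subseteq> S" for c using h.hom_closed[of c] that by simp
  ultimately show ?thesis using h(2) h.hom_one by (intro exI[of _ h]) simp
qed

lemma add_monoid_free_ring: "add_monoid (free_ring M N) = free_Abelian_group (carrier M \<times> carrier N)"
  by (simp add: free_ring_def free_Abelian_group_def)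

abbreviation tensor_class where
  "tensor_class R M N c \<equiv> tensor_rel R M N +>\<^bsub>free_ring M N\<^esub> c"

text \<open>Closure under the operations is all that the tensor relations involve. This covers
  arbitrary modules, as flatness requires, and also algebras, where a ring structure is added
  later.\<close>

locale tensor_pair =
  fixes R :: "('a, 'm) ring_scheme" and M :: "('a, 'b, 'p) module_scheme" and N :: "('a, 'c, 'q) module_scheme"
  assumes add_M: "x \<in> carrier M \<Longrightarrow> y \<in> carrier M \<Longrightarrow> x \<oplus>\<^bsub>M\<^esub> y \<in> carrier M"
    and add_N: "z \<in> carrier N \<Longrightarrow> w \<in> carrier N \<Longrightarrow> z \<oplus>\<^bsub>N\<^esub> w \<in> carrier N"
    and smult_M: "r \<in> carrier R \<Longrightarrow> x \<in> carrier M \<Longrightarrow> r \<odot>\<^bsub>M\<^esub> x \<in> carrier M"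
    and smult_N: "r \<in> carrier R \<Longrightarrow> z \<in> carrier N \<Longrightarrow> r \<odot>\<^bsub>N\<^esub> z \<in> carrier N"
begin

abbreviation "MN \<equiv> carrier M \<times> carrier N"
abbreviation "rel \<equiv> tensor_rel R M N"
abbreviation "cl \<equiv> tensor_class R M N"

definition gens where
  "gens = {frag_of (x \<oplus>\<^bsub>M\<^esub> x', y) - frag_of (x, y) - frag_of (x', y) | x x' y.
         x \<in> carrier M \<and> x' \<in> carrier M \<and> y \<in> carrier N} \<union>
      {frag_of (x, y \<oplus>\<^bsub>N\<^esub> y') - frag_of (x, y) - frag_of (x, y') | x y y'.
         x \<in> carrier M \<and> y \<in> carrier N \<and> y' \<in> carrier N} \<union>
      {frag_of (r \<odot>\<^bsub>M\<^esub> x, y) - frag_of (x, r \<odot>\<^bsub>N\<^esub> y) | r x y.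
         r \<in> carrier R \<and> x \<in> carrier M \<and> y \<in> carrier N}"

lemma rel_eq: "rel = generate (free_Abelian_group MN) gens"
  by (simp add: tensor_rel_def gens_def)

lemma rel_subgroup: "subgroup rel (free_Abelian_group MN)"
  unfolding rel_eq
proof (intro group.generate_is_subgroup[OF group_free_Abelian_group] subsetI)
  have k: "Poly_Mapping.keys (frag_of p - frag_of q - frag_of q') \<subseteq> {p, q, q'}"
    "Poly_Mapping.keys (frag_of p - frag_of q) \<subseteq> {p, q}" for p q q' :: "'b \<times> 'c"
    using keys_diff[of "frag_of p - frag_of q" "frag_of q'"] keys_diff[of "frag_of p" "frag_of q"] by auto
  fix c assume "c \<in> gens"
  thus "c \<in> carrier (free_Abelian_group MN)"
    unfolding gens_def using add_M add_N smult_M smult_N by (auto dest!: subsetD[OF k(1)] subsetD[OF k(2)])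
qed

lemma rel_keys: "c \<in> rel \<Longrightarrow> Poly_Mapping.keys c \<subseteq> MN"
  using subsetD[OF subgroup.subset[OF rel_subgroup]] by simp

lemma rel_zero: "0 \<in> rel"
  using subgroup.one_closed[OF rel_subgroup] by simp

lemma rel_add: "c \<in> rel \<Longrightarrow> d \<in> rel \<Longrightarrow> c + d \<in> rel"
  using subgroup.m_closed[OF rel_subgroup] by simp

lemma rel_minus: "c \<in> rel \<Longrightarrow> - c \<in> rel"
  using subgroup.m_inv_closed[OF rel_subgroup, of c] rel_keys[of c] by simp

lemma rel_diff: "c \<in> rel \<Longrightarrow> d \<in> rel \<Longrightarrow> c - d \<in> rel"
  using rel_add[OF _ rel_minus] by fastforce

lemma rel_addl: "x \<in> carrier M \<Longrightarrow> x' \<in> carrier M \<Longrightarrow> y \<in> carrier N \<Longrightarrow>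
    frag_of (x \<oplus>\<^bsub>M\<^esub> x', y) - frag_of (x, y) - frag_of (x', y) \<in> rel"
  unfolding tensor_rel_def by (rule generate.incl) blast

lemma rel_addr: "x \<in> carrier M \<Longrightarrow> y \<in> carrier N \<Longrightarrow> y' \<in> carrier N \<Longrightarrow>
    frag_of (x, y \<oplus>\<^bsub>N\<^esub> y') - frag_of (x, y) - frag_of (x, y') \<in> rel"
  unfolding tensor_rel_def by (rule generate.incl) blast

lemma rel_smult: "r \<in> carrier R \<Longrightarrow> x \<in> carrier M \<Longrightarrow> y \<in> carrier N \<Longrightarrow>
    frag_of (r \<odot>\<^bsub>M\<^esub> x, y) - frag_of (x, r \<odot>\<^bsub>N\<^esub> y) \<in> rel"
  unfolding tensor_rel_def by (rule generate.incl) blast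

text \<open>Closing the relations under differences spares separate cases for sums and
  inverses.\<close>

lemma rel_induct [consumes 1, case_names zero diff addl addr smult]:
  assumes c: "c \<in> rel" and zero: "P 0" and diff: "\<And>c d. c \<in> rel \<Longrightarrow> d \<in> rel \<Longrightarrow> P c \<Longrightarrow> P d \<Longrightarrow> P (c - d)"
    and "\<And>x x' y. x \<in> carrier M \<Longrightarrow> x' \<in> carrier M \<Longrightarrow> y \<in> carrier N \<Longrightarrow>
      P (frag_of (x \<oplus>\<^bsub>M\<^esub> x', y) - frag_of (x, y) - frag_of (x', y))"
    and "\<And>x y y'. x \<in> carrier M \<Longrightarrow> y \<in> carrier N \<Longrightarrow> y' \<in> carrier N \<Longrightarrow>
      P (frag_of (x, y \<oplus>\<^bsub>N\<^esub> y') - frag_of (x, y) - frag_of (x, y'))"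
    and "\<And>r x y. r \<in> carrier R \<Longrightarrow> x \<in> carrier M \<Longrightarrow> y \<in> carrier N \<Longrightarrow>
      P (frag_of (r \<odot>\<^bsub>M\<^esub> x, y) - frag_of (x, r \<odot>\<^bsub>N\<^esub> y))"
  shows "P c"
proof -
  have gen: "P g \<and> g \<in> rel" if "g \<in> gens" for g
    using that unfolding gens_def
    by (elim UnE CollectE exE conjE; simp only: assms(4-6) rel_addl rel_addr rel_smult simp_thms)
  have "c \<in> generate (free_Abelian_group MN) gens \<Longrightarrow> P c \<and> c \<in> rel"
  proof (induction rule: generate.induct)
    case one
    thus ?case using zero rel_zero by simp
  next
    case (incl g)
    thus ?case by (rule gen)
  next
    case (inv g)
    from gen[OF this] have g: "P g" "g \<in> rel" by simp_all
    have "P (0 - g)" using diff[OF rel_zero g(2) zero g(1)] .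
    thus ?case using rel_minus[OF g(2)] rel_keys[OF g(2)] by simp
  next
    case (eng c d)
    from eng.IH have cd: "P c" "c \<in> rel" "P d" "d \<in> rel" by simp_all
    have "P (c - (0 - d))" using diff[OF cd(2) rel_diff[OF rel_zero cd(4)] cd(1) diff[OF rel_zero cd(4) zero cd(3)]] .
    thus ?case using rel_add[OF cd(2,4)] by simp
  qed
  thus ?thesis using c rel_eq by simp
qed

lemma free_induct [consumes 1, case_names zero diff frag]:
  assumes "Poly_Mapping.keys c \<subseteq> MN" "P 0"
    "\<And>c d. Poly_Mapping.keys c \<subseteq> MN \<Longrightarrow> Poly_Mapping.keys d \<subseteq> MN \<Longrightarrow> P c \<Longrightarrow> P d \<Longrightarrow> P (c - d)"
    "\<And>x y. x \<in> carrier M \<Longrightarrow> y \<in> carrier N \<Longrightarrow> P (frag_of (x, y))"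
  shows "P c"
  using assms(1)
proof (rule free_Abelian_group_induct)
  show "P (frag_of a)" if "a \<in> MN" for a using assms(4) that by (cases a) auto
qed (use assms in auto)

lemma keys_diff_MN: "Poly_Mapping.keys c \<subseteq> MN \<Longrightarrow> Poly_Mapping.keys d \<subseteq> MN \<Longrightarrow> Poly_Mapping.keys (c - d) \<subseteq> MN"
  using keys_diff[of c d] by blast

lemma cl_eq: "cl c = (\<lambda>r. r + c) ` rel"
  by (auto simp: a_r_coset_def r_coset_def free_ring_def)

lemma cl_eq_iff: "cl c = cl d \<longleftrightarrow> c - d \<in> rel"
proof
  assume "cl c = cl d"
  moreover have "c \<in> cl c" unfolding cl_eq using rel_zero by force
  ultimately obtain r where "r \<in> rel" "c = r + d" unfolding cl_eq by auto
  thus "c - d \<in> rel" by simp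
next
  assume r: "c - d \<in> rel"
  have "cl c' \<subseteq> cl d'" if "c' - d' \<in> rel" for c' d'
  proof
    fix u assume "u \<in> cl c'"
    then obtain r where r: "r \<in> rel" "u = r + c'" unfolding cl_eq by auto
    have "u = (r + (c' - d')) + d'" using r by simp
    thus "u \<in> cl d'" unfolding cl_eq using rel_add[OF r(1) that] by blast
  qed
  moreover have "d - c \<in> rel" using rel_minus[OF r] by simp
  ultimately show "cl c = cl d" using r by blast
qed

lemma tensor_carrier: "carrier (tensor R M N) = cl ` {c. Poly_Mapping.keys c \<subseteq> MN}"
  by (auto simp: tensor_def FactRing_def A_RCOSETS_def' free_ring_def)

text \<open>The linear extension is kept on the free group, together with its vanishing on the
  relations, rather than as a map on classes: the proof of flatness handles congruences on
  representatives.\<close>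

definition bilinear_ext where
  "bilinear_ext A f h \<longleftrightarrow> (\<forall>c. Poly_Mapping.keys c \<subseteq> MN \<longrightarrow> h c \<in> carrier A) \<and> h 0 = \<zero>\<^bsub>A\<^esub> \<and>
    (\<forall>c d. Poly_Mapping.keys c \<subseteq> MN \<longrightarrow> Poly_Mapping.keys d \<subseteq> MN \<longrightarrow> h (c - d) = h c \<ominus>\<^bsub>A\<^esub> h d) \<and>
    (\<forall>x\<in>carrier M. \<forall>y\<in>carrier N. h (frag_of (x, y)) = f x y) \<and> (\<forall>c\<in>rel. h c = \<zero>\<^bsub>A\<^esub>)"

lemma bilinear_extD:
  assumes "bilinear_ext A f h"
  shows "Poly_Mapping.keys c \<subseteq> MN \<Longrightarrow> h c \<in> carrier A" "h 0 = \<zero>\<^bsub>A\<^esub>"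
    "Poly_Mapping.keys c \<subseteq> MN \<Longrightarrow> Poly_Mapping.keys d \<subseteq> MN \<Longrightarrow> h (c - d) = h c \<ominus>\<^bsub>A\<^esub> h d"
    "x \<in> carrier M \<Longrightarrow> y \<in> carrier N \<Longrightarrow> h (frag_of (x, y)) = f x y" "c \<in> rel \<Longrightarrow> h c = \<zero>\<^bsub>A\<^esub>"
  using assms by (simp_all add: bilinear_ext_def)

lemma bilinear_extension:
  assumes A: "abelian_group A" and f: "\<And>x y. x \<in> carrier M \<Longrightarrow> y \<in> carrier N \<Longrightarrow> f x y \<in> carrier A"
    and fl: "\<And>x x' y. x \<in> carrier M \<Longrightarrow> x' \<in> carrier M \<Longrightarrow> y \<in> carrier N \<Longrightarrow> f (x \<oplus>\<^bsub>M\<^esub> x') y = f x y \<oplus>\<^bsub>A\<^esub> f x' y"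
    and fr: "\<And>x y y'. x \<in> carrier M \<Longrightarrow> y \<in> carrier N \<Longrightarrow> y' \<in> carrier N \<Longrightarrow> f x (y \<oplus>\<^bsub>N\<^esub> y') = f x y \<oplus>\<^bsub>A\<^esub> f x y'"
    and fs: "\<And>r x y. r \<in> carrier R \<Longrightarrow> x \<in> carrier M \<Longrightarrow> y \<in> carrier N \<Longrightarrow> f (r \<odot>\<^bsub>M\<^esub> x) y = f x (r \<odot>\<^bsub>N\<^esub> y)"
  shows "\<exists>h. bilinear_ext A f h"
proof -
  interpret A: abelian_group A by fact
  have "(\<lambda>(x, y). f x y) \<in> MN \<rightarrow> carrier A" using f by auto
  from frag_hom_exists[OF A this] obtain h where h: "\<And>c. Poly_Mapping.keys c \<subseteq> MN \<Longrightarrow> h c \<in> carrier A" "h 0 = \<zero>\<^bsub>A\<^esub>"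
    "\<And>c d. Poly_Mapping.keys c \<subseteq> MN \<Longrightarrow> Poly_Mapping.keys d \<subseteq> MN \<Longrightarrow> h (c - d) = h c \<ominus>\<^bsub>A\<^esub> h d"
    "\<And>x y. x \<in> carrier M \<Longrightarrow> y \<in> carrier N \<Longrightarrow> h (frag_of (x, y)) = f x y" by force
  have k: "Poly_Mapping.keys (frag_of (x, y)) \<subseteq> MN" if "x \<in> carrier M" "y \<in> carrier N" for x y using that by simp
  have kd: "Poly_Mapping.keys (c - d) \<subseteq> MN" if "Poly_Mapping.keys c \<subseteq> MN" "Poly_Mapping.keys d \<subseteq> MN" for c d
    using keys_diff[of c d] that by blast
  have "h c = \<zero>\<^bsub>A\<^esub>" if "c \<in> rel" for c
    using that
  proof (induction rule: rel_induct)
    case (diff c d)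
    thus ?case using rel_keys h by (simp add: A.r_neg a_minus_def)
  next
    case (addl x x' y)
    note c = k[OF add_M[OF addl(1,2)] addl(3)] k[OF addl(1,3)] k[OF addl(2,3)]
    have "f x y \<oplus>\<^bsub>A\<^esub> f x' y \<ominus>\<^bsub>A\<^esub> f x y \<ominus>\<^bsub>A\<^esub> f x' y = \<zero>\<^bsub>A\<^esub>"
      using f[OF addl(1,3)] f[OF addl(2,3)] by (simp add: a_minus_def A.a_ac A.r_neg A.r_neg1 A.r_neg2)
    thus ?case using h(3)[OF kd[OF c(1,2)] c(3)] h(3)[OF c(1,2)] h(4) addl add_M fl by simp
  next
    case (addr x y y')
    note c = k[OF addr(1) add_N[OF addr(2,3)]] k[OF addr(1,2)] k[OF addr(1,3)]
    have "f x y \<oplus>\<^bsub>A\<^esub> f x y' \<ominus>\<^bsub>A\<^esub> f x y \<ominus>\<^bsub>A\<^esub> f x y' = \<zero>\<^bsub>A\<^esub>"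
      using f[OF addr(1,2)] f[OF addr(1,3)] by (simp add: a_minus_def A.a_ac A.r_neg A.r_neg1 A.r_neg2)
    thus ?case using h(3)[OF kd[OF c(1,2)] c(3)] h(3)[OF c(1,2)] h(4) addr add_N fr by simp
  next
    case (smult r x y)
    note c = k[OF smult_M[OF smult(1,2)] smult(3)] k[OF smult(2) smult_N[OF smult(1,3)]]
    show ?case using h(3)[OF c] h(4) smult smult_M smult_N fs f by (simp add: A.r_neg a_minus_def)
  qed (rule h(2))
  with h show ?thesis unfolding bilinear_ext_def by (intro exI[of _ h]) simp
qed

end

text \<open>The structure map \<open>r \<mapsto> r \<cdot> 1\<close> determines the scalar
  multiplication; in this form the condition can be read off from a ring homomorphism and checked on
  subalgebras directly.\<close>

definition is_alg :: "('a, 'm) ring_scheme \<Rightarrow> ('a, 'b, 'p) module_scheme \<Rightarrow> bool" where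
  "is_alg R M \<longleftrightarrow> cring M \<and> (\<lambda>r. r \<odot>\<^bsub>M\<^esub> \<one>\<^bsub>M\<^esub>) \<in> ring_hom R M \<and>
     (\<forall>r\<in>carrier R. \<forall>x\<in>carrier M. r \<odot>\<^bsub>M\<^esub> x = (r \<odot>\<^bsub>M\<^esub> \<one>\<^bsub>M\<^esub>) \<otimes>\<^bsub>M\<^esub> x)"

lemma is_alg_simps:
  assumes "is_alg R M"
  shows "cring M" "(\<lambda>r. r \<odot>\<^bsub>M\<^esub> \<one>\<^bsub>M\<^esub>) \<in> ring_hom R M"
    "r \<in> carrier R \<Longrightarrow> x \<in> carrier M \<Longrightarrow> r \<odot>\<^bsub>M\<^esub> x = (r \<odot>\<^bsub>M\<^esub> \<one>\<^bsub>M\<^esub>) \<otimes>\<^bsub>M\<^esub> x"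
  using assms unfolding is_alg_def by blast+

lemma is_alg_smult:
  assumes M: "is_alg R M" and rx: "r \<in> carrier R" "x \<in> carrier M"
  shows "r \<odot>\<^bsub>M\<^esub> x \<in> carrier M"
    and "z \<in> carrier M \<Longrightarrow> z \<otimes>\<^bsub>M\<^esub> (r \<odot>\<^bsub>M\<^esub> x) = r \<odot>\<^bsub>M\<^esub> (z \<otimes>\<^bsub>M\<^esub> x)"
proof -
  interpret M: cring M by (rule is_alg_simps(1)[OF M])
  note u = ring_hom_closed[OF is_alg_simps(2)[OF M] rx(1)] and s = is_alg_simps(3)[OF M rx(1)]
  show "r \<odot>\<^bsub>M\<^esub> x \<in> carrier M" unfolding s[OF rx(2)] using u rx by simp
  assume z: "z \<in> carrier M"
  show "z \<otimes>\<^bsub>M\<^esub> (r \<odot>\<^bsub>M\<^esub> x) = r \<odot>\<^bsub>M\<^esub> (z \<otimes>\<^bsub>M\<^esub> x)"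
    unfolding s[OF rx(2)] s[OF M.m_closed[OF z rx(2)]] using u rx z by (simp add: M.m_lcomm)
qed

locale tensor_algebra = M: cring M + N: cring N
  for R :: "('a, 'm) ring_scheme" and M :: "('a, 'b, 'p) module_scheme" and N :: "('a, 'c, 'q) module_scheme" +
  assumes alg_M: "is_alg R M" and alg_N: "is_alg R N"
begin

lemmas smult_M = is_alg_smult(1)[OF alg_M] and smult_mult_M = is_alg_smult(2)[OF alg_M]
  and smult_N = is_alg_smult(1)[OF alg_N] and smult_mult_N = is_alg_smult(2)[OF alg_N]

end

sublocale tensor_algebra \<subseteq> tensor_pair R M N
  by unfold_locales (auto simp: smult_M smult_N)

section \<open>The ring structure on the tensor product of two algebras\<close>

context tensor_algebra
begin

abbreviation "FF \<equiv> free_ring M N"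
abbreviation "T \<equiv> tensor R M N"
abbreviation "pure \<equiv> pure_tensor R M N"

lemma free_carrier: "c \<in> carrier FF \<longleftrightarrow> Poly_Mapping.keys c \<subseteq> MN"
  by (simp add: free_ring_def)

lemma free_add: "c \<oplus>\<^bsub>FF\<^esub> d = c + d" and free_zero: "\<zero>\<^bsub>FF\<^esub> = 0" and free_one: "\<one>\<^bsub>FF\<^esub> = frag_of (\<one>\<^bsub>M\<^esub>, \<one>\<^bsub>N\<^esub>)"
  by (simp_all add: free_ring_def)

lemma free_mult_of: "frag_of (x, y) \<otimes>\<^bsub>FF\<^esub> frag_of (x', y') = frag_of (x \<otimes>\<^bsub>M\<^esub> x', y \<otimes>\<^bsub>N\<^esub> y')"
  by (simp add: free_ring_def)

lemma free_mult_zero: "0 \<otimes>\<^bsub>FF\<^esub> c = 0" "c \<otimes>\<^bsub>FF\<^esub> 0 = 0"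
proof -
  show "0 \<otimes>\<^bsub>FF\<^esub> c = 0" by (simp add: free_ring_def)
  show "c \<otimes>\<^bsub>FF\<^esub> 0 = 0" by (simp add: free_ring_def) (intro frag_extend_eq_0, auto)
qed

lemma free_mult_diff: "(c - d) \<otimes>\<^bsub>FF\<^esub> e = c \<otimes>\<^bsub>FF\<^esub> e - d \<otimes>\<^bsub>FF\<^esub> e" "e \<otimes>\<^bsub>FF\<^esub> (c - d) = e \<otimes>\<^bsub>FF\<^esub> c - e \<otimes>\<^bsub>FF\<^esub> d"
proof -
  have e: "frag_extend (\<lambda>p. u p - v p) e = frag_extend u e - frag_extend v e" for u v :: "_ \<Rightarrow> ('b \<times> 'c) \<Rightarrow>\<^sub>0 int" and e
  proof -
    have "frag_cmul k (a - b) = frag_cmul k a - frag_cmul k b" for k and a b :: "('b \<times> 'c) \<Rightarrow>\<^sub>0 int"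
      by (rule poly_mapping_eqI) (simp add: lookup_minus right_diff_distrib)
    thus ?thesis by (simp add: frag_extend_def sum_subtractf)
  qed
  show "(c - d) \<otimes>\<^bsub>FF\<^esub> e = c \<otimes>\<^bsub>FF\<^esub> e - d \<otimes>\<^bsub>FF\<^esub> e" by (simp add: free_ring_def frag_extend_diff)
  show "e \<otimes>\<^bsub>FF\<^esub> (c - d) = e \<otimes>\<^bsub>FF\<^esub> c - e \<otimes>\<^bsub>FF\<^esub> d"
    by (simp add: free_ring_def frag_extend_diff case_prod_unfold e)
qed

lemma free_mult_add: "(c + d) \<otimes>\<^bsub>FF\<^esub> e = c \<otimes>\<^bsub>FF\<^esub> e + d \<otimes>\<^bsub>FF\<^esub> e"
  by (simp add: free_ring_def frag_extend_add)

lemma free_mult_closed: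
  assumes "Poly_Mapping.keys c \<subseteq> MN" "Poly_Mapping.keys d \<subseteq> MN" shows "Poly_Mapping.keys (c \<otimes>\<^bsub>FF\<^esub> d) \<subseteq> MN"
  using assms(1)
proof (induction rule: free_induct)
  case (frag x y)
  show ?case using assms(2)
  proof (induction rule: free_induct)
    case (frag x' y')
    thus ?case using \<open>x \<in> carrier M\<close> \<open>y \<in> carrier N\<close> by (simp add: free_mult_of)
  qed (simp_all add: free_mult_zero free_mult_diff keys_diff_MN)
qed (simp_all add: free_mult_zero free_mult_diff keys_diff_MN)

lemma free_mult_comm:
  assumes "Poly_Mapping.keys c \<subseteq> MN" "Poly_Mapping.keys d \<subseteq> MN" shows "c \<otimes>\<^bsub>FF\<^esub> d = d \<otimes>\<^bsub>FF\<^esub> c"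
  using assms(1)
proof (induction rule: free_induct)
  case (frag x y)
  show ?case using assms(2)
  proof (induction rule: free_induct)
    case (frag x' y')
    thus ?case using \<open>x \<in> carrier M\<close> \<open>y \<in> carrier N\<close> by (simp add: free_mult_of M.m_comm N.m_comm)
  qed (simp_all add: free_mult_zero free_mult_diff)
qed (simp_all add: free_mult_zero free_mult_diff)

lemma free_mult_assoc:
  assumes "Poly_Mapping.keys c \<subseteq> MN" "Poly_Mapping.keys d \<subseteq> MN" "Poly_Mapping.keys e \<subseteq> MN"
  shows "c \<otimes>\<^bsub>FF\<^esub> d \<otimes>\<^bsub>FF\<^esub> e = c \<otimes>\<^bsub>FF\<^esub> (d \<otimes>\<^bsub>FF\<^esub> e)"
  using assms(1)
proof (induction rule: free_induct)
  case (frag x y)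
  show ?case using assms(2)
  proof (induction rule: free_induct)
    case (frag x' y')
    show ?case using assms(3)
    proof (induction rule: free_induct)
      case (frag x'' y'')
      thus ?case using \<open>x \<in> carrier M\<close> \<open>y \<in> carrier N\<close> \<open>x' \<in> carrier M\<close> \<open>y' \<in> carrier N\<close>
        by (simp add: free_mult_of M.m_assoc N.m_assoc)
    qed (simp_all add: free_mult_zero free_mult_diff)
  qed (simp_all add: free_mult_zero free_mult_diff)
qed (simp_all add: free_mult_zero free_mult_diff)

lemma free_one_mult: "Poly_Mapping.keys c \<subseteq> MN \<Longrightarrow> frag_of (\<one>\<^bsub>M\<^esub>, \<one>\<^bsub>N\<^esub>) \<otimes>\<^bsub>FF\<^esub> c = c"
  by (induction rule: free_induct) (simp_all add: free_mult_zero free_mult_diff free_mult_of)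

lemma free_cring: "cring FF"
proof (rule cringI)
  have k: "Poly_Mapping.keys (c + d) \<subseteq> MN" if "Poly_Mapping.keys c \<subseteq> MN" "Poly_Mapping.keys d \<subseteq> MN" for c d
    using keys_add[of c d] that by blast
  show "abelian_group FF"
  proof (rule abelian_groupI)
    fix c assume "c \<in> carrier FF"
    thus "\<exists>d\<in>carrier FF. d \<oplus>\<^bsub>FF\<^esub> c = \<zero>\<^bsub>FF\<^esub>"
      by (intro bexI[of _ "- c"]) (simp_all add: free_add free_zero free_carrier keys_minus)
  qed (simp_all add: free_add free_zero free_carrier k add_ac)
  show "Group.comm_monoid FF"
  proof (rule Group.comm_monoidI)
    fix c d assume "c \<in> carrier FF" "d \<in> carrier FF"
    thus "c \<otimes>\<^bsub>FF\<^esub> d = d \<otimes>\<^bsub>FF\<^esub> c" by (simp add: free_carrier free_mult_comm)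
  qed (simp_all add: free_carrier free_one free_mult_closed free_mult_assoc free_one_mult)
qed (simp add: free_add free_mult_add)

text \<open>By additivity the multiplier may be taken to be a generator of the free group, and a
  defining relation times a generator is a defining relation of the same kind.\<close>

lemma rel_mult_closed:
  assumes a: "Poly_Mapping.keys a \<subseteq> MN" and c: "c \<in> rel" shows "a \<otimes>\<^bsub>FF\<^esub> c \<in> rel"
  using a
proof (induction rule: free_induct)
  case (frag z w)
  show ?case using c
  proof (induction rule: rel_induct)
    case (addl x x' y)
    thus ?case using rel_addl[of "z \<otimes>\<^bsub>M\<^esub> x" "z \<otimes>\<^bsub>M\<^esub> x'" "w \<otimes>\<^bsub>N\<^esub> y"] frag
      by (simp add: free_mult_diff free_mult_of M.r_distr)
  next
    case (addr x y y')
    thus ?case using rel_addr[of "z \<otimes>\<^bsub>M\<^esub> x" "w \<otimes>\<^bsub>N\<^esub> y" "w \<otimes>\<^bsub>N\<^esub> y'"] frag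
      by (simp add: free_mult_diff free_mult_of N.r_distr)
  next
    case (smult r x y)
    thus ?case using rel_smult[of r "z \<otimes>\<^bsub>M\<^esub> x" "w \<otimes>\<^bsub>N\<^esub> y"] frag
      by (simp add: free_mult_diff free_mult_of smult_mult_M smult_mult_N)
  qed (simp_all add: free_mult_zero free_mult_diff rel_zero rel_diff)
qed (simp_all add: free_mult_zero free_mult_diff rel_zero rel_diff)

lemma rel_ideal: "ideal rel FF"
proof (rule idealI)
  show "ring FF" using free_cring by (rule cring.axioms(1))
  show "subgroup rel (add_monoid FF)" unfolding add_monoid_free_ring by (rule rel_subgroup)
  fix c a assume "c \<in> rel" "a \<in> carrier FF"
  thus "a \<otimes>\<^bsub>FF\<^esub> c \<in> rel" "c \<otimes>\<^bsub>FF\<^esub> a \<in> rel"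
    using rel_mult_closed[of a c] free_mult_comm[of a c] rel_keys[of c] by (simp_all add: free_carrier)
qed

lemma tensor_cring: "cring T"
  unfolding tensor_def by (rule ideal.quotient_is_cring[OF rel_ideal free_cring])

sublocale T: cring T by (rule tensor_cring)

lemma cl_hom: "cl \<in> ring_hom FF T"
  unfolding tensor_def by (rule ideal.rcos_ring_hom[OF rel_ideal])

sublocale cl: ring_hom_cring FF T cl
  by (rule ring_hom_cringI[OF free_cring tensor_cring cl_hom])

lemma cl_diff:
  assumes "Poly_Mapping.keys c \<subseteq> MN" "Poly_Mapping.keys d \<subseteq> MN" shows "cl (c - d) = cl c \<ominus>\<^bsub>T\<^esub> cl d"
proof -
  have "cl (c - d) \<oplus>\<^bsub>T\<^esub> cl d = cl c"
    using cl.hom_add[of "c - d" d] assms keys_diff_MN[OF assms] by (simp add: free_add free_carrier)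
  moreover have "cl (c - d) \<in> carrier T" "cl d \<in> carrier T"
    using assms keys_diff_MN[OF assms] by (auto intro!: cl.hom_closed simp only: free_carrier)
  ultimately show ?thesis using T.r_neg[of "cl d"] T.a_assoc[of "cl (c - d)" "cl d" "\<ominus>\<^bsub>T\<^esub> cl d"] by (simp add: a_minus_def)
qed

lemma pure_eq: "pure x y = cl (frag_of (x, y))"
  by (simp add: pure_tensor_def)

lemma pure_closed [simp]: "x \<in> carrier M \<Longrightarrow> y \<in> carrier N \<Longrightarrow> pure x y \<in> carrier T"
  unfolding pure_eq by (intro cl.hom_closed) (simp add: free_carrier)

lemma pure_mult: "x \<in> carrier M \<Longrightarrow> y \<in> carrier N \<Longrightarrow> x' \<in> carrier M \<Longrightarrow> y' \<in> carrier N \<Longrightarrow>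
    pure x y \<otimes>\<^bsub>T\<^esub> pure x' y' = pure (x \<otimes>\<^bsub>M\<^esub> x') (y \<otimes>\<^bsub>N\<^esub> y')"
  unfolding pure_eq free_mult_of[symmetric] by (intro cl.hom_mult[symmetric]) (simp_all add: free_carrier)

lemma pure_one: "\<one>\<^bsub>T\<^esub> = pure \<one>\<^bsub>M\<^esub> \<one>\<^bsub>N\<^esub>"
  unfolding pure_eq free_one[symmetric] by (rule cl.hom_one[symmetric])

lemma pure_addl:
  assumes "x \<in> carrier M" "x' \<in> carrier M" "y \<in> carrier N"
  shows "pure (x \<oplus>\<^bsub>M\<^esub> x') y = pure x y \<oplus>\<^bsub>T\<^esub> pure x' y"
proof -
  have "frag_of (x \<oplus>\<^bsub>M\<^esub> x', y) - (frag_of (x, y) + frag_of (x', y)) \<in> rel"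
    using rel_addl[OF assms] by (simp add: diff_diff_eq)
  hence "pure (x \<oplus>\<^bsub>M\<^esub> x') y = cl (frag_of (x, y) \<oplus>\<^bsub>FF\<^esub> frag_of (x', y))"
    unfolding pure_eq free_add by (simp only: cl_eq_iff)
  also have "\<dots> = pure x y \<oplus>\<^bsub>T\<^esub> pure x' y"
    unfolding pure_eq using assms by (intro cl.hom_add) (simp_all add: free_carrier)
  finally show ?thesis .
qed

lemma pure_addr:
  assumes "x \<in> carrier M" "y \<in> carrier N" "y' \<in> carrier N"
  shows "pure x (y \<oplus>\<^bsub>N\<^esub> y') = pure x y \<oplus>\<^bsub>T\<^esub> pure x y'"
proof -
  have "frag_of (x, y \<oplus>\<^bsub>N\<^esub> y') - (frag_of (x, y) + frag_of (x, y')) \<in> rel"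
    using rel_addr[OF assms] by (simp add: diff_diff_eq)
  hence "pure x (y \<oplus>\<^bsub>N\<^esub> y') = cl (frag_of (x, y) \<oplus>\<^bsub>FF\<^esub> frag_of (x, y'))"
    unfolding pure_eq free_add by (simp only: cl_eq_iff)
  also have "\<dots> = pure x y \<oplus>\<^bsub>T\<^esub> pure x y'"
    unfolding pure_eq using assms by (intro cl.hom_add) (simp_all add: free_carrier)
  finally show ?thesis .
qed

lemma pure_smult:
  "r \<in> carrier R \<Longrightarrow> x \<in> carrier M \<Longrightarrow> y \<in> carrier N \<Longrightarrow> pure (r \<odot>\<^bsub>M\<^esub> x) y = pure x (r \<odot>\<^bsub>N\<^esub> y)"
  unfolding pure_eq cl_eq_iff by (rule rel_smult)

lemma pure_left_hom: "(\<lambda>x. pure x \<one>\<^bsub>N\<^esub>) \<in> ring_hom M T"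
  by (rule ring_hom_memI) (simp_all add: pure_mult pure_addl pure_one)

lemma pure_right_hom: "(\<lambda>y. pure \<one>\<^bsub>M\<^esub> y) \<in> ring_hom N T"
  by (rule ring_hom_memI) (simp_all add: pure_mult pure_addr pure_one)

lemma pure_decompose: "x \<in> carrier M \<Longrightarrow> y \<in> carrier N \<Longrightarrow> pure x y = pure x \<one>\<^bsub>N\<^esub> \<otimes>\<^bsub>T\<^esub> pure \<one>\<^bsub>M\<^esub> y"
  by (simp add: pure_mult)

lemma tensor_induct [consumes 1, case_names zero diff pure]:
  assumes u: "u \<in> carrier T" and zero: "P \<zero>\<^bsub>T\<^esub>"
    and diff: "\<And>u v. u \<in> carrier T \<Longrightarrow> v \<in> carrier T \<Longrightarrow> P u \<Longrightarrow> P v \<Longrightarrow> P (u \<ominus>\<^bsub>T\<^esub> v)"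
    and pure: "\<And>x y. x \<in> carrier M \<Longrightarrow> y \<in> carrier N \<Longrightarrow> P (pure x y)"
  shows "P u"
proof -
  obtain c where c: "Poly_Mapping.keys c \<subseteq> MN" "u = cl c" using u unfolding tensor_carrier by blast
  have "P (cl c)" using c(1)
  proof (induction rule: free_induct)
    case zero
    show ?case using cl.hom_zero assms(2) by (simp add: free_zero)
  next
    case (diff c d)
    have "cl c \<in> carrier T" "cl d \<in> carrier T" using diff(1,2) by (auto intro!: cl.hom_closed simp: free_carrier)
    thus ?case unfolding cl_diff[OF diff(1,2)] using assms(3) diff by blast
  next
    case (frag x y)
    thus ?case using pure by (simp add: pure_eq)
  qed
  thus ?thesis using c(2) by simp
qed

lemma tensor_subset:
  assumes H: "\<And>x y. x \<in> carrier M \<Longrightarrow> y \<in> carrier N \<Longrightarrow> pure x y \<in> H" and Z: "\<zero>\<^bsub>T\<^esub> \<in> H"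
    and "\<And>u v. u \<in> carrier T \<Longrightarrow> v \<in> carrier T \<Longrightarrow> u \<in> H \<Longrightarrow> v \<in> H \<Longrightarrow> u \<ominus>\<^bsub>T\<^esub> v \<in> H"
  shows "carrier T \<subseteq> H"
proof
  fix u assume "u \<in> carrier T"
  thus "u \<in> H" by (induction rule: tensor_induct) (use assms in auto)
qed

lemma tensor_lift:
  assumes A: "abelian_group A" and f: "\<And>x y. x \<in> carrier M \<Longrightarrow> y \<in> carrier N \<Longrightarrow> f x y \<in> carrier A"
    and fl: "\<And>x x' y. x \<in> carrier M \<Longrightarrow> x' \<in> carrier M \<Longrightarrow> y \<in> carrier N \<Longrightarrow> f (x \<oplus>\<^bsub>M\<^esub> x') y = f x y \<oplus>\<^bsub>A\<^esub> f x' y"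
    and fr: "\<And>x y y'. x \<in> carrier M \<Longrightarrow> y \<in> carrier N \<Longrightarrow> y' \<in> carrier N \<Longrightarrow> f x (y \<oplus>\<^bsub>N\<^esub> y') = f x y \<oplus>\<^bsub>A\<^esub> f x y'"
    and fs: "\<And>r x y. r \<in> carrier R \<Longrightarrow> x \<in> carrier M \<Longrightarrow> y \<in> carrier N \<Longrightarrow> f (r \<odot>\<^bsub>M\<^esub> x) y = f x (r \<odot>\<^bsub>N\<^esub> y)"
  shows "\<exists>\<Psi>. (\<forall>u\<in>carrier T. \<Psi> u \<in> carrier A) \<and> (\<forall>u\<in>carrier T. \<forall>v\<in>carrier T. \<Psi> (u \<oplus>\<^bsub>T\<^esub> v) = \<Psi> u \<oplus>\<^bsub>A\<^esub> \<Psi> v) \<and>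
    (\<forall>x\<in>carrier M. \<forall>y\<in>carrier N. \<Psi> (pure x y) = f x y)"
proof -
  interpret A: abelian_group A by fact
  obtain h where bh: "bilinear_ext A f h" using bilinear_extension[OF A f fl fr fs] by blast
  note h = bilinear_extD[OF bh]
  have eq: "h c = h d" if "Poly_Mapping.keys c \<subseteq> MN" "Poly_Mapping.keys d \<subseteq> MN" "cl c = cl d" for c d
  proof -
    have "h c \<ominus>\<^bsub>A\<^esub> h d = \<zero>\<^bsub>A\<^esub>" using h(3)[OF that(1,2)] h(5)[of "c - d"] that(3) by (simp add: cl_eq_iff)
    moreover have "h c = (h c \<ominus>\<^bsub>A\<^esub> h d) \<oplus>\<^bsub>A\<^esub> h d"
      using h(1)[OF that(1)] h(1)[OF that(2)] by (simp add: a_minus_def A.a_assoc A.l_neg)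
    ultimately show ?thesis using h(1)[OF that(2)] by simp
  qed
  \<comment> \<open>A class is evaluated on a chosen representative; by \<open>eq\<close> the choice
    does not matter.\<close>
  define \<Psi> where "\<Psi> u = h (SOME c. Poly_Mapping.keys c \<subseteq> MN \<and> cl c = u)" for u
  have \<Psi>: "\<Psi> (cl c) = h c" if c: "Poly_Mapping.keys c \<subseteq> MN" for c
  proof -
    have "Poly_Mapping.keys (SOME c'. Poly_Mapping.keys c' \<subseteq> MN \<and> cl c' = cl c) \<subseteq> MN \<and>
        cl (SOME c'. Poly_Mapping.keys c' \<subseteq> MN \<and> cl c' = cl c) = cl c"
      by (rule someI[of "\<lambda>c'. Poly_Mapping.keys c' \<subseteq> MN \<and> cl c' = cl c" c]) (simp add: c)
    thus ?thesis unfolding \<Psi>_def using eq c by blast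
  qed
  have "\<Psi> (u \<oplus>\<^bsub>T\<^esub> v) = \<Psi> u \<oplus>\<^bsub>A\<^esub> \<Psi> v" if uv: "u \<in> carrier T" "v \<in> carrier T" for u v
  proof -
    obtain c where c: "Poly_Mapping.keys c \<subseteq> MN" "u = cl c" using uv(1) unfolding tensor_carrier by blast
    obtain d where d: "Poly_Mapping.keys d \<subseteq> MN" "v = cl d" using uv(2) unfolding tensor_carrier by blast
    have k: "Poly_Mapping.keys (c + d) \<subseteq> MN" using keys_add[of c d] c d by blast
    have "u \<oplus>\<^bsub>T\<^esub> v = cl (c + d)" unfolding c(2) d(2) using cl.hom_add[of c d] c d by (simp add: free_carrier free_add)
    moreover have "h c = h (c + d) \<ominus>\<^bsub>A\<^esub> h d" using h(3)[OF k d(1)] by simp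
    hence "h (c + d) = h c \<oplus>\<^bsub>A\<^esub> h d" using h(1)[OF k] h(1)[OF d(1)] by (simp add: a_minus_def A.a_assoc A.l_neg)
    ultimately show ?thesis using \<Psi>[OF k] \<Psi>[OF c(1)] \<Psi>[OF d(1)] c(2) d(2) by simp
  qed
  moreover have "\<Psi> u \<in> carrier A" if "u \<in> carrier T" for u using that \<Psi> h(1) unfolding tensor_carrier by auto
  moreover have "\<Psi> (pure x y) = f x y" if "x \<in> carrier M" "y \<in> carrier N" for x y
    using \<Psi>[of "frag_of (x, y)"] h(4) that by (simp add: pure_eq)
  ultimately show ?thesis by (intro exI[of _ \<Psi>]) blast
qed

end

section \<open>The retract as an algebra\<close>

lemma (in cring) subring_cring: "subring H R \<Longrightarrow> cring (R\<lparr>carrier := H\<rparr>)"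
  using subcringI' subcring_iff[OF subringE(1)] by blast

lemma is_alg_algebra:
  assumes R: "cring R" and M: "is_alg R M" shows "algebra R M"
proof -
  interpret R: cring R by fact
  interpret M: cring M by (rule is_alg_simps(1)[OF M])
  interpret h: ring_hom_cring R M "\<lambda>r. r \<odot>\<^bsub>M\<^esub> \<one>\<^bsub>M\<^esub>"
    by (rule ring_hom_cringI[OF R M.is_cring is_alg_simps(2)[OF M]])
  note s = is_alg_simps(3)[OF M]
  have c: "r \<odot>\<^bsub>M\<^esub> \<one>\<^bsub>M\<^esub> \<in> carrier M" if "r \<in> carrier R" for r using h.hom_closed[OF that] .
  note sc = is_alg_smult(1)[OF M]
  show ?thesis
  proof (rule algebraI[OF R M.is_cring])
    fix a x assume a: "a \<in> carrier R" "x \<in> carrier M"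
    show "a \<odot>\<^bsub>M\<^esub> x \<in> carrier M" by (rule sc[OF a])
    show "(a \<odot>\<^bsub>M\<^esub> x) \<otimes>\<^bsub>M\<^esub> y = a \<odot>\<^bsub>M\<^esub> (x \<otimes>\<^bsub>M\<^esub> y)" if "y \<in> carrier M" for y
      unfolding s[OF a] s[OF a(1) M.m_closed[OF a(2) that]] using c a that by (simp add: M.m_assoc)
    show "a \<odot>\<^bsub>M\<^esub> (x \<oplus>\<^bsub>M\<^esub> y) = a \<odot>\<^bsub>M\<^esub> x \<oplus>\<^bsub>M\<^esub> a \<odot>\<^bsub>M\<^esub> y" if "y \<in> carrier M" for y
      unfolding s[OF a] s[OF a(1) that] s[OF a(1) M.a_closed[OF a(2) that]] using c a that by (simp add: M.r_distr)
    fix b assume b: "b \<in> carrier R"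
    show "(a \<oplus>\<^bsub>R\<^esub> b) \<odot>\<^bsub>M\<^esub> x = a \<odot>\<^bsub>M\<^esub> x \<oplus>\<^bsub>M\<^esub> b \<odot>\<^bsub>M\<^esub> x"
      unfolding s[OF a] s[OF b a(2)] s[OF R.a_closed[OF a(1) b] a(2)] using h.hom_add[OF a(1) b] c a b by (simp add: M.l_distr)
    have "(a \<otimes>\<^bsub>R\<^esub> b) \<odot>\<^bsub>M\<^esub> x = (a \<odot>\<^bsub>M\<^esub> \<one>\<^bsub>M\<^esub>) \<otimes>\<^bsub>M\<^esub> (b \<odot>\<^bsub>M\<^esub> \<one>\<^bsub>M\<^esub>) \<otimes>\<^bsub>M\<^esub> x"
      using s[OF R.m_closed[OF a(1) b] a(2)] h.hom_mult[OF a(1) b] by simp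
    also have "\<dots> = (a \<odot>\<^bsub>M\<^esub> \<one>\<^bsub>M\<^esub>) \<otimes>\<^bsub>M\<^esub> ((b \<odot>\<^bsub>M\<^esub> \<one>\<^bsub>M\<^esub>) \<otimes>\<^bsub>M\<^esub> x)"
      by (rule M.m_assoc[OF c[OF a(1)] c[OF b] a(2)])
    also have "\<dots> = a \<odot>\<^bsub>M\<^esub> (b \<odot>\<^bsub>M\<^esub> x)"
      unfolding s[OF b a(2), symmetric] by (rule s[OF a(1) sc[OF b a(2)], symmetric])
    finally show "(a \<otimes>\<^bsub>R\<^esub> b) \<odot>\<^bsub>M\<^esub> x = a \<odot>\<^bsub>M\<^esub> (b \<odot>\<^bsub>M\<^esub> x)" .
  next
    fix x assume "x \<in> carrier M"
    thus "\<one>\<^bsub>R\<^esub> \<odot>\<^bsub>M\<^esub> x = x" using s[OF R.one_closed] h.hom_one by simp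
  qed
qed

context retract_data
begin

abbreviation phi where "phi \<equiv> mev R B (mconst R) x"

definition "fixed = {p \<in> carrier B. phi p = p}"

abbreviation AA where "AA \<equiv> B\<lparr>carrier := fixed\<rparr>"

lemma phi_eval: "poly_eval R B (mconst R) I x"
  by (rule poly_eval_mconst[OF x])

lemmas phi_hom = poly_eval.ev_hom[OF phi_eval]

lemma phi_ring_hom: "ring_hom_cring B B phi"
  by (rule ring_hom_cringI[OF mpoly_cring mpoly_cring phi_hom])

lemma phi_idem: "p \<in> carrier B \<Longrightarrow> phi (phi p) = phi p"
proof -
  assume p: "p \<in> carrier B"
  interpret phi: poly_eval R B "mconst R" I x by (rule phi_eval)
  have "(phi \<circ> phi) p = phi p"
  proof (rule mpoly_hom_eqI[OF is_cring mpoly_cring _ phi_hom _ _ p])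
    show "phi \<circ> phi \<in> ring_hom B B" by (rule ring_hom_trans[OF phi_hom phi_hom])
  qed (simp_all add: x_fixed)
  thus ?thesis by simp
qed

lemma phi_fixed: "p \<in> carrier B \<Longrightarrow> phi p \<in> fixed"
  using ring_hom_closed[OF phi_hom] by (simp add: fixed_def phi_idem)

lemma fixed_subring: "subring fixed B"
proof -
  interpret B: cring B by (rule mpoly_cring)
  interpret h: ring_hom_cring B B phi by (rule phi_ring_hom)
  show ?thesis
  proof (rule B.subringI)
    show "\<one>\<^bsub>B\<^esub> \<in> fixed" using h.hom_one by (simp add: fixed_def)
  qed (auto simp: fixed_def h.hom_add h.hom_mult h.hom_a_inv)
qed

lemma AA_cring: "cring AA"
proof -
  interpret B: cring B by (rule mpoly_cring)
  show ?thesis by (rule B.subring_cring[OF fixed_subring])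
qed

lemma fixed_const: "a \<in> carrier R \<Longrightarrow> mconst R a \<in> fixed"
  using poly_eval.ev_const[OF phi_eval] by (simp add: fixed_def)

lemma fixed_x: "i \<in> I \<Longrightarrow> x i \<in> fixed"
  by (simp add: fixed_def x_closed x_fixed)

lemma fixed_F: "F \<in> fixed"
  by (simp add: fixed_def F F_fixed)

lemma AA_alg: "is_alg R AA"
proof -
  interpret B: cring B by (rule mpoly_cring)
  have s: "r \<odot>\<^bsub>B\<^esub> \<one>\<^bsub>B\<^esub> = mconst R r" if "r \<in> carrier R" for r
    using that by (simp add: mpoly_smult_eq)
  have "(\<lambda>r. r \<odot>\<^bsub>AA\<^esub> \<one>\<^bsub>AA\<^esub>) \<in> ring_hom R AA"
    by (intro ring_hom_memI)
       (auto simp: s fixed_const ring_hom_mult[OF mconst_hom] ring_hom_add[OF mconst_hom] ring_hom_one[OF mconst_hom])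
  moreover have "\<forall>r\<in>carrier R. \<forall>p\<in>carrier AA. r \<odot>\<^bsub>AA\<^esub> p = (r \<odot>\<^bsub>AA\<^esub> \<one>\<^bsub>AA\<^esub>) \<otimes>\<^bsub>AA\<^esub> p"
    by (auto simp: s mpoly_smult_eq fixed_def)
  ultimately show ?thesis using AA_cring by (simp only: is_alg_def)
qed

lemma fixed_smult:
  assumes "r \<in> carrier R" "p \<in> fixed"
  shows "r \<odot>\<^bsub>B\<^esub> p = mconst R r \<otimes>\<^bsub>B\<^esub> p" "r \<odot>\<^bsub>B\<^esub> p \<in> fixed"
  using assms subringE(6)[OF fixed_subring fixed_const[OF assms(1)] assms(2)] by (simp_all add: fixed_def mpoly_smult_eq)

text \<open>A fixed polynomial is its own value at \<open>x\<close>, hence lies in the subalgebra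
  generated by the \<open>x i\<close>.\<close>

lemma AA_finitely_generated: "\<exists>G. finite G \<and> G \<subseteq> carrier AA \<and> adjoin R AA G = carrier AA"
proof (intro exI conjI)
  interpret B: cring B by (rule mpoly_cring)
  interpret A: cring AA by (rule AA_cring)
  interpret phi: poly_eval R B "mconst R" I x by (rule phi_eval)
  let ?H = "(\<lambda>s. s \<odot>\<^bsub>AA\<^esub> \<one>\<^bsub>AA\<^esub>) ` carrier R \<union> x ` I"
  show "finite (x ` I)" using finite_I by simp
  show "x ` I \<subseteq> carrier AA" using fixed_x by auto
  have H: "?H \<subseteq> carrier AA"
  proof -
    have "(\<lambda>s. s \<odot>\<^bsub>AA\<^esub> \<one>\<^bsub>AA\<^esub>) ` carrier R \<subseteq> carrier AA"
      using ring_hom_closed[OF is_alg_simps(2)[OF AA_alg]] by blast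
    thus ?thesis using fixed_x by auto
  qed
  show "adjoin R AA (x ` I) = carrier AA"
  proof
    show "adjoin R AA (x ` I) \<subseteq> carrier AA" unfolding adjoin_def by (rule A.generate_ring_incl[OF H])
    show "carrier AA \<subseteq> adjoin R AA (x ` I)"
    proof
      fix p assume "p \<in> carrier AA"
      hence p: "p \<in> carrier B" "phi p = p" by (auto simp: fixed_def)
      have "phi p \<in> adjoin R AA (x ` I)"
      proof (rule phi.ev_mem[OF p(1)])
        fix a assume a: "a \<in> carrier R"
        have "a \<odot>\<^bsub>AA\<^esub> \<one>\<^bsub>AA\<^esub> = mconst R a" using a by (simp add: mpoly_smult_eq)
        thus "mconst R a \<in> adjoin R AA (x ` I)" unfolding adjoin_def using a by (intro generate_ring.incl) force
      next
        show "x i \<in> adjoin R AA (x ` I)" if "i \<in> I" for i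
          unfolding adjoin_def using that by (intro generate_ring.incl) auto
        fix u v assume uv: "u \<in> adjoin R AA (x ` I)" "v \<in> adjoin R AA (x ` I)"
        show "u \<oplus>\<^bsub>B\<^esub> v \<in> adjoin R AA (x ` I)"
          using generate_ring.eng_add[OF uv[unfolded adjoin_def]] by (simp add: adjoin_def)
        show "u \<otimes>\<^bsub>B\<^esub> v \<in> adjoin R AA (x ` I)"
          using generate_ring.eng_mult[OF uv[unfolded adjoin_def]] by (simp add: adjoin_def)
      qed
      thus "p \<in> adjoin R AA (x ` I)" using p(2) by simp
    qed
  qed
qed

text \<open>The Jacobian criterion for the single element \<open>F\<close>, over \<open>R\<close>
  itself, which may have zero divisors: unimodularity cancels the gradient of
  \<open>F\<close>.\<close>

lemma F_alg_independent: "alg_independent R AA {F}"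
proof -
  interpret B: cring B by (rule mpoly_cring)
  interpret A: cring AA by (rule AA_cring)
  interpret P: cring "mpoly R {F}" by (rule mpoly_cring)
  interpret e: poly_eval R B "mconst R" "{F}" "\<lambda>t. t"
    by (rule poly_eval_mconst) (simp add: F)
  interpret eh: ring_hom_cring "mpoly R {F}" B e.ev
    by (rule ring_hom_cringI[OF mpoly_cring mpoly_cring e.ev_hom])
  have mem: "e.ev p \<in> fixed" if p: "p \<in> carrier (mpoly R {F})" for p
    by (rule e.ev_mem[OF p])
       (use subringE(6,7)[OF fixed_subring] fixed_const fixed_F in auto)
  have "e.ev \<in> alg_hom R (mpoly R {F}) AA"
    unfolding alg_hom_def
  proof (intro CollectI conjI ballI)
    show "e.ev \<in> ring_hom (mpoly R {F}) AA"
      by (rule ring_hom_memI) (use mem eh.hom_one in \<open>auto simp: eh.hom_mult eh.hom_add\<close>)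
    fix r p assume rp: "r \<in> carrier R" "p \<in> carrier (mpoly R {F})"
    show "e.ev (r \<odot>\<^bsub>mpoly R {F}\<^esub> p) = r \<odot>\<^bsub>AA\<^esub> e.ev p"
      using fixed_smult(1)[OF rp(1) mem[OF rp(2)]] rp by (simp add: mpoly_smult_eq e.ev_const_mult)
  qed
  moreover have "inj_on e.ev (carrier (mpoly R {F}))"
  proof (rule inj_onI)
    fix p q assume pq: "p \<in> carrier (mpoly R {F})" "q \<in> carrier (mpoly R {F})" "e.ev p = e.ev q"
    let ?d = "p \<ominus>\<^bsub>mpoly R {F}\<^esub> q"
    have d: "?d \<in> carrier (mpoly R {F})" using pq by simp
    have ed: "e.ev ?d = \<zero>\<^bsub>B\<^esub>"
      using pq e.ev_closed[OF pq(2)] by (simp add: P.minus_eq eh.hom_add eh.hom_a_inv B.r_neg)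
    have dz: "mconst R (?d m) = \<zero>\<^bsub>B\<^esub>" for m
    proof (rule e.ev_eq_zero_iff[of "partial_deriv R ` I", OF _ qalg_mpoly _ _ _ d ed])
      show "derivation B D" if "D \<in> partial_deriv R ` I" for D
        using that pd_derivation by (elim imageE) simp
      show "D (mconst R a) = \<zero>\<^bsub>B\<^esub>" if "D \<in> partial_deriv R ` I" for D a
        using that pd_const[of _ _ I] by (elim imageE) simp
      fix g assume g: "g \<in> {F} \<rightarrow> carrier B"
        and z: "\<And>D. D \<in> partial_deriv R ` I \<Longrightarrow> (\<Oplus>\<^bsub>B\<^esub>j\<in>{F}. g j \<otimes>\<^bsub>B\<^esub> D j) = \<zero>\<^bsub>B\<^esub>"
      have gF: "g F \<in> carrier B" using g by simp
      have "g F = \<zero>\<^bsub>B\<^esub>"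
      proof (rule unimodular_zero[OF gF])
        fix i assume "i \<in> I"
        thus "g F \<otimes>\<^bsub>B\<^esub> partial_deriv R i F = \<zero>\<^bsub>B\<^esub>"
          using z[of "partial_deriv R i"] gF F by simp
      qed
      thus "\<forall>j\<in>{F}. g j = \<zero>\<^bsub>B\<^esub>" by simp
    qed simp
    have "?d m = \<zero>" for m using arg_cong[OF dz[of m], of "\<lambda>f. f {#}"] by (simp add: mpoly_zero)
    hence "?d = \<zero>\<^bsub>mpoly R {F}\<^esub>" by (simp add: mpoly_zero fun_eq_iff)
    thus "p = q" using pq by simp
  qed
  ultimately show ?thesis unfolding alg_independent_def using fixed_F by (intro conjI bexI[of _ e.ev]) auto
qed

text \<open>Sending \<open>a\<close> to its coefficients gives an embedding of \<open>A \<otimes> N\<close> into a direct sum of copies of \<open>N\<close>,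
  natural in \<open>N\<close>; it is injective because \<open>a = \<Sum> a\<^sub>m \<phi>(X\<^sup>m)\<close>.\<close>

lemma AA_flat: "flat TYPE('x) R AA"
  unfolding flat_def
proof (intro allI impI)
  fix N N' :: "('a, 'x) module" and g
  assume H: "module R N \<and> module R N' \<and> g \<in> hom (add_monoid N) (add_monoid N') \<and>
     (\<forall>r\<in>carrier R. \<forall>x\<in>carrier N. g (r \<odot>\<^bsub>N\<^esub> x) = r \<odot>\<^bsub>N'\<^esub> g x) \<and> inj_on g (carrier N)"
  interpret B: cring B by (rule mpoly_cring)
  interpret N: module R N using H by blast
  interpret N': module R N' using H by blast
  have g_closed: "g y \<in> carrier N'" if "y \<in> carrier N" for y
    using H that by (auto simp: hom_def)
  have g_add: "g (y \<oplus>\<^bsub>N\<^esub> z) = g y \<oplus>\<^bsub>N'\<^esub> g z" if "y \<in> carrier N" "z \<in> carrier N" for y z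
    using H that by (auto simp: hom_def)
  have g_smult: "g (r \<odot>\<^bsub>N\<^esub> y) = r \<odot>\<^bsub>N'\<^esub> g y" if "r \<in> carrier R" "y \<in> carrier N" for r y
    using H that by blast
  have g_inj: "inj_on g (carrier N)" using H by blast
  have g_zero: "g \<zero>\<^bsub>N\<^esub> = \<zero>\<^bsub>N'\<^esub>"
    using g_add[of "\<zero>\<^bsub>N\<^esub>" "\<zero>\<^bsub>N\<^esub>"] g_closed[of "\<zero>\<^bsub>N\<^esub>"] by (simp add: N'.add.r_cancel_one')
  have g_diff: "g (y \<ominus>\<^bsub>N\<^esub> z) = g y \<ominus>\<^bsub>N'\<^esub> g z" if yz: "y \<in> carrier N" "z \<in> carrier N" for y z
  proof -
    have "g (y \<ominus>\<^bsub>N\<^esub> z) \<oplus>\<^bsub>N'\<^esub> g z = g y"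
      using g_add[of "y \<ominus>\<^bsub>N\<^esub> z" z] yz by (simp add: a_minus_def N.a_assoc N.l_neg)
    hence "g y \<ominus>\<^bsub>N'\<^esub> g z = (g (y \<ominus>\<^bsub>N\<^esub> z) \<oplus>\<^bsub>N'\<^esub> g z) \<ominus>\<^bsub>N'\<^esub> g z" by simp
    also have "\<dots> = g (y \<ominus>\<^bsub>N\<^esub> z)"
      using g_closed[of "y \<ominus>\<^bsub>N\<^esub> z"] g_closed[of z] yz by (simp add: a_minus_def N'.a_assoc N'.r_neg)
    finally show ?thesis ..
  qed
  interpret t: tensor_pair R AA N
    using subringE(7)[OF fixed_subring] by unfold_locales (auto intro: fixed_smult(2))
  interpret t': tensor_pair R AA N'
    using subringE(7)[OF fixed_subring] by unfold_locales (auto intro: fixed_smult(2))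
  \<comment> \<open>\<open>E\<close> is the map of free groups underlying the tensor map;
    injectivity amounts to \<open>E c\<close> being a relation only if \<open>c\<close> is
    one.\<close>
  define E :: "_ \<Rightarrow> (('i multiset \<Rightarrow> 'a) \<times> 'x) \<Rightarrow>\<^sub>0 int" where "E = frag_extend (\<lambda>(x, y). frag_of (id x, g y))"
  have E_diff: "E (c - d) = E c - E d" for c d by (simp add: E_def frag_extend_diff)
  have E_add: "E (c + d) = E c + E d" for c d by (simp add: E_def frag_extend_add)
  have E_of: "E (frag_of (a, y)) = frag_of (a, g y)" for a y by (simp add: E_def)
  have E_zero: "E 0 = 0" by (simp add: E_def)
  have E_keys: "Poly_Mapping.keys (E c) \<subseteq> t'.MN" if "Poly_Mapping.keys c \<subseteq> t.MN" for c
    using that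
  proof (induction rule: t.free_induct)
    case (diff c d)
    thus ?case unfolding E_diff by (intro t'.keys_diff_MN)
  qed (simp_all add: E_zero E_of g_closed)
  have E_rel: "E c \<in> t'.rel" if "c \<in> t.rel" for c
    using that
  proof (induction rule: t.rel_induct)
    case (addl a a' y)
    thus ?case using t'.rel_addl[of a a' "g y"] by (simp add: E_diff E_of g_closed)
  next
    case (addr a y y')
    thus ?case using t'.rel_addr[of a "g y" "g y'"] by (simp add: E_diff E_of g_closed g_add)
  next
    case (smult r a y)
    thus ?case using t'.rel_smult[of r a "g y"] by (simp add: E_diff E_of g_closed g_smult)
  qed (simp_all add: E_zero E_diff t'.rel_zero t'.rel_diff)
  \<comment> \<open>The tensor map is a union over representatives; all of them give the same class
    because \<open>E\<close> maps relations to relations.\<close>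
  have map: "tensor_map R AA N' id g (t.cl c) = t'.cl (E c)" for c
  proof -
    have "t'.cl (E (r + c)) = t'.cl (E c)" if "r \<in> t.rel" for r
      unfolding t'.cl_eq_iff using E_rel[OF that] by (simp add: E_add)
    thus ?thesis unfolding tensor_map_def E_def[symmetric] t.cl_eq using t.rel_zero by auto
  qed
  \<comment> \<open>Multiplying \<open>y\<close> by the coefficient of \<open>a\<close> at
    \<open>m\<close> is bilinear and balanced; its extension \<open>\<Psi> m\<close> is the
    component at \<open>m\<close> of the embedding.\<close>
  define f where "f m = (\<lambda>a y. a m \<odot>\<^bsub>N\<^esub> y)" for m :: "'i multiset"
  define f' where "f' m = (\<lambda>a y. a m \<odot>\<^bsub>N'\<^esub> y)" for m :: "'i multiset"
  have fc: "a m \<in> carrier R" if "a \<in> fixed" for a m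
    using that mpoly_coeff_closed by (auto simp: fixed_def)
  have "\<exists>h. t.bilinear_ext N (f m) h" for m
  proof (rule t.bilinear_extension[OF N.abelian_group_axioms])
    fix r a y assume "r \<in> carrier R" "a \<in> carrier AA" "y \<in> carrier N"
    thus "f m (r \<odot>\<^bsub>AA\<^esub> a) y = f m a (r \<odot>\<^bsub>N\<^esub> y)"
      using m_comm[of r "a m"] N.smult_assoc1[of "a m" r y] fc[of a m] by (simp add: f_def mpoly_smult)
  qed (simp_all add: f_def fc mpoly_add N.smult_l_distr N.smult_r_distr)
  then obtain \<Psi> where \<Psi>: "\<And>m. t.bilinear_ext N (f m) (\<Psi> m)" by metis
  have "\<exists>h. t'.bilinear_ext N' (f' m) h" for m
  proof (rule t'.bilinear_extension[OF N'.abelian_group_axioms])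
    fix r a y assume "r \<in> carrier R" "a \<in> carrier AA" "y \<in> carrier N'"
    thus "f' m (r \<odot>\<^bsub>AA\<^esub> a) y = f' m a (r \<odot>\<^bsub>N'\<^esub> y)"
      using m_comm[of r "a m"] N'.smult_assoc1[of "a m" r y] fc[of a m] by (simp add: f'_def mpoly_smult)
  qed (simp_all add: f'_def fc mpoly_add N'.smult_l_distr N'.smult_r_distr)
  then obtain \<Psi>' where \<Psi>': "\<And>m. t'.bilinear_ext N' (f' m) (\<Psi>' m)" by metis
  note p = t.bilinear_extD[OF \<Psi>] and p' = t'.bilinear_extD[OF \<Psi>']
  have nat: "\<Psi>' m (E c) = g (\<Psi> m c)" if "Poly_Mapping.keys c \<subseteq> t.MN" for m c
    using that
  proof (induction rule: t.free_induct)
    case zero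
    show ?case by (simp add: E_zero p(2) p'(2) g_zero)
  next
    case (diff c d)
    thus ?case by (simp only: E_diff p(3) p'(3) E_keys g_diff p(1))
  next
    case (frag a y)
    thus ?case by (simp add: E_of p(4) p'(4) g_closed f_def f'_def fc g_smult)
  qed
  \<comment> \<open>\<open>?e m\<close> is the image of the monomial \<open>m\<close> under the
    retraction, so a fixed \<open>a\<close> is the sum of the \<open>?e m\<close> with the
    coefficients \<open>a m\<close>.\<close>
  let ?e = "mmon B x"
  interpret phi: poly_eval R B "mconst R" I x by (rule phi_eval)
  have e: "?e m \<in> fixed" if "set_mset m \<subseteq> I" for m
    using that
  proof (induction m)
    case empty
    show ?case using subringE(3)[OF fixed_subring] by simp
  next
    case (add i m)
    thus ?case using subringE(6)[OF fixed_subring, of "?e m" "x i"] fixed_x by (simp add: phi.mmon_add_mset)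
  qed
  have zl: "frag_of (\<zero>\<^bsub>B\<^esub>, y) \<in> t.rel" if "y \<in> carrier N" for y
    using t.rel_minus[OF t.rel_addl[of "\<zero>\<^bsub>B\<^esub>" "\<zero>\<^bsub>B\<^esub>" y]] that subringE(2)[OF fixed_subring] by simp
  have zr: "frag_of (a, \<zero>\<^bsub>N\<^esub>) \<in> t.rel" if "a \<in> fixed" for a
    using t.rel_minus[OF t.rel_addr[of a "\<zero>\<^bsub>N\<^esub>" "\<zero>\<^bsub>N\<^esub>"]] that by simp
  have sum_rel: "sum h W \<in> t.rel" if "\<And>m. m \<in> W \<Longrightarrow> h m \<in> t.rel" for h and W :: "'i multiset set"
    using that by (induction W rule: infinite_finite_induct) (simp_all add: t.rel_zero t.rel_add)
  \<comment> \<open>Modulo relations \<open>c\<close> is the sum of the tensors of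
    \<open>?e m\<close> with \<open>\<Psi> m c\<close>, over \<open>W\<close> and over every larger
    finite index set. The larger sets are included so that two index sets can be merged when
    \<open>c\<close> is a difference.\<close>
  define G where "G c W \<longleftrightarrow> finite W \<and> (\<forall>m\<in>W. set_mset m \<subseteq> I) \<and> (\<forall>W'. finite W' \<longrightarrow> W \<subseteq> W' \<longrightarrow>
      (\<forall>m\<in>W'. set_mset m \<subseteq> I) \<longrightarrow> c - (\<Sum>m\<in>W'. frag_of (?e m, \<Psi> m c)) \<in> t.rel)" for c W
  have GI: "G c W" if "finite W" "\<And>m. m \<in> W \<Longrightarrow> set_mset m \<subseteq> I" "\<And>W'. finite W' \<Longrightarrow> W \<subseteq> W' \<Longrightarrow>
      (\<forall>m\<in>W'. set_mset m \<subseteq> I) \<Longrightarrow> c - (\<Sum>m\<in>W'. frag_of (?e m, \<Psi> m c)) \<in> t.rel" for c W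
    using that by (simp add: G_def)
  have GD: "finite W" "\<forall>m\<in>W. set_mset m \<subseteq> I" "\<And>W'. finite W' \<Longrightarrow> W \<subseteq> W' \<Longrightarrow>
      (\<forall>m\<in>W'. set_mset m \<subseteq> I) \<Longrightarrow> c - (\<Sum>m\<in>W'. frag_of (?e m, \<Psi> m c)) \<in> t.rel" if "G c W" for c W
    using that by (simp_all add: G_def)
  have expand: "\<exists>W. G c W"
    if "Poly_Mapping.keys c \<subseteq> t.MN" for c
    using that
  proof (induction rule: t.free_induct)
    case zero
    have "- (\<Sum>m\<in>W'. frag_of (?e m, \<Psi> m 0)) \<in> t.rel" if "\<forall>m\<in>W'. set_mset m \<subseteq> I" for W'
      using that by (intro t.rel_minus sum_rel) (simp add: p(2) zr e)
    thus ?case by (intro exI[of _ "{}"] GI) simp_all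
  next
    case (diff c d)
    obtain W where W: "G c W" using diff.IH(1) by blast
    obtain V where V: "G d V" using diff.IH(2) by blast
    have "c - d - (\<Sum>m\<in>W'. frag_of (?e m, \<Psi> m (c - d))) \<in> t.rel"
      if W': "finite W'" "W \<union> V \<subseteq> W'" "\<forall>m\<in>W'. set_mset m \<subseteq> I" for W'
    proof -
      have one: "frag_of (?e m, \<Psi> m c) - frag_of (?e m, \<Psi> m (c - d)) - frag_of (?e m, \<Psi> m d) \<in> t.rel" if "m \<in> W'" for m
      proof -
        have cd: "\<Psi> m c \<in> carrier N" "\<Psi> m d \<in> carrier N" using p(1) diff.hyps by blast+
        have "\<Psi> m (c - d) \<oplus>\<^bsub>N\<^esub> \<Psi> m d = \<Psi> m c"
          unfolding p(3)[OF diff.hyps] using cd by (simp add: a_minus_def N.a_assoc N.l_neg)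
        moreover have "\<Psi> m (c - d) \<in> carrier N" using p(1)[OF t.keys_diff_MN[OF diff.hyps]] .
        moreover have "?e m \<in> carrier AA" using e that W'(3) by simp
        ultimately show ?thesis using t.rel_addr[of "?e m" "\<Psi> m (c - d)" "\<Psi> m d"] cd(2) by simp
      qed
      have "c - (\<Sum>m\<in>W'. frag_of (?e m, \<Psi> m c)) \<in> t.rel" using GD(3)[OF W W'(1) _ W'(3)] W'(2) by simp
      moreover have "d - (\<Sum>m\<in>W'. frag_of (?e m, \<Psi> m d)) \<in> t.rel" using GD(3)[OF V W'(1) _ W'(3)] W'(2) by simp
      moreover have "(\<Sum>m\<in>W'. frag_of (?e m, \<Psi> m c) - frag_of (?e m, \<Psi> m (c - d)) - frag_of (?e m, \<Psi> m d)) \<in> t.rel"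
        by (rule sum_rel[OF one])
      ultimately have "(c - (\<Sum>m\<in>W'. frag_of (?e m, \<Psi> m c))) - (d - (\<Sum>m\<in>W'. frag_of (?e m, \<Psi> m d))) +
         (\<Sum>m\<in>W'. frag_of (?e m, \<Psi> m c) - frag_of (?e m, \<Psi> m (c - d)) - frag_of (?e m, \<Psi> m d)) \<in> t.rel"
        by (intro t.rel_add t.rel_diff[of "c - _" "d - _"])
      thus ?thesis unfolding sum_subtractf by (simp add: algebra_simps)
    qed
    thus ?case using GD(1,2)[OF W] GD(1,2)[OF V] by (intro exI[of _ "W \<union> V"] GI) auto
  next
    case (frag a y)
    hence a: "a \<in> fixed" "a \<in> carrier B" "phi a = a" and y: "y \<in> carrier N" by (simp_all add: fixed_def)
    let ?W = "{m. a m \<noteq> \<zero>}"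
    let ?s = "\<lambda>W. \<Oplus>\<^bsub>B\<^esub>m\<in>W. mconst R (a m) \<otimes>\<^bsub>B\<^esub> ?e m"
    have partial: "?s W' \<in> fixed \<and> frag_of (?s W', y) - (\<Sum>m\<in>W'. frag_of (?e m, a m \<odot>\<^bsub>N\<^esub> y)) \<in> t.rel"
      if "finite W'" "\<forall>m\<in>W'. set_mset m \<subseteq> I" for W'
      using that
    proof (induction W' rule: finite_induct)
      case empty
      show ?case using zl[OF y] subringE(2)[OF fixed_subring] by simp
    next
      case (insert m W')
      have em: "?e m \<in> fixed" "?e m \<in> carrier B" using insert.prems e by (auto simp: fixed_def)
      have t: "mconst R (a m) \<otimes>\<^bsub>B\<^esub> ?e m = a m \<odot>\<^bsub>B\<^esub> ?e m"
        "a m \<odot>\<^bsub>B\<^esub> ?e m \<in> fixed"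
        using fixed_smult[OF fc[OF a(1)] em(1)] by simp_all
      have ec: "mconst R (a m) \<otimes>\<^bsub>B\<^esub> ?e m \<in> carrier B" if "set_mset m \<subseteq> I" for m
        using that fc[OF a(1), of m] by (intro B.m_closed) auto
      have s: "?s (insert m W') = a m \<odot>\<^bsub>B\<^esub> ?e m \<oplus>\<^bsub>B\<^esub> ?s W'"
        unfolding t(1)[symmetric] using insert.prems by (intro B.finsum_insert[OF insert.hyps]) (auto intro!: ec)
      have IH: "?s W' \<in> fixed" "frag_of (?s W', y) - (\<Sum>m\<in>W'. frag_of (?e m, a m \<odot>\<^bsub>N\<^esub> y)) \<in> t.rel"
        using insert.IH insert.prems by auto
      have "(frag_of (?s (insert m W'), y) - frag_of (a m \<odot>\<^bsub>B\<^esub> ?e m, y) - frag_of (?s W', y)) +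
          (frag_of (?s W', y) - (\<Sum>m\<in>W'. frag_of (?e m, a m \<odot>\<^bsub>N\<^esub> y))) +
          (frag_of (a m \<odot>\<^bsub>B\<^esub> ?e m, y) - frag_of (?e m, a m \<odot>\<^bsub>N\<^esub> y)) \<in> t.rel"
        using t.rel_addl[of "a m \<odot>\<^bsub>B\<^esub> ?e m" "?s W'" y] t.rel_smult[of "a m" "?e m" y] t(2) IH em(1) y fc[OF a(1)]
        by (intro t.rel_add) (simp_all add: s)
      moreover have "?s (insert m W') \<in> fixed" unfolding s using subringE(7)[OF fixed_subring t(2) IH(1)] .
      ultimately show ?case using insert.hyps by (simp add: algebra_simps)
    qed
    have "frag_of (a, y) - (\<Sum>m\<in>W'. frag_of (?e m, \<Psi> m (frag_of (a, y)))) \<in> t.rel"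
      if W': "finite W'" "?W \<subseteq> W'" "\<forall>m\<in>W'. set_mset m \<subseteq> I" for W'
    proof -
      have "?s W' = a" using phi.ev_superset[OF a(2) W'(1,2)] W'(3) a(3) by simp
      moreover have "\<Psi> m (frag_of (a, y)) = a m \<odot>\<^bsub>N\<^esub> y" for m using p(4)[of a y m] a y by (simp add: f_def)
      ultimately show ?thesis using partial[OF W'(1,3)] by simp
    qed
    thus ?case using mpoly_finite_support[OF a(2)] mpoly_support_subset[OF a(2)] by (intro exI[of _ ?W] GI) auto
  qed
  \<comment> \<open>Naturality and injectivity of \<open>g\<close> make all components of
    \<open>c\<close> zero, and the expansion of \<open>c\<close> then consists of tensors with a
    zero factor.\<close>
  have inj: "c \<in> t.rel" if c: "Poly_Mapping.keys c \<subseteq> t.MN" "E c \<in> t'.rel" for c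
  proof -
    have z: "\<Psi> m c = \<zero>\<^bsub>N\<^esub>" for m
    proof -
      have "g (\<Psi> m c) = g \<zero>\<^bsub>N\<^esub>" using nat[OF c(1)] p'(5)[OF c(2)] g_zero by simp
      thus ?thesis using inj_onD[OF g_inj] p(1)[OF c(1)] by blast
    qed
    obtain W where GW: "G c W" using expand[OF c(1)] by blast
    note W = GD(1)[OF GW] GD(3)[OF GW GD(1)[OF GW] subset_refl GD(2)[OF GW]] GD(2)[OF GW]
    have "(\<Sum>m\<in>W. frag_of (?e m, \<Psi> m c)) \<in> t.rel" using W(3) by (intro sum_rel) (simp add: z zr e)
    from t.rel_add[OF W(2) this] show ?thesis by simp
  qed
  show "inj_on (tensor_map R AA N' id g) (carrier (tensor R AA N))"
  proof (rule inj_onI)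
    fix u v assume uv: "u \<in> carrier (tensor R AA N)" "v \<in> carrier (tensor R AA N)"
      "tensor_map R AA N' id g u = tensor_map R AA N' id g v"
    obtain c where c: "Poly_Mapping.keys c \<subseteq> t.MN" "u = t.cl c" using uv(1) unfolding t.tensor_carrier by blast
    obtain d where d: "Poly_Mapping.keys d \<subseteq> t.MN" "v = t.cl d" using uv(2) unfolding t.tensor_carrier by blast
    have "E (c - d) \<in> t'.rel" using uv(3) unfolding c(2) d(2) map t'.cl_eq_iff by (simp add: E_diff)
    thus "u = v" unfolding c(2) d(2) t.cl_eq_iff by (rule inj[OF t.keys_diff_MN[OF c(1) d(1)]])
  qed
qed

end

section \<open>Base change of the retract\<close>

lemma (in ring_hom_cring) inj_on_zeroI:
  assumes z: "\<And>a. a \<in> carrier R \<Longrightarrow> h a = \<zero>\<^bsub>S\<^esub> \<Longrightarrow> a = \<zero>\<^bsub>R\<^esub>"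
  shows "inj_on h (carrier R)"
proof (rule inj_onI)
  fix a b assume ab: "a \<in> carrier R" "b \<in> carrier R" "h a = h b"
  hence "h (a \<oplus> \<ominus> b) = \<zero>\<^bsub>S\<^esub>" by (simp add: S.r_neg)
  hence "a \<oplus> \<ominus> b = \<zero>" using z ab by simp
  hence "(a \<oplus> \<ominus> b) \<oplus> b = b" using ab by simp
  thus "a = b" using ab by (simp add: R.a_assoc R.l_neg)
qed

text \<open>The additive lift is multiplicative on pure tensors, and both sides of the product rule
  are additive in each factor.\<close>

lemma (in tensor_algebra) tensor_lift_ring:
  assumes C: "cring C" and g: "g \<in> ring_hom M C" and h: "h \<in> ring_hom N C"
    and bal: "\<And>r. r \<in> carrier R \<Longrightarrow> g (r \<odot>\<^bsub>M\<^esub> \<one>\<^bsub>M\<^esub>) = h (r \<odot>\<^bsub>N\<^esub> \<one>\<^bsub>N\<^esub>)"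
  shows "\<exists>\<Psi>. \<Psi> \<in> ring_hom T C \<and> (\<forall>x\<in>carrier M. \<forall>y\<in>carrier N. \<Psi> (pure x y) = g x \<otimes>\<^bsub>C\<^esub> h y)"
proof -
  interpret C: cring C by fact
  interpret g: ring_hom_cring M C g by (rule ring_hom_cringI[OF M.is_cring C g])
  interpret h: ring_hom_cring N C h by (rule ring_hom_cringI[OF N.is_cring C h])
  have gs: "g (r \<odot>\<^bsub>M\<^esub> x) = g (r \<odot>\<^bsub>M\<^esub> \<one>\<^bsub>M\<^esub>) \<otimes>\<^bsub>C\<^esub> g x" if "r \<in> carrier R" "x \<in> carrier M" for r x
    using g.hom_mult[OF smult_M[OF that(1) M.one_closed] that(2)] is_alg_simps(3)[OF alg_M that] by simp
  have hs: "h (r \<odot>\<^bsub>N\<^esub> y) = h (r \<odot>\<^bsub>N\<^esub> \<one>\<^bsub>N\<^esub>) \<otimes>\<^bsub>C\<^esub> h y" if "r \<in> carrier R" "y \<in> carrier N" for r y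
    using h.hom_mult[OF smult_N[OF that(1) N.one_closed] that(2)] is_alg_simps(3)[OF alg_N that] by simp
  have "\<exists>\<Psi>. (\<forall>u\<in>carrier T. \<Psi> u \<in> carrier C) \<and> (\<forall>u\<in>carrier T. \<forall>v\<in>carrier T. \<Psi> (u \<oplus>\<^bsub>T\<^esub> v) = \<Psi> u \<oplus>\<^bsub>C\<^esub> \<Psi> v) \<and>
    (\<forall>x\<in>carrier M. \<forall>y\<in>carrier N. \<Psi> (pure x y) = g x \<otimes>\<^bsub>C\<^esub> h y)"
  proof (rule tensor_lift[OF C.abelian_group_axioms])
    fix r x y assume r: "r \<in> carrier R" "x \<in> carrier M" "y \<in> carrier N"
    have hr: "h (r \<odot>\<^bsub>N\<^esub> \<one>\<^bsub>N\<^esub>) \<in> carrier C" using smult_N[OF r(1)] by simp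
    show "g (r \<odot>\<^bsub>M\<^esub> x) \<otimes>\<^bsub>C\<^esub> h y = g x \<otimes>\<^bsub>C\<^esub> h (r \<odot>\<^bsub>N\<^esub> y)"
      unfolding gs[OF r(1,2)] hs[OF r(1,3)] bal[OF r(1)] using hr r by (simp add: C.m_ac)
  qed (simp_all add: C.l_distr C.r_distr)
  then obtain \<Psi> where \<Psi>: "\<forall>u\<in>carrier T. \<Psi> u \<in> carrier C"
    "\<forall>u\<in>carrier T. \<forall>v\<in>carrier T. \<Psi> (u \<oplus>\<^bsub>T\<^esub> v) = \<Psi> u \<oplus>\<^bsub>C\<^esub> \<Psi> v"
    "\<forall>x\<in>carrier M. \<forall>y\<in>carrier N. \<Psi> (pure x y) = g x \<otimes>\<^bsub>C\<^esub> h y" by blast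
  interpret \<Psi>: abelian_group_hom T C \<Psi>
  proof (rule abelian_group_homI[OF T.abelian_group_axioms C.abelian_group_axioms])
    show "group_hom (add_monoid T) (add_monoid C) \<Psi>"
      using \<Psi>(1,2) T.a_group C.a_group by (auto simp: group_hom_def group_hom_axioms_def hom_def)
  qed
  have diff: "\<Psi> (u \<ominus>\<^bsub>T\<^esub> v) = \<Psi> u \<ominus>\<^bsub>C\<^esub> \<Psi> v" if "u \<in> carrier T" "v \<in> carrier T" for u v
    using that by (simp add: a_minus_def)
  have pp: "\<Psi> (pure x y \<otimes>\<^bsub>T\<^esub> pure x' y') = \<Psi> (pure x y) \<otimes>\<^bsub>C\<^esub> \<Psi> (pure x' y')"
    if "x \<in> carrier M" "y \<in> carrier N" "x' \<in> carrier M" "y' \<in> carrier N" for x y x' y'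
    using that \<Psi>(3) by (simp add: pure_mult C.m_ac)
  have up: "\<Psi> (u \<otimes>\<^bsub>T\<^esub> pure x' y') = \<Psi> u \<otimes>\<^bsub>C\<^esub> \<Psi> (pure x' y')"
    if u: "u \<in> carrier T" and xy: "x' \<in> carrier M" "y' \<in> carrier N" for u x' y'
    using u
  proof (induction rule: tensor_induct)
    case (diff u v)
    have "(u \<ominus>\<^bsub>T\<^esub> v) \<otimes>\<^bsub>T\<^esub> pure x' y' = u \<otimes>\<^bsub>T\<^esub> pure x' y' \<ominus>\<^bsub>T\<^esub> v \<otimes>\<^bsub>T\<^esub> pure x' y'"
      using diff.hyps xy by (simp add: a_minus_def T.l_distr T.l_minus)
    thus ?case using diff xy by (simp add: \<open>\<And>v u. u \<in> carrier T \<Longrightarrow> v \<in> carrier T \<Longrightarrow> \<Psi> (u \<ominus>\<^bsub>T\<^esub> v) = \<Psi> u \<ominus>\<^bsub>C\<^esub> \<Psi> v\<close>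
        a_minus_def C.l_distr C.l_minus)
  qed (use xy pp in simp_all)
  have mult: "\<Psi> (u \<otimes>\<^bsub>T\<^esub> v) = \<Psi> u \<otimes>\<^bsub>C\<^esub> \<Psi> v" if u: "u \<in> carrier T" and v: "v \<in> carrier T" for u v
    using v
  proof (induction rule: tensor_induct)
    case (diff v w)
    have "u \<otimes>\<^bsub>T\<^esub> (v \<ominus>\<^bsub>T\<^esub> w) = u \<otimes>\<^bsub>T\<^esub> v \<ominus>\<^bsub>T\<^esub> u \<otimes>\<^bsub>T\<^esub> w"
      using diff.hyps u by (simp add: a_minus_def T.r_distr T.r_minus)
    thus ?case using diff u by (simp add: \<open>\<And>v u. u \<in> carrier T \<Longrightarrow> v \<in> carrier T \<Longrightarrow> \<Psi> (u \<ominus>\<^bsub>T\<^esub> v) = \<Psi> u \<ominus>\<^bsub>C\<^esub> \<Psi> v\<close>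
        a_minus_def C.r_distr C.r_minus)
  qed (use u up in simp_all)
  have "\<Psi> \<in> ring_hom T C"
    by (rule ring_hom_memI) (use \<Psi> mult g.hom_one h.hom_one in \<open>auto simp: pure_one\<close>)
  thus ?thesis using \<Psi>(3) by blast
qed

locale retract_tensor = retract_data R I F b x
  for R :: "('a, 'm) ring_scheme" (structure) and I :: "'i::wellorder set" and F b x +
  fixes L :: "('a, 'c, 'q) module_scheme"
  assumes alg_L: "is_alg R L"

sublocale retract_tensor \<subseteq> t: tensor_algebra R AA L
  using AA_cring AA_alg alg_L is_alg_simps(1)[OF alg_L] by (intro tensor_algebra.intro tensor_algebra_axioms.intro)

context retract_tensor
begin

abbreviation "BL \<equiv> mpoly L I"

definition rho where "rho = (\<lambda>r. r \<odot>\<^bsub>L\<^esub> \<one>\<^bsub>L\<^esub>)"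

text \<open>The base change of the surjection of \<open>B\<close> onto \<open>A\<close>:
  \<open>X\<^sub>i\<close> goes to the class of \<open>x\<^sub>i \<otimes> 1\<close>.\<close>

definition "Theta = mev L t.T (\<lambda>l. t.pure \<one>\<^bsub>B\<^esub> l) (\<lambda>i. t.pure (x i) \<one>\<^bsub>L\<^esub>)"

lemma rho_hom: "rho \<in> ring_hom R L" unfolding rho_def by (rule is_alg_simps(2)[OF alg_L])

lemma rho_cring_hom: "ring_hom_cring R L rho"
  by (rule ring_hom_cringI[OF is_cring t.N.is_cring rho_hom])

lemma right_hom: "(\<lambda>l. t.pure \<one>\<^bsub>B\<^esub> l) \<in> ring_hom L t.T"
  using t.pure_right_hom by simp

lemma Theta_eval: "poly_eval L t.T (\<lambda>l. t.pure \<one>\<^bsub>B\<^esub> l) I (\<lambda>i. t.pure (x i) \<one>\<^bsub>L\<^esub>)"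
  using t.N.is_cring t.tensor_cring right_hom fixed_x by (auto simp: poly_eval_def poly_eval_axioms_def)

lemma Theta_hom: "Theta \<in> ring_hom BL t.T"
  unfolding Theta_def by (rule poly_eval.ev_hom[OF Theta_eval])

lemma Theta_cring_hom: "ring_hom_cring BL t.T Theta"
  by (rule ring_hom_cringI[OF t.N.mpoly_cring t.tensor_cring Theta_hom])

lemma Theta_closed: "p \<in> carrier BL \<Longrightarrow> Theta p \<in> carrier t.T"
  by (rule ring_hom_closed[OF Theta_hom])

lemma Theta_const: "l \<in> carrier L \<Longrightarrow> Theta (mconst L l) = t.pure \<one>\<^bsub>B\<^esub> l"
  unfolding Theta_def by (rule poly_eval.ev_const[OF Theta_eval])

lemma Theta_var: "i \<in> I \<Longrightarrow> Theta (mvar L i) = t.pure (x i) \<one>\<^bsub>L\<^esub>"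
  unfolding Theta_def by (rule poly_eval.ev_var[OF Theta_eval])

lemma pure_base: "r \<in> carrier R \<Longrightarrow> t.pure (mconst R r) \<one>\<^bsub>L\<^esub> = t.pure \<one>\<^bsub>B\<^esub> (rho r)"
proof -
  interpret B: cring B by (rule mpoly_cring)
  assume r: "r \<in> carrier R"
  have "\<one>\<^bsub>B\<^esub> \<in> fixed" using subringE(3)[OF fixed_subring] .
  thus ?thesis using t.pure_smult[OF r, of "\<one>\<^bsub>B\<^esub>" "\<one>\<^bsub>L\<^esub>"] fixed_smult(1)[OF r] r by (simp add: rho_def)
qed

lemma Theta_comp:
  assumes p: "p \<in> carrier B" shows "Theta (rho \<circ> p) = t.pure (phi p) \<one>\<^bsub>L\<^esub>"
proof -
  interpret B: cring B by (rule mpoly_cring)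
  interpret h: ring_hom_cring R L rho by (rule rho_cring_hom)
  interpret phi: poly_eval R B "mconst R" I x by (rule phi_eval)
  have "phi \<in> ring_hom B AA"
    using phi_hom by (intro ring_hom_memI) (auto simp: phi_fixed ring_hom_mult ring_hom_add ring_hom_one[OF phi_hom])
  hence r: "(\<lambda>a. t.pure a \<one>\<^bsub>L\<^esub>) \<circ> phi \<in> ring_hom B t.T"
    using t.pure_left_hom by (rule ring_hom_trans)
  have l: "Theta \<circ> (\<circ>) rho \<in> ring_hom B t.T" by (rule ring_hom_trans[OF h.comp_hom Theta_hom])
  have "(Theta \<circ> (\<circ>) rho) p = ((\<lambda>a. t.pure a \<one>\<^bsub>L\<^esub>) \<circ> phi) p"
  proof (rule mpoly_hom_eqI[OF is_cring t.tensor_cring l r _ _ p])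
    fix a assume a: "a \<in> carrier R"
    show "(Theta \<circ> (\<circ>) rho) (mconst R a) = ((\<lambda>a. t.pure a \<one>\<^bsub>L\<^esub>) \<circ> phi) (mconst R a)"
      unfolding comp_apply h.comp_mconst[OF a] phi.ev_const[OF a] pure_base[OF a] by (rule Theta_const[OF h.hom_closed[OF a]])
  next
    fix i assume i: "i \<in> I"
    show "(Theta \<circ> (\<circ>) rho) (mvar R i) = ((\<lambda>a. t.pure a \<one>\<^bsub>L\<^esub>) \<circ> phi) (mvar R i)"
      unfolding comp_apply h.comp_mvar phi.ev_var[OF i] by (rule Theta_var[OF i])
  qed
  thus ?thesis by (simp only: comp_apply)
qed

text \<open>The base change of the inclusion of \<open>A\<close> in \<open>B\<close>. Its values on
  pure tensors determine it on the tensor product, so the choice is harmless.\<close>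

definition "Psi = (SOME \<Psi>. \<Psi> \<in> ring_hom t.T BL \<and>
  (\<forall>a\<in>carrier AA. \<forall>l\<in>carrier L. \<Psi> (t.pure a l) = (rho \<circ> a) \<otimes>\<^bsub>BL\<^esub> mconst L l))"

lemma Psi_hom: "Psi \<in> ring_hom t.T BL"
  and Psi_pure: "a \<in> fixed \<Longrightarrow> l \<in> carrier L \<Longrightarrow> Psi (t.pure a l) = (rho \<circ> a) \<otimes>\<^bsub>BL\<^esub> mconst L l"
proof -
  interpret h: ring_hom_cring R L rho by (rule rho_cring_hom)
  interpret B: cring B by (rule mpoly_cring)
  have "\<exists>\<Psi>. \<Psi> \<in> ring_hom t.T BL \<and>
     (\<forall>a\<in>carrier AA. \<forall>l\<in>carrier L. \<Psi> (t.pure a l) = (rho \<circ> a) \<otimes>\<^bsub>BL\<^esub> mconst L l)"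
  proof (rule t.tensor_lift_ring[OF t.N.mpoly_cring _ t.N.mconst_hom])
    show "(\<circ>) rho \<in> ring_hom AA BL"
      by (rule ring_hom_memI)
         (use ring_hom_one[OF h.comp_hom] in \<open>auto simp: fixed_def ring_hom_closed[OF h.comp_hom] ring_hom_mult[OF h.comp_hom] ring_hom_add[OF h.comp_hom]\<close>)
    fix r assume r: "r \<in> carrier R"
    have "r \<odot>\<^bsub>B\<^esub> \<one>\<^bsub>B\<^esub> = mconst R r" using r by (simp add: mpoly_smult_eq)
    thus "rho \<circ> (r \<odot>\<^bsub>AA\<^esub> \<one>\<^bsub>AA\<^esub>) = mconst L (r \<odot>\<^bsub>L\<^esub> \<one>\<^bsub>L\<^esub>)" by (simp add: h.comp_mconst[OF r] rho_def[THEN fun_cong, symmetric])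
  qed
  hence "Psi \<in> ring_hom t.T BL \<and>
     (\<forall>a\<in>carrier AA. \<forall>l\<in>carrier L. Psi (t.pure a l) = (rho \<circ> a) \<otimes>\<^bsub>BL\<^esub> mconst L l)"
    unfolding Psi_def by (rule someI_ex)
  thus "Psi \<in> ring_hom t.T BL"
    and "a \<in> fixed \<Longrightarrow> l \<in> carrier L \<Longrightarrow> Psi (t.pure a l) = (rho \<circ> a) \<otimes>\<^bsub>BL\<^esub> mconst L l" by simp_all
qed

lemma Psi_closed: "u \<in> carrier t.T \<Longrightarrow> Psi u \<in> carrier BL"
  by (rule ring_hom_closed[OF Psi_hom])

text \<open>Together with \<open>Theta_Psi\<close> this makes \<open>Psi\<close> an isomorphism of
  \<open>A \<otimes> L\<close> onto the fixed ring of the base-changed retraction.\<close>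

lemma Psi_Theta:
  assumes p: "p \<in> carrier BL" shows "Psi (Theta p) = retr L rho p"
proof -
  interpret h: ring_hom_cring R L rho by (rule rho_cring_hom)
  interpret B: cring B by (rule mpoly_cring)
  interpret P: cring BL by (rule t.N.mpoly_cring)
  have one: "\<one>\<^bsub>B\<^esub> \<in> fixed" using subringE(3)[OF fixed_subring] .
  have "(Psi \<circ> Theta) p = retr L rho p"
  proof (rule mpoly_hom_eqI[OF t.N.is_cring t.N.mpoly_cring ring_hom_trans[OF Theta_hom Psi_hom] retr_hom[OF t.N.is_cring rho_hom] _ _ p])
    fix a assume a: "a \<in> carrier L"
    have "(rho \<circ> \<one>\<^bsub>B\<^esub>) \<otimes>\<^bsub>BL\<^esub> mconst L a = mconst L a"
      unfolding ring_hom_one[OF h.comp_hom] using a by simp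
    thus "(Psi \<circ> Theta) (mconst L a) = retr L rho (mconst L a)"
      unfolding comp_apply Theta_const[OF a] Psi_pure[OF one a] retr_const[OF t.N.is_cring rho_hom a] .
  next
    fix i assume i: "i \<in> I"
    have "(rho \<circ> x i) \<otimes>\<^bsub>BL\<^esub> mconst L \<one>\<^bsub>L\<^esub> = rho \<circ> x i"
      using h.comp_closed[OF x_closed[OF i]] by (simp add: t.N.mpoly_one[where I=I, symmetric])
    moreover have "retr L rho (mvar L i) = rho \<circ> x i"
      unfolding retr_def using i x_closed by (intro poly_eval.ev_var[OF t.N.poly_eval_mconst]) (auto intro!: h.comp_closed)
    ultimately show "(Psi \<circ> Theta) (mvar L i) = retr L rho (mvar L i)"
      using i by (simp add: Theta_var Psi_pure[OF fixed_x])
  qed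
  thus ?thesis by simp
qed

lemma Theta_Psi:
  assumes u: "u \<in> carrier t.T" shows "Theta (Psi u) = u"
proof -
  interpret h: ring_hom_cring R L rho by (rule rho_cring_hom)
  interpret th: ring_hom_cring BL t.T Theta by (rule Theta_cring_hom)
  interpret ps: ring_hom_cring t.T BL Psi
    by (rule ring_hom_cringI[OF t.tensor_cring t.N.mpoly_cring Psi_hom])
  show ?thesis using u
  proof (induction rule: t.tensor_induct)
    case zero
    show ?case by (simp add: ps.hom_zero th.hom_zero)
  next
    case (diff u v)
    thus ?case by (simp add: a_minus_def)
  next
    case (pure a l)
    hence a: "a \<in> fixed" "a \<in> carrier B" "phi a = a" "l \<in> carrier L" by (simp_all add: fixed_def)
    have "Theta (Psi (t.pure a l)) = Theta (rho \<circ> a) \<otimes>\<^bsub>t.T\<^esub> Theta (mconst L l)"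
      unfolding Psi_pure[OF a(1,4)] using a h.comp_closed[OF a(2)] by (intro th.hom_mult) auto
    also have "\<dots> = t.pure a \<one>\<^bsub>L\<^esub> \<otimes>\<^bsub>t.T\<^esub> t.pure \<one>\<^bsub>B\<^esub> l" using a by (simp only: Theta_comp Theta_const)
    also have "\<dots> = t.pure a l" using t.pure_decompose[of a l] a by simp
    finally show ?case .
  qed
qed

lemma retr_Psi: "u \<in> carrier t.T \<Longrightarrow> retr L rho (Psi u) = Psi u"
  using Psi_Theta[OF Psi_closed] Theta_Psi by simp

lemma Theta_inj:
  assumes "p \<in> carrier BL" "q \<in> carrier BL" "retr L rho p = p" "retr L rho q = q" "Theta p = Theta q"
  shows "p = q"
proof -
  have "p = Psi (Theta p)" by (simp only: Psi_Theta[OF assms(1)] assms(3))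
  also have "\<dots> = q" by (simp only: assms(5) Psi_Theta[OF assms(2)] assms(4))
  finally show ?thesis .
qed

lemma Theta_F: "Theta (rho \<circ> F) = t.pure F \<one>\<^bsub>L\<^esub>"
  using Theta_comp[OF F] F_fixed by simp

lemma comp_F_closed: "rho \<circ> F \<in> carrier BL"
  using ring_hom_cring.comp_closed[OF rho_cring_hom F] .

lemma retr_ev2:
  assumes J: "J \<subseteq> {1..2}" and s: "s \<in> carrier BL" "retr L rho s = s" and q: "q \<in> carrier (mpoly L J)"
  shows "retr L rho (ev2 L I (rho \<circ> F) s q) = ev2 L I (rho \<circ> F) s q"
proof -
  interpret P: cring BL by (rule t.N.mpoly_cring)
  interpret e: poly_eval L BL "mconst L" J "\<lambda>j::nat. if j = 1 then rho \<circ> F else s"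
    by (rule t.N.poly_eval_mconst) (simp add: comp_F_closed s)
  have "(retr L rho \<circ> ev2 L I (rho \<circ> F) s) q = ev2 L I (rho \<circ> F) s q"
  proof (rule mpoly_hom_eqI[OF t.N.is_cring t.N.mpoly_cring ring_hom_trans[OF e.ev_hom retr_hom[OF t.N.is_cring rho_hom]] e.ev_hom _ _ q])
    fix i assume "i \<in> J"
    thus "(retr L rho \<circ> ev2 L I (rho \<circ> F) s) (mvar L i) = ev2 L I (rho \<circ> F) s (mvar L i)"
      using s(2) retr_F[OF t.N.is_cring rho_hom] by simp
  qed (simp add: retr_const[OF t.N.is_cring rho_hom])
  thus ?thesis by simp
qed

lemma retr_gen2_fixed:
  "g \<in> gen2 L I (rho \<circ> F) s \<Longrightarrow> s \<in> carrier BL \<Longrightarrow> retr L rho s = s \<Longrightarrow> retr L rho g = g"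
  unfolding gen2_def using retr_ev2[OF subset_refl] by blast

text \<open>The polynomial variable over \<open>L[F]\<close> is transported to the fixed ring, where
  it becomes \<open>s\<close>. Generation by \<open>F\<close> and \<open>s\<close> comes from
  surjectivity of the given isomorphism; that \<open>s\<close> lies outside \<open>L[F]\<close>
  comes from its injectivity, as a constant and the variable cannot have the same image.\<close>

lemma coordinate_exists:
  assumes fL: "field L" and poly: "is_poly_ring_over_adjoin L (t.pure F \<one>\<^bsub>L\<^esub>) (base_change R AA L)"
  shows "\<exists>s\<in>carrier BL. retr L rho s = s \<and> (\<forall>i\<in>I. rho \<circ> x i \<in> gen2 L I (rho \<circ> F) s) \<and>
    s \<notin> fspan L I (rho \<circ> F)"
proof -
  interpret fL: field L by fact
  interpret P: cring BL by (rule t.N.mpoly_cring)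
  interpret th: ring_hom_cring BL t.T Theta by (rule Theta_cring_hom)
  define C where "C = base_change R AA L"
  have C_simps: "carrier C = carrier t.T" "\<And>u v. u \<otimes>\<^bsub>C\<^esub> v = u \<otimes>\<^bsub>t.T\<^esub> v" "\<And>u v. u \<oplus>\<^bsub>C\<^esub> v = u \<oplus>\<^bsub>t.T\<^esub> v"
    "\<one>\<^bsub>C\<^esub> = \<one>\<^bsub>t.T\<^esub>" "\<zero>\<^bsub>C\<^esub> = \<zero>\<^bsub>t.T\<^esub>" "\<And>l u. l \<odot>\<^bsub>C\<^esub> u = t.pure \<one>\<^bsub>B\<^esub> l \<otimes>\<^bsub>t.T\<^esub> u"
    by (simp_all add: C_def base_change_def)
  interpret C: cring C by (rule cring_cong[OF t.tensor_cring]) (simp_all add: C_simps)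
  define f where "f = t.pure F \<one>\<^bsub>L\<^esub>"
  have f: "f \<in> carrier t.T" using fixed_F by (simp add: f_def)
  have scal: "l \<odot>\<^bsub>C\<^esub> \<one>\<^bsub>C\<^esub> = Theta (mconst L l)" "l \<odot>\<^bsub>C\<^esub> \<one>\<^bsub>C\<^esub> \<in> carrier t.T" if "l \<in> carrier L" for l
    using that ring_hom_closed[OF right_hom that] by (simp_all add: C_simps Theta_const)
  define H where "H = (\<lambda>s. s \<odot>\<^bsub>C\<^esub> \<one>\<^bsub>C\<^esub>) ` carrier L \<union> {f}"
  have H: "H \<subseteq> carrier C" using f scal(2) by (auto simp: H_def C_simps(1))
  define K where "K = generate_ring C H"
  have K_eq: "adjoin L C {f} = K" by (simp add: K_def adjoin_def H_def)
  have K_sub: "subring K C" unfolding K_def by (rule C.generate_ring_is_subring[OF H])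
  define S where "S = C\<lparr>carrier := K\<rparr>"
  have S_simps: "carrier S = K" "\<And>u v. u \<otimes>\<^bsub>S\<^esub> v = u \<otimes>\<^bsub>t.T\<^esub> v" "\<And>u v. u \<oplus>\<^bsub>S\<^esub> v = u \<oplus>\<^bsub>t.T\<^esub> v"
    "\<one>\<^bsub>S\<^esub> = \<one>\<^bsub>t.T\<^esub>" "\<zero>\<^bsub>S\<^esub> = \<zero>\<^bsub>t.T\<^esub>"
    by (simp_all add: S_def C_simps)
  interpret S: cring S unfolding S_def by (rule C.subring_cring[OF K_sub])
  have K_closed: "u \<in> carrier t.T" if "u \<in> K" for u using subringE(1)[OF K_sub] that by (auto simp: C_simps(1))
  have "is_poly_ring S 1 (algebra_via id C)" using poly by (simp add: is_poly_ring_over_adjoin_def C_def[symmetric] f_def[symmetric] K_eq S_def)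
  then obtain h where h: "h \<in> alg_hom S (mpoly S {1::nat}) (algebra_via id C)" "bij_betw h (carrier (mpoly S {1::nat})) (carrier (algebra_via id C))"
    unfolding is_poly_ring_def by (auto simp: atLeastAtMost_singleton)
  have h_hom: "h \<in> ring_hom (mpoly S {1::nat}) (algebra_via id C)" using h(1) by (simp add: alg_hom_def)
  have h_bij: "bij_betw h (carrier (mpoly S {1::nat})) (carrier t.T)" using h(2) by (simp add: C_simps(1))
  interpret Q: cring "mpoly S {1::nat}" by (rule S.mpoly_cring)
  have h_closed: "h P \<in> carrier t.T" if "P \<in> carrier (mpoly S {1::nat})" for P using h_bij that by (auto simp: bij_betw_def)
  have h_one: "h \<one>\<^bsub>mpoly S {1::nat}\<^esub> = \<one>\<^bsub>t.T\<^esub>" using ring_hom_one[OF h_hom] by (simp add: C_simps)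
  have h_const: "h (mconst S c) = c" if c: "c \<in> K" for c
  proof -
    have "h (c \<odot>\<^bsub>mpoly S {1::nat}\<^esub> \<one>\<^bsub>mpoly S {1::nat}\<^esub>) = c \<odot>\<^bsub>algebra_via id C\<^esub> h \<one>\<^bsub>mpoly S {1::nat}\<^esub>"
      using h(1) c by (simp add: alg_hom_def S_simps(1))
    moreover have "c \<odot>\<^bsub>mpoly S {1::nat}\<^esub> \<one>\<^bsub>mpoly S {1::nat}\<^esub> = mconst S c"
      using c by (simp add: S.mpoly_smult_eq S_simps(1))
    ultimately show ?thesis using h_one K_closed[OF c] by (simp add: C_simps)
  qed
  define u where "u = h (mvar S 1)"
  have u: "u \<in> carrier t.T" unfolding u_def by (rule h_closed) simp
  define s where "s = Psi u"
  have s: "s \<in> carrier BL" "retr L rho s = s" "Theta s = u"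
    unfolding s_def using Psi_closed[OF u] retr_Psi[OF u] Theta_Psi[OF u] by blast+
  define FL where "FL = rho \<circ> F"
  note Fs = comp_F_closed[folded FL_def] s(1)
  have gc: "g \<in> carrier BL" if "g \<in> gen2 L I FL s" for g using t.N.gen2_closed[OF Fs that] .
  \<comment> \<open>\<open>L[F]\<close> is given as a generated subring of the tensor product, so
    the transport follows its generation, including additive inverses.\<close>
  have K_gen2: "c \<in> Theta ` gen2 L I FL s" if "c \<in> K" for c
    using that unfolding K_def
  proof (induction rule: generate_ring.induct)
    case one
    have "\<one>\<^bsub>BL\<^esub> \<in> gen2 L I FL s" using t.N.gen2_const[OF Fs t.N.one_closed] by (simp add: t.N.mpoly_one)
    thus ?case using th.hom_one by (intro image_eqI[of _ _ "\<one>\<^bsub>BL\<^esub>"]) (simp_all add: C_simps)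
  next
    case (incl c)
    show ?case
    proof (cases "c = f")
      case True
      thus ?thesis using t.N.gen2_F[OF Fs] Theta_F[folded FL_def] by (intro image_eqI[of _ _ FL]) (simp_all add: f_def)
    next
      case False
      then obtain l where "l \<in> carrier L" "c = l \<odot>\<^bsub>C\<^esub> \<one>\<^bsub>C\<^esub>" using incl by (auto simp: H_def)
      thus ?thesis using scal(1) t.N.gen2_const[OF Fs] by blast
    qed
  next
    case (a_inv c)
    then obtain g where g: "g \<in> gen2 L I FL s" "c = Theta g" by blast
    have m: "mconst L (\<ominus>\<^bsub>L\<^esub> \<one>\<^bsub>L\<^esub>) \<otimes>\<^bsub>BL\<^esub> g \<in> gen2 L I FL s"
      using t.N.gen2_mult[OF Fs t.N.gen2_const[OF Fs] g(1)] by simp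
    have "mconst L (\<ominus>\<^bsub>L\<^esub> \<one>\<^bsub>L\<^esub>) \<otimes>\<^bsub>BL\<^esub> g \<oplus>\<^bsub>BL\<^esub> g = \<zero>\<^bsub>BL\<^esub>"
      using gc[OF g(1)] by (simp add: t.N.mconst_mult t.N.mpoly_add t.N.mpoly_zero t.N.l_minus t.N.l_neg)
    hence "Theta (mconst L (\<ominus>\<^bsub>L\<^esub> \<one>\<^bsub>L\<^esub>) \<otimes>\<^bsub>BL\<^esub> g) \<oplus>\<^bsub>t.T\<^esub> c = \<zero>\<^bsub>t.T\<^esub>"
      using th.hom_add[OF gc[OF m] gc[OF g(1)]] th.hom_zero g(2) by simp
    hence "\<ominus>\<^bsub>C\<^esub> c = Theta (mconst L (\<ominus>\<^bsub>L\<^esub> \<one>\<^bsub>L\<^esub>) \<otimes>\<^bsub>BL\<^esub> g)"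
      using Theta_closed[OF gc[OF m]] Theta_closed[OF gc[OF g(1)]] g(2) by (intro C.minus_equality) (simp_all add: C_simps)
    thus ?case using m by blast
  next
    case (eng_add c d)
    then obtain g g' where g: "g \<in> gen2 L I FL s" "c = Theta g" "g' \<in> gen2 L I FL s" "d = Theta g'" by blast
    have "c \<oplus>\<^bsub>C\<^esub> d = Theta (g \<oplus>\<^bsub>BL\<^esub> g')" using th.hom_add[OF gc[OF g(1)] gc[OF g(3)]] g by (simp add: C_simps)
    thus ?case using t.N.gen2_add[OF Fs g(1,3)] by blast
  next
    case (eng_mult c d)
    then obtain g g' where g: "g \<in> gen2 L I FL s" "c = Theta g" "g' \<in> gen2 L I FL s" "d = Theta g'" by blast
    have "c \<otimes>\<^bsub>C\<^esub> d = Theta (g \<otimes>\<^bsub>BL\<^esub> g')" using th.hom_mult[OF gc[OF g(1)] gc[OF g(3)]] g by (simp add: C_simps)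
    thus ?case using t.N.gen2_mult[OF Fs g(1,3)] by blast
  qed
  have h_gen2: "h P \<in> Theta ` gen2 L I FL s" if "P \<in> carrier (mpoly S {1::nat})" for P
    using that
  proof (induction P rule: S.mpoly_induct)
    case (const a)
    thus ?case using K_gen2 h_const by (simp add: S_simps(1))
  next
    case (add p q)
    then obtain g g' where g: "g \<in> gen2 L I FL s" "h p = Theta g" "g' \<in> gen2 L I FL s" "h q = Theta g'" by blast
    have "h (p \<oplus>\<^bsub>mpoly S {1::nat}\<^esub> q) = Theta (g \<oplus>\<^bsub>BL\<^esub> g')"
      using th.hom_add[OF gc[OF g(1)] gc[OF g(3)]] g ring_hom_add[OF h_hom add.hyps] by (simp add: C_simps)
    thus ?case using t.N.gen2_add[OF Fs g(1,3)] by blast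
  next
    case (var p i)
    then obtain g where g: "g \<in> gen2 L I FL s" "h p = Theta g" by blast
    have "h (p \<otimes>\<^bsub>mpoly S {1::nat}\<^esub> mvar S i) = Theta (g \<otimes>\<^bsub>BL\<^esub> s)"
      using th.hom_mult[OF gc[OF g(1)] s(1)] g s(3) ring_hom_mult[OF h_hom var.hyps(1) S.mvar_closed[OF var.hyps(2)]] var.hyps(2)
      by (simp add: C_simps u_def)
    thus ?case using t.N.gen2_mult[OF Fs g(1) t.N.gen2_s[OF Fs]] by blast
  qed
  have retr_gen2: "retr L rho g = g" if "g \<in> gen2 L I FL s" for g
    using that s(1,2) unfolding FL_def by (rule retr_gen2_fixed)
  have x_gen2: "rho \<circ> x i \<in> gen2 L I FL s" if i: "i \<in> I" for i
  proof -
    have xc: "rho \<circ> x i \<in> carrier BL" by (rule ring_hom_cring.comp_closed[OF rho_cring_hom x_closed[OF i]])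
    have "Theta (rho \<circ> x i) \<in> h ` carrier (mpoly S {1::nat})"
      unfolding bij_betw_imp_surj_on[OF h_bij] by (rule Theta_closed[OF xc])
    hence "Theta (rho \<circ> x i) \<in> Theta ` gen2 L I FL s" using h_gen2 by (elim imageE) simp
    then obtain g where g: "g \<in> gen2 L I FL s" "Theta (rho \<circ> x i) = Theta g" by (elim imageE)
    have "rho \<circ> x i = g"
      by (rule Theta_inj[OF xc gc[OF g(1)] retr_x[OF t.N.is_cring rho_hom i] retr_gen2[OF g(1)] g(2)])
    thus ?thesis using g(1) by simp
  qed
  have fspan_K: "Theta v \<in> K" if "v \<in> fspan L I FL" for v
    using that
  proof (induction rule: fspan.induct)
    case zero
    show ?case using subringE(2)[OF K_sub] th.hom_zero by (simp add: C_simps)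
  next
    case (add v r k)
    have Fk: "FL [^]\<^bsub>BL\<^esub> k \<in> carrier BL" using Fs(1) by simp
    have Fk': "Theta (FL [^]\<^bsub>BL\<^esub> k) \<in> K" for k :: nat
    proof (induction k)
      case 0
      show ?case using subringE(3)[OF K_sub] th.hom_one by (simp add: C_simps)
    next
      case (Suc k)
      have "f \<in> K" unfolding K_def H_def by (intro generate_ring.incl) simp
      thus ?case using subringE(6)[OF K_sub Suc, of f] Fs(1) Theta_F[folded FL_def] by (simp add: C_simps f_def)
    qed
    have "Theta (mconst L r) \<in> K" unfolding scal(1)[OF add.hyps(2), symmetric] K_def H_def
      using add.hyps(2) by (intro generate_ring.incl) blast
    from subringE(6)[OF K_sub this Fk'[of k]] have "Theta (mconst L r \<otimes>\<^bsub>BL\<^esub> FL [^]\<^bsub>BL\<^esub> k) \<in> K"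
      using Fk add.hyps(2) by (simp add: C_simps th.hom_mult)
    from subringE(7)[OF K_sub add.IH this] show ?case
      using Fk add.hyps(2) t.N.fspan_closed[OF Fs(1) add.hyps(1)] by (simp add: C_simps th.hom_add)
  qed
  have "s \<notin> fspan L I FL"
  proof
    assume "s \<in> fspan L I FL"
    hence uK: "u \<in> K" using fspan_K s(3) by blast
    have "mconst S u = mvar S (1::nat)"
    proof (rule inj_onD)
      show "inj_on h (carrier (mpoly S {1::nat}))" using h_bij by (simp add: bij_betw_def)
      show "h (mconst S u) = h (mvar S 1)" using h_const[OF uK] by (simp add: u_def)
      show "mconst S u \<in> carrier (mpoly S {1::nat})" using uK by (simp add: S_simps(1))
    qed simp
    \<comment> \<open>Comparing the coefficients of the variable gives \<open>0 = 1\<close> in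
      \<open>A \<otimes> L\<close>; \<open>Theta\<close> is injective on fixed polynomials, so the
      contradiction descends to the field \<open>L\<close>.\<close>
    hence "mconst S u {#1::nat#} = mvar S (1::nat) {#1#}" by simp
    hence "\<zero>\<^bsub>S\<^esub> = \<one>\<^bsub>S\<^esub>" by (simp add: S.indexed_var_def S.indexed_pmult_def)
    hence eq: "Theta \<zero>\<^bsub>BL\<^esub> = Theta \<one>\<^bsub>BL\<^esub>" using th.hom_zero th.hom_one by (simp add: S_simps)
    have rz: "retr L rho \<zero>\<^bsub>BL\<^esub> = \<zero>\<^bsub>BL\<^esub>"
      by (rule ring_hom_cring.hom_zero[OF ring_hom_cringI[OF P.is_cring P.is_cring retr_hom[OF t.N.is_cring rho_hom]]])
    have "\<zero>\<^bsub>BL\<^esub> = \<one>\<^bsub>BL\<^esub>"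
      by (rule Theta_inj[OF P.zero_closed P.one_closed rz ring_hom_one[OF retr_hom[OF t.N.is_cring rho_hom]] eq])
    hence "\<zero>\<^bsub>BL\<^esub> ({#} :: 'i multiset) = \<one>\<^bsub>BL\<^esub> {#}" by simp
    thus False using fL.one_not_zero by (simp add: t.N.mpoly_zero t.N.mpoly_one)
  qed
  thus ?thesis using s x_gen2 unfolding FL_def by blast
qed

end

section \<open>Fibres of the retract in which F is a coordinate\<close>

lemma (in cring) mpoly_carrier_mono: "J \<subseteq> J' \<Longrightarrow> p \<in> carrier (mpoly R J) \<Longrightarrow> p \<in> carrier (mpoly R J')"
  by (auto simp: mpoly_carrier_iff)

text \<open>The conclusion of the specialization theorem at one prime, taken as hypotheses on a
  field \<open>L\<close>: \<open>F\<close> and \<open>s\<close> generate the fibre, and the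
  nonvanishing in \<open>jac_s\<close> makes them independent.\<close>

locale coordinate_fibre = retract_tensor R I F b x L
  for R :: "('a, 'm) ring_scheme" (structure) and I :: "'i::wellorder set" and F b x
    and L :: "('a, 'c, 'q) module_scheme" +
  fixes s :: "'i multiset \<Rightarrow> 'c" and i1 j1 :: 'i
  assumes field_L: "field L" and s: "s \<in> carrier (mpoly L I)" and s_fixed: "retr L rho s = s"
    and x_gen2: "\<And>i. i \<in> I \<Longrightarrow> rho \<circ> x i \<in> gen2 L I (rho \<circ> F) s"
    and ij: "i1 \<in> I" "j1 \<in> I" and jac_s: "jac L I (rho \<circ> F) i1 j1 s \<noteq> \<zero>\<^bsub>mpoly L I\<^esub>"
begin

lemma ev2_eval: "J \<subseteq> {1..2::nat} \<Longrightarrow> poly_eval L BL (mconst L) J (\<lambda>j::nat. if j = 1 then rho \<circ> F else s)"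
  by (rule t.N.poly_eval_mconst) (simp add: comp_F_closed s)

lemma L_domain: "domain L"
  using field_L by (rule field.axioms(1))

text \<open>The index set is a parameter so that one map serves both for \<open>L[F, s]\<close> and,
  with only the first variable, for \<open>L[F]\<close>.\<close>

lemma ev2_inj:
  assumes J: "J \<subseteq> {1..2::nat}"
  shows "inj_on (ev2 L I (rho \<circ> F) s) (carrier (mpoly L J))"
proof -
  interpret G: grad_poly L I "rho \<circ> F" "\<lambda>i. rho \<circ> b i" by (rule hom_grad_poly[OF t.N.is_cring rho_hom])
  interpret h: ring_hom_cring "mpoly L J" BL "ev2 L I (rho \<circ> F) s"
    by (rule ring_hom_cringI[OF t.N.mpoly_cring t.N.mpoly_cring poly_eval.ev_hom[OF ev2_eval[OF J]]])
  show ?thesis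
  proof (rule h.inj_on_zeroI)
    fix q assume q: "q \<in> carrier (mpoly L J)" "ev2 L I (rho \<circ> F) s q = \<zero>\<^bsub>BL\<^esub>"
    have "q \<in> carrier (mpoly L {1..2::nat})" by (rule t.N.mpoly_carrier_mono[OF J q(1)])
    from G.ev_pair_zero[OF L_domain s ij jac_s this q(2)] show "q = \<zero>\<^bsub>mpoly L J\<^esub>"
      by (simp add: t.N.mpoly_zero fun_eq_iff)
  qed
qed

lemma Theta_ev2_inj:
  assumes J: "J \<subseteq> {1..2::nat}"
  shows "inj_on (\<lambda>q. Theta (ev2 L I (rho \<circ> F) s q)) (carrier (mpoly L J))"
proof (rule inj_onI)
  fix p q assume pq: "p \<in> carrier (mpoly L J)" "q \<in> carrier (mpoly L J)"
    "Theta (ev2 L I (rho \<circ> F) s p) = Theta (ev2 L I (rho \<circ> F) s q)"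
  note e = poly_eval.ev_closed[OF ev2_eval[OF J]]
  have "ev2 L I (rho \<circ> F) s p = ev2 L I (rho \<circ> F) s q"
    using Theta_inj[OF e[OF pq(1)] e[OF pq(2)] retr_ev2[OF J s s_fixed pq(1)] retr_ev2[OF J s s_fixed pq(2)] pq(3)] .
  thus "p = q" using inj_onD[OF ev2_inj[OF J]] pq by blast
qed

lemma Theta_ev2_surj:
  assumes u: "u \<in> carrier t.T"
  shows "\<exists>q\<in>carrier (mpoly L {1..2::nat}). u = Theta (ev2 L I (rho \<circ> F) s q)"
proof -
  have "Psi u \<in> gen2 L I (rho \<circ> F) s"
    by (rule fixed_gen2[OF t.N.is_cring rho_hom s x_gen2 Psi_closed[OF u] retr_Psi[OF u]])
  then obtain q where "q \<in> carrier (mpoly L {1..2::nat})" "Psi u = ev2 L I (rho \<circ> F) s q"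
    unfolding gen2_def by blast
  thus ?thesis using Theta_Psi[OF u] by metis
qed

lemma base_change_poly_ring: "is_poly_ring L 2 (base_change R AA L)"
  unfolding is_poly_ring_def
proof (rule bexI)
  let ?h = "\<lambda>q. Theta (ev2 L I (rho \<circ> F) s q)"
  interpret e: poly_eval L BL "mconst L" "{1..2::nat}" "\<lambda>j::nat. if j = 1 then rho \<circ> F else s"
    by (rule ev2_eval) simp
  have h_hom: "?h \<in> ring_hom (mpoly L {1..2::nat}) t.T"
    using ring_hom_trans[OF e.ev_hom Theta_hom] by (simp add: comp_def)
  have simps: "carrier (base_change R AA L) = carrier t.T"
    by (simp add: base_change_def)
  show "bij_betw ?h (carrier (mpoly L {1..2::nat})) (carrier (base_change R AA L))"
    unfolding bij_betw_def simps
  proof (intro conjI equalityI subsetI)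
    show "inj_on ?h (carrier (mpoly L {1..2::nat}))" by (rule Theta_ev2_inj) simp
    show "u \<in> ?h ` carrier (mpoly L {1..2::nat})" if "u \<in> carrier t.T" for u using Theta_ev2_surj[OF that] by blast
    show "u \<in> carrier t.T" if "u \<in> ?h ` carrier (mpoly L {1..2::nat})" for u
      using that ring_hom_closed[OF h_hom] by blast
  qed
  show "?h \<in> alg_hom L (mpoly L {1..2::nat}) (base_change R AA L)"
    unfolding alg_hom_def
  proof (intro CollectI conjI ballI)
    show "?h \<in> ring_hom (mpoly L {1..2::nat}) (base_change R AA L)"
      by (rule ring_hom_memI)
         (simp_all add: base_change_def ring_hom_closed[OF h_hom] ring_hom_mult[OF h_hom] ring_hom_add[OF h_hom] ring_hom_one[OF h_hom])
    fix l q assume l: "l \<in> carrier L" and q: "q \<in> carrier (mpoly L {1..2::nat})"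
    have "?h (l \<odot>\<^bsub>mpoly L {1..2::nat}\<^esub> q) = ?h (mconst L l) \<otimes>\<^bsub>t.T\<^esub> ?h q"
      unfolding t.N.mpoly_smult_eq[OF l q] by (rule ring_hom_mult[OF h_hom t.N.mconst_closed[OF l] q])
    also have "?h (mconst L l) = t.pure \<one>\<^bsub>B\<^esub> l" unfolding e.ev_const[OF l] by (rule Theta_const[OF l])
    finally show "?h (l \<odot>\<^bsub>mpoly L {1..2::nat}\<^esub> q) = l \<odot>\<^bsub>base_change R AA L\<^esub> ?h q"
      by (simp add: base_change_def)
  qed
qed

lemma jac_ev2_one:
  assumes q: "q \<in> carrier (mpoly L {1::nat})"
  shows "jac L I (rho \<circ> F) i j (ev2 L I (rho \<circ> F) s q) = \<zero>\<^bsub>BL\<^esub>"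
proof -
  interpret P: cring BL by (rule t.N.mpoly_cring)
  interpret G: grad_poly L I "rho \<circ> F" "\<lambda>i. rho \<circ> b i" by (rule hom_grad_poly[OF t.N.is_cring rho_hom])
  interpret e: poly_eval L BL "mconst L" "{1..2::nat}" "\<lambda>j::nat. if j = 1 then rho \<circ> F else s"
    by (rule ev2_eval) simp
  have q': "q \<in> carrier (mpoly L {1..2::nat})" by (rule t.N.mpoly_carrier_mono[OF _ q]) simp
  have "q (add_mset 2 m) = \<zero>\<^bsub>L\<^esub>" for m using t.N.mpoly_support_subset[OF q, of "add_mset 2 m"] by auto
  hence "partial_deriv L 2 q = \<zero>\<^bsub>mpoly L {1..2::nat}\<^esub>" by (simp add: partial_deriv_def t.N.mpoly_zero fun_eq_iff)
  moreover have "ev2 L I (rho \<circ> F) s (\<zero>\<^bsub>mpoly L {1..2::nat}\<^esub>) = \<zero>\<^bsub>BL\<^esub>"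
    using ring_hom_cring.hom_zero[OF ring_hom_cringI[OF t.N.mpoly_cring t.N.mpoly_cring e.ev_hom]] .
  ultimately show ?thesis using G.jac_ev_pair[OF s q', of i j] t.N.jac_closed[OF comp_F_closed s, of i j] by simp
qed

section \<open>The subalgebra R[F] and its tensor product with the fibre field\<close>

definition "K = adjoin R AA {F}"

definition "RF = AA\<lparr>carrier := K\<rparr>"

lemma RF_simps: "carrier RF = K" "u \<otimes>\<^bsub>RF\<^esub> v = u \<otimes>\<^bsub>B\<^esub> v" "u \<oplus>\<^bsub>RF\<^esub> v = u \<oplus>\<^bsub>B\<^esub> v"
  "\<one>\<^bsub>RF\<^esub> = \<one>\<^bsub>B\<^esub>" "\<zero>\<^bsub>RF\<^esub> = \<zero>\<^bsub>B\<^esub>" "r \<odot>\<^bsub>RF\<^esub> u = r \<odot>\<^bsub>B\<^esub> u"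
  by (simp_all add: RF_def)

lemma K_gens: "(\<lambda>s. s \<odot>\<^bsub>AA\<^esub> \<one>\<^bsub>AA\<^esub>) ` carrier R \<union> {F} \<subseteq> carrier AA"
  using ring_hom_closed[OF is_alg_simps(2)[OF AA_alg]] fixed_F by auto

lemma K_subring: "subring K AA"
  unfolding K_def adjoin_def by (rule t.M.generate_ring_is_subring[OF K_gens])

lemma K_fixed: "a \<in> K \<Longrightarrow> a \<in> fixed"
  using subringE(1)[OF K_subring] by auto

lemma K_smult_one: "r \<in> carrier R \<Longrightarrow> r \<odot>\<^bsub>B\<^esub> \<one>\<^bsub>B\<^esub> \<in> K"
  unfolding K_def adjoin_def by (rule generate_ring.incl) force

lemma K_F: "F \<in> K"
  unfolding K_def adjoin_def by (rule generate_ring.incl) simp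

lemma RF_cring: "cring RF"
  unfolding RF_def by (rule t.M.subring_cring[OF K_subring])

lemma RF_alg: "is_alg R RF"
proof -
  note A = is_alg_simps[OF AA_alg]
  have "(\<lambda>r. r \<odot>\<^bsub>RF\<^esub> \<one>\<^bsub>RF\<^esub>) \<in> ring_hom R RF"
    using ring_hom_mult[OF A(2)] ring_hom_add[OF A(2)] ring_hom_one[OF A(2)] K_smult_one
    by (intro ring_hom_memI) (simp_all add: RF_simps)
  moreover have "\<forall>r\<in>carrier R. \<forall>a\<in>carrier RF. r \<odot>\<^bsub>RF\<^esub> a = (r \<odot>\<^bsub>RF\<^esub> \<one>\<^bsub>RF\<^esub>) \<otimes>\<^bsub>RF\<^esub> a"
    using A(3) K_fixed by (simp add: RF_simps)
  ultimately show ?thesis using RF_cring by (simp only: is_alg_def)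
qed

sublocale u: tensor_algebra R RF L
  using RF_cring RF_alg alg_L is_alg_simps(1)[OF alg_L] by (intro tensor_algebra.intro tensor_algebra_axioms.intro)

text \<open>The tensor product of \<open>R[F]\<close> is formed with its own relations, so this map
  is not an inclusion by construction; injectivity is the content of
  \<open>incl_inj\<close>.\<close>

definition "incl = tensor_map R AA L id id"

lemma rel_incl: "c \<in> u.rel \<Longrightarrow> c \<in> t.rel"
proof (induction rule: u.rel_induct)
  case (addl a a' y)
  thus ?case using t.rel_addl[of a a' y] K_fixed by (simp add: RF_simps)
next
  case (addr a y y')
  thus ?case using t.rel_addr[of a y y'] K_fixed by (simp add: RF_simps)
next
  case (smult r a y)
  thus ?case using t.rel_smult[of r a y] K_fixed by (simp add: RF_simps)
qed (simp_all add: t.rel_zero t.rel_diff)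

lemma incl_cl: "incl (u.cl c) = t.cl c"
proof -
  have e: "frag_extend (\<lambda>(x, y). frag_of (id x, id y)) d = d" for d :: "('i multiset \<Rightarrow> 'a) \<times> 'c \<Rightarrow>\<^sub>0 int"
  proof -
    have "(\<lambda>(x, y). frag_of (id x, id y)) = (frag_of :: ('i multiset \<Rightarrow> 'a) \<times> 'c \<Rightarrow> _)" by (simp add: fun_eq_iff)
    thus ?thesis by (simp only: frag_expansion[symmetric])
  qed
  have "t.cl (r + c) = t.cl c" if "r \<in> u.rel" for r
    unfolding t.cl_eq_iff using rel_incl[OF that] by simp
  thus ?thesis unfolding incl_def tensor_map_def e u.cl_eq using u.rel_zero by auto
qed

lemma incl_pure: "incl (u.pure a l) = t.pure a l"
  by (simp add: u.pure_eq t.pure_eq incl_cl)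

lemma keys_incl: "Poly_Mapping.keys c \<subseteq> u.MN \<Longrightarrow> Poly_Mapping.keys c \<subseteq> t.MN"
  using K_fixed by (force simp: RF_simps)

lemma incl_hom: "incl \<in> ring_hom u.T t.T"
proof (rule ring_hom_memI)
  fix v w assume v: "v \<in> carrier u.T" and w: "w \<in> carrier u.T"
  obtain c where c: "Poly_Mapping.keys c \<subseteq> u.MN" "v = u.cl c" using v unfolding u.tensor_carrier by blast
  obtain d where d: "Poly_Mapping.keys d \<subseteq> u.MN" "w = u.cl d" using w unfolding u.tensor_carrier by blast
  have c': "c \<in> carrier (free_ring RF L)" "c \<in> carrier (free_ring AA L)" and d': "d \<in> carrier (free_ring RF L)" "d \<in> carrier (free_ring AA L)"
    unfolding u.free_carrier t.free_carrier using c(1) d(1) keys_incl by blast+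
  show "incl v \<in> carrier t.T" unfolding c(2) incl_cl using t.cl.hom_closed[OF c'(2)] .
  have "c \<otimes>\<^bsub>free_ring RF L\<^esub> d = c \<otimes>\<^bsub>free_ring AA L\<^esub> d" by (simp add: free_ring_def RF_simps)
  thus "incl (v \<otimes>\<^bsub>u.T\<^esub> w) = incl v \<otimes>\<^bsub>t.T\<^esub> incl w"
    unfolding c(2) d(2) u.cl.hom_mult[OF c'(1) d'(1), symmetric] incl_cl by (simp only: t.cl.hom_mult[OF c'(2) d'(2)])
  have "c \<oplus>\<^bsub>free_ring RF L\<^esub> d = c \<oplus>\<^bsub>free_ring AA L\<^esub> d" by (simp add: free_ring_def)
  thus "incl (v \<oplus>\<^bsub>u.T\<^esub> w) = incl v \<oplus>\<^bsub>t.T\<^esub> incl w"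
    unfolding c(2) d(2) u.cl.hom_add[OF c'(1) d'(1), symmetric] incl_cl by (simp only: t.cl.hom_add[OF c'(2) d'(2)])
next
  show "incl \<one>\<^bsub>u.T\<^esub> = \<one>\<^bsub>t.T\<^esub>" unfolding u.pure_one t.pure_one incl_pure by (simp add: RF_simps)
qed

text \<open>The map from a polynomial ring in one variable over \<open>L\<close> that sends the
  variable to \<open>F \<otimes> 1\<close>. It is surjective, and its composition with
  \<open>incl\<close> is injective.\<close>

definition "ThetaF = mev L u.T (\<lambda>l. u.pure \<one>\<^bsub>RF\<^esub> l) (\<lambda>j::nat. u.pure F \<one>\<^bsub>L\<^esub>)"

lemma ThetaF_eval: "poly_eval L u.T (\<lambda>l. u.pure \<one>\<^bsub>RF\<^esub> l) {1} (\<lambda>j::nat. u.pure F \<one>\<^bsub>L\<^esub>)"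
  using t.N.is_cring u.tensor_cring u.pure_right_hom K_F
  by (auto simp: poly_eval_def poly_eval_axioms_def RF_simps)

lemma ThetaF_hom: "ThetaF \<in> ring_hom (mpoly L {1}) u.T"
  unfolding ThetaF_def by (rule poly_eval.ev_hom[OF ThetaF_eval])

lemma ThetaF_const: "l \<in> carrier L \<Longrightarrow> ThetaF (mconst L l) = u.pure \<one>\<^bsub>RF\<^esub> l"
  unfolding ThetaF_def by (rule poly_eval.ev_const[OF ThetaF_eval])

lemma ThetaF_var: "ThetaF (mvar L 1) = u.pure F \<one>\<^bsub>L\<^esub>"
  unfolding ThetaF_def by (rule poly_eval.ev_var[OF ThetaF_eval]) simp

lemma incl_ThetaF:
  assumes q: "q \<in> carrier (mpoly L {1})"
  shows "incl (ThetaF q) = Theta (ev2 L I (rho \<circ> F) s q)"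
proof -
  interpret e: poly_eval L BL "mconst L" "{1}" "\<lambda>j::nat. if j = 1 then rho \<circ> F else s"
    by (rule ev2_eval) simp
  have "(incl \<circ> ThetaF) q = (Theta \<circ> ev2 L I (rho \<circ> F) s) q"
  proof (rule mpoly_hom_eqI[OF t.N.is_cring t.tensor_cring ring_hom_trans[OF ThetaF_hom incl_hom] ring_hom_trans[OF e.ev_hom Theta_hom] _ _ q])
    fix a assume a: "a \<in> carrier L"
    show "(incl \<circ> ThetaF) (mconst L a) = (Theta \<circ> ev2 L I (rho \<circ> F) s) (mconst L a)"
      unfolding comp_apply ThetaF_const[OF a] e.ev_const[OF a] Theta_const[OF a] incl_pure by (simp add: RF_simps)
  next
    fix j :: nat assume "j \<in> {1}"
    hence j: "j = 1" by simp
    show "(incl \<circ> ThetaF) (mvar L j) = (Theta \<circ> ev2 L I (rho \<circ> F) s) (mvar L j)"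
    proof -
      have "ev2 L I (rho \<circ> F) s (mvar L 1) = (if (1::nat) = 1 then rho \<circ> F else s)" by (rule e.ev_var) simp
      also have "\<dots> = rho \<circ> F" by (simp only: simp_thms if_True)
      finally have v: "ev2 L I (rho \<circ> F) s (mvar L 1) = rho \<circ> F" .
      have l: "(incl \<circ> ThetaF) (mvar L 1) = incl (ThetaF (mvar L 1))" by (rule comp_apply)
      have r: "(Theta \<circ> ev2 L I (rho \<circ> F) s) (mvar L 1) = Theta (ev2 L I (rho \<circ> F) s (mvar L 1))" by (rule comp_apply)
      show ?thesis unfolding j l r v ThetaF_var incl_pure Theta_F ..
    qed
  qed
  thus ?thesis by (simp only: comp_apply)
qed

lemma ThetaF_surj: "carrier u.T \<subseteq> ThetaF ` carrier (mpoly L {1})"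
proof -
  interpret th: ring_hom_cring "mpoly L {1::nat}" u.T ThetaF
    by (rule ring_hom_cringI[OF t.N.mpoly_cring u.tensor_cring ThetaF_hom])
  let ?H = "ThetaF ` carrier (mpoly L {1})"
  have rings: "ring (mpoly L {1::nat})" "ring u.T"
    by (rule cring.axioms(1)[OF t.N.mpoly_cring], rule cring.axioms(1)[OF u.tensor_cring])
  have "subring ?H u.T"
    by (rule ring_hom_ring.img_is_subring[OF ring_hom_ringI2[OF rings ThetaF_hom] ring.carrier_is_subring[OF rings(1)]])
  note zero = subringE(2)[OF this] and one = subringE(3)[OF this] and minus = subringE(5)[OF this]
    and mult = subringE(6)[OF this] and add = subringE(7)[OF this]
  have right: "u.pure \<one>\<^bsub>RF\<^esub> l \<in> ?H" if "l \<in> carrier L" for l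
    using ThetaF_const[OF that] t.N.mconst_closed[OF that] by (metis image_eqI)
  have left: "u.pure a \<one>\<^bsub>L\<^esub> \<in> ?H" if "a \<in> K" for a
    using that unfolding K_def adjoin_def
  proof (induction rule: generate_ring.induct)
    case one
    show ?case using \<open>\<one>\<^bsub>u.T\<^esub> \<in> ?H\<close> by (simp add: u.pure_one RF_simps)
  next
    case (incl a)
    show ?case
    proof (cases "a = F")
      case True
      thus ?thesis using ThetaF_var by (intro image_eqI[of _ _ "mvar L 1"]) auto
    next
      case False
      then obtain r where r: "r \<in> carrier R" "a = r \<odot>\<^bsub>RF\<^esub> \<one>\<^bsub>RF\<^esub>" using incl by (auto simp: RF_simps)
      have "u.pure a \<one>\<^bsub>L\<^esub> = u.pure \<one>\<^bsub>RF\<^esub> (r \<odot>\<^bsub>L\<^esub> \<one>\<^bsub>L\<^esub>)"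
        unfolding r(2) by (rule u.pure_smult[OF r(1) u.M.one_closed t.N.one_closed])
      thus ?thesis using right[OF u.smult_N[OF r(1) t.N.one_closed]] by simp
    qed
  next
    case (a_inv a)
    have a: "a \<in> K" "\<ominus>\<^bsub>AA\<^esub> a \<in> K" using a_inv.hyps generate_ring.a_inv[OF a_inv.hyps] by (simp_all add: K_def adjoin_def)
    have z: "\<ominus>\<^bsub>AA\<^esub> a \<oplus>\<^bsub>RF\<^esub> a = \<zero>\<^bsub>RF\<^esub>" using t.M.l_neg[of a] K_fixed[OF a(1)] by (simp add: RF_simps)
    have "u.pure (\<ominus>\<^bsub>AA\<^esub> a) \<one>\<^bsub>L\<^esub> \<oplus>\<^bsub>u.T\<^esub> u.pure a \<one>\<^bsub>L\<^esub> = u.pure (\<ominus>\<^bsub>AA\<^esub> a \<oplus>\<^bsub>RF\<^esub> a) \<one>\<^bsub>L\<^esub>"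
      using a by (intro u.pure_addl[symmetric]) (simp_all add: RF_simps)
    also have "\<dots> = \<zero>\<^bsub>u.T\<^esub>" unfolding z
      using ring_hom_cring.hom_zero[OF ring_hom_cringI[OF RF_cring u.tensor_cring u.pure_left_hom]] .
    finally have "\<ominus>\<^bsub>u.T\<^esub> u.pure a \<one>\<^bsub>L\<^esub> = u.pure (\<ominus>\<^bsub>AA\<^esub> a) \<one>\<^bsub>L\<^esub>"
      using a by (intro u.T.minus_equality) (simp_all add: RF_simps)
    thus ?case using minus[OF a_inv.IH] by simp
  next
    case (eng_add a c)
    hence ac: "a \<in> K" "c \<in> K" by (simp_all add: K_def adjoin_def)
    have "u.pure (a \<oplus>\<^bsub>RF\<^esub> c) \<one>\<^bsub>L\<^esub> = u.pure a \<one>\<^bsub>L\<^esub> \<oplus>\<^bsub>u.T\<^esub> u.pure c \<one>\<^bsub>L\<^esub>"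
      using ac by (intro u.pure_addl) (simp_all add: RF_simps)
    thus ?case using add[OF eng_add.IH] by (simp add: RF_simps)
  next
    case (eng_mult a c)
    hence ac: "a \<in> K" "c \<in> K" by (simp_all add: K_def adjoin_def)
    have "u.pure (a \<otimes>\<^bsub>RF\<^esub> c) \<one>\<^bsub>L\<^esub> = u.pure a \<one>\<^bsub>L\<^esub> \<otimes>\<^bsub>u.T\<^esub> u.pure c \<one>\<^bsub>L\<^esub>"
      using ac by (intro ring_hom_mult[OF u.pure_left_hom]) (simp_all add: RF_simps)
    thus ?case using mult[OF eng_mult.IH] by (simp add: RF_simps)
  qed
  show ?thesis
  proof (rule u.tensor_subset)
    fix a l assume al: "a \<in> carrier RF" "l \<in> carrier L"
    show "u.pure a l \<in> ?H" unfolding u.pure_decompose[OF al] using al by (intro mult left right) (simp_all add: RF_simps)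
  next
    show "v \<ominus>\<^bsub>u.T\<^esub> w \<in> ?H" if "v \<in> ?H" "w \<in> ?H" for v w unfolding a_minus_def by (intro add minus that)
  qed (rule zero)
qed

text \<open>Tensoring does not preserve injections in general. Here every element of
  \<open>R[F] \<otimes> L\<close> is a polynomial in \<open>F\<close> over \<open>L\<close>, and
  \<open>F\<close> stays algebraically independent over \<open>L\<close> in
  \<open>A \<otimes> L\<close>.\<close>

lemma incl_inj: "inj_on incl (carrier u.T)"
proof (rule inj_onI)
  fix v w assume vw: "v \<in> carrier u.T" "w \<in> carrier u.T" "incl v = incl w"
  obtain p where p: "p \<in> carrier (mpoly L {1})" "v = ThetaF p" using ThetaF_surj vw(1) by blast
  obtain q where q: "q \<in> carrier (mpoly L {1})" "w = ThetaF q" using ThetaF_surj vw(2) by blast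
  have J: "{1} \<subseteq> {1..2::nat}" by simp
  have "p = q" using inj_onD[OF Theta_ev2_inj[OF J] _ p(1) q(1)] vw(3) incl_ThetaF[OF p(1)] incl_ThetaF[OF q(1)] p(2) q(2) by simp
  thus "v = w" using p(2) q(2) by simp
qed

text \<open>\<open>A \<otimes> L\<close> is generated by \<open>s\<close> over
  \<open>R[F] \<otimes> L\<close> since it is generated by \<open>F\<close> and \<open>s\<close>
  over \<open>L\<close>. For independence the Jacobian criterion is applied with coefficient ring
  \<open>R[F] \<otimes> L\<close>: a single \<open>D\<^sub>i\<^sub>j\<close> kills the coefficients,
  which are polynomials in \<open>F\<close>, and does not kill \<open>s\<close>.\<close>

lemma incl_poly_ring: "is_poly_ring u.T 1 (algebra_via incl t.T)"
proof -
  interpret P: cring BL by (rule t.N.mpoly_cring)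
  interpret Pd: "domain" BL by (rule domain.mpoly_domain[OF L_domain])
  have su: "Theta s \<in> carrier t.T" by (rule Theta_closed[OF s])
  let ?h = "mev u.T t.T incl (\<lambda>j::nat. Theta s)"
  have he: "poly_eval u.T t.T incl {1} (\<lambda>j::nat. Theta s)"
    using u.tensor_cring t.tensor_cring incl_hom su by (simp add: poly_eval_def poly_eval_axioms_def)
  note h_hom = poly_eval.ev_hom[OF he] and h_const = poly_eval.ev_const[OF he]
  have h_var: "?h (mvar u.T 1) = Theta s" by (rule poly_eval.ev_var[OF he]) simp
  have alg: "?h \<in> alg_hom u.T (mpoly u.T {1}) (algebra_via incl t.T)"
    unfolding alg_hom_def
  proof (intro CollectI conjI ballI)
    show "?h \<in> ring_hom (mpoly u.T {1}) (algebra_via incl t.T)"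
      by (rule ring_hom_memI)
         (simp_all add: ring_hom_closed[OF h_hom] ring_hom_mult[OF h_hom] ring_hom_add[OF h_hom] ring_hom_one[OF h_hom])
    fix v q assume v: "v \<in> carrier u.T" and q: "q \<in> carrier (mpoly u.T {1::nat})"
    show "?h (v \<odot>\<^bsub>mpoly u.T {1}\<^esub> q) = v \<odot>\<^bsub>algebra_via incl t.T\<^esub> ?h q"
      unfolding u.T.mpoly_smult_eq[OF v q] ring_hom_mult[OF h_hom u.T.mconst_closed[OF v] q] h_const[OF v] by simp
  qed
  have surj: "w \<in> ?h ` carrier (mpoly u.T {1})" if w: "w \<in> carrier t.T" for w
  proof -
    let ?H = "{p \<in> carrier BL. Theta p \<in> ?h ` carrier (mpoly u.T {1})}"
    obtain q where q: "q \<in> carrier (mpoly L {1..2::nat})" "w = Theta (ev2 L I (rho \<circ> F) s q)" using Theta_ev2_surj[OF w] by blast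
    interpret B: cring "mpoly u.T {1::nat}" by (rule u.T.mpoly_cring)
    have J: "{1..2::nat} \<subseteq> {1..2::nat}" by simp
    have img: "?h (mconst u.T v) \<in> ?h ` carrier (mpoly u.T {1})" if "v \<in> carrier u.T" for v using that by blast
    have "ev2 L I (rho \<circ> F) s q \<in> ?H"
    proof (rule poly_eval.ev_mem[OF ev2_eval[OF J] q(1)])
      fix l assume l: "l \<in> carrier L"
      have v: "u.pure \<one>\<^bsub>RF\<^esub> l \<in> carrier u.T" using l by simp
      have "Theta (mconst L l) = ?h (mconst u.T (u.pure \<one>\<^bsub>RF\<^esub> l))"
        unfolding h_const[OF v] Theta_const[OF l] incl_pure by (simp add: RF_simps)
      thus "mconst L l \<in> ?H" using l img[OF v] by simp
    next
      fix j :: nat assume "j \<in> {1..2::nat}"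
      have v: "u.pure F \<one>\<^bsub>L\<^esub> \<in> carrier u.T" using K_F by (simp add: RF_simps)
      have "Theta (rho \<circ> F) = ?h (mconst u.T (u.pure F \<one>\<^bsub>L\<^esub>))" unfolding h_const[OF v] Theta_F incl_pure ..
      hence "rho \<circ> F \<in> ?H" using img[OF v] comp_F_closed by simp
      moreover have "?h (mvar u.T 1) \<in> ?h ` carrier (mpoly u.T {1})" by (rule imageI) simp
      hence "s \<in> ?H" using h_var s by simp
      ultimately show "(if j = 1 then rho \<circ> F else s) \<in> ?H" by simp
    next
      fix p p' assume "p \<in> ?H" "p' \<in> ?H"
      then obtain r r' where r: "p \<in> carrier BL" "r \<in> carrier (mpoly u.T {1})" "Theta p = ?h r"
        "p' \<in> carrier BL" "r' \<in> carrier (mpoly u.T {1})" "Theta p' = ?h r'" by blast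
      have "Theta (p \<oplus>\<^bsub>BL\<^esub> p') = ?h (r \<oplus>\<^bsub>mpoly u.T {1}\<^esub> r')"
        using ring_hom_add[OF Theta_hom r(1,4)] ring_hom_add[OF h_hom r(2,5)] r(3,6) by simp
      thus "p \<oplus>\<^bsub>BL\<^esub> p' \<in> ?H" using r by auto
      have "Theta (p \<otimes>\<^bsub>BL\<^esub> p') = ?h (r \<otimes>\<^bsub>mpoly u.T {1}\<^esub> r')"
        using ring_hom_mult[OF Theta_hom r(1,4)] ring_hom_mult[OF h_hom r(2,5)] r(3,6) by simp
      thus "p \<otimes>\<^bsub>BL\<^esub> p' \<in> ?H" using r by auto
    qed
    thus ?thesis using q(2) by simp
  qed
  have Psi_s: "Psi (Theta s) = s" using Psi_Theta[OF s] s_fixed by simp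
  have Psi_zero: "Psi \<zero>\<^bsub>t.T\<^esub> = \<zero>\<^bsub>BL\<^esub>"
    using ring_hom_cring.hom_zero[OF ring_hom_cringI[OF t.tensor_cring t.N.mpoly_cring Psi_hom]] .
  have Theta_zero: "Theta \<zero>\<^bsub>BL\<^esub> = \<zero>\<^bsub>t.T\<^esub>" using ring_hom_cring.hom_zero[OF Theta_cring_hom] .
  have incl_zero: "incl \<zero>\<^bsub>u.T\<^esub> = \<zero>\<^bsub>t.T\<^esub>"
    using ring_hom_cring.hom_zero[OF ring_hom_cringI[OF u.tensor_cring t.tensor_cring incl_hom]] .
  \<comment> \<open>The criterion needs a derivation of the target, so the evaluation is carried by
    \<open>Psi\<close> from \<open>A \<otimes> L\<close> into the domain
    \<open>L[X]\<close>.\<close>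
  let ?k = "mev u.T BL (Psi \<circ> incl) (\<lambda>j::nat. s)"
  have ke: "poly_eval u.T BL (Psi \<circ> incl) {1} (\<lambda>j::nat. s)"
    using u.tensor_cring t.N.mpoly_cring[of I] ring_hom_trans[OF incl_hom Psi_hom] s by (simp add: poly_eval_def poly_eval_axioms_def)
  have k_eq: "Psi (?h q) = ?k q" if q: "q \<in> carrier (mpoly u.T {1::nat})" for q
  proof -
    have "(Psi \<circ> ?h) q = ?k q"
    proof (rule mpoly_hom_eqI[OF u.tensor_cring t.N.mpoly_cring ring_hom_trans[OF h_hom Psi_hom] poly_eval.ev_hom[OF ke] _ _ q])
      show "(Psi \<circ> ?h) (mconst u.T a) = ?k (mconst u.T a)" if a: "a \<in> carrier u.T" for a
        unfolding comp_apply h_const[OF a] poly_eval.ev_const[OF ke a] ..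
      fix j :: nat assume j: "j \<in> {1}"
      show "(Psi \<circ> ?h) (mvar u.T j) = ?k (mvar u.T j)"
        unfolding comp_apply poly_eval.ev_var[OF ke j] poly_eval.ev_var[OF he j] by (rule Psi_s)
    qed
    thus ?thesis by (simp only: comp_apply)
  qed
  have kill: "jac L I (rho \<circ> F) i j (Psi (incl v)) = \<zero>\<^bsub>BL\<^esub>" if v: "v \<in> carrier u.T" for v i j
  proof -
    obtain q where q: "q \<in> carrier (mpoly L {1})" "v = ThetaF q" using ThetaF_surj v by blast
    have J: "{1} \<subseteq> {1..2::nat}" by simp
    have "Psi (incl v) = ev2 L I (rho \<circ> F) s q"
      unfolding q(2) incl_ThetaF[OF q(1)] Psi_Theta[OF poly_eval.ev_closed[OF ev2_eval[OF J] q(1)]] by (rule retr_ev2[OF J s s_fixed q(1)])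
    thus ?thesis using jac_ev2_one[OF q(1)] by simp
  qed
  have qalg: "qalg BL"
  proof -
    interpret G: grad_poly L I "rho \<circ> F" "\<lambda>i. rho \<circ> b i" by (rule hom_grad_poly[OF t.N.is_cring rho_hom])
    show ?thesis by (rule G.qalg_mpoly)
  qed
  have inj: "q = \<zero>\<^bsub>mpoly u.T {1}\<^esub>" if q: "q \<in> carrier (mpoly u.T {1::nat})" "?h q = \<zero>\<^bsub>t.T\<^esub>" for q
  proof -
    have kq: "?k q = \<zero>\<^bsub>BL\<^esub>" using k_eq[OF q(1)] q(2) Psi_zero by simp
    have z: "(Psi \<circ> incl) (q m) = \<zero>\<^bsub>BL\<^esub>" for m
    proof (rule poly_eval.ev_eq_zero_iff[OF ke, of "{jac L I (rho \<circ> F) i1 j1}", OF _ qalg _ _ _ q(1) kq])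
      show "derivation BL D" if "D \<in> {jac L I (rho \<circ> F) i1 j1}" for D
        using that t.N.jac_derivation[OF comp_F_closed] by simp
      show "D ((Psi \<circ> incl) v) = \<zero>\<^bsub>BL\<^esub>" if "D \<in> {jac L I (rho \<circ> F) i1 j1}" "v \<in> carrier u.T" for D v
        using that kill by simp
      fix g assume g: "g \<in> {1::nat} \<rightarrow> carrier BL"
        and gz: "\<And>D. D \<in> {jac L I (rho \<circ> F) i1 j1} \<Longrightarrow> (\<Oplus>\<^bsub>BL\<^esub>j\<in>{1::nat}. g j \<otimes>\<^bsub>BL\<^esub> D s) = \<zero>\<^bsub>BL\<^esub>"
      have jc: "jac L I (rho \<circ> F) i1 j1 s \<in> carrier BL" by (rule t.N.jac_closed[OF comp_F_closed s])
      have g1: "g 1 \<in> carrier BL" using g by auto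
      have "g 1 \<otimes>\<^bsub>BL\<^esub> jac L I (rho \<circ> F) i1 j1 s = \<zero>\<^bsub>BL\<^esub>" using gz[of "jac L I (rho \<circ> F) i1 j1"] g1 jc by simp
      thus "\<forall>j\<in>{1}. g j = \<zero>\<^bsub>BL\<^esub>" using Pd.integral[OF _ g1 jc] jac_s by blast
    qed simp
    have "q m = \<zero>\<^bsub>u.T\<^esub>" for m
    proof -
      have qm: "q m \<in> carrier u.T" by (rule u.T.mpoly_coeff_closed[OF q(1)])
      have "incl (q m) = Theta ((Psi \<circ> incl) (q m))"
        unfolding comp_apply by (rule Theta_Psi[OF ring_hom_closed[OF incl_hom qm], symmetric])
      also have "\<dots> = incl \<zero>\<^bsub>u.T\<^esub>" unfolding z Theta_zero incl_zero ..
      finally show ?thesis using inj_onD[OF incl_inj _ qm u.T.zero_closed] by blast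
    qed
    thus ?thesis by (simp add: u.T.mpoly_zero fun_eq_iff)
  qed
  have "bij_betw ?h (carrier (mpoly u.T {1})) (carrier t.T)"
    unfolding bij_betw_def
  proof (intro conjI equalityI subsetI)
    show "inj_on ?h (carrier (mpoly u.T {1}))"
      using ring_hom_cring.inj_on_zeroI[OF ring_hom_cringI[OF u.T.mpoly_cring t.tensor_cring h_hom] inj] .
    show "w \<in> ?h ` carrier (mpoly u.T {1})" if "w \<in> carrier t.T" for w by (rule surj[OF that])
    show "w \<in> carrier t.T" if "w \<in> ?h ` carrier (mpoly u.T {1})" for w using that ring_hom_closed[OF h_hom] by blast
  qed
  thus ?thesis unfolding is_poly_ring_def atLeastAtMost_singleton using alg by (intro bexI[OF _ alg]) simp
qed

lemma residual_poly_ring: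
  "is_poly_ring (tensor R (AA\<lparr>carrier := adjoin R AA {F}\<rparr>) L) 1
     (algebra_via (tensor_map R AA L id id) (tensor R AA L))"
  using incl_poly_ring by (simp only: RF_def K_def incl_def)

end

section \<open>The main theorem\<close>

lemma frac_fieldD:
  assumes "frac_field R P L"
  shows "field L" "(\<lambda>r. r \<odot>\<^bsub>L\<^esub> \<one>\<^bsub>L\<^esub>) \<in> ring_hom R L"
    "r \<in> carrier R \<Longrightarrow> r \<odot>\<^bsub>L\<^esub> \<one>\<^bsub>L\<^esub> = \<zero>\<^bsub>L\<^esub> \<longleftrightarrow> r \<in> P"
    "c \<in> carrier L \<Longrightarrow> \<exists>a\<in>carrier R. \<exists>d\<in>carrier R. d \<odot>\<^bsub>L\<^esub> \<one>\<^bsub>L\<^esub> \<noteq> \<zero>\<^bsub>L\<^esub> \<and> (d \<odot>\<^bsub>L\<^esub> \<one>\<^bsub>L\<^esub>) \<otimes>\<^bsub>L\<^esub> c = a \<odot>\<^bsub>L\<^esub> \<one>\<^bsub>L\<^esub>"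
    "is_alg R L"
proof -
  note f = assms[unfolded frac_field_def]
  show fL: "field L" using f by (rule conjunct1)
  note f2 = f[THEN conjunct2]
  show h: "(\<lambda>r. r \<odot>\<^bsub>L\<^esub> \<one>\<^bsub>L\<^esub>) \<in> ring_hom R L" using f2 by (rule conjunct1)
  note f3 = f2[THEN conjunct2]
  note f4 = f3[THEN conjunct2]
  show "r \<in> carrier R \<Longrightarrow> r \<odot>\<^bsub>L\<^esub> \<one>\<^bsub>L\<^esub> = \<zero>\<^bsub>L\<^esub> \<longleftrightarrow> r \<in> P" using f4[THEN conjunct1] by (rule bspec)
  show "c \<in> carrier L \<Longrightarrow> \<exists>a\<in>carrier R. \<exists>d\<in>carrier R. d \<odot>\<^bsub>L\<^esub> \<one>\<^bsub>L\<^esub> \<noteq> \<zero>\<^bsub>L\<^esub> \<and> (d \<odot>\<^bsub>L\<^esub> \<one>\<^bsub>L\<^esub>) \<otimes>\<^bsub>L\<^esub> c = a \<odot>\<^bsub>L\<^esub> \<one>\<^bsub>L\<^esub>"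
    using f4[THEN conjunct2] by (rule bspec)
  show "is_alg R L" unfolding is_alg_def
    using h f3[THEN conjunct1] domain.axioms(1)[OF field.axioms(1)[OF fL]] by (intro conjI)
qed

text \<open>A minimal prime below \<open>P\<close> provides the generic fibre in which
  \<open>F\<close> is assumed to be a coordinate; the inclusion of the two primes is the kernel
  condition of the specialization theorem.\<close>

lemma (in retract_data) prime_fibre:
  assumes noeth: "noetherian_ring R"
    and gen: "\<And>P. minimal_prime P R \<Longrightarrow> is_poly_ring_over_adjoin (Qt_alg R P)
       (pure_tensor R AA (Qt_alg R P) F \<one>\<^bsub>Qt_alg R P\<^esub>) (base_change R AA (Qt_alg R P))"
    and P: "primeideal P R"
  shows "is_poly_ring (residue_alg R P) 2 (base_change R AA (residue_alg R P)) \<and>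
    is_poly_ring (tensor R (AA\<lparr>carrier := adjoin R AA {F}\<rparr>) (residue_alg R P)) 1
     (algebra_via (tensor_map R AA (residue_alg R P) id id) (tensor R AA (residue_alg R P)))"
proof -
  obtain Q where Q: "minimal_prime Q R" "Q \<subseteq> P" using minimal_prime_exists[OF P] by blast
  have Qp: "primeideal Q R" using Q(1) by (simp add: minimal_prime_def)
  note K = frac_fieldD[OF frac_field_Qt_alg[OF is_cring Qp]]
  note k = frac_fieldD[OF frac_field_residue_alg[OF is_cring P]]
  interpret k: field "residue_alg R P" by (rule k(1))
  interpret tk: retract_tensor R I F b x "residue_alg R P"
    using retract_data_axioms k(5) by (simp add: retract_tensor_def retract_tensor_axioms_def)
  interpret tK: retract_tensor R I F b x "Qt_alg R Q"
    using retract_data_axioms K(5) by (simp add: retract_tensor_def retract_tensor_axioms_def)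
  obtain s where s: "s \<in> carrier (mpoly (Qt_alg R Q) I)" "retr (Qt_alg R Q) tK.rho s = s"
    "\<And>i. i \<in> I \<Longrightarrow> tK.rho \<circ> x i \<in> gen2 (Qt_alg R Q) I (tK.rho \<circ> F) s" "s \<notin> fspan (Qt_alg R Q) I (tK.rho \<circ> F)"
    using tK.coordinate_exists[OF K(1) gen[OF Q(1)]] by blast
  have ker: "tk.rho r = \<zero>\<^bsub>residue_alg R P\<^esub>" if "r \<in> carrier R" "tK.rho r = \<zero>\<^bsub>Qt_alg R Q\<^esub>" for r
    using that K(3) k(3) Q(2) by (auto simp: tk.rho_def tK.rho_def)
  obtain \<tau> where t: "\<tau> \<in> carrier B" "phi \<tau> = \<tau>"
    "\<And>i. i \<in> I \<Longrightarrow> tk.rho \<circ> x i \<in> gen2 (residue_alg R P) I (tk.rho \<circ> F) (tk.rho \<circ> \<tau>)"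
    "\<exists>i\<in>I. \<exists>j\<in>I. jac (residue_alg R P) I (tk.rho \<circ> F) i j (tk.rho \<circ> \<tau>) \<noteq> \<zero>\<^bsub>mpoly (residue_alg R P) I\<^esub>"
    using coordinate_specialization[OF noeth K(1) k(1) tK.rho_hom tk.rho_hom ker K(4)[folded tK.rho_def[THEN fun_cong]] k(4)[folded tk.rho_def[THEN fun_cong]] s(1,2,3,4)]
    by blast
  obtain i j where ij: "i \<in> I" "j \<in> I" "jac (residue_alg R P) I (tk.rho \<circ> F) i j (tk.rho \<circ> \<tau>) \<noteq> \<zero>\<^bsub>mpoly (residue_alg R P) I\<^esub>"
    using t(4) by blast
  have "retr (residue_alg R P) tk.rho (tk.rho \<circ> \<tau>) = tk.rho \<circ> \<tau>"
    using retr_natural[OF k.is_cring tk.rho_hom t(1)] t(2) by simp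
  moreover have "tk.rho \<circ> \<tau> \<in> carrier (mpoly (residue_alg R P) I)"
    by (rule ring_hom_cring.comp_closed[OF tk.rho_cring_hom t(1)])
  ultimately interpret c: coordinate_fibre R I F b x "residue_alg R P" "tk.rho \<circ> \<tau>" i j
    using t(3) ij k(1) tk.retract_tensor_axioms by (simp add: coordinate_fibre_def coordinate_fibre_axioms_def)
  show ?thesis using c.base_change_poly_ring c.residual_poly_ring by blast
qed

lemma (in cring) contains_rat_qalg:
  assumes "contains_rat R" shows "qalg R"
proof -
  obtain h :: "rat \<Rightarrow> 'a" where h: "h \<in> ring_hom \<lparr>carrier = UNIV, monoid.mult = (*), one = 1, ring.zero = 0, ring.add = (+)\<rparr> R"
    using assms unfolding contains_rat_def by blast
  have c: "h q \<in> carrier R" for q using ring_hom_closed[OF h] by simp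
  have a: "h (p + q) = h p \<oplus> h q" for p q using ring_hom_add[OF h] by simp
  have m: "h (p * q) = h p \<otimes> h q" for p q using ring_hom_mult[OF h] by simp
  have o: "h 1 = \<one>" using ring_hom_one[OF h] by simp
  have z: "h 0 = \<zero>" using a[of 0 0] c[of 0] by (simp add: add.r_cancel_one')
  have n: "add_pow R n \<one> = h (of_nat n)" for n :: nat
  proof (induction n)
    case (Suc n)
    thus ?case using a[of "of_nat n" 1] o by (simp add: add.nat_pow_Suc add.commute)
  qed (simp add: z)
  show ?thesis unfolding qalg_def
  proof (intro allI impI bexI)
    fix n :: nat assume "n > 0"
    thus "h (inverse (of_nat n)) \<otimes> add_pow R n \<one> = \<one>" unfolding n m[symmetric] using o by simp
  qed (rule c)
qed

text \<open>The combinations of the \<open>f i\<close> form an ideal containing them, so if the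
  generated ideal is everything, \<open>1\<close> is such a combination. This supplies the Bezout
  coefficients of \<open>grad_poly\<close>.\<close>

lemma (in cring) genideal_finite_image:
  assumes I: "finite I" and f: "f \<in> I \<rightarrow> carrier R" and g: "genideal R (f ` I) = carrier R"
  shows "\<exists>b. b \<in> I \<rightarrow> carrier R \<and> (\<Oplus>i\<in>I. b i \<otimes> f i) = \<one>"
proof -
  define J where "J = {y. \<exists>b. b \<in> I \<rightarrow> carrier R \<and> y = (\<Oplus>i\<in>I. b i \<otimes> f i)}"
  have JI: "(\<Oplus>i\<in>I. b i \<otimes> f i) \<in> J" if "b \<in> I \<rightarrow> carrier R" for b using that by (auto simp: J_def)
  have JE: "\<exists>b. b \<in> I \<rightarrow> carrier R \<and> y = (\<Oplus>i\<in>I. b i \<otimes> f i)" if "y \<in> J" for y using that by (simp add: J_def)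
  have J_mult: "a \<otimes> y \<in> J" if ay: "a \<in> carrier R" "y \<in> J" for a y
  proof -
    obtain b where b: "b \<in> I \<rightarrow> carrier R" "y = (\<Oplus>i\<in>I. b i \<otimes> f i)" using JE[OF ay(2)] by blast
    have "a \<otimes> y = (\<Oplus>i\<in>I. a \<otimes> (b i \<otimes> f i))" unfolding b(2) using b(1) f ay(1) by (intro finsum_rdistr I) auto
    also have "\<dots> = (\<Oplus>i\<in>I. (a \<otimes> b i) \<otimes> f i)" using b(1) f ay(1) by (intro finsum_cong') (auto simp: m_assoc Pi_iff)
    finally show ?thesis using b(1) ay(1) JI[of "\<lambda>i. a \<otimes> b i"] by (auto simp: Pi_iff)
  qed
  have J_sub: "J \<subseteq> carrier R" using f by (auto simp: J_def intro!: finsum_closed)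
  have J_add: "y \<oplus> z \<in> J" if yz: "y \<in> J" "z \<in> J" for y z
  proof -
    obtain b where b: "b \<in> I \<rightarrow> carrier R" "y = (\<Oplus>i\<in>I. b i \<otimes> f i)" using JE[OF yz(1)] by blast
    obtain c where c: "c \<in> I \<rightarrow> carrier R" "z = (\<Oplus>i\<in>I. c i \<otimes> f i)" using JE[OF yz(2)] by blast
    have "y \<oplus> z = (\<Oplus>i\<in>I. b i \<otimes> f i \<oplus> c i \<otimes> f i)" unfolding b(2) c(2) using b(1) c(1) f by (intro finsum_addf[symmetric]) auto
    also have "\<dots> = (\<Oplus>i\<in>I. (b i \<oplus> c i) \<otimes> f i)" using b(1) c(1) f by (intro finsum_cong') (auto simp: l_distr Pi_iff)
    finally show ?thesis using b(1) c(1) JI[of "\<lambda>i. b i \<oplus> c i"] by (auto simp: Pi_iff)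
  qed
  have "ideal J R"
  proof (rule idealI[OF ring_axioms])
    show "subgroup J (add_monoid R)"
    proof (rule add.subgroupI[OF J_sub _ _ J_add])
      show "J \<noteq> {}" using JI[of "\<lambda>_. \<zero>"] by auto
      fix y assume y: "y \<in> J"
      have "\<ominus> y = (\<ominus> \<one>) \<otimes> y" using y J_sub by (simp add: l_minus subset_iff)
      thus "\<ominus> y \<in> J" using J_mult[of "\<ominus> \<one>" y] y by simp
    qed
    show "a \<otimes> y \<in> J" "y \<otimes> a \<in> J" if "y \<in> J" "a \<in> carrier R" for y a
      using J_mult[OF that(2,1)] m_comm[of y a] that J_sub by auto
  qed
  moreover have "f ` I \<subseteq> J"
  proof
    fix y assume "y \<in> f ` I"
    then obtain k where k: "k \<in> I" "y = f k" by blast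
    have "(\<Oplus>i\<in>I. (if k = i then \<one> else \<zero>) \<otimes> f i) = (\<Oplus>i\<in>I. if k = i then f i else \<zero>)"
      using f by (intro finsum_cong') (auto simp: Pi_iff)
    also have "\<dots> = y" using finsum_singleton[OF k(1) I f] k(2) by simp
    finally show "y \<in> J" using JI[of "\<lambda>i. if k = i then \<one> else \<zero>"] by (auto simp: Pi_iff)
  qed
  ultimately have "carrier R \<subseteq> J" using genideal_minimal[of J "f ` I"] g by simp
  thus ?thesis using JE[of \<one>] by (metis one_closed subsetD)
qed

text \<open>A retraction is evaluation at the images \<open>x i\<close> of the variables, and its
  image \<open>A\<close> is its set of fixed points; that \<phi> fixes \<open>A\<close> gives both
  \<open>x_fixed\<close> and \<open>F_fixed\<close>.\<close>

lemma retract_data_exists: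
  fixes R :: "('a, 'm) ring_scheme" and I :: "'i::wellorder set" and F :: "'i multiset \<Rightarrow> 'a"
  assumes R: "cring R" and rat: "contains_rat R" and I: "finite I" and ret: "is_retract R (mpoly R I) A" and FA: "F \<in> A"
    and gen: "genideal (mpoly R I) ((\<lambda>i. partial_deriv R i F) ` I) = carrier (mpoly R I)"
  shows "\<exists>b x. retract_data R I F b x \<and> A = {p \<in> carrier (mpoly R I). mev R (mpoly R I) (mconst R) x p = p}"
proof -
  interpret R: cring R by fact
  interpret B: cring "mpoly R I" by (rule R.mpoly_cring)
  have A: "A \<subseteq> carrier (mpoly R I)" using ret subringE(1) unfolding is_retract_def by blast
  obtain \<phi> where \<phi>: "\<phi> \<in> alg_hom R (mpoly R I) ((mpoly R I)\<lparr>carrier := A\<rparr>)" "\<phi> ` carrier (mpoly R I) = A" "\<And>a. a \<in> A \<Longrightarrow> \<phi> a = a"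
    using ret unfolding is_retract_def by blast
  have \<phi>_hom': "\<phi> \<in> ring_hom (mpoly R I) ((mpoly R I)\<lparr>carrier := A\<rparr>)" using \<phi>(1) by (simp add: alg_hom_def)
  have \<phi>_mem: "\<phi> p \<in> A" if "p \<in> carrier (mpoly R I)" for p using \<phi>(2) that by blast
  have \<phi>_hom: "\<phi> \<in> ring_hom (mpoly R I) (mpoly R I)"
    using ring_hom_mult[OF \<phi>_hom'] ring_hom_add[OF \<phi>_hom'] ring_hom_one[OF \<phi>_hom'] \<phi>_mem A
    by (intro ring_hom_memI) (auto simp: subset_iff)
  define x where "x i = \<phi> (mvar R i)" for i
  have x: "x \<in> I \<rightarrow> carrier (mpoly R I)" using \<phi>_mem A by (auto simp: x_def)
  interpret e: poly_eval R "mpoly R I" "mconst R" I x by (rule R.poly_eval_mconst[OF x])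
  have ev: "e.ev p = \<phi> p" if p: "p \<in> carrier (mpoly R I)" for p
  proof (rule mpoly_hom_eqI[OF R R.mpoly_cring e.ev_hom \<phi>_hom _ _ p])
    fix a assume a: "a \<in> carrier R"
    have "\<phi> (a \<odot>\<^bsub>mpoly R I\<^esub> \<one>\<^bsub>mpoly R I\<^esub>) = a \<odot>\<^bsub>mpoly R I\<^esub> \<phi> \<one>\<^bsub>mpoly R I\<^esub>"
      using \<phi>(1) a by (simp add: alg_hom_def)
    hence "\<phi> (mconst R a) = mconst R a"
      using a ring_hom_one[OF \<phi>_hom] by (simp add: R.mpoly_smult_eq)
    thus "e.ev (mconst R a) = \<phi> (mconst R a)" using a by simp
  qed (simp add: x_def)
  have FB: "F \<in> carrier (mpoly R I)" using FA A by blast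
  have "(\<lambda>i. partial_deriv R i F) \<in> I \<rightarrow> carrier (mpoly R I)" using FB by auto
  from B.genideal_finite_image[OF I this gen] obtain b where b: "b \<in> I \<rightarrow> carrier (mpoly R I)"
    "(\<Oplus>\<^bsub>mpoly R I\<^esub>i\<in>I. b i \<otimes>\<^bsub>mpoly R I\<^esub> partial_deriv R i F) = \<one>\<^bsub>mpoly R I\<^esub>" by blast
  have "grad_poly R I F b"
    using R R.contains_rat_qalg[OF rat] I FB b by (simp add: grad_poly_def grad_poly_axioms_def)
  moreover have "e.ev (x i) = x i" if "i \<in> I" for i
    using ev[OF funcset_mem[OF x that]] \<phi>(3)[OF \<phi>_mem[of "mvar R i"]] that by (simp add: x_def)
  moreover have "e.ev F = F" using ev[OF FB] \<phi>(3)[OF FA] by simp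
  ultimately have "retract_data R I F b x" using x by (simp add: retract_data_def retract_data_axioms_def)
  moreover have "A = {p \<in> carrier (mpoly R I). e.ev p = p}"
    using A ev \<phi>(3) \<phi>_mem by (auto simp: subset_iff) (metis)
  ultimately show ?thesis by blast
qed

theorem theoremA:
  fixes R :: "('a, 'm) ring_scheme"
    and n :: nat
    and A :: "(nat multiset \<Rightarrow> 'a) set"
    and F :: "nat multiset \<Rightarrow> 'a"
  defines "B \<equiv> mpoly R {1..n}"
  defines "AA \<equiv> B\<lparr>carrier := A\<rparr>"
  assumes "cring R" and "noetherian_ring R" and "contains_rat R"
    and "is_retract R B A"
    and "\<And>P. minimal_prime P R \<Longrightarrow> tr_deg (quot_alg R P) (base_change R AA (quot_alg R P)) = 2"
    and "F \<in> A"
    and "\<And>P. minimal_prime P R \<Longrightarrow>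
           is_poly_ring_over_adjoin (Qt_alg R P)
             (pure_tensor R AA (Qt_alg R P) F \<one>\<^bsub>Qt_alg R P\<^esub>) (base_change R AA (Qt_alg R P))"
    and "genideal B ((\<lambda>i. partial_deriv R i F) ` {1..n}) = carrier B"
  shows "residual_coordinate TYPE('x) R AA F"
proof -
  obtain b x where d: "retract_data R {1..n} F b x"
    and A: "A = {p \<in> carrier B. mev R B (mconst R) x p = p}"
    using retract_data_exists[OF assms(3,5) finite_atLeastAtMost assms(6)[unfolded B_def] assms(8) assms(10)[unfolded B_def]]
    unfolding B_def by blast
  interpret d: retract_data R "{1..n}" F b x by (rule d)
  \<comment> \<open>From here on \<open>A\<close> is literally the ring of fixed points, and the
    results on the retraction apply.\<close>
  have AA: "AA = d.AA" unfolding AA_def B_def d.fixed_def A ..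
  have fib: "is_poly_ring (residue_alg R P) 2 (base_change R AA (residue_alg R P)) \<and>
    is_poly_ring (tensor R (AA\<lparr>carrier := adjoin R AA {F}\<rparr>) (residue_alg R P)) 1
     (algebra_via (tensor_map R AA (residue_alg R P) id id) (tensor R AA (residue_alg R P)))" if "primeideal P R" for P
    unfolding AA using assms(9) by (intro d.prime_fibre[OF assms(4) _ that]) (simp only: AA)
  have "A2_fibration TYPE('x) R AA"
    unfolding A2_fibration_def using fib is_alg_algebra[OF assms(3) d.AA_alg] d.AA_finitely_generated d.AA_flat
    unfolding AA by blast
  moreover have "alg_independent R AA {F}" unfolding AA by (rule d.F_alg_independent)
  moreover have "F \<in> carrier AA" using assms(8) by (simp add: AA_def)
  ultimately show ?thesis unfolding residual_coordinate_def Let_def using fib by blast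
qed

end
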